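(* Let $(\Sigma,C)$ be a monoidal theory. DPOI rewriting in $\mathbf{FTerm}(\Sigma,C)$ (i.e. DPOI rewriting of hypergraphs with interface in $\mathbf{Hyp}_{\Sigma,C}$) has the Knuth-Bendix property: for every finite DPOI rewriting system the set of critical pairs is finite and computable, a terminating finite DPOI rewriting system is confluent if and only if all its critical pairs are joinable, and confluence of terminating finite DPOI rewriting systems is decidable.
   Context: A monoidal theory $(\Sigma,C)$: finite set $C$ of colours, signature $\Sigma$ of operations $o\colon w\to v$, $w,v\in C^{\star}$. $\mathbf{Hyp}_{\Sigma,C}$: category of finite directed hypergraphs with nodes labelled in $C$ and hyperedges labelled in $\Sigma$ (ordered source and target lists; a hyperedge labelled $o\colon w\to v$ has source labels forming $w$ and target labels forming $v$), with label-preserving homomorphisms. $\mathbf{FTerm}(\Sigma,C)$ is the prop of isomorphism classes of cospans in $\mathbf{Hyp}_{\Sigma,C}$ between discrete hypergraphs (words over $C$), composed by pushout. DPOI rewriting: a DPOI rule is a span $L\leftarrow K\rightarrow R$ in $\mathbf{Hyp}_{\Sigma,C}$; a DPOI rewriting system is a finite set of rules. For morphisms $G\xleftarrow{r}I$ and $H\xleftarrow{p}I$, $(G\leftarrow I)\Rightarrow(H\leftarrow I)$ iff for some rule there are $L\to G$, $R\to H$ and a cospan $K\to D\xleftarrow{q}I$ with maps $D\to G$, $D\to H$ such that the two squares ($K,L,D,G$ and $K,R,D,H$) are pushouts and $r=q;(D\to G)$, $p=q;(D\to H)$. Confluence refers to the reflexive-transitive closure of this relation on objects with interface $G\leftarrow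 I$. Critical pair: given rules $L_1\leftarrow K_1\to R_1$ and $L_2\leftarrow K_2\to R_2$ and two rewriting steps $(H_1\leftarrow J)\Leftarrow(S\leftarrow J)\Rightarrow(H_2\leftarrow J)$ with matches $f_i\colon L_i\to S$ and pushout complements $C_i$ (with $J\to C_i$, $C_i\to S$), this is a critical pair if $[f_1,f_2]\colon L_1+L_2\to S$ is an epimorphism and the square $J\to C_1\to S$, $J\to C_2\to S$ is a pullback. It is joinable if there is $W\leftarrow J$ with $(H_1\leftarrow J)\Rightarrow^{*}(W\leftarrow J)$ and $(H_2\leftarrow J)\Rightarrow^{*}(W\leftarrow J)$. *)

theory Defs
  imports "HOL-Library.Nat_Bijection"
begin

section \<open>Finite labelled hypergraphs\<close>

record ('c, 'o) monoidal_theory =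
  colours :: "'c set"
  ops :: "'o set"
  arity :: "'o \<Rightarrow> 'c list"
  coarity :: "'o \<Rightarrow> 'c list"

definition wf_theory :: "('c, 'o) monoidal_theory \<Rightarrow> bool" where
  "wf_theory T \<longleftrightarrow> finite (colours T) \<and>
     (\<forall>f \<in> ops T. set (arity T f) \<subseteq> colours T \<and> set (coarity T f) \<subseteq> colours T)"

text \<open>
  The nodes of a hypergraph are the positions of the list \<open>vcol\<close> of node colours, its hyperedges
  are the positions of the list \<open>edg\<close>; a hyperedge carries its label, its source list and its
  target list. Every finite hypergraph is isomorphic to one of this form, and hypergraphs and
  homomorphisms become finite data without junk, so that HOL equality is equality of objects and of
  morphisms. Parallel hyperedges with the same label are allowed.
\<close>

datatype ('c, 'o) hgraph =
  HGraph (vcol: "'c list") (edg: "('o \<times> nat list \<times> nat list) list")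

definition hyp :: "('c, 'o) monoidal_theory \<Rightarrow> ('c, 'o) hgraph set" where
  "hyp T = {G. set (vcol G) \<subseteq> colours T \<and>
     (\<forall>(f, s, t) \<in> set (edg G). f \<in> ops T \<and>
        set s \<subseteq> {..<length (vcol G)} \<and> map ((!) (vcol G)) s = arity T f \<and>
        set t \<subseteq> {..<length (vcol G)} \<and> map ((!) (vcol G)) t = coarity T f)}"

definition discrete_hyp :: "('c, 'o) monoidal_theory \<Rightarrow> ('c, 'o) hgraph set" where
  "discrete_hyp T = {G \<in> hyp T. edg G = []}"

text \<open>A homomorphism is the pair of the tables of its node map and its hyperedge map.\<close>

type_synonym hmor = "nat list \<times> nat list"

definition hmors :: "('c, 'o) hgraph \<Rightarrow> ('c, 'o) hgraph \<Rightarrow> hmor set" where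
  "hmors G H = {(a, b).
     length a = length (vcol G) \<and>
     (\<forall>i < length a. a ! i < length (vcol H) \<and> vcol H ! (a ! i) = vcol G ! i) \<and>
     length b = length (edg G) \<and>
     (\<forall>e < length b. b ! e < length (edg H) \<and>
        (case edg G ! e of (f, s, t) \<Rightarrow> edg H ! (b ! e) = (f, map ((!) a) s, map ((!) a) t)))}"

definition hid :: "('c, 'o) hgraph \<Rightarrow> hmor" where
  "hid G = ([0..<length (vcol G)], [0..<length (edg G)])"

text \<open>Composition in diagrammatic order: first \<open>f\<close>, then \<open>g\<close>.\<close>

definition hcomp :: "hmor \<Rightarrow> hmor \<Rightarrow> hmor"  (infixl \<open>;;\<close> 75) where
  "f ;; g = (map ((!) (fst g)) (fst f), map ((!) (snd g)) (snd f))"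

definition coproduct :: "('c, 'o) hgraph \<Rightarrow> ('c, 'o) hgraph \<Rightarrow> ('c, 'o) hgraph" where
  "coproduct G H = (let n = length (vcol G) in
     HGraph (vcol G @ vcol H)
       (edg G @ map (\<lambda>(f, s, t). (f, map ((+) n) s, map ((+) n) t)) (edg H)))"

definition copair :: "hmor \<Rightarrow> hmor \<Rightarrow> hmor" where
  "copair f g = (fst f @ fst g, snd f @ snd g)"

definition epi ::
  "('c, 'o) monoidal_theory \<Rightarrow> ('c, 'o) hgraph \<Rightarrow> ('c, 'o) hgraph \<Rightarrow> hmor \<Rightarrow> bool" where
  "epi T G H f \<longleftrightarrow> f \<in> hmors G H \<and>
     (\<forall>X \<in> hyp T. \<forall>u \<in> hmors H X. \<forall>v \<in> hmors H X. f ;; u = f ;; v \<longrightarrow> u = v)"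

text \<open>\<open>pushout T K L D G l k f d\<close>: the cospan \<open>f : L \<rightarrow> G\<close>, \<open>d : D \<rightarrow> G\<close> is a pushout of the span
  \<open>l : K \<rightarrow> L\<close>, \<open>k : K \<rightarrow> D\<close>.\<close>

definition pushout :: "('c, 'o) monoidal_theory \<Rightarrow> ('c, 'o) hgraph \<Rightarrow> ('c, 'o) hgraph \<Rightarrow>
    ('c, 'o) hgraph \<Rightarrow> ('c, 'o) hgraph \<Rightarrow> hmor \<Rightarrow> hmor \<Rightarrow> hmor \<Rightarrow> hmor \<Rightarrow> bool" where
  "pushout T K L D G l k f d \<longleftrightarrow>
     l \<in> hmors K L \<and> k \<in> hmors K D \<and> f \<in> hmors L G \<and> d \<in> hmors D G \<and> l ;; f = k ;; d \<and>
     (\<forall>X \<in> hyp T. \<forall>a \<in> hmors L X. \<forall>b \<in> hmors D X. l ;; a = k ;; b \<longrightarrow>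
        (\<exists>!u. u \<in> hmors G X \<and> f ;; u = a \<and> d ;; u = b))"

text \<open>\<open>pullback T J C1 C2 S j1 j2 c1 c2\<close>: the span \<open>j1 : J \<rightarrow> C1\<close>, \<open>j2 : J \<rightarrow> C2\<close> is a pullback of
  the cospan \<open>c1 : C1 \<rightarrow> S\<close>, \<open>c2 : C2 \<rightarrow> S\<close>.\<close>

definition pullback :: "('c, 'o) monoidal_theory \<Rightarrow> ('c, 'o) hgraph \<Rightarrow> ('c, 'o) hgraph \<Rightarrow>
    ('c, 'o) hgraph \<Rightarrow> ('c, 'o) hgraph \<Rightarrow> hmor \<Rightarrow> hmor \<Rightarrow> hmor \<Rightarrow> hmor \<Rightarrow> bool" where
  "pullback T J C1 C2 S j1 j2 c1 c2 \<longleftrightarrow>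
     j1 \<in> hmors J C1 \<and> j2 \<in> hmors J C2 \<and> c1 \<in> hmors C1 S \<and> c2 \<in> hmors C2 S \<and>
     j1 ;; c1 = j2 ;; c2 \<and>
     (\<forall>X \<in> hyp T. \<forall>a \<in> hmors X C1. \<forall>b \<in> hmors X C2. a ;; c1 = b ;; c2 \<longrightarrow>
        (\<exists>!u. u \<in> hmors X J \<and> u ;; j1 = a \<and> u ;; j2 = b))"


section \<open>DPOI rewriting\<close>

text \<open>
  The parameter \<open>\<I>\<close> below is the class of objects admitted as interfaces, both as the apex of
  a rule and as the interface of a rewritten object. For \<open>\<I> = hyp T\<close> this is DPOI rewriting in the
  category of hypergraphs; for \<open>\<I> = discrete_hyp T\<close> the rewritten objects are the cospans of
  \<open>FTerm(\<Sigma>,C)\<close>, a cospan \<open>n \<rightarrow> G \<leftarrow> m\<close> of discrete hypergraphs being the same as a morphism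
  \<open>n + m \<rightarrow> G\<close>.
\<close>

datatype ('c, 'o) dpoi_rule =
  Rule (rl: "('c, 'o) hgraph") (rk: "('c, 'o) hgraph") (rr: "('c, 'o) hgraph")
       (lleg: hmor) (rleg: hmor)

definition wf_rule ::
  "('c, 'o) monoidal_theory \<Rightarrow> ('c, 'o) hgraph set \<Rightarrow> ('c, 'o) dpoi_rule \<Rightarrow> bool" where
  "wf_rule T \<I> \<rho> \<longleftrightarrow> rl \<rho> \<in> hyp T \<and> rk \<rho> \<in> hyp T \<inter> \<I> \<and> rr \<rho> \<in> hyp T \<and>
     lleg \<rho> \<in> hmors (rk \<rho>) (rl \<rho>) \<and> rleg \<rho> \<in> hmors (rk \<rho>) (rr \<rho>)"

definition dpoi_system ::
  "('c, 'o) monoidal_theory \<Rightarrow> ('c, 'o) hgraph set \<Rightarrow> ('c, 'o) dpoi_rule set \<Rightarrow> bool" where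
  "dpoi_system T \<I> \<R> \<longleftrightarrow> finite \<R> \<and> (\<forall>\<rho> \<in> \<R>. wf_rule T \<I> \<rho>)"

text \<open>An object with interface \<open>I\<close> is a pair of a hypergraph \<open>G\<close> and a morphism \<open>I \<rightarrow> G\<close>.\<close>

type_synonym ('c, 'o) iobj = "('c, 'o) hgraph \<times> hmor"

definition iobjs :: "('c, 'o) monoidal_theory \<Rightarrow> ('c, 'o) hgraph \<Rightarrow> ('c, 'o) iobj set" where
  "iobjs T I = {(G, r). G \<in> hyp T \<and> r \<in> hmors I G}"

text \<open>
  The data witnessing one rewriting step by the rule \<open>L \<leftarrow> K \<rightarrow> R\<close>: the match \<open>L \<rightarrow> G\<close>, the morphism
  \<open>R \<rightarrow> H\<close>, the context \<open>D\<close>, and the morphisms \<open>K \<rightarrow> D\<close>, \<open>I \<rightarrow> D\<close>, \<open>D \<rightarrow> G\<close>, \<open>D \<rightarrow> H\<close>, in this order.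
\<close>

datatype ('c, 'o) dpoi_step =
  Step (srule: "('c, 'o) dpoi_rule") (smatch: hmor) (scomatch: hmor)
       (sctxt: "('c, 'o) hgraph") (sk: hmor) (si: hmor) (sg: hmor) (sh: hmor)

definition is_step :: "('c, 'o) monoidal_theory \<Rightarrow> ('c, 'o) hgraph \<Rightarrow>
    ('c, 'o) iobj \<Rightarrow> ('c, 'o) dpoi_step \<Rightarrow> ('c, 'o) iobj \<Rightarrow> bool" where
  "is_step T I X \<sigma> Y \<longleftrightarrow> X \<in> iobjs T I \<and> Y \<in> iobjs T I \<and>
     (case (X, \<sigma>, Y) of ((G, r), Step (Rule L K R l r') f h D k q g g', (H, p)) \<Rightarrow>
        D \<in> hyp T \<and> q \<in> hmors I D \<and>
        pushout T K L D G l k f g \<and>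
        pushout T K R D H r' k h g' \<and>
        r = q ;; g \<and> p = q ;; g')"

definition reduces :: "('c, 'o) monoidal_theory \<Rightarrow> ('c, 'o) dpoi_rule set \<Rightarrow>
    ('c, 'o) hgraph \<Rightarrow> ('c, 'o) iobj \<Rightarrow> ('c, 'o) iobj \<Rightarrow> bool" where
  "reduces T \<R> I X Y \<longleftrightarrow> (\<exists>\<sigma>. srule \<sigma> \<in> \<R> \<and> is_step T I X \<sigma> Y)"

definition iobj_iso :: "('c, 'o) monoidal_theory \<Rightarrow> ('c, 'o) hgraph \<Rightarrow>
    ('c, 'o) iobj \<Rightarrow> ('c, 'o) iobj \<Rightarrow> bool" where
  "iobj_iso T I X Y \<longleftrightarrow> X \<in> iobjs T I \<and> Y \<in> iobjs T I \<and>
     (\<exists>u \<in> hmors (fst X) (fst Y). \<exists>v \<in> hmors (fst Y) (fst X).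
        u ;; v = hid (fst X) \<and> v ;; u = hid (fst Y) \<and> snd X ;; u = snd Y)"

text \<open>
  Objects with interface matter only up to isomorphism under the interface. A rewriting step already
  produces every isomorphic copy of its result, but the reflexive closure has to be taken up to
  isomorphism: otherwise two copies of the same result could not be joined by empty sequences.
\<close>

definition reduces_star :: "('c, 'o) monoidal_theory \<Rightarrow> ('c, 'o) dpoi_rule set \<Rightarrow>
    ('c, 'o) hgraph \<Rightarrow> ('c, 'o) iobj \<Rightarrow> ('c, 'o) iobj \<Rightarrow> bool" where
  "reduces_star T \<R> I = (\<lambda>X Y. reduces T \<R> I X Y \<or> iobj_iso T I X Y)\<^sup>*\<^sup>*"

definition joinable :: "('c, 'o) monoidal_theory \<Rightarrow> ('c, 'o) dpoi_rule set \<Rightarrow>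
    ('c, 'o) hgraph \<Rightarrow> ('c, 'o) iobj \<Rightarrow> ('c, 'o) iobj \<Rightarrow> bool" where
  "joinable T \<R> I Y Z \<longleftrightarrow>
     (\<exists>W \<in> iobjs T I. reduces_star T \<R> I Y W \<and> reduces_star T \<R> I Z W)"

definition terminating ::
  "('c, 'o) monoidal_theory \<Rightarrow> ('c, 'o) hgraph set \<Rightarrow> ('c, 'o) dpoi_rule set \<Rightarrow> bool" where
  "terminating T \<I> \<R> \<longleftrightarrow>
     (\<forall>I \<in> hyp T \<inter> \<I>. \<not> (\<exists>X :: nat \<Rightarrow> ('c, 'o) iobj. \<forall>n. reduces T \<R> I (X n) (X (Suc n))))"

definition confluent ::
  "('c, 'o) monoidal_theory \<Rightarrow> ('c, 'o) hgraph set \<Rightarrow> ('c, 'o) dpoi_rule set \<Rightarrow> bool" where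
  "confluent T \<I> \<R> \<longleftrightarrow>
     (\<forall>I \<in> hyp T \<inter> \<I>. \<forall>X \<in> iobjs T I. \<forall>Y \<in> iobjs T I. \<forall>Z \<in> iobjs T I.
        reduces_star T \<R> I X Y \<and> reduces_star T \<R> I X Z \<longrightarrow> joinable T \<R> I Y Z)"


section \<open>Critical pairs\<close>

datatype ('c, 'o) cpair =
  CPair (cifc: "('c, 'o) hgraph") (csrc: "('c, 'o) iobj")
        (cstep1: "('c, 'o) dpoi_step") (ctgt1: "('c, 'o) iobj")
        (cstep2: "('c, 'o) dpoi_step") (ctgt2: "('c, 'o) iobj")

text \<open>
  This is the set of all critical pairs over the concrete hypergraphs above, not a set of
  representatives: since nodes and hyperedges are list positions, each isomorphism class of critical
  pairs has only finitely many members.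
\<close>

definition critical_pairs ::
  "('c, 'o) monoidal_theory \<Rightarrow> ('c, 'o) dpoi_rule set \<Rightarrow> ('c, 'o) cpair set" where
  "critical_pairs T \<R> = {CPair J (S, j) \<sigma>1 Y1 \<sigma>2 Y2 | J S j \<sigma>1 Y1 \<sigma>2 Y2.
     J \<in> hyp T \<and> srule \<sigma>1 \<in> \<R> \<and> srule \<sigma>2 \<in> \<R> \<and>
     is_step T J (S, j) \<sigma>1 Y1 \<and> is_step T J (S, j) \<sigma>2 Y2 \<and>
     epi T (coproduct (rl (srule \<sigma>1)) (rl (srule \<sigma>2))) S (copair (smatch \<sigma>1) (smatch \<sigma>2)) \<and>
     pullback T J (sctxt \<sigma>1) (sctxt \<sigma>2) S (si \<sigma>1) (si \<sigma>2) (sg \<sigma>1) (sg \<sigma>2)}"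

definition cpair_joinable ::
  "('c, 'o) monoidal_theory \<Rightarrow> ('c, 'o) dpoi_rule set \<Rightarrow> ('c, 'o) cpair \<Rightarrow> bool" where
  "cpair_joinable T \<R> cp \<longleftrightarrow> joinable T \<R> (cifc cp) (ctgt1 cp) (ctgt2 cp)"


section \<open>Partial recursive functions\<close>

datatype recf = Zero | Succ | Proj nat | Comp recf "recf list" | PrimRec recf recf | Mu recf

inductive evalr :: "recf \<Rightarrow> nat list \<Rightarrow> nat \<Rightarrow> bool" where
  zero: "evalr Zero xs 0"
| succ: "evalr Succ [x] (Suc x)"
| proj: "i < length xs \<Longrightarrow> evalr (Proj i) xs (xs ! i)"
| comp: "list_all2 (\<lambda>g y. evalr g xs y) gs ys \<Longrightarrow> evalr f ys z \<Longrightarrow> evalr (Comp f gs) xs z"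
| prim_0: "evalr f xs y \<Longrightarrow> evalr (PrimRec f g) (0 # xs) y"
| prim_Suc: "evalr (PrimRec f g) (n # xs) y \<Longrightarrow> evalr g (n # y # xs) z \<Longrightarrow>
    evalr (PrimRec f g) (Suc n # xs) z"
| mu: "evalr f (n # xs) 0 \<Longrightarrow> (\<forall>m < n. \<exists>y. evalr f (m # xs) (Suc y)) \<Longrightarrow> evalr (Mu f) xs n"


section \<open>Coding of finite data by numbers\<close>

text \<open>Colours and operations are coded by way of numberings \<open>\<kappa>\<close> and \<open>\<nu>\<close>.\<close>

definition code_hgraph :: "('c \<Rightarrow> nat) \<Rightarrow> ('o \<Rightarrow> nat) \<Rightarrow> ('c, 'o) hgraph \<Rightarrow> nat" where
  "code_hgraph \<kappa> \<nu> G = list_encode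
     [list_encode (map \<kappa> (vcol G)),
      list_encode (map (\<lambda>(f, s, t). list_encode [\<nu> f, list_encode s, list_encode t]) (edg G))]"

definition code_hmor :: "hmor \<Rightarrow> nat" where
  "code_hmor f = list_encode [list_encode (fst f), list_encode (snd f)]"

definition code_iobj :: "('c \<Rightarrow> nat) \<Rightarrow> ('o \<Rightarrow> nat) \<Rightarrow> ('c, 'o) iobj \<Rightarrow> nat" where
  "code_iobj \<kappa> \<nu> X = list_encode [code_hgraph \<kappa> \<nu> (fst X), code_hmor (snd X)]"

definition code_rule :: "('c \<Rightarrow> nat) \<Rightarrow> ('o \<Rightarrow> nat) \<Rightarrow> ('c, 'o) dpoi_rule \<Rightarrow> nat" where
  "code_rule \<kappa> \<nu> \<rho> = list_encode
     [code_hgraph \<kappa> \<nu> (rl \<rho>), code_hgraph \<kappa> \<nu> (rk \<rho>), code_hgraph \<kappa> \<nu> (rr \<rho>),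
      code_hmor (lleg \<rho>), code_hmor (rleg \<rho>)]"

definition code_step :: "('c \<Rightarrow> nat) \<Rightarrow> ('o \<Rightarrow> nat) \<Rightarrow> ('c, 'o) dpoi_step \<Rightarrow> nat" where
  "code_step \<kappa> \<nu> \<sigma> = list_encode
     [code_rule \<kappa> \<nu> (srule \<sigma>), code_hmor (smatch \<sigma>), code_hmor (scomatch \<sigma>),
      code_hgraph \<kappa> \<nu> (sctxt \<sigma>), code_hmor (sk \<sigma>), code_hmor (si \<sigma>),
      code_hmor (sg \<sigma>), code_hmor (sh \<sigma>)]"

definition code_cpair :: "('c \<Rightarrow> nat) \<Rightarrow> ('o \<Rightarrow> nat) \<Rightarrow> ('c, 'o) cpair \<Rightarrow> nat" where
  "code_cpair \<kappa> \<nu> cp = list_encode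
     [code_hgraph \<kappa> \<nu> (cifc cp), code_iobj \<kappa> \<nu> (csrc cp),
      code_step \<kappa> \<nu> (cstep1 cp), code_iobj \<kappa> \<nu> (ctgt1 cp),
      code_step \<kappa> \<nu> (cstep2 cp), code_iobj \<kappa> \<nu> (ctgt2 cp)]"

definition code_system :: "('c \<Rightarrow> nat) \<Rightarrow> ('o \<Rightarrow> nat) \<Rightarrow> ('c, 'o) dpoi_rule list \<Rightarrow> nat" where
  "code_system \<kappa> \<nu> \<rho>s = list_encode (map (code_rule \<kappa> \<nu>) \<rho>s)"

definition hgraph_ops :: "('c, 'o) hgraph \<Rightarrow> 'o set" where
  "hgraph_ops G = fst ` set (edg G)"

definition system_ops :: "('c, 'o) dpoi_rule set \<Rightarrow> 'o set" where
  "system_ops \<R> = (\<Union>\<rho> \<in> \<R>. hgraph_ops (rl \<rho>) \<union> hgraph_ops (rk \<rho>) \<union> hgraph_ops (rr \<rho>))"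

text \<open>
  The signature may be infinite, even uncountable. A finite system mentions only finitely many
  operations, so it is presented to an algorithm by numbering just these, injectively but otherwise
  arbitrarily. The algorithm must work for all systems and all such presentations. If a numbering of
  the whole signature is given, its restriction is one of the admitted ones.
\<close>

definition presents :: "('c, 'o) monoidal_theory \<Rightarrow> ('c, 'o) hgraph set \<Rightarrow>
    ('c \<Rightarrow> nat) \<Rightarrow> ('o \<Rightarrow> nat) \<Rightarrow> ('c, 'o) dpoi_rule list \<Rightarrow> ('c, 'o) dpoi_rule set \<Rightarrow> bool" where
  "presents T \<I> \<kappa> \<nu> \<rho>s \<R> \<longleftrightarrow> dpoi_system T \<I> \<R> \<and> set \<rho>s = \<R> \<and>
     inj_on \<kappa> (colours T) \<and> inj_on \<nu> (system_ops \<R>)"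

definition critical_pairs_computable ::
  "('c, 'o) monoidal_theory \<Rightarrow> ('c, 'o) hgraph set \<Rightarrow> bool" where
  "critical_pairs_computable T \<I> \<longleftrightarrow> (\<exists>P. \<forall>\<kappa> \<nu> \<rho>s \<R>. presents T \<I> \<kappa> \<nu> \<rho>s \<R> \<longrightarrow>
     (\<exists>cps. set cps = critical_pairs T \<R> \<and>
        evalr P [code_system \<kappa> \<nu> \<rho>s] (list_encode (map (code_cpair \<kappa> \<nu>) cps))))"

text \<open>On codes of systems that do not terminate, the decision procedure may diverge or answer
  anything.\<close>

definition confluence_decidable_if_terminating ::
  "('c, 'o) monoidal_theory \<Rightarrow> ('c, 'o) hgraph set \<Rightarrow> bool" where
  "confluence_decidable_if_terminating T \<I> \<longleftrightarrow>
     (\<exists>P. \<forall>\<kappa> \<nu> \<rho>s \<R>. presents T \<I> \<kappa> \<nu> \<rho>s \<R> \<and> terminating T \<I> \<R> \<longrightarrow>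
        evalr P [code_system \<kappa> \<nu> \<rho>s] (if confluent T \<I> \<R> then 1 else 0))"

definition knuth_bendix_property ::
  "('c, 'o) monoidal_theory \<Rightarrow> ('c, 'o) hgraph set \<Rightarrow> bool" where
  "knuth_bendix_property T \<I> \<longleftrightarrow>
     (\<forall>\<R>. dpoi_system T \<I> \<R> \<longrightarrow> finite (critical_pairs T \<R>)) \<and>
     critical_pairs_computable T \<I> \<and>
     (\<forall>\<R>. dpoi_system T \<I> \<R> \<and> terminating T \<I> \<R> \<longrightarrow>
        (confluent T \<I> \<R> \<longleftrightarrow> (\<forall>cp \<in> critical_pairs T \<R>. cpair_joinable T \<R> cp))) \<and>
     confluence_decidable_if_terminating T \<I>"

end

theory Submission
  imports Defs
begin

text \<open>
  Pushouts and pullbacks of hypergraphs are computed pointwise on nodes and hyperedges. Given two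
  steps from \<open>G\<close> with matches \<open>f\<^sub>i : L\<^sub>i \<rightarrow> G\<close> and contexts \<open>C\<^sub>i\<close>, let \<open>S\<close> be the image of \<open>[f\<^sub>1, f\<^sub>2]\<close>.
  Pushouts are stable under pullback, so restricting the contexts to \<open>C'\<^sub>i \<rightarrow> S\<close> yields a critical pair
  with interface \<open>J = C'\<^sub>1 \<times>\<^sub>S C'\<^sub>2\<close>. Outside \<open>S\<close> both contexts coincide with \<open>G\<close>; therefore, with
  \<open>E = C\<^sub>1 \<times>\<^sub>G C\<^sub>2\<close>, each \<open>C\<^sub>i\<close> is the pushout of \<open>C'\<^sub>i\<close> and \<open>E\<close> over \<open>J\<close>, and by pasting the results of the
  given steps are the pushouts along \<open>J \<rightarrow> E\<close> of the results of the critical pair. Rewriting is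
  preserved by such pushouts, so joinable critical pairs give local confluence, and Newman's lemma
  modulo isomorphism gives confluence. Conversely a critical pair is an instance of confluence; if
  the rules have discrete interfaces then so has \<open>J\<close>, because a hyperedge hit by a match then does
  not belong to the context.

  Critical pairs can be described by quantifiers over list codes below a computable bound, whence
  they can be enumerated. To decide confluence of a terminating system, rewrite both sides of every
  critical pair to normal forms and compare these up to isomorphism: if they all agree then all
  critical pairs are joinable, and if the system is confluent then they agree.
\<close>

section \<open>Recursive functions\<close>

text \<open>Joinability has to be over the interface \<open>J\<close>: the remainder of the graph is
  glued on along \<open>J\<close>, and only a join that keeps \<open>J\<close> in place can be
  carried along. Left legs \<open>K -> L\<close> need not be injective, so one match can have
  several pushout complements, each a step of its own, and contexts can be folded. Gluing is
  therefore tested by maps into a two-element set instead of explicit quotients, which also turns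
  the universal property into a check of finitely many finite lists. Two obstacles come from
  \<open>T\<close>: \<open>pushout\<close>, \<open>pullback\<close> and \<open>epi\<close> quantify
  over all of \<open>hyp T\<close>, and labels may come from uncountable types. The first is met by
  pointwise characterisations without \<open>T\<close>, the second by relabelling with numbers along
  maps injective on the labels that occur. Programs are hardly ever written out; closure rules for
  \<open>computable\<close> and \<open>decidable\<close> on bijectively coded types supply them.
  Finiteness of the set of critical pairs is read off from the list that enumerates it. As the
  lengths of reductions to normal form are not known in advance, the decision procedure searches for
  them.\<close>

definition recursive_in :: "nat \<Rightarrow> (nat list \<Rightarrow> nat) \<Rightarrow> bool" where
  "recursive_in k f \<longleftrightarrow> (\<exists>P. \<forall>xs. length xs = k \<longrightarrow> evalr P xs (f xs))"

lemma recursive_in_cong: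
  assumes "recursive_in k f" and "\<And>xs. length xs = k \<Longrightarrow> g xs = f xs"
  shows "recursive_in k g"
  using assms unfolding recursive_in_def by metis

lemma recursive_in_proj: "i < k \<Longrightarrow> recursive_in k (\<lambda>xs. xs ! i)"
  unfolding recursive_in_def by (metis evalr.proj)

lemma recursive_in_comp:
  assumes f: "recursive_in (length gs) f" and gs: "\<And>g. g \<in> set gs \<Longrightarrow> recursive_in k g"
  shows "recursive_in k (\<lambda>xs. f (map (\<lambda>g. g xs) gs))"
proof -
  obtain P where P: "\<And>xs. length xs = length gs \<Longrightarrow> evalr P xs (f xs)"
    using f unfolding recursive_in_def by blast
  obtain Q where Q: "\<And>g xs. g \<in> set gs \<Longrightarrow> length xs = k \<Longrightarrow> evalr (Q g) xs (g xs)"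
    using gs unfolding recursive_in_def by metis
  have "evalr (Comp P (map Q gs)) xs (f (map (\<lambda>g. g xs) gs))" if "length xs = k" for xs
    by (rule evalr.comp[where ys = "map (\<lambda>g. g xs) gs"])
      (use that P Q in \<open>auto simp: list_all2_conv_all_nth\<close>)
  then show ?thesis
    unfolding recursive_in_def by blast
qed

lemma recursive_in_comp1:
  "recursive_in 1 (\<lambda>xs. f (xs ! 0)) \<Longrightarrow> recursive_in k g \<Longrightarrow> recursive_in k (\<lambda>xs. f (g xs))"
  using recursive_in_comp[of "[g]" "\<lambda>xs. f (xs ! 0)" k] by simp

lemma recursive_in_comp2:
  "recursive_in 2 (\<lambda>xs. f (xs ! 0) (xs ! 1)) \<Longrightarrow> recursive_in k g \<Longrightarrow> recursive_in k h \<Longrightarrow>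
    recursive_in k (\<lambda>xs. f (g xs) (h xs))"
  using recursive_in_comp[of "[g, h]" "\<lambda>xs. f (xs ! 0) (xs ! 1)" k]
  by (auto simp: numeral_2_eq_2)

lemma recursive_in_Suc: "recursive_in k g \<Longrightarrow> recursive_in k (\<lambda>xs. Suc (g xs))"
proof (rule recursive_in_comp1[where f = "Suc"])
  show "recursive_in 1 (\<lambda>xs. Suc (xs ! 0))"
    unfolding recursive_in_def
    by (rule exI[of _ Succ]) (auto simp: length_Suc_conv intro: evalr.succ)
qed

lemma recursive_in_const: "recursive_in k (\<lambda>_. c)"
proof (induction c)
  case 0
  then show ?case
    unfolding recursive_in_def using evalr.zero by blast
next
  case (Suc c)
  then show ?case by (rule recursive_in_Suc)
qed

lemma recursive_in_rec_nat_aux: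
  assumes z: "recursive_in k z" and s: "recursive_in (Suc (Suc k)) s"
  shows "recursive_in (Suc k) (\<lambda>xs. rec_nat (z (tl xs)) (\<lambda>n y. s (n # y # tl xs)) (hd xs))"
proof -
  obtain P where P: "\<And>xs. length xs = k \<Longrightarrow> evalr P xs (z xs)"
    using z unfolding recursive_in_def by blast
  obtain Q where Q: "\<And>xs. length xs = Suc (Suc k) \<Longrightarrow> evalr Q xs (s xs)"
    using s unfolding recursive_in_def by blast
  have "evalr (PrimRec P Q) (n # xs) (rec_nat (z xs) (\<lambda>n y. s (n # y # xs)) n)"
    if "length xs = k" for n xs
    using that
  proof (induction n)
    case (Suc n)
    then show ?case
      using prim_Suc[OF Suc.IH] Q by simp
  qed (auto intro: prim_0 P)
  then show ?thesis
    unfolding recursive_in_def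
    by (intro exI[of _ "PrimRec P Q"]) (auto simp: length_Suc_conv)
qed

text \<open>\<open>PrimRec\<close> recurses on the first argument with the parameters behind it. To
  recurse on a computed number \<open>n xs\<close>, the whole list \<open>xs\<close> is passed on as
  the parameters, rebuilt from its projections.\<close>

lemma recursive_in_rec_nat:
  assumes z: "recursive_in k z"
    and s: "recursive_in (Suc (Suc k)) (\<lambda>ys. s (tl (tl ys)) (ys ! 0) (ys ! 1))"
    and n: "recursive_in k n"
  shows "recursive_in k (\<lambda>xs. rec_nat (z xs) (s xs) (n xs))"
proof -
  let ?F = "\<lambda>ys. rec_nat (z (tl ys)) (\<lambda>m y. s (tl ys) m y) (hd ys)"
  have F: "recursive_in (Suc k) ?F"
    using recursive_in_rec_nat_aux[OF z s] by simp
  let ?gs = "n # map (\<lambda>i xs. xs ! i) [0..<k]"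
  have "recursive_in k (\<lambda>xs. ?F (map (\<lambda>g. g xs) ?gs))"
  proof (rule recursive_in_comp)
    show "recursive_in (length ?gs) ?F" using F by simp
    show "recursive_in k g" if "g \<in> set ?gs" for g
      using that n by (auto intro: recursive_in_proj)
  qed
  then show ?thesis
  proof (rule recursive_in_cong)
    fix xs :: "nat list"
    assume "length xs = k"
    then have "map (\<lambda>i. xs ! i) [0..<k] = xs"
      by (metis map_nth)
    then show "rec_nat (z xs) (s xs) (n xs) = ?F (map (\<lambda>g. g xs) ?gs)"
      by (simp add: comp_def)
  qed
qed

section \<open>Arithmetic and the Cantor pairing\<close>

lemma recursive_in_add: "recursive_in k f \<Longrightarrow> recursive_in k g \<Longrightarrow> recursive_in k (\<lambda>xs. f xs + g xs)"
proof (rule recursive_in_comp2[where f = "(+)"])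
  have "recursive_in 2 (\<lambda>xs. rec_nat (xs ! 1) (\<lambda>n y. Suc y) (xs ! 0))"
    by (intro recursive_in_rec_nat recursive_in_proj recursive_in_Suc) auto
  moreover have "rec_nat b (\<lambda>n y. Suc y) a = a + b" for a b :: nat
    by (induction a) auto
  ultimately show "recursive_in 2 (\<lambda>xs. xs ! 0 + xs ! 1)" by simp
qed

lemma recursive_in_mult: "recursive_in k f \<Longrightarrow> recursive_in k g \<Longrightarrow> recursive_in k (\<lambda>xs. f xs * g xs)"
proof (rule recursive_in_comp2[where f = "(*)"])
  have "recursive_in 2 (\<lambda>xs. rec_nat 0 (\<lambda>n y. y + xs ! 1) (xs ! 0))"
  proof (intro recursive_in_rec_nat recursive_in_proj recursive_in_add recursive_in_const)
    show "recursive_in (Suc (Suc 2)) (\<lambda>x. tl (tl x) ! 1)"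
      by (rule recursive_in_cong[OF recursive_in_proj[of 3]]) (auto simp: nth_tl numeral_eq_Suc)
  qed auto
  moreover have "rec_nat 0 (\<lambda>n y. y + b) a = a * b" for a b :: nat
    by (induction a) auto
  ultimately show "recursive_in 2 (\<lambda>xs. xs ! 0 * xs ! 1)" by simp
qed

lemma recursive_in_pred: "recursive_in k f \<Longrightarrow> recursive_in k (\<lambda>xs. f xs - 1)"
proof (rule recursive_in_comp1[where f = "\<lambda>x. x - 1"])
  have "recursive_in 1 (\<lambda>xs. rec_nat 0 (\<lambda>n y. n) (xs ! 0))"
    by (intro recursive_in_rec_nat recursive_in_proj recursive_in_const) auto
  moreover have "rec_nat 0 (\<lambda>n y. n) a = a - 1" for a :: nat
    by (cases a) auto
  ultimately show "recursive_in 1 (\<lambda>xs. xs ! 0 - 1)" by simp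
qed

lemma recursive_in_diff: "recursive_in k f \<Longrightarrow> recursive_in k g \<Longrightarrow> recursive_in k (\<lambda>xs. f xs - g xs)"
proof (rule recursive_in_comp2[where f = "(-)"])
  have "recursive_in 2 (\<lambda>xs. rec_nat (xs ! 0) (\<lambda>n y. y - 1) (xs ! 1))"
    by (intro recursive_in_rec_nat recursive_in_proj recursive_in_pred) auto
  moreover have "rec_nat a (\<lambda>n y. y - 1) b = a - b" for a b :: nat
    by (induction b) auto
  ultimately show "recursive_in 2 (\<lambda>xs. xs ! 0 - xs ! 1)" by simp
qed

lemma recursive_in_triangle: "recursive_in k f \<Longrightarrow> recursive_in k (\<lambda>xs. triangle (f xs))"
proof (rule recursive_in_comp1[where f = "triangle"])
  have "recursive_in 1 (\<lambda>xs. rec_nat 0 (\<lambda>n y. y + Suc n) (xs ! 0))"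
    by (intro recursive_in_rec_nat recursive_in_proj recursive_in_const recursive_in_add
        recursive_in_Suc) auto
  moreover have "rec_nat 0 (\<lambda>n y. y + Suc n) a = triangle a" for a :: nat
    by (induction a) auto
  ultimately show "recursive_in 1 (\<lambda>xs. triangle (xs ! 0))" by simp
qed

lemma recursive_in_prod_encode:
  "recursive_in k f \<Longrightarrow> recursive_in k g \<Longrightarrow> recursive_in k (\<lambda>xs. prod_encode (f xs, g xs))"
  unfolding prod_encode_def prod.case
  by (intro recursive_in_triangle recursive_in_add)

text \<open>The sum of the components of \<open>prod_decode z\<close> is the largest \<open>w\<close> with \<open>triangle w \<le> z\<close>.\<close>

definition triangle_root :: "nat \<Rightarrow> nat" where
  "triangle_root z = rec_nat 0 (\<lambda>n w. w + (1 - (triangle (Suc w) - Suc n))) z"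

lemma triangle_root_bounds:
  "triangle (triangle_root z) \<le> z \<and> z < triangle (Suc (triangle_root z))"
  unfolding triangle_root_def
proof (induction z)
  case (Suc z)
  define w where "w = rec_nat 0 (\<lambda>n w. w + (1 - (triangle (Suc w) - Suc n))) z"
  have IH: "triangle w \<le> z" "z < triangle (Suc w)" using Suc by (simp_all add: w_def)
  show ?case
  \<comment> \<open>By truncated subtraction the summand
    \<open>1 - (triangle (Suc w) - Suc n)\<close> is 1 exactly when \<open>Suc w\<close> is still
    admissible for \<open>Suc n\<close>, and 0 otherwise, so the root grows by at most one per
    step.\<close>
  proof (cases "triangle (Suc w) \<le> Suc z")
    case True
    then have "rec_nat 0 (\<lambda>n w. w + (1 - (triangle (Suc w) - Suc n))) (Suc z) = Suc w"
      by (simp add: w_def)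
    then show ?thesis using True IH by simp
  next
    case False
    then have "rec_nat 0 (\<lambda>n w. w + (1 - (triangle (Suc w) - Suc n))) (Suc z) = w"
      by (simp add: w_def)
    then show ?thesis using False IH by simp
  qed
qed simp

lemma triangle_mono: "m \<le> n \<Longrightarrow> triangle m \<le> triangle n"
  unfolding triangle_def by (intro div_le_mono mult_le_mono) auto

lemma triangle_root_prod_encode: "triangle_root (prod_encode (a, b)) = a + b"
proof -
  let ?w = "triangle_root (prod_encode (a, b))"
  have z: "triangle (a + b) \<le> prod_encode (a, b)" "prod_encode (a, b) < triangle (Suc (a + b))"
    by (simp_all add: prod_encode_def)
  have "\<not> ?w < a + b"
    using triangle_mono[of "Suc ?w" "a + b"] triangle_root_bounds[of "prod_encode (a, b)"] z
    by linarith
  moreover have "\<not> a + b < ?w"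
    using triangle_mono[of "Suc (a + b)" ?w] triangle_root_bounds[of "prod_encode (a, b)"] z
    by linarith
  ultimately show ?thesis by simp
qed

text \<open>The Cantor pairing puts \<open>(a, b)\<close> at offset \<open>a\<close> on the diagonal
  that starts at \<open>triangle (a + b)\<close>, so the number of the diagonal and the offset
  recover both components by subtraction.\<close>

lemma fst_prod_decode: "fst (prod_decode z) = z - triangle (triangle_root z)"
  and snd_prod_decode: "snd (prod_decode z) = triangle_root z - (z - triangle (triangle_root z))"
proof -
  obtain a b where "z = prod_encode (a, b)"
    by (metis prod_decode_inverse surj_pair)
  then show "fst (prod_decode z) = z - triangle (triangle_root z)"
    and "snd (prod_decode z) = triangle_root z - (z - triangle (triangle_root z))"
    by (simp_all add: triangle_root_prod_encode) (simp_all add: prod_encode_def)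
qed

lemma recursive_in_triangle_root:
  "recursive_in k f \<Longrightarrow> recursive_in k (\<lambda>xs. triangle_root (f xs))"
proof (rule recursive_in_comp1[where f = "triangle_root"])
  show "recursive_in 1 (\<lambda>xs. triangle_root (xs ! 0))"
    unfolding triangle_root_def
    by (intro recursive_in_rec_nat recursive_in_proj recursive_in_const recursive_in_add
        recursive_in_Suc recursive_in_diff recursive_in_triangle) auto
qed

section \<open>Total recursive functions of one argument\<close>

definition recursive :: "(nat \<Rightarrow> nat) \<Rightarrow> bool" where
  "recursive f \<longleftrightarrow> (\<exists>P. \<forall>x. evalr P [x] (f x))"

lemma recursive_iff: "recursive f \<longleftrightarrow> recursive_in 1 (\<lambda>xs. f (xs ! 0))"
proof
  show "recursive f \<Longrightarrow> recursive_in 1 (\<lambda>xs. f (xs ! 0))"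
    unfolding recursive_in_def recursive_def
    by (elim exE, rule_tac x = P in exI) (auto simp: length_Suc_conv)
next
  assume "recursive_in 1 (\<lambda>xs. f (xs ! 0))"
  then obtain P where P: "\<And>xs. length xs = 1 \<Longrightarrow> evalr P xs (f (xs ! 0))"
    unfolding recursive_in_def by blast
  show "recursive f"
    unfolding recursive_def using P[of "[x]" for x] by auto
qed

lemma recursive_id: "recursive (\<lambda>x. x)"
  and recursive_const: "recursive (\<lambda>_. c)"
  and recursive_comp: "recursive f \<Longrightarrow> recursive g \<Longrightarrow> recursive (\<lambda>x. f (g x))"
  and recursive_Suc: "recursive f \<Longrightarrow> recursive (\<lambda>x. Suc (f x))"
  and recursive_add: "recursive f \<Longrightarrow> recursive g \<Longrightarrow> recursive (\<lambda>x. f x + g x)"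
  and recursive_mult: "recursive f \<Longrightarrow> recursive g \<Longrightarrow> recursive (\<lambda>x. f x * g x)"
  and recursive_diff: "recursive f \<Longrightarrow> recursive g \<Longrightarrow> recursive (\<lambda>x. f x - g x)"
  and recursive_prod_encode:
    "recursive f \<Longrightarrow> recursive g \<Longrightarrow> recursive (\<lambda>x. prod_encode (f x, g x))"
  unfolding recursive_iff
  by (simp_all add: recursive_in_proj recursive_in_const recursive_in_comp1[of f] recursive_in_Suc
      recursive_in_add recursive_in_mult recursive_in_diff recursive_in_prod_encode)

lemma recursive_fst: "recursive f \<Longrightarrow> recursive (\<lambda>x. fst (prod_decode (f x)))"
  and recursive_snd: "recursive f \<Longrightarrow> recursive (\<lambda>x. snd (prod_decode (f x)))"
  unfolding recursive_iff fst_prod_decode snd_prod_decode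
  by (simp_all add: recursive_in_triangle recursive_in_triangle_root recursive_in_diff)

text \<open>With pairing, functions of one argument suffice: the step function receives the
  parameter, the counter and the previous value as one number, which keeps the later calculus free
  of arities.\<close>

lemma recursive_rec_nat:
  assumes z: "recursive z" and n: "recursive n"
    and s: "recursive s"
  shows "recursive (\<lambda>x. rec_nat (z x) (\<lambda>m y. s (prod_encode (x, prod_encode (m, y)))) (n x))"
  unfolding recursive_iff
proof (intro recursive_in_rec_nat)
  show "recursive_in 1 (\<lambda>xs. z (xs ! 0))" "recursive_in 1 (\<lambda>xs. n (xs ! 0))"
    using z n by (simp_all add: recursive_iff)
  have "recursive_in 3 (\<lambda>ys. s (prod_encode (ys ! 2, prod_encode (ys ! 0, ys ! 1))))"
    by (rule recursive_in_comp1[where f = s])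
      (use s in \<open>auto simp: recursive_iff intro!: recursive_in_prod_encode recursive_in_proj\<close>)
  then have "recursive_in (Suc (Suc 1)) (\<lambda>ys. s (prod_encode (ys ! 2, prod_encode (ys ! 0, ys ! 1))))"
    by (simp add: numeral_3_eq_3)
  then show "recursive_in (Suc (Suc 1))
     (\<lambda>ys. s (prod_encode (tl (tl ys) ! 0, prod_encode (ys ! 0, ys ! 1))))"
    by (rule recursive_in_cong) (auto simp: nth_tl numeral_eq_Suc)
qed

section \<open>Computability of functions between coded types\<close>

text \<open>\<open>bdd m x\<close> bounds the list lengths and the numbers occurring in
  \<open>x\<close> by \<open>m\<close>, whereas codes of lists grow much faster. Size estimates are
  carried out for \<open>bdd\<close>, and only the last axiom turns them into a bound on codes, so
  that a search over all \<open>x\<close> with \<open>bdd m x\<close> becomes a search over finitely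
  many codes. Bijectivity makes every number a code, so \<open>decode\<close> involves no test for
  well-formedness.\<close>

class coded =
  fixes encode :: "'a \<Rightarrow> nat"
    and bdd :: "nat \<Rightarrow> 'a \<Rightarrow> bool"
  assumes bij_encode: "bij encode"
    and bdd_mono: "bdd m x \<Longrightarrow> m \<le> n \<Longrightarrow> bdd n x"
    and bdd_encode: "bdd (encode x) x"
    and ex_code_bound: "\<exists>b. recursive b \<and> (\<forall>m x. bdd m x \<longrightarrow> encode x \<le> b m)"

definition decode :: "nat \<Rightarrow> 'a::coded" where
  "decode = inv encode"

lemma decode_encode [simp]: "decode (encode x) = x"
  unfolding decode_def by (rule inv_f_f[OF bij_is_inj[OF bij_encode]])

lemma encode_decode [simp]: "encode (decode n :: 'a::coded) = n"
  unfolding decode_def by (rule surj_f_inv_f[OF bij_is_surj[OF bij_encode]])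

lemma encode_eq_iff [simp]: "encode x = encode y \<longleftrightarrow> x = y"
  by (metis decode_encode)

text \<open>The choice is harmless: computability only asks that some program exists, not that it
  can be exhibited.\<close>

definition code_bound :: "'a::coded itself \<Rightarrow> nat \<Rightarrow> nat" where
  "code_bound _ = (SOME b. recursive b \<and> (\<forall>m x::'a. bdd m x \<longrightarrow> encode x \<le> b m))"

lemma recursive_code_bound: "recursive (code_bound TYPE('a::coded))"
  and encode_le_code_bound: "bdd m (x::'a) \<Longrightarrow> encode x \<le> code_bound TYPE('a::coded) m"
  using someI_ex[OF ex_code_bound[where 'a = 'a]] unfolding code_bound_def by auto

definition computable :: "('a::coded \<Rightarrow> 'b::coded) \<Rightarrow> bool" where
  "computable f \<longleftrightarrow> recursive (\<lambda>n. encode (f (decode n)))"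

definition decidable :: "('a::coded \<Rightarrow> bool) \<Rightarrow> bool" where
  "decidable P \<longleftrightarrow> recursive (\<lambda>n. of_bool (P (decode n)))"

named_theorems comp_intros

lemma computableI: "recursive g \<Longrightarrow> (\<And>x. encode (f x) = g (encode x)) \<Longrightarrow> computable f"
  unfolding computable_def by simp

lemma computable_ident [comp_intros]: "computable (\<lambda>x. x)"
  and computable_const [comp_intros]: "computable (\<lambda>_. c)"
  unfolding computable_def by (simp_all add: recursive_id recursive_const)

lemma computable_comp: "computable f \<Longrightarrow> computable g \<Longrightarrow> computable (\<lambda>x. f (g x))"
  unfolding computable_def using recursive_comp[of "\<lambda>n. encode (f (decode n))"] by fastforce

lemma decidable_comp: "decidable P \<Longrightarrow> computable g \<Longrightarrow> decidable (\<lambda>x. P (g x))"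
  unfolding computable_def decidable_def
  using recursive_comp[of "\<lambda>n. of_bool (P (decode n))"] by fastforce


subsection \<open>Numbers and truth values\<close>

instantiation nat :: coded
begin

definition "encode (n::nat) = n"
definition "bdd (m::nat) (n::nat) \<longleftrightarrow> n \<le> m"

instance
  by standard (auto simp: encode_nat_def bdd_nat_def bij_def inj_def intro!: exI[of _ "\<lambda>n. n"] recursive_id)

end

lemma encode_nat [simp]: "encode (n::nat) = n"
  by (simp add: encode_nat_def)

lemma decode_nat [simp]: "decode n = (n::nat)"
  by (metis decode_encode encode_nat)

lemma computable_Suc [comp_intros]: "computable f \<Longrightarrow> computable (\<lambda>x. Suc (f x))"
  and computable_add [comp_intros]:
    "computable f \<Longrightarrow> computable g \<Longrightarrow> computable (\<lambda>x. f x + g x :: nat)"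
  and computable_mult [comp_intros]:
    "computable f \<Longrightarrow> computable g \<Longrightarrow> computable (\<lambda>x. f x * g x :: nat)"
  and computable_diff [comp_intros]:
    "computable f \<Longrightarrow> computable g \<Longrightarrow> computable (\<lambda>x. f x - g x :: nat)"
  unfolding computable_def encode_nat
  by (simp_all add: recursive_Suc recursive_add recursive_mult recursive_diff)

lemma computable_encode [comp_intros]:
  "computable f \<Longrightarrow> computable (\<lambda>x. encode (f x))"
  and computable_decode [comp_intros]:
  "computable g \<Longrightarrow> computable (\<lambda>x. decode (g x))"
  and computable_code_bound [comp_intros]:
  "computable g \<Longrightarrow> computable (\<lambda>x. code_bound TYPE('a::coded) (g x))"
  unfolding computable_def encode_nat encode_decode
  by (auto intro: recursive_comp recursive_code_bound)

lemma decidable_iff: "decidable P \<longleftrightarrow> computable (\<lambda>x. of_bool (P x) :: nat)"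
  by (simp add: decidable_def computable_def)

lemma computable_of_bool [comp_intros]: "decidable P \<Longrightarrow> computable (\<lambda>x. of_bool (P x) :: nat)"
  by (simp add: decidable_iff)

lemma recursive_le: "recursive f \<Longrightarrow> recursive g \<Longrightarrow> recursive (\<lambda>x. of_bool (f x \<le> g x))"
proof -
  assume "recursive f" "recursive g"
  then have "recursive (\<lambda>x. 1 - (f x - g x))"
    by (intro recursive_diff recursive_const)
  moreover have "1 - (f x - g x) = of_bool (f x \<le> g x)" for x
    by auto
  ultimately show ?thesis by simp
qed

lemma decidable_not [comp_intros]: "decidable P \<Longrightarrow> decidable (\<lambda>x. \<not> P x)"
proof -
  assume "decidable P"
  then have "recursive (\<lambda>n. 1 - of_bool (P (decode n)))"
    unfolding decidable_def by (intro recursive_diff recursive_const)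
  moreover have "(1 - of_bool b :: nat) = of_bool (\<not> b)" for b
    by simp
  ultimately show ?thesis unfolding decidable_def by (simp only:)
qed

lemma decidable_conj [comp_intros]: "decidable P \<Longrightarrow> decidable Q \<Longrightarrow> decidable (\<lambda>x. P x \<and> Q x)"
  unfolding decidable_def of_bool_conj by (rule recursive_mult)

lemma decidable_disj [comp_intros]: "decidable P \<Longrightarrow> decidable Q \<Longrightarrow> decidable (\<lambda>x. P x \<or> Q x)"
  and decidable_imp [comp_intros]: "decidable P \<Longrightarrow> decidable Q \<Longrightarrow> decidable (\<lambda>x. P x \<longrightarrow> Q x)"
  using decidable_not[OF decidable_conj[OF decidable_not[of P] decidable_not[of Q]]]
    decidable_not[OF decidable_conj[of P, OF _ decidable_not[of Q]]] by simp_all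

lemma decidable_le [comp_intros]:
    "computable f \<Longrightarrow> computable g \<Longrightarrow> decidable (\<lambda>x. f x \<le> (g x :: nat))"
  and decidable_less [comp_intros]:
    "computable f \<Longrightarrow> computable g \<Longrightarrow> decidable (\<lambda>x. f x < (g x :: nat))"
  unfolding decidable_def computable_def Suc_le_eq[symmetric]
  by (auto intro: recursive_le recursive_Suc)

lemma decidable_eq [comp_intros]:
  "computable f \<Longrightarrow> computable g \<Longrightarrow> decidable (\<lambda>x. f x = (g x :: 'a::coded))"
proof -
  assume "computable f" "computable g"
  then have "decidable (\<lambda>x. encode (f x) \<le> encode (g x) \<and> encode (g x) \<le> encode (f x))"
    by (intro comp_intros)
  then show ?thesis by (simp add: order_eq_iff[symmetric])
qed

lemma computable_if [comp_intros]:
  assumes "decidable P" "computable f" "computable g"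
  shows "computable (\<lambda>x. if P x then f x else g x)"
proof (rule computableI)
  show "recursive (\<lambda>n. of_bool (P (decode n)) * encode (f (decode n)) +
      (1 - of_bool (P (decode n))) * encode (g (decode n)))"
    using assms unfolding decidable_def computable_def
    by (intro recursive_add recursive_mult recursive_diff recursive_const)
qed auto


subsection \<open>Pairs, recursion and bounded quantification\<close>

lemma prod_encode_mono: "a \<le> c \<Longrightarrow> b \<le> d \<Longrightarrow> prod_encode (a, b) \<le> prod_encode (c, d)"
  unfolding prod_encode_def by (auto intro!: add_mono triangle_mono)

instantiation prod :: (coded, coded) coded
begin

definition "encode p = prod_encode (encode (fst p), encode (snd p))"
definition "bdd m p \<longleftrightarrow> bdd m (fst p) \<and> bdd m (snd p)"

instance
proof
  have "encode = prod_encode \<circ> map_prod (encode :: 'a \<Rightarrow> nat) (encode :: 'b \<Rightarrow> nat)"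
    by (auto simp: encode_prod_def)
  moreover have "bij (map_prod (encode :: 'a \<Rightarrow> nat) (encode :: 'b \<Rightarrow> nat))"
    using bij_betw_map_prod[OF bij_encode bij_encode] by simp
  ultimately show "bij (encode :: 'a \<times> 'b \<Rightarrow> nat)"
    using bij_comp[of "map_prod encode encode :: 'a \<times> 'b \<Rightarrow> nat \<times> nat" prod_encode] bij_prod_encode
    by simp
next
  fix m n and x :: "'a \<times> 'b"
  show "bdd m x \<Longrightarrow> m \<le> n \<Longrightarrow> bdd n x"
    unfolding bdd_prod_def using bdd_mono[of m "fst x" n] bdd_mono[of m "snd x" n] by simp
  show "bdd (encode x) x"
    unfolding bdd_prod_def encode_prod_def
    by (auto intro: bdd_mono[OF bdd_encode] le_prod_encode_1 le_prod_encode_2)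
next
  have "encode x \<le> prod_encode (code_bound TYPE('a) m, code_bound TYPE('b) m)"
    if "bdd m x" for m and x :: "'a \<times> 'b"
    using that unfolding bdd_prod_def encode_prod_def
    by (auto intro!: prod_encode_mono encode_le_code_bound)
  then show "\<exists>b. recursive b \<and> (\<forall>m x :: 'a \<times> 'b. bdd m x \<longrightarrow> encode x \<le> b m)"
    using recursive_prod_encode[OF recursive_code_bound recursive_code_bound]
    by (intro exI[of _ "\<lambda>m. prod_encode (code_bound TYPE('a) m, code_bound TYPE('b) m)"]) simp
qed

end

lemma decode_prod:
  "(decode k :: 'a::coded \<times> 'b::coded) = (decode (fst (prod_decode k)), decode (snd (prod_decode k)))"
  by (rule encode_eq_iff[THEN iffD1], subst encode_decode) (simp add: encode_prod_def)

lemma computable_Pair [comp_intros]: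
  "computable f \<Longrightarrow> computable g \<Longrightarrow> computable (\<lambda>x. (f x, g x))"
  unfolding computable_def encode_prod_def by (simp add: recursive_prod_encode)

lemma computable_fst [comp_intros]: "computable f \<Longrightarrow> computable (\<lambda>x. fst (f x))"
  and computable_snd [comp_intros]: "computable f \<Longrightarrow> computable (\<lambda>x. snd (f x))"
proof -
  have *: "computable (fst :: 'b \<times> 'c \<Rightarrow> 'b)" "computable (snd :: 'b \<times> 'c \<Rightarrow> 'c)"
    by (rule computableI[OF recursive_fst[OF recursive_id]]
        computableI[OF recursive_snd[OF recursive_id]], simp add: encode_prod_def)+
  show "computable f \<Longrightarrow> computable (\<lambda>x. fst (f x))"
    by (rule computable_comp[OF *(1)])
  show "computable f \<Longrightarrow> computable (\<lambda>x. snd (f x))"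
    by (rule computable_comp[OF *(2)])
qed

lemma computable_rec_nat [comp_intros]:
  assumes z: "computable z"
    and s: "computable (\<lambda>p. s (fst p) (fst (snd p)) (snd (snd p)))"
    and n: "computable n"
  shows "computable (\<lambda>x. rec_nat (z x) (s x) (n x) :: 'a::coded)"
proof (rule computableI)
  let ?s = "\<lambda>k. encode (s (decode (fst (prod_decode k)))
    (fst (prod_decode (snd (prod_decode k)))) (decode (snd (prod_decode (snd (prod_decode k))))))"
  have "recursive ?s"
    using s unfolding computable_def by (simp add: decode_prod)
  then show "recursive (\<lambda>k. rec_nat (encode (z (decode k)))
      (\<lambda>m y. ?s (prod_encode (k, prod_encode (m, y)))) (encode (n (decode k))))"
    using z n unfolding computable_def by (intro recursive_rec_nat)
  have "encode (rec_nat a (s x) k) =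
      rec_nat (encode a) (\<lambda>m y. encode (s x m (decode y))) k" for a x k
  proof (induction k)
    case (Suc k)
    have "decode (rec_nat (encode a) (\<lambda>m y. encode (s x m (decode y))) k) = rec_nat a (s x) k"
      unfolding Suc.IH[symmetric] by (rule decode_encode)
    then show ?case by simp
  qed simp
  then show "encode (rec_nat (z x) (s x) (n x)) = rec_nat (encode (z (decode (encode x))))
      (\<lambda>m y. ?s (prod_encode (encode x, prod_encode (m, y)))) (encode (n (decode (encode x))))" for x
    by simp
qed

lemma decidable_ex_less [comp_intros]:
  fixes P :: "'x::coded \<Rightarrow> nat \<Rightarrow> bool"
  assumes P: "decidable (\<lambda>p. P (fst p) (snd p))" and b: "computable b"
  shows "decidable (\<lambda>x. \<exists>i < b x. P x i)"
proof -
  have *: "decidable (\<lambda>q. P (fst q) (fst (snd q)))" for q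
    using decidable_comp[OF P, of "\<lambda>q. (fst q, fst (snd q))"] by (simp add: comp_intros)
  have "computable (\<lambda>x. rec_nat 0 (\<lambda>m y. if P x m then 1 else y) (b x) :: nat)"
    by (intro comp_intros b *)
  moreover have "rec_nat 0 (\<lambda>m y. if P x m then 1 else y) n = (of_bool (\<exists>i < n. P x i) :: nat)" for x n
    by (induction n) (auto simp: less_Suc_eq)
  ultimately show ?thesis by (simp add: decidable_iff)
qed

lemma decidable_all_less [comp_intros]:
  fixes P :: "'x::coded \<Rightarrow> nat \<Rightarrow> bool"
  assumes P: "decidable (\<lambda>p. P (fst p) (snd p))" and b: "computable b"
  shows "decidable (\<lambda>x. \<forall>i < b x. P x i)"
proof -
  have "decidable (\<lambda>x. \<not> (\<exists>i < b x. \<not> P x i))"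
    by (intro comp_intros P b)
  then show ?thesis by simp
qed

subsection \<open>Lists\<close>

text \<open>Pairing is monotone in both components, so the largest code belongs to the list of
  \<open>n\<close> copies of \<open>c\<close>, and the displayed recursion computes exactly that
  code.\<close>

lemma list_encode_bound:
  "length xs \<le> n \<Longrightarrow> \<forall>x \<in> set xs. x \<le> c \<Longrightarrow>
    list_encode xs \<le> rec_nat 0 (\<lambda>_ y. Suc (prod_encode (c, y))) n"
proof (induction xs arbitrary: n)
  case (Cons x xs)
  then obtain k where "n = Suc k" by (cases n) auto
  then show ?case using Cons by (auto intro!: prod_encode_mono)
qed simp

lemma length_le_list_encode: "length xs \<le> list_encode xs"
proof (induction xs)
  case (Cons x xs)
  then show ?case using le_prod_encode_2[of "list_encode xs" x] by simp
qed simp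

lemma le_list_encode: "x \<in> set xs \<Longrightarrow> x \<le> list_encode xs"
proof (induction xs)
  case (Cons y xs)
  then show ?case
    using le_prod_encode_2[of "list_encode xs" y] le_prod_encode_1[of y "list_encode xs"] by auto
qed simp

instantiation list :: (coded) coded
begin

definition "encode xs = list_encode (map encode xs)"
definition "bdd m xs \<longleftrightarrow> length xs \<le> m \<and> (\<forall>x \<in> set xs. bdd m x)"

instance
proof
  have "inj (map (encode :: 'a \<Rightarrow> nat))"
    by (simp add: bij_encode bij_is_inj)
  moreover have "surj (map (encode :: 'a \<Rightarrow> nat))"
    by (rule surjI[of _ "map decode"]) (simp add: comp_def)
  ultimately have "bij (map (encode :: 'a \<Rightarrow> nat))"
    by (rule bijI)
  then have "bij (list_encode \<circ> map (encode :: 'a \<Rightarrow> nat))"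
    by (rule bij_comp[OF _ bij_list_encode])
  moreover have "list_encode \<circ> map (encode :: 'a \<Rightarrow> nat) = encode"
    by (auto simp: encode_list_def)
  ultimately show "bij (encode :: 'a list \<Rightarrow> nat)"
    by (simp only:)
next
  fix m n and x :: "'a list"
  show "bdd m x \<Longrightarrow> m \<le> n \<Longrightarrow> bdd n x"
    unfolding bdd_list_def using bdd_mono[of m _ n] by auto
  show "bdd (encode x) x"
    unfolding bdd_list_def encode_list_def
    using length_le_list_encode[of "map encode x"] le_list_encode[of _ "map encode x"]
    by (auto intro: bdd_mono[OF bdd_encode])
next
  let ?b = "\<lambda>m. rec_nat 0 (\<lambda>_ y. Suc (prod_encode (code_bound TYPE('a) m, y))) m"
  have "recursive (\<lambda>k. Suc (prod_encode (code_bound TYPE('a) (fst (prod_decode k)),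
      snd (prod_decode (snd (prod_decode k))))))"
    by (intro recursive_Suc recursive_prod_encode recursive_comp[OF recursive_code_bound]
        recursive_fst recursive_snd recursive_id)
  from recursive_rec_nat[OF recursive_const[of 0] recursive_id this]
  have "recursive ?b" by simp
  moreover have "encode x \<le> ?b m" if "bdd m x" for m and x :: "'a list"
    using that unfolding bdd_list_def encode_list_def
    by (intro list_encode_bound) (auto intro: encode_le_code_bound)
  ultimately show "\<exists>b. recursive b \<and> (\<forall>m x :: 'a list. bdd m x \<longrightarrow> encode x \<le> b m)"
    by (intro exI[of _ ?b]) simp
qed

end

lemma encode_Nil [simp]: "encode [] = 0"
  and encode_Cons: "encode (x # xs) = Suc (prod_encode (encode x, encode xs))"
  by (simp_all add: encode_list_def)

lemma encode_nat_list: "encode (xs :: nat list) = list_encode xs"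
proof -
  have "map encode xs = xs"
    by (rule map_idI) simp
  then show ?thesis
    by (simp add: encode_list_def)
qed

text \<open>Unlike \<open>hd\<close> and \<open>nth\<close>, the following are specified outside their intended domains, with
  computable values.\<close>

definition head :: "'a::coded list \<Rightarrow> 'a" where
  "head xs = (case xs of [] \<Rightarrow> decode 0 | x # _ \<Rightarrow> x)"

definition item :: "'a::coded list \<Rightarrow> nat \<Rightarrow> 'a" where
  "item xs i = head (drop i xs)"

lemma item_eq_nth: "i < length xs \<Longrightarrow> item xs i = xs ! i"
  by (simp add: item_def head_def Cons_nth_drop_Suc[symmetric])

lemma computable_Cons [comp_intros]:
  "computable f \<Longrightarrow> computable g \<Longrightarrow> computable (\<lambda>x. f x # g x)"
  unfolding computable_def encode_Cons by (intro recursive_Suc recursive_prod_encode)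

lemma prod_decode_0: "prod_decode 0 = (0, 0)"
  using prod_encode_inverse[of "(0, 0)"] by (simp add: prod_encode_def)

lemma computable_head [comp_intros]: "computable f \<Longrightarrow> computable (\<lambda>x. head (f x))"
proof -
  have "computable (head :: 'b list \<Rightarrow> 'b)"
  proof (rule computableI)
    show "recursive (\<lambda>n. fst (prod_decode (n - 1)))"
      by (intro recursive_fst recursive_diff recursive_id recursive_const)
    show "encode (head xs) = fst (prod_decode (encode xs - 1))" for xs :: "'b list"
      by (cases xs) (simp_all add: head_def encode_Cons prod_decode_0)
  qed
  then show "computable f \<Longrightarrow> computable (\<lambda>x. head (f x))"
    by (rule computable_comp)
qed

lemma computable_tl [comp_intros]: "computable f \<Longrightarrow> computable (\<lambda>x. tl (f x))"
proof -
  have "computable (tl :: 'b list \<Rightarrow> 'b list)"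
  proof (rule computableI)
    show "recursive (\<lambda>n. snd (prod_decode (n - 1)))"
      by (intro recursive_snd recursive_diff recursive_id recursive_const)
    show "encode (tl xs) = snd (prod_decode (encode xs - 1))" for xs :: "'b list"
      by (cases xs) (simp_all add: encode_Cons prod_decode_0)
  qed
  then show "computable f \<Longrightarrow> computable (\<lambda>x. tl (f x))"
    by (rule computable_comp)
qed

lemma computable_item [comp_intros]:
  "computable f \<Longrightarrow> computable i \<Longrightarrow> computable (\<lambda>x. item (f x) (i x))"
proof -
  assume fi: "computable f" "computable i"
  have "computable (\<lambda>x. head (rec_nat (f x) (\<lambda>_. tl) (i x)))"
    by (intro comp_intros fi)
  moreover have "rec_nat xs (\<lambda>_. tl) k = drop k xs" for xs :: "'b list" and k
    by (induction k) (simp_all add: tl_drop drop_Suc)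
  ultimately show ?thesis unfolding item_def by simp
qed

text \<open>Only recursion on numbers is available, so the fold is run as a loop on the state
  (remaining list, accumulator). The code of the list serves as the number of rounds: it is at least
  the length, and surplus rounds on an empty list change nothing.\<close>

lemma computable_fold [comp_intros]:
  assumes f: "computable (\<lambda>p. f (fst p) (fst (snd p)) (snd (snd p)))"
    and xs: "computable xs" and z: "computable z"
  shows "computable (\<lambda>x. fold (f x) (xs x) (z x))"
proof -
  let ?step = "\<lambda>x (_ :: nat) s. if fst s = [] then s else (tl (fst s), f x (head (fst s)) (snd s))"
  have f': "computable (\<lambda>p. f (fst p) (head (fst (snd (snd p)))) (snd (snd (snd p))))"
    using computable_comp[OF f, of "\<lambda>p. (fst p, head (fst (snd (snd p))), snd (snd (snd p)))"]
    by (simp add: comp_intros)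
  have "computable (\<lambda>x. snd (rec_nat (xs x, z x) (?step x) (encode (xs x))))"
    by (intro comp_intros f' xs z)
  moreover have "snd (rec_nat (ys, a) (?step x) n) = fold (f x) ys a" if "length ys \<le> n" for x ys a n
  proof -
    \<comment> \<open>\<open>rec_nat\<close> performs the last round outermost; this moves the first
      round to the inside, where the induction on the list can use it.\<close>
    have *: "rec_nat (ys, a) (?step x) (Suc k) = rec_nat (?step x 0 (ys, a)) (?step x) k" for ys a k
      by (induction k) simp_all
    show ?thesis
      using that
    proof (induction ys arbitrary: a n)
      case Nil
      have "rec_nat ([], a) (?step x) n = ([], a)" by (induction n) simp_all
      then show ?case by simp
    next
      case (Cons y ys)
      then obtain k where k: "n = Suc k" "length ys \<le> k" by (cases n) auto
      show ?case
        unfolding k(1) * using Cons.IH[OF k(2)] by (simp add: head_def)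
    qed
  qed
  moreover have "length ys \<le> encode ys" for ys :: "'b list"
    unfolding encode_list_def using length_le_list_encode[of "map encode ys"] by simp
  ultimately show ?thesis by simp
qed

lemma computable_rev [comp_intros]:
  assumes "computable f" shows "computable (\<lambda>x. rev (f x))"
proof -
  have "computable (\<lambda>x. fold (\<lambda>a ys. a # ys) (f x) [])"
    by (intro comp_intros assms)
  then show ?thesis by (simp add: fold_Cons_rev)
qed

lemma computable_append [comp_intros]:
  assumes "computable f" "computable g" shows "computable (\<lambda>x. f x @ g x)"
proof -
  have "computable (\<lambda>x. fold (\<lambda>a ys. a # ys) (rev (f x)) (g x))"
    by (intro comp_intros assms)
  then show ?thesis by (simp add: fold_Cons_rev)
qed

lemma computable_length [comp_intros]:
  assumes "computable f" shows "computable (\<lambda>x. length (f x))"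
proof -
  have "computable (\<lambda>x. fold (\<lambda>_ n. Suc n) (f x) 0)"
    by (intro comp_intros assms)
  moreover have "fold (\<lambda>_ n. Suc n) xs k = length xs + k" for xs :: "'b list" and k
    by (induction xs arbitrary: k) simp_all
  ultimately show ?thesis by simp
qed

lemma computable_map [comp_intros]:
  assumes f: "computable (\<lambda>p. f (fst p) (snd p))" and xs: "computable xs"
  shows "computable (\<lambda>x. map (f x) (xs x))"
proof -
  have f': "computable (\<lambda>p. f (fst p) (fst (snd p)))"
    using computable_comp[OF f, of "\<lambda>p. (fst p, fst (snd p))"] by (simp add: comp_intros)
  have "computable (\<lambda>x. rev (fold (\<lambda>a ys. f x a # ys) (xs x) []))"
    by (intro comp_intros f' xs)
  moreover have "fold (\<lambda>a ys. f x a # ys) zs ys = rev (map (f x) zs) @ ys" for x zs ys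
    by (induction zs arbitrary: ys) simp_all
  ultimately show ?thesis by simp
qed

lemma computable_filter [comp_intros]:
  assumes P: "decidable (\<lambda>p. P (fst p) (snd p))" and xs: "computable xs"
  shows "computable (\<lambda>x. filter (P x) (xs x))"
proof -
  have P': "decidable (\<lambda>p. P (fst p) (fst (snd p)))"
    using decidable_comp[OF P, of "\<lambda>p. (fst p, fst (snd p))"] by (simp add: comp_intros)
  have "computable (\<lambda>x. rev (fold (\<lambda>a ys. if P x a then a # ys else ys) (xs x) []))"
    by (intro comp_intros P' xs)
  moreover have "fold (\<lambda>a ys. if P x a then a # ys else ys) zs ys = rev (filter (P x) zs) @ ys" for x zs ys
    by (induction zs arbitrary: ys) simp_all
  ultimately show ?thesis by simp
qed

lemma computable_upt [comp_intros]:
  assumes "computable n" shows "computable (\<lambda>x. [0..<n x])"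
proof -
  have "computable (\<lambda>x. rec_nat [] (\<lambda>m ys. ys @ [m]) (n x))"
    by (intro comp_intros assms)
  moreover have "rec_nat [] (\<lambda>m ys. ys @ [m]) k = [0..<k]" for k
    by (induction k) simp_all
  ultimately show ?thesis by simp
qed

lemma decidable_ball_set [comp_intros]:
  assumes P: "decidable (\<lambda>p. P (fst p) (snd p))" and xs: "computable xs"
  shows "decidable (\<lambda>x. \<forall>y \<in> set (xs x). P x y)"
proof -
  have "decidable (\<lambda>x. filter (\<lambda>y. \<not> P x y) (xs x) = [])"
    by (intro comp_intros P xs)
  then show ?thesis by (simp add: filter_empty_conv)
qed

lemma decidable_bex_set [comp_intros]:
  assumes P: "decidable (\<lambda>p. P (fst p) (snd p))" and xs: "computable xs"
  shows "decidable (\<lambda>x. \<exists>y \<in> set (xs x). P x y)"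
proof -
  have "decidable (\<lambda>x. \<not> (\<forall>y \<in> set (xs x). \<not> P x y))"
    by (intro comp_intros P xs)
  then show ?thesis by simp
qed

text \<open>Completeness is what counts: members that are not \<open>bdd m\<close> are sorted out by
  the conditions under which the list is used.\<close>

definition candidates :: "nat \<Rightarrow> 'a::coded list" where
  "candidates m = map decode [0..<Suc (code_bound TYPE('a) m)]"

lemma bdd_in_candidates: "bdd m x \<Longrightarrow> x \<in> set (candidates m)"
  using encode_le_code_bound[of m x] unfolding candidates_def set_map set_upt
  by (intro image_eqI[of _ _ "encode x"]) auto

lemma computable_candidates [comp_intros]:
  "computable m \<Longrightarrow> computable (\<lambda>x. candidates (m x) :: 'a::coded list)"
  unfolding candidates_def by (intro comp_intros)

text \<open>Minimisation by \<open>Mu\<close>. Nothing is claimed where no \<open>n\<close>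
  satisfies \<open>P x\<close>; the program may diverge there, and this is where partiality
  enters.\<close>

lemma evalr_Least:
  assumes "decidable (\<lambda>p. P (fst p) (snd p))"
  obtains R where "\<And>x n. P x n \<Longrightarrow> evalr R [encode x] (LEAST n. P x n)"
proof -
  \<comment> \<open>\<open>Mu\<close> looks for the value 0 and passes the searched number first,
    hence the negated truth value and the swapped components.\<close>
  define g where "g z = (1 - of_bool (P (decode (snd (prod_decode z))) (fst (prod_decode z))) :: nat)" for z
  have "recursive (\<lambda>z. prod_encode (snd (prod_decode z), fst (prod_decode z)))"
    by (intro recursive_prod_encode recursive_fst recursive_snd recursive_id)
  from recursive_comp[OF assms[unfolded decidable_def] this]
  have "recursive (\<lambda>z. of_bool (P (decode (snd (prod_decode z))) (fst (prod_decode z))))"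
    by (simp only: decode_prod prod_encode_inverse fst_conv snd_conv decode_nat)
  then have "recursive g"
    unfolding g_def by (rule recursive_diff[OF recursive_const])
  then have "recursive_in 1 (\<lambda>xs. g (xs ! 0))"
    by (simp only: recursive_iff)
  then have "recursive_in 2 (\<lambda>xs. g (prod_encode (xs ! 0, xs ! 1)))"
    by (rule recursive_in_comp1) (intro recursive_in_prod_encode recursive_in_proj; simp)
  then obtain Q where Q: "\<And>xs. length xs = 2 \<Longrightarrow> evalr Q xs (g (prod_encode (xs ! 0, xs ! 1)))"
    unfolding recursive_in_def by blast
  have g: "evalr Q [n, encode x] (of_bool (\<not> P x n))" for n x
    using Q[of "[n, encode x]"] by (cases "P x n") (simp_all add: g_def)
  have "evalr (Mu Q) [encode x] (LEAST n. P x n)" if "P x n" for x n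
  proof (rule evalr.mu)
    show "evalr Q [LEAST n. P x n, encode x] 0"
      using g[of "LEAST n. P x n" x] LeastI[of "P x", OF that] by simp
    show "\<forall>m < (LEAST n. P x n). \<exists>y. evalr Q [m, encode x] (Suc y)"
    proof (intro allI impI)
      fix m
      assume "m < (LEAST n. P x n)"
      then have "\<not> P x m" by (rule not_less_Least)
      then show "\<exists>y. evalr Q [m, encode x] (Suc y)"
        using g[of m x] by (intro exI[of _ 0]) simp
    qed
  qed
  then show thesis by (rule that)
qed

lemma evalr_computable:
  assumes "computable f"
  obtains R where "\<And>x. evalr R [encode x] (encode (f x))"
proof -
  obtain R where R: "\<And>n. evalr R [n] (encode (f (decode n)))"
    using assms unfolding computable_def recursive_def by blast
  have "evalr R [encode x] (encode (f x))" for x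
    using R[of "encode x"] by simp
  then show thesis by (rule that)
qed

section \<open>Pushouts and pullbacks of finite sets\<close>

lemma map_nth_comp: "set xs \<subseteq> {..<length f} \<Longrightarrow> map ((!) (map g f)) xs = map g (map ((!) f) xs)"
  by auto

lemma nth_in_range: "set xs \<subseteq> {..<n} \<Longrightarrow> i < length xs \<Longrightarrow> xs ! i < n"
  using nth_mem by blast

lemma map_nth_upt: "length xs = n \<Longrightarrow> map ((!) xs) [0..<n] = xs"
  using map_nth[of xs] by simp

lemma map_upt_nth: "set xs \<subseteq> {..<n} \<Longrightarrow> map ((!) [0..<n]) xs = xs"
  by (rule map_idI) auto

lemma list_eq_via_covering:
  assumes "set F = {..<n}" "length x = n" "length y = n" "map ((!) x) F = map ((!) y) F"
  shows "x = y"
proof (rule nth_equalityI)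
  fix i
  assume "i < length x"
  then have "i \<in> set F" using assms(1,2) by simp
  then show "x ! i = y ! i" using assms(4) by simp
qed (simp add: assms)

text \<open>\<open>r z\<close> picks one index over \<open>z\<close>; since \<open>ab\<close> is
  constant on the fibres of \<open>F\<close>, the choice does not influence the value.\<close>

lemma lift_along_covering:
  assumes F: "set F = {..<n}" and len: "length ab = length F"
    and wd: "\<And>i j. i < length F \<Longrightarrow> j < length F \<Longrightarrow> F ! i = F ! j \<Longrightarrow> ab ! i = ab ! j"
  shows "\<exists>c. length c = n \<and> map ((!) c) F = ab"
proof -
  define r where "r z = (SOME i. i < length F \<and> F ! i = z)" for z
  have r: "r z < length F \<and> F ! r z = z" if "z < n" for z
  proof -
    have "z \<in> set F" using that F by simp
    then show ?thesis
      unfolding r_def in_set_conv_nth by (rule someI_ex)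
  qed
  define c where "c = map (\<lambda>z. ab ! r z) [0..<n]"
  have "map ((!) c) F = ab"
  proof (rule nth_equalityI)
    fix i
    assume "i < length (map ((!) c) F)"
    then have i: "i < length F" by simp
    then have "F ! i < n" using F nth_mem by blast
    then show "map ((!) c) F ! i = ab ! i"
      using i r[of "F ! i"] wd[of "r (F ! i)" i] by (simp add: c_def)
  qed (simp add: len)
  then show ?thesis by (intro exI[of _ c]) (simp add: c_def)
qed

text \<open>
  The cospan \<open>f\<close>, \<open>d\<close> into \<open>{..<n}\<close> is a pushout of the span \<open>l\<close>, \<open>k\<close>. The universal property is
  required only for maps into a two-element set, which suffices because that set is a cogenerator
  of the category of sets; this keeps the quantifiers bounded.
\<close>

definition set_po :: "nat \<Rightarrow> nat list \<Rightarrow> nat list \<Rightarrow> nat list \<Rightarrow> nat list \<Rightarrow> bool" where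
  "set_po n l k f d \<longleftrightarrow> set (f @ d) = {..<n} \<and>
     (\<forall>a b :: nat list. length a = length f \<and> length b = length d \<and> set a \<union> set b \<subseteq> {0, 1} \<and>
        map ((!) a) l = map ((!) b) k \<longrightarrow>
        (\<exists>c. length c = n \<and> map ((!) c) f = a \<and> map ((!) c) d = b))"

text \<open>Passage from two-valued maps to arbitrary values: if \<open>a @ b\<close> took different
  values at two glued indices, the indicator \<open>\<chi>\<close> of one of these values would turn
  it into a compatible two-valued pair that does not factor.\<close>

lemma set_po_lift:
  assumes po: "set_po n l k f d" and l: "set l \<subseteq> {..<length f}" and k: "set k \<subseteq> {..<length d}"
    and a: "length a = length f" and b: "length b = length d"
    and ab: "map ((!) a) l = map ((!) b) k"
  shows "\<exists>c. length c = n \<and> map ((!) c) f = a \<and> map ((!) c) d = b"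
proof -
  have "\<exists>c. length c = n \<and> map ((!) c) (f @ d) = a @ b"
  proof (rule lift_along_covering)
    show "set (f @ d) = {..<n}" using po by (simp add: set_po_def)
    show "length (a @ b) = length (f @ d)" using a b by simp
    fix i j
    assume ij: "i < length (f @ d)" "j < length (f @ d)" "(f @ d) ! i = (f @ d) ! j"
    define \<chi> where "\<chi> v = (if v = (a @ b) ! i then 1 else 0 :: nat)" for v
    have "map ((!) (map \<chi> a)) l = map \<chi> (map ((!) a) l)"
      using l a by (intro map_nth_comp) simp
    also have "\<dots> = map ((!) (map \<chi> b)) k"
      unfolding ab using k b by (intro map_nth_comp[symmetric]) simp
    finally obtain c where "map ((!) c) f = map \<chi> a" "map ((!) c) d = map \<chi> b"
      using po[unfolded set_po_def, THEN conjunct2, rule_format, of "map \<chi> a" "map \<chi> b"] a b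
      by (auto simp: \<chi>_def)
    then have c: "map ((!) c) (f @ d) = map \<chi> (a @ b)" by simp
    have "\<chi> ((a @ b) ! i) = c ! ((f @ d) ! i)"
      using ij(1) a b by (metis c length_append length_map nth_map)
    also have "\<dots> = \<chi> ((a @ b) ! j)"
      unfolding ij(3) using ij(2) a b by (metis c length_append length_map nth_map)
    finally show "(a @ b) ! i = (a @ b) ! j"
      by (simp add: \<chi>_def split: if_splits)
  qed
  then show ?thesis using a b by (auto simp: append_eq_append_conv)
qed

text \<open>In place of a generated equivalence relation, two points of the disjoint union are glued
  iff no compatible two-valued pair separates them. \<open>\<phi> i\<close> collects the compatible
  pairs with value 1 at \<open>i\<close>, so the pushout is the set of distinct
  \<open>\<phi> i\<close>, numbered by \<open>h\<close>.\<close>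

lemma set_po_exists:
  assumes len: "length l = length k" and l: "set l \<subseteq> {..<p}" and k: "set k \<subseteq> {..<q}"
  shows "\<exists>n f d. length f = p \<and> length d = q \<and> map ((!) f) l = map ((!) d) k \<and> set_po n l k f d"
proof -
  define \<phi> where "\<phi> i = {(a, b). length a = p \<and> length b = q \<and> map ((!) a) l = map ((!) b) k \<and>
      (a @ b) ! i = (1 :: nat)}" for i
  obtain h n where h: "bij_betw h (\<phi> ` {..<p + q}) {..<n :: nat}"
    using ex_bij_betw_finite_nat[of "\<phi> ` {..<p + q}"] by (auto simp: atLeast0LessThan)
  define F where "F = map (\<lambda>i. h (\<phi> i)) [0..<p + q]"
  have F_eq: "F ! i = F ! j \<longleftrightarrow> \<phi> i = \<phi> j" if "i < p + q" "j < p + q" for i j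
    using that bij_betw_imp_inj_on[OF h] by (auto simp: F_def inj_on_def)
  have F_set: "set F = {..<n}"
    using bij_betw_imp_surj_on[OF h] by (simp add: F_def image_image atLeast0LessThan)
  have F_len: "length F = p + q" by (simp add: F_def)
  define f d where "f = take p F" and "d = drop p F"
  have fd: "f @ d = F" "length f = p" "length d = q" by (simp_all add: f_def d_def F_len)
  have "map ((!) f) l = map ((!) d) k"
  proof (rule nth_equalityI)
    fix i
    assume "i < length (map ((!) f) l)"
    then have i: "i < length l" by simp
    then have li: "l ! i < p" and ki: "k ! i < q" using l k len by (auto intro: nth_in_range)
    have "(a, b) \<in> \<phi> (l ! i) \<longleftrightarrow> (a, b) \<in> \<phi> (p + k ! i)" for a b
    proof (cases "length a = p \<and> map ((!) a) l = map ((!) b) k")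
      case True
      then have "a ! (l ! i) = b ! (k ! i)"
        using i len by (metis nth_map)
      then have "(a @ b) ! (l ! i) = (a @ b) ! (p + k ! i)"
        using True li by (simp add: nth_append)
      then show ?thesis
        by (simp only: \<phi>_def mem_Collect_eq prod.case)
    qed (simp only: \<phi>_def mem_Collect_eq prod.case, blast)
    then have "\<phi> (l ! i) = \<phi> (p + k ! i)"
      by (simp only: set_eq_iff split_paired_All simp_thms)
    then have "F ! (l ! i) = F ! (p + k ! i)"
      using F_eq li ki by simp
    then show "map ((!) f) l ! i = map ((!) d) k ! i"
      using i len li ki by (simp add: fd(1)[symmetric] nth_append fd(2,3))
  qed (simp add: len)
  moreover have "set_po n l k f d"
    unfolding set_po_def
  proof (intro conjI allI impI)
    show "set (f @ d) = {..<n}" by (simp add: fd F_set)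
    fix a b :: "nat list"
    assume *: "length a = length f \<and> length b = length d \<and> set a \<union> set b \<subseteq> {0, 1} \<and>
        map ((!) a) l = map ((!) b) k"
    have "\<exists>c. length c = n \<and> map ((!) c) F = a @ b"
    proof (rule lift_along_covering[OF F_set])
      show "length (a @ b) = length F" using * fd F_len by simp
      fix i j
      assume ij: "i < length F" "j < length F" "F ! i = F ! j"
      then have "\<phi> i = \<phi> j" using F_eq F_len by simp
      moreover have "(a @ b) ! i' = 1 \<longleftrightarrow> (a, b) \<in> \<phi> i'" for i'
        using * fd(2,3) by (simp add: \<phi>_def)
      ultimately have "(a @ b) ! i = 1 \<longleftrightarrow> (a @ b) ! j = 1"
        by simp
      moreover have "(a @ b) ! i' \<in> set (a @ b)" if "i' < length F" for i'
        using * fd(2,3) that F_len by (intro nth_mem) simp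
      then have "(a @ b) ! i \<in> {0, 1}" "(a @ b) ! j \<in> {0, 1}"
        using * ij by (auto simp: subset_iff)
      ultimately show "(a @ b) ! i = (a @ b) ! j"
        by (elim insertE) simp_all
    qed
    then obtain c where c: "length c = n" "map ((!) c) (f @ d) = a @ b"
      unfolding fd(1) by blast
    moreover have "map ((!) c) f = a" "map ((!) c) d = b"
      using c(2) * by (simp_all add: append_eq_append_conv)
    ultimately show "\<exists>c. length c = n \<and> map ((!) c) f = a \<and> map ((!) c) d = b"
      by blast
  qed
  ultimately show ?thesis using fd by blast
qed

text \<open>The zipped legs list the fibre product without repetition: distinctness yields
  uniqueness of mediating maps, the set equation their existence.\<close>

definition set_pb :: "nat list \<Rightarrow> nat list \<Rightarrow> nat list \<Rightarrow> nat list \<Rightarrow> bool" where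
  "set_pb j1 j2 c1 c2 \<longleftrightarrow> length j1 = length j2 \<and> distinct (zip j1 j2) \<and>
     set (zip j1 j2) = {(x, y). x < length c1 \<and> y < length c2 \<and> c1 ! x = c2 ! y}"

lemma set_pb_range:
  assumes "set_pb j1 j2 c1 c2"
  shows "set j1 \<subseteq> {..<length c1}" "set j2 \<subseteq> {..<length c2}"
    "map ((!) c1) j1 = map ((!) c2) j2"
proof -
  have len: "length j1 = length j2" and Z: "\<And>x y. (x, y) \<in> set (zip j1 j2) \<Longrightarrow>
      x < length c1 \<and> y < length c2 \<and> c1 ! x = c2 ! y"
    using assms unfolding set_pb_def by auto
  have *: "j1 ! i < length c1 \<and> j2 ! i < length c2 \<and> c1 ! (j1 ! i) = c2 ! (j2 ! i)" if "i < length j1" for i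
    using that len by (intro Z) (auto simp: set_zip)
  show "set j1 \<subseteq> {..<length c1}" "set j2 \<subseteq> {..<length c2}"
    using * len by (auto simp: in_set_conv_nth)
  show "map ((!) c1) j1 = map ((!) c2) j2"
    using * len by (auto intro!: nth_equalityI)
qed

lemma set_pb_lift:
  assumes pb: "set_pb j1 j2 c1 c2" and a: "set a \<subseteq> {..<length c1}" and b: "set b \<subseteq> {..<length c2}"
    and ab: "map ((!) c1) a = map ((!) c2) b"
  shows "\<exists>u. set u \<subseteq> {..<length j1} \<and> map ((!) j1) u = a \<and> map ((!) j2) u = b"
proof -
  have len: "length a = length b" using arg_cong[OF ab, of length] by simp
  have "\<exists>j < length j1. j1 ! j = a ! i \<and> j2 ! j = b ! i" if "i < length a" for i
  proof -
    have "c1 ! (a ! i) = c2 ! (b ! i)"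
      using arg_cong[OF ab, of "\<lambda>xs. xs ! i"] that len by simp
    moreover have "a ! i < length c1" "b ! i < length c2"
      using a b that len by (auto intro: nth_in_range)
    ultimately have "(a ! i, b ! i) \<in> set (zip j1 j2)"
      using pb unfolding set_pb_def by auto
    then show ?thesis by (auto simp: set_zip)
  qed
  then obtain \<psi> where \<psi>: "\<And>i. i < length a \<Longrightarrow> \<psi> i < length j1 \<and> j1 ! \<psi> i = a ! i \<and> j2 ! \<psi> i = b ! i"
    by metis
  show ?thesis
    by (rule exI[of _ "map \<psi> [0..<length a]"]) (use \<psi> len in \<open>auto intro!: nth_equalityI\<close>)
qed

lemma set_pb_unique:
  assumes pb: "set_pb j1 j2 c1 c2" and u: "set u \<subseteq> {..<length j1}" and v: "set v \<subseteq> {..<length j1}"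
    and 1: "map ((!) j1) u = map ((!) j1) v" and 2: "map ((!) j2) u = map ((!) j2) v"
  shows "u = v"
proof (rule nth_equalityI)
  show len: "length u = length v" using arg_cong[OF 1, of length] by simp
  fix i
  assume i: "i < length u"
  have lt: "u ! i < length j1" "v ! i < length j1"
    using u v i len by (auto intro: nth_in_range)
  have len12: "length j1 = length j2" and dist: "distinct (zip j1 j2)"
    using pb unfolding set_pb_def by blast+
  have "j1 ! (u ! i) = j1 ! (v ! i)" "j2 ! (u ! i) = j2 ! (v ! i)"
    using arg_cong[OF 1, of "\<lambda>xs. xs ! i"] arg_cong[OF 2, of "\<lambda>xs. xs ! i"] i len by simp_all
  then have "zip j1 j2 ! (u ! i) = zip j1 j2 ! (v ! i)"
    using lt len12 by simp
  then show "u ! i = v ! i"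
    using nth_eq_iff_index_eq[OF dist, of "u ! i" "v ! i"] lt len12 by simp
qed

lemma set_pb_exists: "\<exists>j1 j2. set_pb j1 j2 c1 c2"
proof -
  have "finite {(x, y). x < length c1 \<and> y < length c2 \<and> c1 ! x = c2 ! y}"
    by (rule finite_subset[of _ "{..<length c1} \<times> {..<length c2}"]) auto
  then obtain zs where "set zs = {(x, y). x < length c1 \<and> y < length c2 \<and> c1 ! x = c2 ! y}" "distinct zs"
    using finite_distinct_list by blast
  then have "set_pb (map fst zs) (map snd zs) c1 c2"
    by (simp add: set_pb_def zip_map_fst_snd)
  then show ?thesis by blast
qed


section \<open>The category of hypergraphs\<close>

abbreviation nv :: "('c, 'o) hgraph \<Rightarrow> nat" where "nv G \<equiv> length (vcol G)"
abbreviation ne :: "('c, 'o) hgraph \<Rightarrow> nat" where "ne G \<equiv> length (edg G)"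

definition act :: "nat list \<Rightarrow> 'o \<times> nat list \<times> nat list \<Rightarrow> 'o \<times> nat list \<times> nat list" where
  "act a e = (fst e, map ((!) a) (fst (snd e)), map ((!) a) (snd (snd e)))"

definition edge_in :: "nat \<Rightarrow> 'o \<times> nat list \<times> nat list \<Rightarrow> bool" where
  "edge_in n e \<longleftrightarrow> set (fst (snd e)) \<subseteq> {..<n} \<and> set (snd (snd e)) \<subseteq> {..<n}"

definition valid :: "('c, 'o) hgraph \<Rightarrow> bool" where
  "valid G \<longleftrightarrow> (\<forall>e \<in> set (edg G). edge_in (nv G) e)"

lemma act_comp: "edge_in (length a) e \<Longrightarrow> act (map ((!) b) a) e = act b (act a e)"
  unfolding act_def edge_in_def by (auto simp: map_nth_comp)

lemma act_upt: "edge_in n e \<Longrightarrow> act [0..<n] e = e"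
  unfolding act_def edge_in_def by (auto simp: map_upt_nth)

lemma map_act_comp:
  "valid G \<Longrightarrow> length a = nv G \<Longrightarrow> map (act (map ((!) b) a)) (edg G) = map (act b) (map (act a) (edg G))"
  unfolding valid_def by (auto simp: act_comp)

lemma map_nth_eq_iff:
  "set xs \<subseteq> {..<m} \<and> map g xs = ys \<longleftrightarrow>
    length xs = length ys \<and> (\<forall>i < length xs. xs ! i < m \<and> g (xs ! i) = ys ! i)"
  by (simp only: list_eq_iff_nth_eq all_set_conv_all_nth length_map subset_iff lessThan_iff
      Ball_def[symmetric]) auto

text \<open>Turns the pointwise definition into equations between lists; composites are then handled
  by \<open>map_nth_comp\<close>, which asks only for range conditions.\<close>

lemma hmors_iff:
  "f \<in> hmors G H \<longleftrightarrow> set (fst f) \<subseteq> {..<nv H} \<and> map ((!) (vcol H)) (fst f) = vcol G \<and>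
     set (snd f) \<subseteq> {..<ne H} \<and> map ((!) (edg H)) (snd f) = map (act (fst f)) (edg G)"
proof -
  obtain a b where f: "f = (a, b)" by (cases f)
  show ?thesis
    unfolding hmors_def f mem_Collect_eq prod.case fst_conv snd_conv
    using map_nth_eq_iff[of a "nv H" "(!) (vcol H)" "vcol G"]
      map_nth_eq_iff[of b "ne H" "(!) (edg H)" "map (act a) (edg G)"]
    by (simp add: act_def case_prod_beta' cong: conj_cong) (metis (no_types, lifting))
qed

lemma hmors_len: "f \<in> hmors G H \<Longrightarrow> length (fst f) = nv G" "f \<in> hmors G H \<Longrightarrow> length (snd f) = ne G"
  unfolding hmors_iff by (metis length_map)+

lemma hmors_range: "f \<in> hmors G H \<Longrightarrow> set (fst f) \<subseteq> {..<nv H}" "f \<in> hmors G H \<Longrightarrow> set (snd f) \<subseteq> {..<ne H}"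
  unfolding hmors_iff by auto

lemma fst_hcomp: "fst (f ;; g) = map ((!) (fst g)) (fst f)"
  and snd_hcomp: "snd (f ;; g) = map ((!) (snd g)) (snd f)"
  by (simp_all add: hcomp_def)

lemma hcomp_hmors: "valid G \<Longrightarrow> f \<in> hmors G H \<Longrightarrow> g \<in> hmors H X \<Longrightarrow> f ;; g \<in> hmors G X"
proof -
  assume v: "valid G" and f: "f \<in> hmors G H" and g: "g \<in> hmors H X"
  have gl: "length (fst g) = nv H" "length (snd g) = ne H" using hmors_len[OF g] by auto
  have "map ((!) (vcol X)) (map ((!) (fst g)) (fst f)) = map ((!) (map ((!) (vcol X)) (fst g))) (fst f)"
    using f gl by (intro map_nth_comp[symmetric]) (simp add: hmors_iff)
  also have "\<dots> = vcol G" using f g by (simp add: hmors_iff)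
  finally have 1: "map ((!) (vcol X)) (map ((!) (fst g)) (fst f)) = vcol G" .
  have "map ((!) (edg X)) (map ((!) (snd g)) (snd f)) = map ((!) (map ((!) (edg X)) (snd g))) (snd f)"
    using f gl by (intro map_nth_comp[symmetric]) (simp add: hmors_iff)
  also have "\<dots> = map (act (fst g)) (map ((!) (edg H)) (snd f))"
    using f g by (simp only: hmors_iff map_nth_comp)
  also have "\<dots> = map (act (map ((!) (fst g)) (fst f))) (edg G)"
    using f map_act_comp[OF v, of "fst f" "fst g"] hmors_len[OF f] by (simp add: hmors_iff)
  finally have 2: "map ((!) (edg X)) (map ((!) (snd g)) (snd f)) =
      map (act (map ((!) (fst g)) (fst f))) (edg G)" .
  have "\<And>x. x \<in> set (fst f) \<Longrightarrow> fst g ! x < nv X" "\<And>x. x \<in> set (snd f) \<Longrightarrow> snd g ! x < ne X"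
    using f g gl by (auto simp: hmors_iff subset_iff)
  then show "f ;; g \<in> hmors G X"
    unfolding hmors_iff hcomp_def fst_conv snd_conv 1 2 by auto
qed

lemma hcomp_assoc:
  assumes f: "f \<in> hmors G H" and g: "g \<in> hmors H X"
  shows "(f ;; g) ;; h = f ;; (g ;; h)"
proof -
  have "set (fst f) \<subseteq> {..<length (fst g)}" "set (snd f) \<subseteq> {..<length (snd g)}"
    using hmors_len[OF g] hmors_range[OF f] by simp_all
  then show ?thesis
    unfolding hcomp_def fst_conv snd_conv by (simp only: map_nth_comp)
qed

lemma hid_hmors: "valid G \<Longrightarrow> hid G \<in> hmors G G"
  unfolding hmors_iff hid_def valid_def by (auto simp: map_nth act_upt intro!: nth_equalityI)

lemma hcomp_hid_right: "f \<in> hmors G H \<Longrightarrow> f ;; hid H = f"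
  using hmors_range[of f G H] by (simp add: hcomp_def hid_def map_upt_nth prod_eq_iff)

lemma hcomp_hid_left: "f \<in> hmors G H \<Longrightarrow> hid G ;; f = f"
  using hmors_len[of f G H] by (simp add: hcomp_def hid_def map_nth_upt prod_eq_iff)

lemma hyp_iff: "G \<in> hyp T \<longleftrightarrow> valid G \<and> set (vcol G) \<subseteq> colours T \<and>
   (\<forall>e \<in> set (edg G). fst e \<in> ops T \<and> map ((!) (vcol G)) (fst (snd e)) = arity T (fst e) \<and>
      map ((!) (vcol G)) (snd (snd e)) = coarity T (fst e))"
  unfolding hyp_def valid_def edge_in_def mem_Collect_eq case_prod_beta' by blast

lemma hyp_valid: "G \<in> hyp T \<Longrightarrow> valid G"
  by (simp add: hyp_iff)

text \<open>A homomorphism keeps the label of every hyperedge and the colours of its nodes, so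
  typing is reflected. What it does not reflect is that the node positions used in \<open>D\<close>
  exist, whence the assumption \<open>valid D\<close>.\<close>

lemma hyp_source:
  assumes a: "a \<in> hmors D G" and G: "G \<in> hyp T" and D: "valid D"
  shows "D \<in> hyp T"
proof -
  have "fst e \<in> ops T \<and> map ((!) (vcol D)) (fst (snd e)) = arity T (fst e) \<and>
      map ((!) (vcol D)) (snd (snd e)) = coarity T (fst e)" if e: "e \<in> set (edg D)" for e
  proof -
    have "act (fst a) e \<in> set (map ((!) (edg G)) (snd a))"
      using a e by (simp add: hmors_iff)
    then have "act (fst a) e \<in> set (edg G)"
      using hmors_range[OF a] by auto
    then have *: "fst (act (fst a) e) \<in> ops T"
      "map ((!) (vcol G)) (fst (snd (act (fst a) e))) = arity T (fst (act (fst a) e))"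
      "map ((!) (vcol G)) (snd (snd (act (fst a) e))) = coarity T (fst (act (fst a) e))"
      using G unfolding hyp_iff by blast+
    have "edge_in (length (fst a)) e"
      using D e hmors_len[OF a] by (simp add: valid_def)
    then have "map ((!) (map ((!) (vcol G)) (fst a))) (fst (snd e)) = map ((!) (vcol G)) (map ((!) (fst a)) (fst (snd e)))"
      "map ((!) (map ((!) (vcol G)) (fst a))) (snd (snd e)) = map ((!) (vcol G)) (map ((!) (fst a)) (snd (snd e)))"
      unfolding edge_in_def by (intro map_nth_comp; simp)+
    moreover have "map ((!) (vcol G)) (fst a) = vcol D"
      using a by (simp add: hmors_iff)
    ultimately show ?thesis
      using * by (simp only: act_def fst_conv snd_conv simp_thms)
  qed
  moreover have "set (vcol D) \<subseteq> colours T"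
  proof -
    have "set (map ((!) (vcol G)) (fst a)) \<subseteq> set (vcol G)"
      using hmors_range[OF a] by auto
    then show ?thesis using a G unfolding hmors_iff hyp_iff by auto
  qed
  ultimately show ?thesis using D by (simp add: hyp_iff)
qed

text \<open>The conditions on a homomorphism are equations and ranges at single nodes and
  hyperedges, and each of these is hit by \<open>f\<close> or by \<open>d\<close>, where the
  condition is known.\<close>

lemma hom_descend:
  assumes f: "f \<in> hmors L G" and d: "d \<in> hmors D G" and v: "valid L" "valid D"
    and FV: "set (fst f @ fst d) = {..<nv G}" and FE: "set (snd f @ snd d) = {..<ne G}"
    and u: "length (fst u) = nv G" "length (snd u) = ne G"
    and fu: "f ;; u \<in> hmors L X" and du: "d ;; u \<in> hmors D X"
  shows "u \<in> hmors G X"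
proof -
  note defs = hmors_iff hcomp_def fst_conv snd_conv
  have fu': "map ((!) (vcol X)) (map ((!) (fst u)) (fst f)) = vcol L"
    "map ((!) (edg X)) (map ((!) (snd u)) (snd f)) = map (act (map ((!) (fst u)) (fst f))) (edg L)"
    using fu unfolding defs by blast+
  have du': "map ((!) (vcol X)) (map ((!) (fst u)) (fst d)) = vcol D"
    "map ((!) (edg X)) (map ((!) (snd u)) (snd d)) = map (act (map ((!) (fst u)) (fst d))) (edg D)"
    using du unfolding defs by blast+
  have f': "map ((!) (vcol G)) (fst f) = vcol L" "map ((!) (edg G)) (snd f) = map (act (fst f)) (edg L)"
    and d': "map ((!) (vcol G)) (fst d) = vcol D" "map ((!) (edg G)) (snd d) = map (act (fst d)) (edg D)"
    using f d unfolding hmors_iff by blast+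
  have 1: "map ((!) (vcol X)) (fst u) = vcol G"
  proof (rule list_eq_via_covering[OF FV])
    have "map ((!) (map ((!) (vcol X)) (fst u))) (fst f @ fst d) =
        map ((!) (vcol X)) (map ((!) (fst u)) (fst f @ fst d))"
      using FV u by (intro map_nth_comp) simp
    then show "map ((!) (map ((!) (vcol X)) (fst u))) (fst f @ fst d) = map ((!) (vcol G)) (fst f @ fst d)"
      by (simp only: map_append fu' du' f' d')
  qed (simp_all add: u)
  have 2: "map ((!) (edg X)) (snd u) = map (act (fst u)) (edg G)"
  proof (rule list_eq_via_covering[OF FE])
    have "map ((!) (map ((!) (edg X)) (snd u))) (snd f @ snd d) =
        map ((!) (edg X)) (map ((!) (snd u)) (snd f @ snd d))"
      using FE u by (intro map_nth_comp) simp
    also have "\<dots> = map (act (fst u)) (map ((!) (edg G)) (snd f @ snd d))"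
      using hmors_len[OF f] hmors_len[OF d]
      by (simp only: map_append fu' du' f' d' map_act_comp[OF v(1)] map_act_comp[OF v(2)])
    also have "\<dots> = map ((!) (map (act (fst u)) (edg G))) (snd f @ snd d)"
      using FE by (intro map_nth_comp[symmetric]) simp
    finally show "map ((!) (map ((!) (edg X)) (snd u))) (snd f @ snd d) =
      map ((!) (map (act (fst u)) (edg G))) (snd f @ snd d)" .
  qed (simp_all add: u)
  have "set (map ((!) (fst u)) (fst f @ fst d)) \<subseteq> {..<nv X}" "set (map ((!) (snd u)) (snd f @ snd d)) \<subseteq> {..<ne X}"
    using fu du unfolding hmors_iff hcomp_def by auto
  then have "(!) (fst u) ` {..<nv G} \<subseteq> {..<nv X}" "(!) (snd u) ` {..<ne G} \<subseteq> {..<ne X}"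
    unfolding set_map FV FE by blast+
  then have "set (fst u) \<subseteq> {..<nv X}" "set (snd u) \<subseteq> {..<ne X}"
    using u by (auto simp: in_set_conv_nth image_subset_iff)
  then show ?thesis unfolding hmors_iff using 1 2 by blast
qed

lemma act_inj:
  assumes e: "edge_in n e" "edge_in n e'" and act: "act j1 e = act j1 e'" "act j2 e = act j2 e'"
    and inj: "\<And>u v. set u \<subseteq> {..<n} \<Longrightarrow> set v \<subseteq> {..<n} \<Longrightarrow> map ((!) j1) u = map ((!) j1) v \<Longrightarrow>
      map ((!) j2) u = map ((!) j2) v \<Longrightarrow> u = v"
  shows "e = e'"
  using assms(1-4) inj unfolding edge_in_def act_def by (auto simp: prod_eq_iff)

lemma act_in: "edge_in (length a) e \<Longrightarrow> set a \<subseteq> {..<n} \<Longrightarrow> edge_in n (act a e)"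
  unfolding edge_in_def act_def by (force simp: subset_iff)

text \<open>Dual to \<open>hom_descend\<close>: equations in \<open>J\<close> are tested after the
  jointly injective \<open>j1\<close> and \<open>j2\<close>. Joint injectivity on nodes settles the
  hyperedge equation as well, because its two sides are labels with source and target lists and are
  compared node by node.\<close>

lemma hom_lift:
  assumes j1: "j1 \<in> hmors J C1" and j2: "j2 \<in> hmors J C2" and v: "valid X" "valid J"
    and inj: "\<And>u v. set u \<subseteq> {..<nv J} \<Longrightarrow> set v \<subseteq> {..<nv J} \<Longrightarrow> map ((!) (fst j1)) u = map ((!) (fst j1)) v \<Longrightarrow>
      map ((!) (fst j2)) u = map ((!) (fst j2)) v \<Longrightarrow> u = v"
    and u: "set (fst u) \<subseteq> {..<nv J}" "set (snd u) \<subseteq> {..<ne J}"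
    and u1: "u ;; j1 \<in> hmors X C1" and u2: "u ;; j2 \<in> hmors X C2"
  shows "u \<in> hmors X J"
proof -
  have len: "length (fst u) = nv X" "length (snd u) = ne X"
    using hmors_len[OF u1] by (simp_all add: hcomp_def)
  have "map ((!) (vcol J)) (fst u) = map ((!) (map ((!) (vcol C1)) (fst j1))) (fst u)"
    using j1 by (simp add: hmors_iff)
  also have "\<dots> = map ((!) (vcol C1)) (map ((!) (fst j1)) (fst u))"
    using u hmors_len[OF j1] by (intro map_nth_comp) simp
  also have "\<dots> = vcol X" using u1 by (simp add: hmors_iff hcomp_def)
  finally have 1: "map ((!) (vcol J)) (fst u) = vcol X" .
  have act: "act (fst j) (edg J ! (snd u ! e)) = act (fst j) (act (fst u) (edg X ! e))"
    if j: "j \<in> hmors J C" and uj: "u ;; j \<in> hmors X C" and e: "e < ne X" for j C e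
  proof -
    have ue: "snd u ! e < ne J" using u(2) len e by (auto intro: nth_in_range)
    have "act (fst j) (edg J ! (snd u ! e)) = map ((!) (edg C)) (snd j) ! (snd u ! e)"
      using j ue by (simp add: hmors_iff)
    also have "\<dots> = edg C ! (snd (u ;; j) ! e)"
      using ue e len hmors_len[OF j] by (simp add: hcomp_def)
    also have "\<dots> = map ((!) (edg C)) (snd (u ;; j)) ! e"
      using e hmors_len[OF uj] by simp
    also have "\<dots> = act (fst (u ;; j)) (edg X ! e)"
      using uj e by (simp add: hmors_iff)
    also have "\<dots> = act (fst j) (act (fst u) (edg X ! e))"
      unfolding hcomp_def fst_conv
      using v(1) e len by (intro act_comp) (simp add: valid_def)
    finally show ?thesis .
  qed
  have "map ((!) (edg J)) (snd u) = map (act (fst u)) (edg X)"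
  proof (rule nth_equalityI)
    fix e
    assume "e < length (map ((!) (edg J)) (snd u))"
    then have e: "e < ne X" using len by simp
    have ue: "snd u ! e < ne J" using u(2) len e by (auto intro: nth_in_range)
    have "edg J ! (snd u ! e) = act (fst u) (edg X ! e)"
    proof (rule act_inj[OF _ _ act[OF j1 u1 e] act[OF j2 u2 e] inj])
      show "edge_in (nv J) (edg J ! (snd u ! e))" using v ue by (simp add: valid_def)
      show "edge_in (nv J) (act (fst u) (edg X ! e))"
        using v e len u by (intro act_in) (simp_all add: valid_def)
    qed
    then show "map ((!) (edg J)) (snd u) ! e = map (act (fst u)) (edg X) ! e"
      using e len by simp
  qed (simp add: len)
  then show ?thesis unfolding hmors_iff using u 1 by blast
qed

lemma cover_vcol:
  assumes "f \<in> hmors L G" "d \<in> hmors D G" and FV: "set (fst f @ fst d) = {..<nv G}"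
  shows "set (vcol G) = set (vcol L) \<union> set (vcol D)"
proof -
  have "set (vcol G) = (!) (vcol G) ` set (fst f @ fst d)"
    unfolding FV by (auto simp: set_conv_nth)
  also have "\<dots> = set (map ((!) (vcol G)) (fst f)) \<union> set (map ((!) (vcol G)) (fst d))" by auto
  finally show ?thesis using assms(1,2) unfolding hmors_iff by simp
qed

lemma cover_edg:
  assumes "f \<in> hmors L G" "d \<in> hmors D G" and FE: "set (snd f @ snd d) = {..<ne G}"
  shows "set (edg G) = act (fst f) ` set (edg L) \<union> act (fst d) ` set (edg D)"
proof -
  have "set (edg G) = (!) (edg G) ` set (snd f @ snd d)"
    unfolding FE by (auto simp: set_conv_nth)
  also have "\<dots> = set (map ((!) (edg G)) (snd f)) \<union> set (map ((!) (edg G)) (snd d))" by auto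
  finally show ?thesis using assms(1,2) unfolding hmors_iff by simp
qed

text \<open>Each node and hyperedge of \<open>G\<close> is the image of one from \<open>L\<close> or
  \<open>D\<close>, which carries its typing along.\<close>

lemma cover_hyp:
  assumes f: "f \<in> hmors L G" and d: "d \<in> hmors D G" and L: "L \<in> hyp T" and D: "D \<in> hyp T"
    and FV: "set (fst f @ fst d) = {..<nv G}" and FE: "set (snd f @ snd d) = {..<ne G}"
  shows "G \<in> hyp T"
proof -
  note V = cover_vcol[OF f d FV] and E = cover_edg[OF f d FE]
  have *: "edge_in (nv G) (act (fst a) e) \<and> fst (act (fst a) e) \<in> ops T \<and>
      map ((!) (vcol G)) (fst (snd (act (fst a) e))) = arity T (fst (act (fst a) e)) \<and>
      map ((!) (vcol G)) (snd (snd (act (fst a) e))) = coarity T (fst (act (fst a) e))"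
    if a: "a \<in> hmors A G" and A: "A \<in> hyp T" and e: "e \<in> set (edg A)" for a A e
  proof -
    have len: "length (fst a) = nv A" and rng: "set (fst a) \<subseteq> {..<nv G}"
      using hmors_len[OF a] hmors_range[OF a] by auto
    have ein: "edge_in (length (fst a)) e"
      using A e len unfolding hyp_iff valid_def by simp
    then have "map ((!) (map ((!) (vcol G)) (fst a))) (fst (snd e)) = map ((!) (vcol G)) (map ((!) (fst a)) (fst (snd e)))"
      "map ((!) (map ((!) (vcol G)) (fst a))) (snd (snd e)) = map ((!) (vcol G)) (map ((!) (fst a)) (snd (snd e)))"
      unfolding edge_in_def by (intro map_nth_comp; simp)+
    moreover have "map ((!) (vcol G)) (fst a) = vcol A"
      using a by (simp add: hmors_iff)
    moreover have "fst e \<in> ops T" "map ((!) (vcol A)) (fst (snd e)) = arity T (fst e)"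
      "map ((!) (vcol A)) (snd (snd e)) = coarity T (fst e)"
      using A e unfolding hyp_iff by blast+
    ultimately show ?thesis
      using act_in[OF ein rng] by (simp only: act_def fst_conv snd_conv simp_thms)
  qed
  show ?thesis
    unfolding hyp_iff valid_def V E
    using *[OF f L] *[OF d D] L D unfolding hyp_iff by auto
qed

text \<open>The prefix stands for concrete: nodes and hyperedges are glued separately as sets,
  without reference to a theory. Colours and incidence enter only through the morphism conditions,
  which determine them on \<open>G\<close> because \<open>f\<close> and \<open>d\<close> cover
  it.\<close>

definition cpo :: "('c, 'o) hgraph \<Rightarrow> ('c, 'o) hgraph \<Rightarrow> ('c, 'o) hgraph \<Rightarrow> ('c, 'o) hgraph \<Rightarrow>
    hmor \<Rightarrow> hmor \<Rightarrow> hmor \<Rightarrow> hmor \<Rightarrow> bool" where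
  "cpo K L D G l k f d \<longleftrightarrow>
     l \<in> hmors K L \<and> k \<in> hmors K D \<and> f \<in> hmors L G \<and> d \<in> hmors D G \<and> l ;; f = k ;; d \<and>
     set_po (nv G) (fst l) (fst k) (fst f) (fst d) \<and> set_po (ne G) (snd l) (snd k) (snd f) (snd d)"

lemma cpoD:
  assumes "cpo K L D G l k f d"
  shows "l \<in> hmors K L" "k \<in> hmors K D" "f \<in> hmors L G" "d \<in> hmors D G" "l ;; f = k ;; d"
    "set_po (nv G) (fst l) (fst k) (fst f) (fst d)" "set_po (ne G) (snd l) (snd k) (snd f) (snd d)"
    "set (fst f @ fst d) = {..<nv G}" "set (snd f @ snd d) = {..<ne G}"
  using assms unfolding cpo_def set_po_def by blast+

lemma cpo_lift:
  assumes po: "cpo K L D G l k f d" and v: "valid L" "valid D"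
    and a: "a \<in> hmors L X" and b: "b \<in> hmors D X" and ab: "l ;; a = k ;; b"
  shows "\<exists>u \<in> hmors G X. f ;; u = a \<and> d ;; u = b"
proof -
  note po' = cpoD[OF po]
  have ab': "map ((!) (fst a)) (fst l) = map ((!) (fst b)) (fst k)"
    "map ((!) (snd a)) (snd l) = map ((!) (snd b)) (snd k)"
    using ab unfolding hcomp_def prod.inject by blast+
  have len: "length (fst f) = nv L" "length (snd f) = ne L" "length (fst d) = nv D" "length (snd d) = ne D"
    "length (fst a) = nv L" "length (snd a) = ne L" "length (fst b) = nv D" "length (snd b) = ne D"
    using po'(3,4) a b by (auto dest: hmors_len)
  obtain uV where uV: "length uV = nv G" "map ((!) uV) (fst f) = fst a" "map ((!) uV) (fst d) = fst b"
    using set_po_lift[OF po'(6) _ _ _ _ ab'(1)] hmors_range[OF po'(1)] hmors_range[OF po'(2)] len by metis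
  obtain uE where uE: "length uE = ne G" "map ((!) uE) (snd f) = snd a" "map ((!) uE) (snd d) = snd b"
    using set_po_lift[OF po'(7) _ _ _ _ ab'(2)] hmors_range[OF po'(1)] hmors_range[OF po'(2)] len by metis
  have fu: "f ;; (uV, uE) = a" and du: "d ;; (uV, uE) = b"
    unfolding hcomp_def fst_conv snd_conv uV uE by simp_all
  have "(uV, uE) \<in> hmors G X"
    by (rule hom_descend[OF po'(3,4) v po'(8,9)]) (simp_all add: fu du a b uV(1) uE(1))
  then show ?thesis using fu du by blast
qed

lemma cpo_unique:
  assumes po: "cpo K L D G l k f d" and u: "u \<in> hmors G X" and v: "v \<in> hmors G X"
    and f: "f ;; u = f ;; v" and d: "d ;; u = d ;; v"
  shows "u = v"
proof (rule prod_eqI)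
  note po' = cpoD[OF po]
  show "fst u = fst v"
    using f d unfolding hcomp_def prod.inject
    by (intro list_eq_via_covering[OF po'(8) hmors_len(1)[OF u] hmors_len(1)[OF v]])
      (simp only: map_append)
  show "snd u = snd v"
    using f d unfolding hcomp_def prod.inject
    by (intro list_eq_via_covering[OF po'(9) hmors_len(2)[OF u] hmors_len(2)[OF v]])
      (simp only: map_append)
qed

lemma cpo_pushout:
  assumes po: "cpo K L D G l k f d" and v: "valid L" "valid D"
  shows "pushout T K L D G l k f d"
  unfolding pushout_def
proof (intro conjI ballI impI)
  fix X a b
  assume "a \<in> hmors L X" "b \<in> hmors D X" "l ;; a = k ;; b"
  then obtain u where "u \<in> hmors G X" "f ;; u = a" "d ;; u = b"
    using cpo_lift[OF po v] by blast
  then show "\<exists>!u. u \<in> hmors G X \<and> f ;; u = a \<and> d ;; u = b"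
    by (intro ex1I[of _ u]) (simp, rule cpo_unique[OF po], simp_all)
qed (use cpoD[OF po] in simp_all)

text \<open>The sets of nodes and of hyperedges are glued first. The colouring and the incidence
  structure of \<open>G\<close> then arise as mediating maps, into the colours and into the
  hyperedges over the glued nodes.\<close>

lemma cpo_exists:
  assumes l: "l \<in> hmors K L" and k: "k \<in> hmors K D"
    and K: "K \<in> hyp T" and L: "L \<in> hyp T" and D: "D \<in> hyp T"
  shows "\<exists>G \<in> hyp T. \<exists>f d. cpo K L D G l k f d"
proof -
  have l': "set (fst l) \<subseteq> {..<nv L}" "map ((!) (vcol L)) (fst l) = vcol K"
    "set (snd l) \<subseteq> {..<ne L}" "map ((!) (edg L)) (snd l) = map (act (fst l)) (edg K)"
    and k': "set (fst k) \<subseteq> {..<nv D}" "map ((!) (vcol D)) (fst k) = vcol K"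
    "set (snd k) \<subseteq> {..<ne D}" "map ((!) (edg D)) (snd k) = map (act (fst k)) (edg K)"
    using l k by (simp_all only: hmors_iff simp_thms)
  have len: "length (fst l) = length (fst k)" "length (snd l) = length (snd k)"
    using hmors_len[OF l] hmors_len[OF k] by simp_all
  obtain n fV dV where V: "length fV = nv L" "length dV = nv D"
    "map ((!) fV) (fst l) = map ((!) dV) (fst k)" "set_po n (fst l) (fst k) fV dV"
    using set_po_exists[OF len(1) l'(1) k'(1)] by blast
  obtain m fE dE where E: "length fE = ne L" "length dE = ne D"
    "map ((!) fE) (snd l) = map ((!) dE) (snd k)" "set_po m (snd l) (snd k) fE dE"
    using set_po_exists[OF len(2) l'(3) k'(3)] by blast
  have compat: "map ((!) (vcol L)) (fst l) = map ((!) (vcol D)) (fst k)"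
    unfolding l'(2) k'(2) ..
  have "\<exists>c. length c = n \<and> map ((!) c) fV = vcol L \<and> map ((!) c) dV = vcol D"
    by (rule set_po_lift[OF V(4) _ _ _ _ compat]) (simp_all only: V(1,2) l'(1) k'(1))
  then obtain c where c: "length c = n" "map ((!) c) fV = vcol L" "map ((!) c) dV = vcol D"
    by blast
  have "map ((!) (map (act fV) (edg L))) (snd l) = map (act fV) (map (act (fst l)) (edg K))"
    unfolding l'(4)[symmetric] by (rule map_nth_comp[OF l'(3)])
  also have "\<dots> = map (act (map ((!) fV) (fst l))) (edg K)"
    using map_act_comp[OF hyp_valid[OF K], of "fst l"] hmors_len[OF l] by simp
  also have "\<dots> = map (act dV) (map (act (fst k)) (edg K))"
    unfolding V(3) using map_act_comp[OF hyp_valid[OF K], of "fst k"] hmors_len[OF k] by simp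
  also have "\<dots> = map ((!) (map (act dV) (edg D))) (snd k)"
    unfolding k'(4)[symmetric] by (rule map_nth_comp[OF k'(3), symmetric])
  finally have compat: "map ((!) (map (act fV) (edg L))) (snd l) = map ((!) (map (act dV) (edg D))) (snd k)" .
  have "\<exists>es. length es = m \<and> map ((!) es) fE = map (act fV) (edg L) \<and>
      map ((!) es) dE = map (act dV) (edg D)"
    by (rule set_po_lift[OF E(4) _ _ _ _ compat]) (simp_all only: E(1,2) l'(3) k'(3) length_map)
  then obtain es where es: "length es = m" "map ((!) es) fE = map (act fV) (edg L)"
    "map ((!) es) dE = map (act dV) (edg D)"
    by blast
  define G where "G = HGraph c es"
  have sV: "set (fV @ dV) = {..<n}" and sE: "set (fE @ dE) = {..<m}"
    using V(4) E(4) unfolding set_po_def by blast+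
  then have "set fV \<subseteq> {..<n}" "set dV \<subseteq> {..<n}" "set fE \<subseteq> {..<m}" "set dE \<subseteq> {..<m}"
    by auto
  then have f: "(fV, fE) \<in> hmors L G" and d: "(dV, dE) \<in> hmors D G"
    unfolding hmors_iff G_def fst_conv snd_conv hgraph.sel c es by simp_all
  have "G \<in> hyp T"
    by (rule cover_hyp[OF f d L D]) (simp_all only: fst_conv snd_conv G_def hgraph.sel c es sV sE)
  moreover have "cpo K L D G l k (fV, fE) (dV, dE)"
    unfolding cpo_def hcomp_def fst_conv snd_conv
    using l k f d V E by (simp only: G_def hgraph.sel c es simp_thms)
  ultimately show ?thesis by blast
qed

section \<open>Pushouts up to isomorphism\<close>

lemma pushoutD:
  assumes "pushout T K L D G l k f d"
  shows "l \<in> hmors K L" "k \<in> hmors K D" "f \<in> hmors L G" "d \<in> hmors D G" "l ;; f = k ;; d"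
  using assms unfolding pushout_def by blast+

lemma pushout_lift:
  assumes "pushout T K L D G l k f d" and "X \<in> hyp T" "a \<in> hmors L X" "b \<in> hmors D X" "l ;; a = k ;; b"
  obtains u where "u \<in> hmors G X" "f ;; u = a" "d ;; u = b"
  using assms unfolding pushout_def by blast

lemma pushout_unique:
  assumes po: "pushout T K L D G l k f d" and h: "K \<in> hyp T" "L \<in> hyp T" "D \<in> hyp T" "X \<in> hyp T"
    and u: "u \<in> hmors G X" and v: "v \<in> hmors G X"
    and eq: "f ;; u = f ;; v" "d ;; u = d ;; v"
  shows "u = v"
proof -
  note po' = pushoutD[OF po]
  have "f ;; u \<in> hmors L X" "d ;; u \<in> hmors D X"
    using po' u h by (auto intro: hcomp_hmors hyp_valid)
  moreover have "l ;; (f ;; u) = k ;; (d ;; u)"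
    using po'(5) hcomp_assoc[OF po'(1,3)] hcomp_assoc[OF po'(2,4)] by metis
  ultimately have "\<exists>!w. w \<in> hmors G X \<and> f ;; w = f ;; u \<and> d ;; w = d ;; u"
    using po h(4) unfolding pushout_def by blast
  then show ?thesis using u v eq by metis
qed

lemma set_po_iso:
  assumes po: "set_po m l k f0 d0" and u: "length u = n" "set u \<subseteq> {..<m}" and v: "length v = m" "set v \<subseteq> {..<n}"
    and uv: "map ((!) v) u = [0..<n]"
    and fu: "map ((!) u) f = f0" and du: "map ((!) u) d = d0"
    and fv: "map ((!) v) f0 = f" and dv: "map ((!) v) d0 = d"
    and fd: "set (f @ d) \<subseteq> {..<n}"
  shows "set_po n l k f d"
  unfolding set_po_def
proof (intro conjI allI impI)
  have s0: "set (f0 @ d0) = {..<m}" using po by (simp add: set_po_def)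
  have "{..<n} = set (map ((!) v) u)" unfolding uv by auto
  also have "\<dots> \<subseteq> set (map ((!) v) (f0 @ d0))"
    using u(2) unfolding set_map s0 by blast
  finally show "set (f @ d) = {..<n}"
    using fd unfolding map_append fv dv by blast
  fix a b :: "nat list"
  assume *: "length a = length f \<and> length b = length d \<and> set a \<union> set b \<subseteq> {0, 1} \<and>
    map ((!) a) l = map ((!) b) k"
  have "length f = length f0" "length d = length d0"
    unfolding fu[symmetric] du[symmetric] by simp_all
  then obtain c where c: "length c = m" "map ((!) c) f0 = a" "map ((!) c) d0 = b"
    using po * unfolding set_po_def by metis
  have sfd: "set f \<subseteq> {..<length u}" "set d \<subseteq> {..<length u}" using fd u(1) by auto
  have "map ((!) (map ((!) c) u)) f = a"
    by (simp only: map_nth_comp[OF sfd(1)] fu c)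
  moreover have "map ((!) (map ((!) c) u)) d = b"
    by (simp only: map_nth_comp[OF sfd(2)] du c)
  ultimately show "\<exists>c. length c = n \<and> map ((!) c) f = a \<and> map ((!) c) d = b"
    using u(1) by (metis length_map)
qed

lemma pushout_cospans_iso:
  assumes po: "pushout T K L D G l k f d" and po': "pushout T K L D P l k f' d'"
    and h: "K \<in> hyp T" "L \<in> hyp T" "D \<in> hyp T" "G \<in> hyp T" "P \<in> hyp T"
  obtains u v where "u \<in> hmors G P" "v \<in> hmors P G" "u ;; v = hid G" "v ;; u = hid P"
    "f ;; u = f'" "d ;; u = d'" "f' ;; v = f" "d' ;; v = d"
proof -
  note p = pushoutD[OF po] and p' = pushoutD[OF po']
  obtain u where u: "u \<in> hmors G P" "f ;; u = f'" "d ;; u = d'"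
    using pushout_lift[OF po h(5) p'(3,4,5)] .
  obtain v where v: "v \<in> hmors P G" "f' ;; v = f" "d' ;; v = d"
    using pushout_lift[OF po' h(4) p(3,4,5)] .
  have uv: "u ;; v \<in> hmors G G" and vu: "v ;; u \<in> hmors P P"
    using u v h by (auto intro: hcomp_hmors hyp_valid)
  have "u ;; v = hid G"
    by (rule pushout_unique[OF po h(1-4) uv hid_hmors[OF hyp_valid[OF h(4)]]])
      (simp_all add: hcomp_hid_right[OF p(3)] hcomp_hid_right[OF p(4)] u v
        hcomp_assoc[OF p(3) u(1), symmetric] hcomp_assoc[OF p(4) u(1), symmetric])
  moreover have "v ;; u = hid P"
    by (rule pushout_unique[OF po' h(1-3,5) vu hid_hmors[OF hyp_valid[OF h(5)]]])
      (simp_all add: hcomp_hid_right[OF p'(3)] hcomp_hid_right[OF p'(4)] u v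
        hcomp_assoc[OF p'(3) v(1), symmetric] hcomp_assoc[OF p'(4) v(1), symmetric])
  ultimately show thesis using that u v by blast
qed

text \<open>An abstract pushout is isomorphic to the concrete one built by
  \<open>cpo_exists\<close>, and the pointwise description passes along that isomorphism. The
  converse is \<open>cpo_pushout\<close>.\<close>

lemma pushout_cpo:
  assumes po: "pushout T K L D G l k f d" and h: "K \<in> hyp T" "L \<in> hyp T" "D \<in> hyp T" "G \<in> hyp T"
  shows "cpo K L D G l k f d"
proof -
  note p = pushoutD[OF po]
  obtain P f' d' where P: "P \<in> hyp T" and c: "cpo K L D P l k f' d'"
    using cpo_exists[OF p(1,2) h(1-3)] by blast
  note c' = cpoD[OF c]
  obtain u v where uv: "u \<in> hmors G P" "v \<in> hmors P G" "u ;; v = hid G" "v ;; u = hid P"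
    "f ;; u = f'" "d ;; u = d'" "f' ;; v = f" "d' ;; v = d"
    using pushout_cospans_iso[OF po cpo_pushout[OF c] h P] h hyp_valid by metis
  have r: "set (fst f @ fst d) \<subseteq> {..<nv G}" "set (snd f @ snd d) \<subseteq> {..<ne G}"
    using p(3,4) unfolding hmors_iff by auto
  have "set_po (nv G) (fst l) (fst k) (fst f) (fst d)"
    by (rule set_po_iso[OF c'(6) hmors_len(1)[OF uv(1)] hmors_range(1)[OF uv(1)] hmors_len(1)[OF uv(2)]
        hmors_range(1)[OF uv(2)] _ _ _ _ _ r(1)])
      (simp_all only: fst_hcomp[symmetric] uv hid_def fst_conv)
  moreover have "set_po (ne G) (snd l) (snd k) (snd f) (snd d)"
    by (rule set_po_iso[OF c'(7) hmors_len(2)[OF uv(1)] hmors_range(2)[OF uv(1)] hmors_len(2)[OF uv(2)]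
        hmors_range(2)[OF uv(2)] _ _ _ _ _ r(2)])
      (simp_all only: snd_hcomp[symmetric] uv hid_def snd_conv)
  ultimately show ?thesis using p unfolding cpo_def by blast
qed

subsection \<open>Pasting\<close>

lemma pushout_swap: "pushout T K L D G l k f d \<Longrightarrow> pushout T K D L G k l d f"
  unfolding pushout_def by (elim conjE, intro conjI ballI impI) (simp_all add: conj_commute)

text \<open>The mediating map is built in two stages, first out of \<open>G\<close> by the first
  square and then out of \<open>G'\<close> by the second.\<close>

lemma pushout_paste:
  assumes po: "pushout T K L D G l k f d" and po': "pushout T D G D' G' d e g d'"
    and h: "K \<in> hyp T" "L \<in> hyp T" "D \<in> hyp T" "G \<in> hyp T" "D' \<in> hyp T" "G' \<in> hyp T"
  shows "pushout T K L D' G' l (k ;; e) (f ;; g) d'"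
  unfolding pushout_def
proof (intro conjI ballI impI)
  note p = pushoutD[OF po] and p' = pushoutD[OF po'] and v = h[THEN hyp_valid]
  show "l \<in> hmors K L" "d' \<in> hmors D' G'" by fact+
  show "k ;; e \<in> hmors K D'" using hcomp_hmors[OF v(1) p(2) p'(2)] .
  show "f ;; g \<in> hmors L G'" using hcomp_hmors[OF v(2) p(3) p'(3)] .
  show "l ;; (f ;; g) = k ;; e ;; d'"
    using hcomp_assoc[OF p(1,3), of g] hcomp_assoc[OF p(2,4), of g] hcomp_assoc[OF p(2) p'(2), of d']
      p(5) p'(5) by simp
  fix X a b
  assume X: "X \<in> hyp T" and a: "a \<in> hmors L X" and b: "b \<in> hmors D' X" and ab: "l ;; a = k ;; e ;; b"
  have eb: "e ;; b \<in> hmors D X" using hcomp_hmors[OF v(3) p'(2) b] .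
  have "l ;; a = k ;; (e ;; b)" using ab hcomp_assoc[OF p(2) p'(2)] by simp
  then obtain w where w: "w \<in> hmors G X" "f ;; w = a" "d ;; w = e ;; b"
    using pushout_lift[OF po X a eb] by blast
  obtain u where u: "u \<in> hmors G' X" "g ;; u = w" "d' ;; u = b"
    using pushout_lift[OF po' X w(1) b w(3)] by blast
  show "\<exists>!u. u \<in> hmors G' X \<and> f ;; g ;; u = a \<and> d' ;; u = b"
  proof (rule ex1I[of _ u])
    show "u \<in> hmors G' X \<and> f ;; g ;; u = a \<and> d' ;; u = b"
      using u w hcomp_assoc[OF p(3) p'(3), of u] by simp
    fix u'
    assume u': "u' \<in> hmors G' X \<and> f ;; g ;; u' = a \<and> d' ;; u' = b"
    have gu: "g ;; u' \<in> hmors G X" using hcomp_hmors[OF v(4) p'(3)] u' by blast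
    have "g ;; u' = w"
    proof (rule pushout_unique[OF po h(1-3) X gu w(1)])
      show "f ;; (g ;; u') = f ;; w"
        using u' w hcomp_assoc[OF p(3) p'(3), of u'] by simp
      show "d ;; (g ;; u') = d ;; w"
        using u' w hcomp_assoc[OF p'(1,3), of u'] hcomp_assoc[OF p'(2,4), of u'] p'(5) by simp
    qed
    then show "u' = u"
      using pushout_unique[OF po' h(3-5) X, of u' u] u u' by simp
  qed
qed

text \<open>The mediating map of the outer rectangle is the one sought: uniqueness for the first
  square shows that it restricts to \<open>a\<close> on \<open>G\<close>.\<close>

lemma pushout_cancel:
  assumes po: "pushout T K L D G l k f d" and outer: "pushout T K L D' G' l (k ;; e) f' d'"
    and e: "e \<in> hmors D D'" and g: "g \<in> hmors G G'" and fg: "f ;; g = f'" and dg: "d ;; g = e ;; d'"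
    and h: "K \<in> hyp T" "L \<in> hyp T" "D \<in> hyp T" "G \<in> hyp T" "D' \<in> hyp T" "G' \<in> hyp T"
  shows "pushout T D G D' G' d e g d'"
  unfolding pushout_def
proof (intro conjI ballI impI)
  note p = pushoutD[OF po] and p' = pushoutD[OF outer] and v = h[THEN hyp_valid]
  show "d \<in> hmors D G" "e \<in> hmors D D'" "g \<in> hmors G G'" "d' \<in> hmors D' G'" "d ;; g = e ;; d'" by fact+
  fix X a b
  assume X: "X \<in> hyp T" and a: "a \<in> hmors G X" and b: "b \<in> hmors D' X" and ab: "d ;; a = e ;; b"
  have fa: "f ;; a \<in> hmors L X" using hcomp_hmors[OF v(2) p(3) a] .
  have "l ;; (f ;; a) = k ;; e ;; b"
    using hcomp_assoc[OF p(1,3), of a] hcomp_assoc[OF p(2,4), of a] hcomp_assoc[OF p(2) e, of b] p(5) ab by simp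
  then obtain u where u: "u \<in> hmors G' X" "f' ;; u = f ;; a" "d' ;; u = b"
    using pushout_lift[OF outer X fa b] by blast
  show "\<exists>!u. u \<in> hmors G' X \<and> g ;; u = a \<and> d' ;; u = b"
  proof (rule ex1I[of _ u])
    have gu: "g ;; u \<in> hmors G X" using hcomp_hmors[OF v(4) g u(1)] .
    have "g ;; u = a"
    proof (rule pushout_unique[OF po h(1-3) X gu a])
      show "f ;; (g ;; u) = f ;; a"
        using hcomp_assoc[OF p(3) g, of u] fg u by simp
      show "d ;; (g ;; u) = d ;; a"
        using hcomp_assoc[OF p(4) g, of u] hcomp_assoc[OF e p'(4), of u] dg ab u by simp
    qed
    then show "u \<in> hmors G' X \<and> g ;; u = a \<and> d' ;; u = b" using u by blast
    fix u'
    assume u': "u' \<in> hmors G' X \<and> g ;; u' = a \<and> d' ;; u' = b"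
    show "u' = u"
    proof (rule pushout_unique[OF outer h(1,2,5) X _ u(1)])
      show "u' \<in> hmors G' X" "d' ;; u' = d' ;; u" using u u' by simp_all
      show "f' ;; u' = f' ;; u"
        using hcomp_assoc[OF p(3) g, of u'] fg u(2) u' by metis
    qed
  qed
qed

lemma pushout_iso:
  assumes po: "pushout T K L D G l k f d"
    and u: "u \<in> hmors G H" and v: "v \<in> hmors H G" and uv: "u ;; v = hid G" and vu: "v ;; u = hid H"
    and h: "K \<in> hyp T" "L \<in> hyp T" "D \<in> hyp T" "G \<in> hyp T" "H \<in> hyp T"
  shows "pushout T K L D H l k (f ;; u) (d ;; u)"
  unfolding pushout_def
proof (intro conjI ballI impI)
  note p = pushoutD[OF po] and va = h[THEN hyp_valid]
  show "l \<in> hmors K L" "k \<in> hmors K D" by fact+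
  show "f ;; u \<in> hmors L H" "d ;; u \<in> hmors D H"
    using hcomp_hmors[OF va(2) p(3) u] hcomp_hmors[OF va(3) p(4) u] .
  show "l ;; (f ;; u) = k ;; (d ;; u)"
    using hcomp_assoc[OF p(1,3), of u] hcomp_assoc[OF p(2,4), of u] p(5) by simp
  fix X a b
  assume X: "X \<in> hyp T" and a: "a \<in> hmors L X" and b: "b \<in> hmors D X" and ab: "l ;; a = k ;; b"
  then obtain w where w: "w \<in> hmors G X" "f ;; w = a" "d ;; w = b"
    using pushout_lift[OF po] by blast
  have vw: "v ;; w \<in> hmors H X" using hcomp_hmors[OF va(5) v w(1)] .
  have uvw: "u ;; (v ;; w) = w"
    using hcomp_assoc[OF u v, of w] uv hcomp_hid_left[OF w(1)] by simp
  show "\<exists>!w. w \<in> hmors H X \<and> f ;; u ;; w = a \<and> d ;; u ;; w = b"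
  proof (rule ex1I[of _ "v ;; w"])
    show "v ;; w \<in> hmors H X \<and> f ;; u ;; (v ;; w) = a \<and> d ;; u ;; (v ;; w) = b"
      using vw uvw w hcomp_assoc[OF p(3) u, of "v ;; w"] hcomp_assoc[OF p(4) u, of "v ;; w"] by simp
    fix w'
    assume w': "w' \<in> hmors H X \<and> f ;; u ;; w' = a \<and> d ;; u ;; w' = b"
    then have uw: "u ;; w' \<in> hmors G X" using hcomp_hmors[OF va(4) u] by blast
    have "u ;; w' = w"
      using w(2,3) w' hcomp_assoc[OF p(3) u, of w'] hcomp_assoc[OF p(4) u, of w']
      by (intro pushout_unique[OF po h(1-3) X uw w(1)]) metis+
    then show "w' = v ;; w"
      using hcomp_assoc[OF v u, of w'] vu hcomp_hid_left[of w' H X] w' by simp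
  qed
qed

lemma pushout_exists:
  assumes "l \<in> hmors K L" "k \<in> hmors K D" "K \<in> hyp T" "L \<in> hyp T" "D \<in> hyp T"
  obtains G f d where "G \<in> hyp T" "pushout T K L D G l k f d"
  using cpo_exists[OF assms] cpo_pushout[OF _ hyp_valid[OF assms(4)] hyp_valid[OF assms(5)]] by blast

subsection \<open>Pullbacks\<close>

definition cpb :: "('c, 'o) hgraph \<Rightarrow> ('c, 'o) hgraph \<Rightarrow> ('c, 'o) hgraph \<Rightarrow> ('c, 'o) hgraph \<Rightarrow>
    hmor \<Rightarrow> hmor \<Rightarrow> hmor \<Rightarrow> hmor \<Rightarrow> bool" where
  "cpb J C1 C2 S j1 j2 c1 c2 \<longleftrightarrow>
     j1 \<in> hmors J C1 \<and> j2 \<in> hmors J C2 \<and> c1 \<in> hmors C1 S \<and> c2 \<in> hmors C2 S \<and> j1 ;; c1 = j2 ;; c2 \<and>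
     set_pb (fst j1) (fst j2) (fst c1) (fst c2) \<and> set_pb (snd j1) (snd j2) (snd c1) (snd c2)"

lemma cpbD:
  assumes "cpb J C1 C2 S j1 j2 c1 c2"
  shows "j1 \<in> hmors J C1" "j2 \<in> hmors J C2" "c1 \<in> hmors C1 S" "c2 \<in> hmors C2 S" "j1 ;; c1 = j2 ;; c2"
    "set_pb (fst j1) (fst j2) (fst c1) (fst c2)" "set_pb (snd j1) (snd j2) (snd c1) (snd c2)"
  using assms unfolding cpb_def by simp_all

lemma cpb_lift:
  assumes pb: "cpb J C1 C2 S j1 j2 c1 c2" and v: "valid X" "valid J"
    and a: "a \<in> hmors X C1" and b: "b \<in> hmors X C2" and ab: "a ;; c1 = b ;; c2"
  shows "\<exists>u \<in> hmors X J. u ;; j1 = a \<and> u ;; j2 = b"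
proof -
  note p = cpbD[OF pb]
  have len: "length (fst j1) = nv J" "length (snd j1) = ne J"
    "length (fst c1) = nv C1" "length (snd c1) = ne C1" "length (fst c2) = nv C2" "length (snd c2) = ne C2"
    using hmors_len[OF p(1)] hmors_len[OF p(3)] hmors_len[OF p(4)] by simp_all
  have ab': "map ((!) (fst c1)) (fst a) = map ((!) (fst c2)) (fst b)"
    "map ((!) (snd c1)) (snd a) = map ((!) (snd c2)) (snd b)"
    using ab unfolding hcomp_def prod.inject by blast+
  have "\<exists>u. set u \<subseteq> {..<length (fst j1)} \<and> map ((!) (fst j1)) u = fst a \<and> map ((!) (fst j2)) u = fst b"
    by (rule set_pb_lift[OF p(6) _ _ ab'(1)]) (simp_all only: len hmors_range[OF a] hmors_range[OF b])
  then obtain uV where uV: "set uV \<subseteq> {..<nv J}" "map ((!) (fst j1)) uV = fst a" "map ((!) (fst j2)) uV = fst b"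
    unfolding len by blast
  have "\<exists>u. set u \<subseteq> {..<length (snd j1)} \<and> map ((!) (snd j1)) u = snd a \<and> map ((!) (snd j2)) u = snd b"
    by (rule set_pb_lift[OF p(7) _ _ ab'(2)]) (simp_all only: len hmors_range[OF a] hmors_range[OF b])
  then obtain uE where uE: "set uE \<subseteq> {..<ne J}" "map ((!) (snd j1)) uE = snd a" "map ((!) (snd j2)) uE = snd b"
    unfolding len by blast
  have u1: "(uV, uE) ;; j1 = a" and u2: "(uV, uE) ;; j2 = b"
    unfolding hcomp_def fst_conv snd_conv uV uE by simp_all
  have "(uV, uE) \<in> hmors X J"
    by (rule hom_lift[OF p(1,2) v])
      (simp_all only: u1 u2 a b fst_conv snd_conv uV(1) uE(1), rule set_pb_unique[OF p(6)], simp_all only: len)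
  then show ?thesis using u1 u2 by blast
qed

lemma cpb_unique:
  assumes pb: "cpb J C1 C2 S j1 j2 c1 c2" and u: "u \<in> hmors X J" and v: "v \<in> hmors X J"
    and eq: "u ;; j1 = v ;; j1" "u ;; j2 = v ;; j2"
  shows "u = v"
proof -
  note p = cpbD[OF pb]
  have len: "length (fst j1) = nv J" "length (snd j1) = ne J"
    using hmors_len[OF p(1)] by simp_all
  have eq': "map ((!) (fst j1)) (fst u) = map ((!) (fst j1)) (fst v)"
    "map ((!) (snd j1)) (snd u) = map ((!) (snd j1)) (snd v)"
    "map ((!) (fst j2)) (fst u) = map ((!) (fst j2)) (fst v)"
    "map ((!) (snd j2)) (snd u) = map ((!) (snd j2)) (snd v)"
    using eq unfolding hcomp_def prod.inject by blast+
  have "fst u = fst v" "snd u = snd v"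
    using set_pb_unique[OF p(6) _ _ eq'(1,3)] set_pb_unique[OF p(7) _ _ eq'(2,4)]
      hmors_range[OF u] hmors_range[OF v] len by simp_all
  then show ?thesis by (rule prod_eqI)
qed

lemma cpb_pullback:
  assumes pb: "cpb J C1 C2 S j1 j2 c1 c2" and J: "valid J"
  shows "pullback T J C1 C2 S j1 j2 c1 c2"
  unfolding pullback_def
proof (intro conjI ballI impI)
  fix X a b
  assume "X \<in> hyp T" "a \<in> hmors X C1" "b \<in> hmors X C2" "a ;; c1 = b ;; c2"
  then obtain u where "u \<in> hmors X J" "u ;; j1 = a" "u ;; j2 = b"
    using cpb_lift[OF pb hyp_valid J] by blast
  then show "\<exists>!u. u \<in> hmors X J \<and> u ;; j1 = a \<and> u ;; j2 = b"
    by (intro ex1I[of _ u]) (simp, rule cpb_unique[OF pb], simp_all)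
qed (use cpbD[OF pb] in simp_all)

text \<open>Nodes and hyperedges are paired off separately. Two hyperedges with the same image in
  \<open>S\<close> have the same label, and their source and target lists agree over
  \<open>S\<close>, so these lists lift to lists of node pairs.\<close>

lemma cpb_exists:
  assumes c1: "c1 \<in> hmors C1 S" and c2: "c2 \<in> hmors C2 S" and h: "C1 \<in> hyp T" "C2 \<in> hyp T"
  shows "\<exists>J \<in> hyp T. \<exists>j1 j2. cpb J C1 C2 S j1 j2 c1 c2"
proof -
  have c1': "set (fst c1) \<subseteq> {..<nv S}" "map ((!) (vcol S)) (fst c1) = vcol C1"
    "set (snd c1) \<subseteq> {..<ne S}" "map ((!) (edg S)) (snd c1) = map (act (fst c1)) (edg C1)"
    and c2': "set (fst c2) \<subseteq> {..<nv S}" "map ((!) (vcol S)) (fst c2) = vcol C2"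
    "set (snd c2) \<subseteq> {..<ne S}" "map ((!) (edg S)) (snd c2) = map (act (fst c2)) (edg C2)"
    using c1 c2 by (simp_all only: hmors_iff simp_thms)
  have len: "length (fst c1) = nv C1" "length (snd c1) = ne C1" "length (fst c2) = nv C2" "length (snd c2) = ne C2"
    using hmors_len[OF c1] hmors_len[OF c2] by simp_all
  obtain v1 v2 where V: "set_pb v1 v2 (fst c1) (fst c2)" using set_pb_exists by blast
  obtain e1 e2 where E: "set_pb e1 e2 (snd c1) (snd c2)" using set_pb_exists by blast
  note V' = set_pb_range[OF V] and E' = set_pb_range[OF E]
  have lenV: "length v1 = length v2" and lenE: "length e1 = length e2"
    using V E by (simp_all add: set_pb_def)
  have "\<exists>e. edge_in (length v1) e \<and> act v1 e = edg C1 ! (e1 ! i) \<and> act v2 e = edg C2 ! (e2 ! i)"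
    if i: "i < length e1" for i
  proof -
    let ?x = "edg C1 ! (e1 ! i)" and ?y = "edg C2 ! (e2 ! i)"
    have i1: "e1 ! i < ne C1" and i2: "e2 ! i < ne C2"
      using nth_in_range[OF E'(1) i] nth_in_range[OF E'(2), of i] i lenE len by simp_all
    have "act (fst c1) ?x = map ((!) (edg S)) (snd c1) ! (e1 ! i)"
      unfolding c1'(4) using i1 by simp
    also have "\<dots> = edg S ! (map ((!) (snd c1)) e1 ! i)"
      using i i1 len by simp
    also have "\<dots> = map ((!) (edg S)) (snd c2) ! (e2 ! i)"
      unfolding E'(3) using i i2 len lenE by simp
    also have "\<dots> = act (fst c2) ?y"
      unfolding c2'(4) using i2 by simp
    finally have act: "act (fst c1) ?x = act (fst c2) ?y" .
    have "edge_in (nv C1) ?x" "edge_in (nv C2) ?y"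
      using h i1 i2 unfolding hyp_iff valid_def by simp_all
    then have r: "set (fst (snd ?x)) \<subseteq> {..<length (fst c1)}" "set (snd (snd ?x)) \<subseteq> {..<length (fst c1)}"
      "set (fst (snd ?y)) \<subseteq> {..<length (fst c2)}" "set (snd (snd ?y)) \<subseteq> {..<length (fst c2)}"
      unfolding edge_in_def len by blast+
    have m: "map ((!) (fst c1)) (fst (snd ?x)) = map ((!) (fst c2)) (fst (snd ?y))"
      "map ((!) (fst c1)) (snd (snd ?x)) = map ((!) (fst c2)) (snd (snd ?y))" and l: "fst ?x = fst ?y"
      using act unfolding act_def prod.inject by blast+
    obtain s t where "set s \<subseteq> {..<length v1}" "map ((!) v1) s = fst (snd ?x)" "map ((!) v2) s = fst (snd ?y)"
      "set t \<subseteq> {..<length v1}" "map ((!) v1) t = snd (snd ?x)" "map ((!) v2) t = snd (snd ?y)"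
      using set_pb_lift[OF V r(1,3) m(1)] set_pb_lift[OF V r(2,4) m(2)] by blast
    then show ?thesis
      by (intro exI[of _ "(fst ?x, s, t)"]) (simp add: edge_in_def act_def prod_eq_iff l)
  qed
  then obtain pre where pre: "\<And>i. i < length e1 \<Longrightarrow> edge_in (length v1) (pre i)"
    "\<And>i. i < length e1 \<Longrightarrow> act v1 (pre i) = edg C1 ! (e1 ! i)"
    "\<And>i. i < length e1 \<Longrightarrow> act v2 (pre i) = edg C2 ! (e2 ! i)"
    by metis
  define J where "J = HGraph (map ((!) (vcol C1)) v1) (map pre [0..<length e1])"
  have vJ: "valid J" unfolding valid_def J_def using pre(1) by simp
  have j1: "(v1, e1) \<in> hmors J C1"
    unfolding hmors_iff J_def fst_conv snd_conv hgraph.sel using V'(1) E'(1) len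
    by (auto simp: pre intro!: nth_equalityI)
  have "map ((!) (vcol C2)) v2 = map ((!) (vcol S)) (map ((!) (fst c2)) v2)"
    unfolding c2'(2)[symmetric] by (rule map_nth_comp[OF V'(2)])
  also have "\<dots> = map ((!) (vcol C1)) v1"
    unfolding c1'(2)[symmetric] V'(3)[symmetric] by (rule map_nth_comp[OF V'(1), symmetric])
  finally have "map ((!) (vcol C2)) v2 = map ((!) (vcol C1)) v1" .
  then have j2: "(v2, e2) \<in> hmors J C2"
    unfolding hmors_iff J_def fst_conv snd_conv hgraph.sel using V'(2) E'(2) len lenE
    by (auto simp: pre intro!: nth_equalityI)
  have "cpb J C1 C2 S (v1, e1) (v2, e2) c1 c2"
    unfolding cpb_def using j1 j2 c1 c2 V E V'(3) E'(3) by (simp add: hcomp_def)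
  then show ?thesis using hyp_source[OF j1 h(1) vJ] by blast
qed

lemma set_pb_iso:
  assumes pb: "set_pb p1 p2 c1 c2" and u: "length u = n" "set u \<subseteq> {..<m}" and v: "length v = m" "set v \<subseteq> {..<n}"
    and m: "length p1 = m" and uv: "map ((!) v) u = [0..<n]" and vu: "map ((!) u) v = [0..<m]"
    and j1: "j1 = map ((!) p1) u" and j2: "j2 = map ((!) p2) u"
  shows "set_pb j1 j2 c1 c2"
proof -
  have len: "length p2 = m" and d: "distinct (zip p1 p2)"
    using pb m unfolding set_pb_def by simp_all
  have z: "zip j1 j2 = map ((!) (zip p1 p2)) u"
  proof (rule nth_equalityI)
    fix i
    assume "i < length (zip j1 j2)"
    then have i: "i < length u" by (simp add: j1 j2)
    then show "zip j1 j2 ! i = map ((!) (zip p1 p2)) u ! i"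
      using nth_in_range[OF u(2) i] len m by (simp add: j1 j2)
  qed (simp add: j1 j2)
  have "distinct (map ((!) v) u)" unfolding uv by simp
  then have du: "distinct u" by (simp add: distinct_map)
  have "{..<m} = set (map ((!) u) v)" unfolding vu by auto
  also have "\<dots> \<subseteq> set u" using u v by auto
  finally have su: "set u = {..<m}" using u by blast
  have "distinct (zip j1 j2)"
    unfolding z distinct_map using du d len m u(2)
    by (auto simp: inj_on_def nth_eq_iff_index_eq subset_iff simp del: nth_zip)
  moreover have "set (zip j1 j2) = set (zip p1 p2)"
    unfolding z set_map su using len m by (auto simp: set_conv_nth simp del: nth_zip)
  moreover have "length j1 = length j2"
    unfolding j1 j2 by simp
  ultimately show ?thesis using pb unfolding set_pb_def by simp
qed

lemma pullback_unique:
  assumes pb: "pullback T J C1 C2 S j1 j2 c1 c2" and h: "X \<in> hyp T"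
    and u: "u \<in> hmors X J" and v: "v \<in> hmors X J"
    and eq: "u ;; j1 = v ;; j1" "u ;; j2 = v ;; j2"
  shows "u = v"
proof -
  have j: "j1 \<in> hmors J C1" "j2 \<in> hmors J C2" "j1 ;; c1 = j2 ;; c2"
    using pb unfolding pullback_def by blast+
  have "u ;; j1 \<in> hmors X C1" "u ;; j2 \<in> hmors X C2"
    using hcomp_hmors[OF hyp_valid[OF h] u] j by blast+
  moreover have "(u ;; j1) ;; c1 = (u ;; j2) ;; c2"
    using hcomp_assoc[OF u j(1)] hcomp_assoc[OF u j(2)] j(3) by simp
  ultimately have "\<exists>!w. w \<in> hmors X J \<and> w ;; j1 = u ;; j1 \<and> w ;; j2 = u ;; j2"
    using pb h unfolding pullback_def by blast
  then show ?thesis using u v eq by metis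
qed

lemma pullback_cpb:
  assumes pb: "pullback T J C1 C2 S j1 j2 c1 c2" and h: "J \<in> hyp T" "C1 \<in> hyp T" "C2 \<in> hyp T"
  shows "cpb J C1 C2 S j1 j2 c1 c2"
proof -
  have p: "j1 \<in> hmors J C1" "j2 \<in> hmors J C2" "c1 \<in> hmors C1 S" "c2 \<in> hmors C2 S" "j1 ;; c1 = j2 ;; c2"
    using pb unfolding pullback_def by blast+
  obtain P p1 p2 where P: "P \<in> hyp T" and c: "cpb P C1 C2 S p1 p2 c1 c2"
    using cpb_exists[OF p(3,4) h(2,3)] by blast
  note c' = cpbD[OF c]
  obtain u where u: "u \<in> hmors J P" "u ;; p1 = j1" "u ;; p2 = j2"
    using cpb_lift[OF c hyp_valid[OF h(1)] hyp_valid[OF P] p(1,2,5)] by blast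
  obtain v where v: "v \<in> hmors P J" "v ;; j1 = p1" "v ;; j2 = p2"
    using pb P c'(1,2,5) unfolding pullback_def by blast
  have "u ;; v = hid J"
    using hcomp_hmors[OF hyp_valid[OF h(1)] u(1) v(1)] hid_hmors[OF hyp_valid[OF h(1)]]
    by (rule pullback_unique[OF pb h(1)])
      (simp_all add: hcomp_assoc[OF u(1) v(1)] u v hcomp_hid_left[OF p(1)] hcomp_hid_left[OF p(2)])
  moreover have "v ;; u = hid P"
    using hcomp_hmors[OF hyp_valid[OF P] v(1) u(1)] hid_hmors[OF hyp_valid[OF P]]
    by (rule cpb_unique[OF c])
      (simp_all add: hcomp_assoc[OF v(1) u(1)] u v hcomp_hid_left[OF c'(1)] hcomp_hid_left[OF c'(2)])
  ultimately have i: "map ((!) (fst v)) (fst u) = [0..<nv J]" "map ((!) (snd v)) (snd u) = [0..<ne J]"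
    "map ((!) (fst u)) (fst v) = [0..<nv P]" "map ((!) (snd u)) (snd v) = [0..<ne P]"
    unfolding hcomp_def hid_def prod.inject by blast+
  have "set_pb (fst j1) (fst j2) (fst c1) (fst c2)"
    by (rule set_pb_iso[OF c'(6) hmors_len(1)[OF u(1)] hmors_range(1)[OF u(1)] hmors_len(1)[OF v(1)]
        hmors_range(1)[OF v(1)] hmors_len(1)[OF c'(1)] i(1,3)]) (simp_all only: fst_hcomp[symmetric] u)
  moreover have "set_pb (snd j1) (snd j2) (snd c1) (snd c2)"
    by (rule set_pb_iso[OF c'(7) hmors_len(2)[OF u(1)] hmors_range(2)[OF u(1)] hmors_len(2)[OF v(1)]
        hmors_range(2)[OF v(1)] hmors_len(2)[OF c'(1)] i(2,4)]) (simp_all only: snd_hcomp[symmetric] u)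
  ultimately show ?thesis using p unfolding cpb_def by blast
qed

subsection \<open>Subgraphs and epimorphisms\<close>

lemma preimage_list: "set xs \<subseteq> set s \<Longrightarrow> \<exists>ys. set ys \<subseteq> {..<length s} \<and> map ((!) s) ys = xs"
proof (induction xs)
  case (Cons x xs)
  then obtain ys where "set ys \<subseteq> {..<length s}" "map ((!) s) ys = xs" by auto
  moreover obtain i where "i < length s" "s ! i = x"
    using Cons.prems by (auto simp: in_set_conv_nth)
  ultimately show ?case by (intro exI[of _ "i # ys"]) simp
qed simp

lemma subgraph_exists:
  assumes G: "G \<in> hyp T" and V: "V \<subseteq> {..<nv G}" and E: "E \<subseteq> {..<ne G}"
    and closed: "\<And>e. e \<in> E \<Longrightarrow> set (fst (snd (edg G ! e))) \<union> set (snd (snd (edg G ! e))) \<subseteq> V"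
  obtains S s where "S \<in> hyp T" "s \<in> hmors S G" "distinct (fst s)" "distinct (snd s)"
    "set (fst s) = V" "set (snd s) = E"
proof -
  obtain vs where vs: "set vs = V" "distinct vs"
    using finite_distinct_list[OF finite_subset[OF V]] by blast
  obtain es where es: "set es = E" "distinct es"
    using finite_distinct_list[OF finite_subset[OF E]] by blast
  have "\<exists>x. edge_in (length vs) x \<and> act vs x = edg G ! e" if e: "e \<in> E" for e
  proof -
    obtain s t where "set s \<subseteq> {..<length vs}" "map ((!) vs) s = fst (snd (edg G ! e))"
      "set t \<subseteq> {..<length vs}" "map ((!) vs) t = snd (snd (edg G ! e))"
      using preimage_list[of _ vs] closed[OF e] unfolding vs by (metis Un_subset_iff)
    then show ?thesis
      by (intro exI[of _ "(fst (edg G ! e), s, t)"]) (simp add: edge_in_def act_def)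
  qed
  then obtain pre where pre: "\<And>e. e \<in> E \<Longrightarrow> edge_in (length vs) (pre e)" "\<And>e. e \<in> E \<Longrightarrow> act vs (pre e) = edg G ! e"
    by metis
  define S where "S = HGraph (map ((!) (vcol G)) vs) (map pre es)"
  have s: "(vs, es) \<in> hmors S G"
    unfolding hmors_iff S_def using vs(1) es(1) V E pre(2) by simp
  have "valid S" unfolding valid_def S_def using pre(1) es by simp
  then have "S \<in> hyp T" by (rule hyp_source[OF s G])
  then show thesis using that[of S "(vs, es)"] s vs es by simp
qed

lemma map_nth_distinct_inj:
  assumes "distinct s" "set u \<subseteq> {..<length s}" "set v \<subseteq> {..<length s}" "map ((!) s) u = map ((!) s) v"
  shows "u = v"
proof -
  have "inj_on ((!) s) {..<length s}"
    using assms(1) by (auto simp: inj_on_def nth_eq_iff_index_eq)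
  then have "inj_on ((!) s) (set u \<union> set v)"
    by (rule inj_on_subset) (use assms(2,3) in blast)
  then show ?thesis using assms(4) by (rule map_inj_on[rotated])
qed

lemma subgraph_lift:
  assumes s: "s \<in> hmors S G" and d: "distinct (fst s)" "distinct (snd s)" and v: "valid X" "valid S"
    and a: "a \<in> hmors X G" and V: "set (fst a) \<subseteq> set (fst s)" and E: "set (snd a) \<subseteq> set (snd s)"
  obtains u where "u \<in> hmors X S" "u ;; s = a"
proof -
  obtain uV uE where u: "set uV \<subseteq> {..<nv S}" "map ((!) (fst s)) uV = fst a"
    "set uE \<subseteq> {..<ne S}" "map ((!) (snd s)) uE = snd a"
    using preimage_list[OF V] preimage_list[OF E] hmors_len[OF s] by metis
  have us: "(uV, uE) ;; s = a"
    unfolding hcomp_def fst_conv snd_conv u by simp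
  have "(uV, uE) \<in> hmors X S"
  proof (rule hom_lift[OF s s v])
    fix x y
    assume "set x \<subseteq> {..<nv S}" "set y \<subseteq> {..<nv S}" "map ((!) (fst s)) x = map ((!) (fst s)) y"
    then show "x = y" using map_nth_distinct_inj[OF d(1), of x y] hmors_len[OF s] by simp
  qed (simp_all add: us a u)
  then show thesis using that us by blast
qed

text \<open>The work is in showing surjectivity: a missed element of \<open>H\<close> is doubled,
  and the two embeddings into the result agree after \<open>f\<close>. Hyperedges come first,
  because a missed node can be doubled with all hyperedges left in place only if none of them
  touches it.\<close>

lemma epi_iff:
  assumes G: "G \<in> hyp T" and H: "H \<in> hyp T"
  shows "epi T G H f \<longleftrightarrow> f \<in> hmors G H \<and> set (fst f) = {..<nv H} \<and> set (snd f) = {..<ne H}"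
proof
  assume f: "f \<in> hmors G H \<and> set (fst f) = {..<nv H} \<and> set (snd f) = {..<ne H}"
  show "epi T G H f"
    unfolding epi_def
  proof (intro conjI ballI impI)
    fix X u v
    assume uv: "u \<in> hmors H X" "v \<in> hmors H X" "f ;; u = f ;; v"
    then have "map ((!) (fst u)) (fst f) = map ((!) (fst v)) (fst f)"
      "map ((!) (snd u)) (snd f) = map ((!) (snd v)) (snd f)"
      unfolding hcomp_def prod.inject by blast+
    then have "fst u = fst v" "snd u = snd v"
      using f hmors_len[OF uv(1)] hmors_len[OF uv(2)] by (blast intro: list_eq_via_covering)+
    then show "u = v" by (rule prod_eqI)
  qed (use f in blast)
next
  assume epi: "epi T G H f"
  then have f: "f \<in> hmors G H" by (simp add: epi_def)
  have fixed: "\<And>X u. X \<in> hyp T \<Longrightarrow> ([0..<nv H], [0..<ne H]) \<in> hmors H X \<Longrightarrow> u \<in> hmors H X \<Longrightarrow>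
      f ;; ([0..<nv H], [0..<ne H]) = f ;; u \<Longrightarrow> u = ([0..<nv H], [0..<ne H])"
    using epi unfolding epi_def by metis
  have edges: "set (snd f) = {..<ne H}"
  proof (rule ccontr)
    assume "set (snd f) \<noteq> {..<ne H}"
    then obtain e where e: "e < ne H" "e \<notin> set (snd f)"
      using hmors_range(2)[OF f] by blast
    \<comment> \<open>A parallel copy of the missed hyperedge is appended, and \<open>u\<close>
      sends the original to the copy.\<close>
    define X where "X = HGraph (vcol H) (edg H @ [edg H ! e])"
    define u where "u = ([0..<nv H], [0..<ne H][e := ne H])"
    have ein: "edge_in (nv H) x" if "x \<in> set (edg H)" for x
      using H that unfolding hyp_iff valid_def by blast
    have "X \<in> hyp T"
      using H e unfolding hyp_iff valid_def X_def by auto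
    moreover have "([0..<nv H], [0..<ne H]) \<in> hmors H X"
      unfolding hmors_iff X_def by (auto simp: act_upt[OF ein] nth_append intro!: nth_equalityI)
    moreover have "u \<in> hmors H X"
      unfolding hmors_iff X_def u_def using e
      by (auto simp: act_upt[OF ein] nth_append nth_list_update intro!: nth_equalityI
          dest!: set_update_subset_insert[THEN subsetD])
    moreover have "f ;; ([0..<nv H], [0..<ne H]) = f ;; u"
      using e hmors_range(2)[OF f] unfolding hcomp_def u_def
      by (auto simp: nth_list_update)
    ultimately have "u = ([0..<nv H], [0..<ne H])" by (rule fixed)
    then have "[0..<ne H][e := ne H] ! e = [0..<ne H] ! e" by (simp add: u_def)
    then show False using e by simp
  qed
  have "set (fst f) = {..<nv H}"
  proof (rule ccontr)
    assume "set (fst f) \<noteq> {..<nv H}"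
    then obtain n where n: "n < nv H" "n \<notin> set (fst f)"
      using hmors_range(1)[OF f] by blast
    define X where "X = HGraph (vcol H @ [vcol H ! n]) (edg H)"
    define u where "u = ([0..<nv H][n := nv H], [0..<ne H])"
    have ein: "edge_in (nv H) x" if "x \<in> set (edg H)" for x
      using H that unfolding hyp_iff valid_def by blast
    \<comment> \<open>Every hyperedge is already known to be hit by \<open>f\<close>, so its nodes
      are hit as well and differ from \<open>n\<close>.\<close>
    have nin: "n \<notin> set (fst (snd x)) \<union> set (snd (snd x))" if x: "x \<in> set (edg H)" for x
    proof -
      obtain i where "i < ne H" "x = edg H ! i" using x by (auto simp: in_set_conv_nth)
      then have "x \<in> set (map ((!) (edg H)) (snd f))" using edges by auto
      then obtain y where y: "y \<in> set (edg G)" "x = act (fst f) y"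
        using f unfolding hmors_iff by auto
      have "edge_in (nv G) y" using G y(1) unfolding hyp_iff valid_def by blast
      then have "set (fst (snd x)) \<union> set (snd (snd x)) \<subseteq> set (fst f)"
        using hmors_len[OF f] unfolding y(2) edge_in_def act_def by auto
      then show ?thesis using n by blast
    qed
    have act_u: "act (fst u) x = x" if x: "x \<in> set (edg H)" for x
    proof -
      have "map ((!) (fst u)) w = w" if "set w \<subseteq> {..<nv H}" "n \<notin> set w" for w
      proof (rule map_idI)
        fix x
        assume "x \<in> set w"
        then have "x < nv H" "x \<noteq> n" using that by auto
        then show "fst u ! x = x" by (simp add: u_def)
      qed
      then show ?thesis
        using ein[OF x] nin[OF x] unfolding act_def edge_in_def by (simp add: prod_eq_iff)
    qed
    have idX: "([0..<nv H], [0..<ne H]) \<in> hmors H X"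
      unfolding hmors_iff X_def by (auto simp: act_upt[OF ein] nth_append intro!: nth_equalityI)
    have uX: "u \<in> hmors H X"
      unfolding hmors_iff
    proof (intro conjI)
      show "map ((!) (edg X)) (snd u) = map (act (fst u)) (edg H)"
        by (auto simp: X_def u_def act_u[unfolded u_def fst_conv] intro!: nth_equalityI)
      show "map ((!) (vcol X)) (fst u) = vcol H"
        using n(1) by (auto simp: X_def u_def nth_append nth_list_update intro!: nth_equalityI)
      show "set (fst u) \<subseteq> {..<nv X}" "set (snd u) \<subseteq> {..<ne X}"
        by (auto simp: X_def u_def dest!: set_update_subset_insert[THEN subsetD])
    qed
    have mapc: "map ((!) (vcol X)) w = map ((!) (vcol H)) w" if "set w \<subseteq> {..<nv H}" for w
      using that by (auto simp: X_def nth_append)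
    have "X \<in> hyp T"
    proof -
      have "edge_in (nv X) x" if "x \<in> set (edg H)" for x
        using ein[OF that] unfolding edge_in_def X_def by auto
      moreover have "set (vcol X) \<subseteq> colours T"
        using H n unfolding hyp_iff X_def by auto
      moreover have "edg X = edg H" by (simp add: X_def)
      ultimately show ?thesis
        using H ein unfolding hyp_iff valid_def edge_in_def by (auto simp: mapc)
    qed
    moreover have "f ;; ([0..<nv H], [0..<ne H]) = f ;; u"
      using n hmors_range(1)[OF f] unfolding hcomp_def u_def
      by (auto simp: nth_list_update)
    ultimately have "u = ([0..<nv H], [0..<ne H])" using fixed idX uX by blast
    then have "[0..<nv H][n := nv H] ! n = [0..<nv H] ! n" by (simp add: u_def)
    then show False using n by simp
  qed
  then show "f \<in> hmors G H \<and> set (fst f) = {..<nv H} \<and> set (snd f) = {..<ne H}"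
    using f edges by blast
qed

section \<open>Restriction of a rewriting step to a subgraph\<close>

text \<open>The indicator of \<open>y\<close>, taken together with 0 on the other leg, is compatible
  because \<open>k\<close> misses \<open>y\<close>. Having to factor through the apex, it separates
  \<open>y\<close> from every other point of the context.\<close>

lemma set_po_inj:
  assumes po: "set_po n l k f c" and k: "set k \<subseteq> {..<length c}" and len: "length l = length k"
    and l: "set l \<subseteq> {..<length f}"
    and y: "y < length c" "y' < length c" "c ! y = c ! y'" "y \<notin> set k"
  shows "y = y'"
proof (rule ccontr)
  assume "y \<noteq> y'"
  define a where "a = map (\<lambda>_. 0 :: nat) f"
  define b where "b = map (\<lambda>j. if j = y then 1 else 0 :: nat) [0..<length c]"
  have "map ((!) a) l = map ((!) b) k"
  proof (rule nth_equalityI)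
    fix i
    assume "i < length (map ((!) a) l)"
    then have i: "i < length l" "i < length k" using len by simp_all
    then have "k ! i \<noteq> y" "k ! i < length c" "l ! i < length f"
      using y(4) nth_mem[OF i(2)] nth_in_range[OF k i(2)] nth_in_range[OF l i(1)] by auto
    then show "map ((!) a) l ! i = map ((!) b) k ! i" using i by (simp add: a_def b_def)
  qed (simp add: len)
  moreover have "length a = length f" "length b = length c" "set a \<union> set b \<subseteq> {0, 1}"
    by (auto simp: a_def b_def)
  ultimately obtain w where "map ((!) w) c = b"
    using po unfolding set_po_def by blast
  then have "b ! y = w ! (c ! y)" "b ! y' = w ! (c ! y')"
    using y by auto
  then show False using y \<open>y \<noteq> y'\<close> by (simp add: b_def)
qed

text \<open>Stability of pushouts under pullback, for a subset \<open>s\<close> of the apex that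
  contains the image of \<open>f\<close>. A compatible pair on the restricted context is extended to
  the whole context, factored through the old apex and restricted to \<open>s\<close>.\<close>

lemma set_po_restrict:
  assumes po: "set_po n l k f c" and l: "set l \<subseteq> {..<length f}"
    and s: "distinct s" "set s \<subseteq> {..<n}"
    and f: "f = map ((!) s) f'" "set f' \<subseteq> {..<length s}"
    and t: "distinct t" "set t = {y. y < length c \<and> c ! y \<in> set s}"
    and c: "map ((!) c) t = map ((!) s) c'" "set c' \<subseteq> {..<length s}"
    and k: "k = map ((!) t) k'" "set k' \<subseteq> {..<length t}"
  shows "set_po (length s) l k' f' c'"
  unfolding set_po_def
proof (intro conjI allI impI)
  have len: "length c' = length t" using arg_cong[OF c(1), of length] by simp
  have ct: "c ! (t ! i) = s ! (c' ! i)" if "i < length t" for i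
    using arg_cong[OF c(1), of "\<lambda>xs. xs ! i"] that len by simp
  have surj: "set (f @ c) = {..<n}" using po by (simp add: set_po_def)
  have "z \<in> set (f' @ c')" if z: "z < length s" for z
  proof -
    have "s ! z \<in> set (f @ c)" using s(2) z nth_mem surj by blast
    then consider x where "x \<in> set f'" "s ! z = s ! x" | y where "y < length c" "s ! z = c ! y"
      unfolding f(1) by (auto simp: in_set_conv_nth)
    then show ?thesis
    proof cases
      case 1
      then have "z = x" using s(1) z f(2) by (auto simp: nth_eq_iff_index_eq)
      then show ?thesis using 1 by simp
    next
      case 2
      then have "y \<in> set t" using z nth_mem[of z s] by (simp add: t(2))
      then obtain i where i: "i < length t" "t ! i = y" by (auto simp: in_set_conv_nth)
      then have "s ! z = s ! (c' ! i)" using 2 ct by metis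
      then have "z = c' ! i" using s(1) z nth_in_range[OF c(2)] i len by (simp add: nth_eq_iff_index_eq)
      then show ?thesis using i len by simp
    qed
  qed
  then show "set (f' @ c') = {..<length s}" using f(2) c(2) by auto
  fix a b :: "nat list"
  assume *: "length a = length f' \<and> length b = length c' \<and> set a \<union> set b \<subseteq> {0, 1} \<and>
    map ((!) a) l = map ((!) b) k'"
  define idx where "idx y = (THE i. i < length t \<and> t ! i = y)" for y
  have idx: "idx (t ! i) = i" if "i < length t" for i
    unfolding idx_def using t(1) that by (auto simp: nth_eq_iff_index_eq)
  \<comment> \<open>The default 0 off \<open>t\<close> does not disturb compatibility, because
    \<open>k\<close> factors through \<open>t\<close>.\<close>
  define b' where "b' = map (\<lambda>y. if y \<in> set t then b ! idx y else 0) [0..<length c]"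
  have tlt: "t ! i < length c" if "i < length t" for i
    using nth_mem[OF that] by (simp add: t(2))
  have b't: "b' ! (t ! i) = b ! i" if "i < length t" for i
    using that tlt[OF that] by (simp add: b'_def idx)
  have "map ((!) b') k = map ((!) b) k'"
    unfolding k(1) map_map comp_def using k(2) b't by (intro map_cong) auto
  then have compat: "map ((!) a) l = map ((!) b') k" using * by simp
  have "\<exists>w. length w = n \<and> map ((!) w) f = a \<and> map ((!) w) c = b'"
  proof (rule set_po_lift[OF po l _ _ _ compat])
    show "set k \<subseteq> {..<length c}" unfolding k(1) using k(2) tlt by auto
    show "length a = length f" using * f(1) by simp
  qed (simp add: b'_def)
  then obtain w where w: "map ((!) w) f = a" "map ((!) w) c = b'" by blast
  have sf: "map ((!) (map ((!) w) s)) f' = a"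
    using map_nth_comp[OF f(2), of "(!) w"] w(1) f(1) by (simp only:)
  have "map ((!) (map ((!) w) s)) c' = map ((!) w) (map ((!) c) t)"
    using map_nth_comp[OF c(2), of "(!) w"] by (simp only: c(1))
  also have "\<dots> = map ((!) (map ((!) w) c)) t"
    using tlt by (intro map_nth_comp[symmetric]) (auto simp: in_set_conv_nth)
  also have "\<dots> = b"
    unfolding w(2) using b't * len by (intro nth_equalityI) simp_all
  finally show "\<exists>w. length w = length s \<and> map ((!) w) f' = a \<and> map ((!) w) c' = b"
    using sf by (metis length_map)
qed

text \<open>
  Outside the range of \<open>s\<close> both \<open>c1\<close> and \<open>c2\<close> are bijective, so there the pullback of \<open>c1\<close> and \<open>c2\<close> is a
  copy of the domain of \<open>c1\<close>; hence that domain is glued from its part \<open>t1\<close> over \<open>s\<close> and the pullback.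
\<close>

lemma set_po_context:
  assumes s: "distinct s"
    and t1: "distinct t1" "set t1 = {y. y < length c1 \<and> c1 ! y \<in> set s}"
    and t2: "set t2 = {y. y < length c2 \<and> c2 ! y \<in> set s}"
    and c1': "map ((!) c1) t1 = map ((!) s) c1'" "set c1' \<subseteq> {..<length s}"
    and c2': "map ((!) c2) t2 = map ((!) s) c2'" "set c2' \<subseteq> {..<length s}"
    and E: "set_pb e1 e2 c1 c2" and J: "set_pb j1 j2 c1' c2'"
    and e: "map ((!) e1) e = map ((!) t1) j1" "map ((!) e2) e = map ((!) t2) j2" "set e \<subseteq> {..<length e1}"
    and ex: "\<And>y. y < length c1 \<Longrightarrow> c1 ! y \<notin> set s \<Longrightarrow> \<exists>y' < length c2. c2 ! y' = c1 ! y"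
    and inj: "\<And>y y'. y < length c2 \<Longrightarrow> y' < length c2 \<Longrightarrow> c2 ! y = c2 ! y' \<Longrightarrow> c2 ! y \<notin> set s \<Longrightarrow> y = y'"
  shows "set_po (length c1) j1 e t1 e1"
  unfolding set_po_def
proof (intro conjI allI impI)
  have len: "length c1' = length t1" "length c2' = length t2" "length e = length j1"
    using arg_cong[OF c1'(1), of length] arg_cong[OF c2'(1), of length] arg_cong[OF e(1), of length] by simp_all
  have ct: "c1 ! (t1 ! i) = s ! (c1' ! i)" if "i < length t1" for i
    using arg_cong[OF c1'(1), of "\<lambda>xs. xs ! i"] that len by simp
  have ct2: "c2 ! (t2 ! i) = s ! (c2' ! i)" if "i < length t2" for i
    using arg_cong[OF c2'(1), of "\<lambda>xs. xs ! i"] that len by simp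
  have E12: "length e1 = length e2" "distinct (zip e1 e2)"
    and Ein: "\<And>x y. (x, y) \<in> set (zip e1 e2) \<longleftrightarrow> x < length c1 \<and> y < length c2 \<and> c1 ! x = c2 ! y"
    using E unfolding set_pb_def by simp_all
  have J12: "length j1 = length j2"
    and Jin: "\<And>x y. (x, y) \<in> set (zip j1 j2) \<longleftrightarrow> x < length c1' \<and> y < length c2' \<and> c1' ! x = c2' ! y"
    using J unfolding set_pb_def by simp_all
  have Enth: "e1 ! i < length c1 \<and> e2 ! i < length c2 \<and> c1 ! (e1 ! i) = c2 ! (e2 ! i)" if "i < length e1" for i
    unfolding Ein[symmetric] using that E12 by (auto simp: set_zip)
  have Einj: "i = j" if "i < length e1" "j < length e1" "e1 ! i = e1 ! j" "e2 ! i = e2 ! j" for i j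
    using nth_eq_iff_index_eq[OF E12(2), of i j] that E12(1) by simp
  show cover: "set (t1 @ e1) = {..<length c1}"
  proof
    show "set (t1 @ e1) \<subseteq> {..<length c1}" using t1(2) Enth by (auto simp: in_set_conv_nth)
    show "{..<length c1} \<subseteq> set (t1 @ e1)"
    proof
      fix y
      assume "y \<in> {..<length c1}"
      then have y: "y < length c1" by simp
      show "y \<in> set (t1 @ e1)"
      proof (cases "c1 ! y \<in> set s")
        case True
        then show ?thesis using y t1(2) by simp
      next
        case False
        then obtain y' where "y' < length c2" "c2 ! y' = c1 ! y" using ex y by blast
        then have "(y, y') \<in> set (zip e1 e2)" using y by (simp add: Ein)
        then show ?thesis by (auto dest: set_zip_leftD)
      qed
    qed
  qed
  fix a b :: "nat list"
  assume *: "length a = length t1 \<and> length b = length e1 \<and> set a \<union> set b \<subseteq> {0, 1} \<and>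
    map ((!) a) j1 = map ((!) b) e"
  \<comment> \<open>A point reached from both \<open>t1\<close> and \<open>e1\<close> lies over
    \<open>s\<close>, so its partner in the domain of \<open>c2\<close> comes from
    \<open>t2\<close>. The two indices then match in the pullback \<open>j1\<close>,
    \<open>j2\<close>, where compatibility of \<open>a\<close> and \<open>b\<close> equates the
    values.\<close>
  have te: "a ! i = b ! j" if i: "i < length t1" and j: "j < length e1" and eq: "t1 ! i = e1 ! j" for i j
  proof -
    have in_s: "c1 ! (t1 ! i) \<in> set s" using nth_mem[OF i] by (simp add: t1(2))
    have c12: "c1 ! (t1 ! i) = c2 ! (e2 ! j)" and e2: "e2 ! j < length c2" using Enth[OF j] eq by simp_all
    then have "e2 ! j \<in> set t2" using in_s by (simp add: t2)
    then obtain i2 where i2: "i2 < length t2" "t2 ! i2 = e2 ! j" by (auto simp: in_set_conv_nth)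
    then have "s ! (c1' ! i) = s ! (c2' ! i2)" using c12 ct[OF i] ct2[of i2] by simp
    then have "c1' ! i = c2' ! i2"
      using s nth_in_range[OF c1'(2), of i] nth_in_range[OF c2'(2), of i2] i i2 len
      by (simp add: nth_eq_iff_index_eq)
    then have "(i, i2) \<in> set (zip j1 j2)" using i i2 len by (simp add: Jin)
    then obtain x where x: "x < length j1" "j1 ! x = i" "j2 ! x = i2" by (auto simp: set_zip)
    have xe: "x < length e" using x len by simp
    have "e1 ! (e ! x) = t1 ! (j1 ! x)" "e2 ! (e ! x) = t2 ! (j2 ! x)"
      using arg_cong[OF e(1), of "\<lambda>xs. xs ! x"] arg_cong[OF e(2), of "\<lambda>xs. xs ! x"] x xe J12 by simp_all
    then have "e ! x = j"
      using Einj[of "e ! x" j] nth_in_range[OF e(3) xe] j x eq i2 by simp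
    then show ?thesis
      using x xe * by (metis nth_map)
  qed
  have "\<exists>w. length w = length c1 \<and> map ((!) w) (t1 @ e1) = a @ b"
  proof (rule lift_along_covering[OF cover])
    show "length (a @ b) = length (t1 @ e1)" using * by simp
    fix i j
    assume i: "i < length (t1 @ e1)" and j: "j < length (t1 @ e1)" and eq: "(t1 @ e1) ! i = (t1 @ e1) ! j"
    define i' j' where "i' = i - length t1" and "j' = j - length t1"
    \<comment> \<open>For two indices with equal first projection: over \<open>s\<close> both values
      equal that of \<open>a\<close> at the same index of \<open>t1\<close>; off \<open>s\<close>
      injectivity of \<open>c2\<close> makes the second projections equal too, hence the
      indices.\<close>
    have ee: "b ! i' = b ! j'" if "i' < length e1" "j' < length e1" "e1 ! i' = e1 ! j'"
    proof (cases "c1 ! (e1 ! i') \<in> set s")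
      case True
      then have "e1 ! i' \<in> set t1" using Enth[OF that(1)] by (simp add: t1(2))
      then obtain x where "x < length t1" "t1 ! x = e1 ! i'" by (auto simp: in_set_conv_nth)
      then show ?thesis using te[of x i'] te[of x j'] that by simp
    next
      case False
      then have "e2 ! i' = e2 ! j'"
        using inj[of "e2 ! i'" "e2 ! j'"] Enth[OF that(1)] Enth[OF that(2)] that(3) by simp
      then show ?thesis using Einj[OF that] by simp
    qed
    show "(a @ b) ! i = (a @ b) ! j"
    proof (cases "i < length t1"; cases "j < length t1")
      assume ij: "i < length t1" "j < length t1"
      then have "i = j" using eq t1(1) by (simp add: nth_append nth_eq_iff_index_eq)
      then show ?thesis by simp
    next
      assume ij: "i < length t1" "\<not> j < length t1"
      then show ?thesis using te[of i j'] eq j * by (simp add: nth_append j'_def)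
    next
      assume ij: "\<not> i < length t1" "j < length t1"
      then show ?thesis using te[of j i'] eq i * by (simp add: nth_append i'_def)
    next
      assume ij: "\<not> i < length t1" "\<not> j < length t1"
      then show ?thesis using ee eq i j * by (simp add: nth_append i'_def j'_def)
    qed
  qed
  then obtain w where w: "length w = length c1" "map ((!) w) t1 @ map ((!) w) e1 = a @ b" by auto
  then have "map ((!) w) t1 = a" "map ((!) w) e1 = b"
    using * by (simp_all add: append_eq_append_conv)
  then show "\<exists>w. length w = length c1 \<and> map ((!) w) t1 = a \<and> map ((!) w) e1 = b"
    using w(1) by blast
qed

lemma subgraph_mono:
  assumes s: "s \<in> hmors S G" "distinct (fst s)" "distinct (snd s)"
    and u: "u \<in> hmors X S" and v: "v \<in> hmors X S" and eq: "u ;; s = v ;; s"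
  shows "u = v"
proof (rule prod_eqI)
  have "map ((!) (fst s)) (fst u) = map ((!) (fst s)) (fst v)" "map ((!) (snd s)) (snd u) = map ((!) (snd s)) (snd v)"
    using eq unfolding hcomp_def prod.inject by blast+
  then show "fst u = fst v" "snd u = snd v"
    using map_nth_distinct_inj[OF s(2), of "fst u" "fst v"] map_nth_distinct_inj[OF s(3), of "snd u" "snd v"]
      hmors_range[OF u] hmors_range[OF v] hmors_len[OF s(1)] by simp_all
qed

text \<open>The restricted context is the preimage of \<open>S\<close> under \<open>c\<close>, which
  is closed under incidence as \<open>S\<close> is. \<open>k\<close> factors through it because
  \<open>l ;; f = k ;; c\<close> lands in \<open>S\<close>.\<close>

lemma restrict_pushout:
  assumes po: "cpo K L C G l k f c" and h: "K \<in> hyp T" "L \<in> hyp T" "C \<in> hyp T" "G \<in> hyp T" "S \<in> hyp T"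
    and s: "s \<in> hmors S G" "distinct (fst s)" "distinct (snd s)"
    and f: "set (fst f) \<subseteq> set (fst s)" "set (snd f) \<subseteq> set (snd s)"
  obtains C' t c' f' k' where "C' \<in> hyp T" "t \<in> hmors C' C" "distinct (fst t)" "distinct (snd t)"
    "set (fst t) = {y. y < nv C \<and> fst c ! y \<in> set (fst s)}"
    "set (snd t) = {y. y < ne C \<and> snd c ! y \<in> set (snd s)}"
    "c' \<in> hmors C' S" "c' ;; s = t ;; c" "f' \<in> hmors L S" "f' ;; s = f" "k' \<in> hmors K C'" "k' ;; t = k"
    "cpo K L C' S l k' f' c'"
proof -
  note p = cpoD[OF po] and v = h[THEN hyp_valid]
  let ?V = "{y. y < nv C \<and> fst c ! y \<in> set (fst s)}" and ?E = "{y. y < ne C \<and> snd c ! y \<in> set (snd s)}"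
  have len: "length (fst c) = nv C" "length (snd c) = ne C" "length (fst f) = nv L" "length (snd f) = ne L"
    "length (fst s) = nv S" "length (snd s) = ne S"
    using hmors_len[OF p(4)] hmors_len[OF p(3)] hmors_len[OF s(1)] by simp_all
  have closed: "set (fst (snd (edg C ! e))) \<union> set (snd (snd (edg C ! e))) \<subseteq> ?V" if "e \<in> ?E" for e
  proof -
    have e: "e < ne C" "snd c ! e \<in> set (snd s)" using that by simp_all
    then obtain i where i: "i < ne S" "snd s ! i = snd c ! e" using len by (auto simp: in_set_conv_nth)
    have ein: "edge_in (nv C) (edg C ! e)" using v(3) e unfolding valid_def by simp
    have "act (fst c) (edg C ! e) = map ((!) (edg G)) (snd c) ! e"
      using p(4) e by (simp add: hmors_iff)
    also have "\<dots> = map ((!) (edg G)) (snd s) ! i" using e i len by simp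
    also have "\<dots> = act (fst s) (edg S ! i)" using s(1) i by (simp add: hmors_iff)
    finally have "act (fst c) (edg C ! e) = act (fst s) (edg S ! i)" .
    moreover have "edge_in (nv S) (edg S ! i)" using v(5) i unfolding valid_def by simp
    ultimately have "set (fst (snd (act (fst c) (edg C ! e)))) \<subseteq> set (fst s)"
      "set (snd (snd (act (fst c) (edg C ! e)))) \<subseteq> set (fst s)"
      using len unfolding edge_in_def act_def by auto
    then show ?thesis using ein unfolding edge_in_def act_def by auto
  qed
  obtain C' t where t: "C' \<in> hyp T" "t \<in> hmors C' C" "distinct (fst t)" "distinct (snd t)"
    "set (fst t) = ?V" "set (snd t) = ?E"
    using subgraph_exists[OF h(3), of ?V ?E] closed by auto
  have tc: "t ;; c \<in> hmors C' G" using hcomp_hmors[OF hyp_valid[OF t(1)] t(2) p(4)] .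
  have "set (fst (t ;; c)) \<subseteq> set (fst s)" "set (snd (t ;; c)) \<subseteq> set (snd s)"
    unfolding hcomp_def using t(5,6) by auto
  then obtain c' where c': "c' \<in> hmors C' S" "c' ;; s = t ;; c"
    using subgraph_lift[OF s hyp_valid[OF t(1)] v(5) tc] by blast
  obtain f' where f': "f' \<in> hmors L S" "f' ;; s = f"
    using subgraph_lift[OF s v(2) v(5) p(3) f] by blast
  have lf: "l ;; f = k ;; c" by (rule p(5))
  have "set (fst (k ;; c)) \<subseteq> set (fst s)" "set (snd (k ;; c)) \<subseteq> set (snd s)"
    unfolding lf[symmetric] using f hmors_range[OF p(1)] len by (auto simp: hcomp_def subset_iff)
  then have "set (fst k) \<subseteq> set (fst t)" "set (snd k) \<subseteq> set (snd t)"
    unfolding t(5,6) using hmors_range[OF p(2)] by (auto simp: hcomp_def)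
  then obtain k' where k': "k' \<in> hmors K C'" "k' ;; t = k"
    using subgraph_lift[OF t(2-4) v(1) hyp_valid[OF t(1)] p(2)] by blast
  have lent: "length (fst t) = nv C'" "length (snd t) = ne C'" using hmors_len[OF t(2)] by simp_all
  have "set_po (length (fst s)) (fst l) (fst k') (fst f') (fst c')"
    by (rule set_po_restrict[OF p(6) _ s(2) _ _ _ t(3)])
      (simp_all only: len lent hmors_range[OF p(1)] hmors_range[OF s(1)] hmors_range[OF f'(1)] hmors_range[OF c'(1)]
        hmors_range[OF k'(1)] t(5) fst_hcomp[symmetric] f'(2) c'(2) k'(2))
  moreover have "set_po (length (snd s)) (snd l) (snd k') (snd f') (snd c')"
    by (rule set_po_restrict[OF p(7) _ s(3) _ _ _ t(4)])
      (simp_all only: len lent hmors_range[OF p(1)] hmors_range[OF s(1)] hmors_range[OF f'(1)] hmors_range[OF c'(1)]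
        hmors_range[OF k'(1)] t(6) snd_hcomp[symmetric] f'(2) c'(2) k'(2))
  moreover have "l ;; f' = k' ;; c'"
  proof (rule subgraph_mono[OF s])
    show "l ;; f' \<in> hmors K S" "k' ;; c' \<in> hmors K S"
      using hcomp_hmors[OF v(1) p(1) f'(1)] hcomp_hmors[OF v(1) k'(1) c'(1)] .
    show "l ;; f' ;; s = k' ;; c' ;; s"
      using hcomp_assoc[OF p(1) f'(1), of s] hcomp_assoc[OF k'(1) c'(1), of s] hcomp_assoc[OF k'(1) t(2), of c]
        p(5) f'(2) c'(2) k'(2) by simp
  qed
  ultimately have "cpo K L C' S l k' f' c'"
    unfolding cpo_def using p(1) k' f' c' len by simp
  then show thesis using that[OF t c' f' k'] by blast
qed

text \<open>By commutativity the image of \<open>k\<close> is mapped into the image of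
  \<open>f\<close>, so a point lying over the complement of that image is missed by \<open>k\<close>
  and \<open>set_po_inj\<close> applies.\<close>

lemma set_po_off_image:
  assumes po: "set_po n l k f c" and k: "set k \<subseteq> {..<length c}" and l: "set l \<subseteq> {..<length f}"
    and comm: "map ((!) f) l = map ((!) c) k"
    and y: "y < length c" "y' < length c" "c ! y = c ! y'" "c ! y \<notin> set f"
  shows "y = y'"
proof (rule set_po_inj[OF po k _ l y(1-3)])
  show len: "length l = length k" using arg_cong[OF comm, of length] by simp
  show "y \<notin> set k"
  proof
    assume "y \<in> set k"
    then obtain i where i: "i < length k" "k ! i = y" by (auto simp: in_set_conv_nth)
    then have "f ! (l ! i) = c ! y" using arg_cong[OF comm, of "\<lambda>xs. xs ! i"] len by simp
    then have "c ! y \<in> set f" using nth_in_range[OF l, of i] i len by (metis nth_mem)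
    then show False using y(4) by simp
  qed
qed

lemma set_pb_swap: "set_pb j1 j2 c1 c2 \<Longrightarrow> set_pb j2 j1 c2 c1"
proof -
  assume pb: "set_pb j1 j2 c1 c2"
  have z: "zip j2 j1 = map prod.swap (zip j1 j2)" using zip_commute[of j2 j1] by (simp add: case_prod_beta' prod.swap_def)
  have len: "length j1 = length j2" and d: "distinct (zip j1 j2)"
    and st: "\<And>x y. (x, y) \<in> set (zip j1 j2) \<longleftrightarrow> x < length c1 \<and> y < length c2 \<and> c1 ! x = c2 ! y"
    using pb unfolding set_pb_def by simp_all
  have "(y, x) \<in> set (zip j2 j1) \<longleftrightarrow> (x, y) \<in> set (zip j1 j2)" for x y
    unfolding z set_map by force
  then have "set (zip j2 j1) = {(y, x). y < length c2 \<and> x < length c1 \<and> c2 ! y = c1 ! x}"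
    unfolding st by auto
  then show "set_pb j2 j1 c2 c1"
    unfolding set_pb_def using len d by (simp add: z distinct_map)
qed

text \<open>Collects everything the critical pair construction asks of left-hand sides and contexts.
  Results of steps do not occur, as they are glued on afterwards by pasting.\<close>

lemma overlap:
  assumes po1: "cpo K1 L1 C1 G l1 k1 f1 c1" and po2: "cpo K2 L2 C2 G l2 k2 f2 c2"
    and h1: "K1 \<in> hyp T" "L1 \<in> hyp T" "C1 \<in> hyp T" and h2: "K2 \<in> hyp T" "L2 \<in> hyp T" "C2 \<in> hyp T"
    and G: "G \<in> hyp T"
  obtains S f1' f2' C1' t1 c1' k1' C2' t2 c2' k2' J j1 j2 E e1 e2 e
  where "S \<in> hyp T" "C1' \<in> hyp T" "C2' \<in> hyp T" "J \<in> hyp T" "E \<in> hyp T"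
    "set (fst f1') \<union> set (fst f2') = {..<nv S}" "set (snd f1') \<union> set (snd f2') = {..<ne S}"
    "cpo K1 L1 C1' S l1 k1' f1' c1'" "t1 \<in> hmors C1' C1" "k1' ;; t1 = k1"
    "cpo K2 L2 C2' S l2 k2' f2' c2'" "t2 \<in> hmors C2' C2" "k2' ;; t2 = k2"
    "cpb J C1' C2' S j1 j2 c1' c2'" "cpb E C1 C2 G e1 e2 c1 c2"
    "cpo J C1' E C1 j1 e t1 e1" "cpo J C2' E C2 j2 e t2 e2"
proof -
  note p1 = cpoD[OF po1] and p2 = cpoD[OF po2]
  have closed: "set (fst (snd (edg G ! x))) \<union> set (snd (snd (edg G ! x))) \<subseteq> set (fst f)"
    if f: "f \<in> hmors L G" and L: "L \<in> hyp T" and x: "x \<in> set (snd f)" for f L x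
  proof -
    obtain i where i: "i < ne L" "snd f ! i = x" using x hmors_len[OF f] by (auto simp: in_set_conv_nth)
    have "edg G ! x = map ((!) (edg G)) (snd f) ! i" using i hmors_len[OF f] by simp
    also have "\<dots> = act (fst f) (edg L ! i)" using f i by (simp add: hmors_iff)
    finally have "edg G ! x = act (fst f) (edg L ! i)" .
    moreover have "edge_in (nv L) (edg L ! i)" using L i unfolding hyp_iff valid_def by simp
    ultimately show ?thesis using hmors_len[OF f] unfolding edge_in_def act_def by auto
  qed
  obtain S s where S: "S \<in> hyp T" and s: "s \<in> hmors S G" "distinct (fst s)" "distinct (snd s)"
    and sV: "set (fst s) = set (fst f1) \<union> set (fst f2)" and sE: "set (snd s) = set (snd f1) \<union> set (snd f2)"
  proof (rule subgraph_exists[OF G, of "set (fst f1) \<union> set (fst f2)" "set (snd f1) \<union> set (snd f2)"])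
    show "set (fst f1) \<union> set (fst f2) \<subseteq> {..<nv G}" "set (snd f1) \<union> set (snd f2) \<subseteq> {..<ne G}"
      using hmors_range[OF p1(3)] hmors_range[OF p2(3)] by simp_all
    show "set (fst (snd (edg G ! x))) \<union> set (snd (snd (edg G ! x))) \<subseteq> set (fst f1) \<union> set (fst f2)"
      if "x \<in> set (snd f1) \<union> set (snd f2)" for x
      using that closed[OF p1(3) h1(2)] closed[OF p2(3) h2(2)] by blast
  qed
  have sub: "set (fst f1) \<subseteq> set (fst s)" "set (snd f1) \<subseteq> set (snd s)"
    "set (fst f2) \<subseteq> set (fst s)" "set (snd f2) \<subseteq> set (snd s)"
    unfolding sV sE by blast+
  obtain C1' t1 c1' f1' k1' where 1: "C1' \<in> hyp T" "t1 \<in> hmors C1' C1" "distinct (fst t1)" "distinct (snd t1)"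
    "set (fst t1) = {y. y < nv C1 \<and> fst c1 ! y \<in> set (fst s)}"
    "set (snd t1) = {y. y < ne C1 \<and> snd c1 ! y \<in> set (snd s)}"
    "c1' \<in> hmors C1' S" "c1' ;; s = t1 ;; c1" "f1' \<in> hmors L1 S" "f1' ;; s = f1" "k1' \<in> hmors K1 C1'" "k1' ;; t1 = k1"
    "cpo K1 L1 C1' S l1 k1' f1' c1'"
    using restrict_pushout[OF po1 h1 G S s sub(1,2)] .
  obtain C2' t2 c2' f2' k2' where 2: "C2' \<in> hyp T" "t2 \<in> hmors C2' C2" "distinct (fst t2)" "distinct (snd t2)"
    "set (fst t2) = {y. y < nv C2 \<and> fst c2 ! y \<in> set (fst s)}"
    "set (snd t2) = {y. y < ne C2 \<and> snd c2 ! y \<in> set (snd s)}"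
    "c2' \<in> hmors C2' S" "c2' ;; s = t2 ;; c2" "f2' \<in> hmors L2 S" "f2' ;; s = f2" "k2' \<in> hmors K2 C2'" "k2' ;; t2 = k2"
    "cpo K2 L2 C2' S l2 k2' f2' c2'"
    using restrict_pushout[OF po2 h2 G S s sub(3,4)] .
  obtain J j1 j2 where J: "J \<in> hyp T" and Jpb: "cpb J C1' C2' S j1 j2 c1' c2'"
    using cpb_exists[OF 1(7) 2(7) 1(1) 2(1)] by blast
  obtain E e1 e2 where E: "E \<in> hyp T" and Epb: "cpb E C1 C2 G e1 e2 c1 c2"
    using cpb_exists[OF p1(4) p2(4) h1(3) h2(3)] by blast
  note j = cpbD[OF Jpb] and e' = cpbD[OF Epb]
  have "j1 ;; t1 ;; c1 = j2 ;; t2 ;; c2"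
    using hcomp_assoc[OF j(1) 1(2), of c1] hcomp_assoc[OF j(2) 2(2), of c2]
      hcomp_assoc[OF j(1) 1(7), of s] hcomp_assoc[OF j(2) 2(7), of s] 1(8) 2(8) j(5) by simp
  then obtain e where e: "e \<in> hmors J E" "e ;; e1 = j1 ;; t1" "e ;; e2 = j2 ;; t2"
    using cpb_lift[OF Epb hyp_valid[OF J] hyp_valid[OF E]
        hcomp_hmors[OF hyp_valid[OF J] j(1) 1(2)] hcomp_hmors[OF hyp_valid[OF J] j(2) 2(2)]] by blast
  have len: "length (fst c1) = nv C1" "length (snd c1) = ne C1" "length (fst c2) = nv C2" "length (snd c2) = ne C2"
    "length (fst s) = nv S" "length (snd s) = ne S" "length (fst e1) = nv E" "length (snd e1) = ne E"
    "length (fst e2) = nv E" "length (snd e2) = ne E"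
    "length (fst f1) = nv L1" "length (snd f1) = ne L1" "length (fst f2) = nv L2" "length (snd f2) = ne L2"
    using hmors_len[OF p1(4)] hmors_len[OF p2(4)] hmors_len[OF s(1)] hmors_len[OF e'(1)] hmors_len[OF e'(2)]
      hmors_len[OF p1(3)] hmors_len[OF p2(3)] by simp_all
  have other: "\<exists>y' < length d. d ! y' = z" if "set_po n l k f d" "z < n" "z \<notin> set f" for n l k f d z
  proof -
    have "z \<in> set (f @ d)" using that unfolding set_po_def by simp
    then show ?thesis using that(3) by (auto simp: in_set_conv_nth)
  qed
  have comm: "map ((!) (fst f1)) (fst l1) = map ((!) (fst c1)) (fst k1)"
    "map ((!) (snd f1)) (snd l1) = map ((!) (snd c1)) (snd k1)"
    "map ((!) (fst f2)) (fst l2) = map ((!) (fst c2)) (fst k2)"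
    "map ((!) (snd f2)) (snd l2) = map ((!) (snd c2)) (snd k2)"
    using p1(5) p2(5) unfolding hcomp_def prod.inject by blast+
  have rng: "fst c1 ! y < nv G" if "y < nv C1" for y
    using nth_in_range[OF hmors_range(1)[OF p1(4)]] that len by simp
  have rngE: "snd c1 ! y < ne G" if "y < ne C1" for y
    using nth_in_range[OF hmors_range(2)[OF p1(4)]] that len by simp
  have rng2: "fst c2 ! y < nv G" if "y < nv C2" for y
    using nth_in_range[OF hmors_range(1)[OF p2(4)]] that len by simp
  have rng2E: "snd c2 ! y < ne G" if "y < ne C2" for y
    using nth_in_range[OF hmors_range(2)[OF p2(4)]] that len by simp
  have r: "set (fst k1) \<subseteq> {..<length (fst c1)}" "set (fst l1) \<subseteq> {..<length (fst f1)}"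
    "set (snd k1) \<subseteq> {..<length (snd c1)}" "set (snd l1) \<subseteq> {..<length (snd f1)}"
    "set (fst k2) \<subseteq> {..<length (fst c2)}" "set (fst l2) \<subseteq> {..<length (fst f2)}"
    "set (snd k2) \<subseteq> {..<length (snd c2)}" "set (snd l2) \<subseteq> {..<length (snd f2)}"
    unfolding len using hmors_range[OF p1(1)] hmors_range[OF p1(2)] hmors_range[OF p2(1)] hmors_range[OF p2(2)]
    by simp_all
  have t: "set (fst t1) = {y. y < length (fst c1) \<and> fst c1 ! y \<in> set (fst s)}"
    "set (snd t1) = {y. y < length (snd c1) \<and> snd c1 ! y \<in> set (snd s)}"
    "set (fst t2) = {y. y < length (fst c2) \<and> fst c2 ! y \<in> set (fst s)}"
    "set (snd t2) = {y. y < length (snd c2) \<and> snd c2 ! y \<in> set (snd s)}"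
    unfolding len by (fact 1(5,6) 2(5,6))+
  have m: "map ((!) (fst c1)) (fst t1) = map ((!) (fst s)) (fst c1')" "map ((!) (snd c1)) (snd t1) = map ((!) (snd s)) (snd c1')"
    "map ((!) (fst c2)) (fst t2) = map ((!) (fst s)) (fst c2')" "map ((!) (snd c2)) (snd t2) = map ((!) (snd s)) (snd c2')"
    using 1(8) 2(8) unfolding hcomp_def prod.inject by simp_all
  have c': "set (fst c1') \<subseteq> {..<length (fst s)}" "set (snd c1') \<subseteq> {..<length (snd s)}"
    "set (fst c2') \<subseteq> {..<length (fst s)}" "set (snd c2') \<subseteq> {..<length (snd s)}"
    unfolding len using hmors_range[OF 1(7)] hmors_range[OF 2(7)] by simp_all
  have em: "map ((!) (fst e1)) (fst e) = map ((!) (fst t1)) (fst j1)" "map ((!) (snd e1)) (snd e) = map ((!) (snd t1)) (snd j1)"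
    "map ((!) (fst e2)) (fst e) = map ((!) (fst t2)) (fst j2)" "map ((!) (snd e2)) (snd e) = map ((!) (snd t2)) (snd j2)"
    using e(2,3) unfolding hcomp_def prod.inject by simp_all
  have er: "set (fst e) \<subseteq> {..<length (fst e1)}" "set (snd e) \<subseteq> {..<length (snd e1)}"
    "set (fst e) \<subseteq> {..<length (fst e2)}" "set (snd e) \<subseteq> {..<length (snd e2)}"
    unfolding len using hmors_range[OF e(1)] by simp_all
  have "set_po (length (fst c1)) (fst j1) (fst e) (fst t1) (fst e1)"
  proof (rule set_po_context[OF s(2) 1(3) t(1,3) m(1) c'(1) m(3) c'(3) e'(6) j(6) em(1,3) er(1)])
    show "\<exists>y' < length (fst c2). fst c2 ! y' = fst c1 ! y" if "y < length (fst c1)" "fst c1 ! y \<notin> set (fst s)" for y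
      using other[OF p2(6) rng, of y] that sub(3) unfolding len by blast
    show "y = y'" if "y < length (fst c2)" "y' < length (fst c2)" "fst c2 ! y = fst c2 ! y'" "fst c2 ! y \<notin> set (fst s)" for y y'
      using set_po_off_image[OF p2(6) r(5,6) comm(3) that(1-3)] that(4) sub by blast
  qed
  moreover have "set_po (length (snd c1)) (snd j1) (snd e) (snd t1) (snd e1)"
  proof (rule set_po_context[OF s(3) 1(4) t(2,4) m(2) c'(2) m(4) c'(4) e'(7) j(7) em(2,4) er(2)])
    show "\<exists>y' < length (snd c2). snd c2 ! y' = snd c1 ! y" if "y < length (snd c1)" "snd c1 ! y \<notin> set (snd s)" for y
      using other[OF p2(7) rngE, of y] that sub(4) unfolding len by blast
    show "y = y'" if "y < length (snd c2)" "y' < length (snd c2)" "snd c2 ! y = snd c2 ! y'" "snd c2 ! y \<notin> set (snd s)" for y y'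
      using set_po_off_image[OF p2(7) r(7,8) comm(4) that(1-3)] that(4) sub by blast
  qed
  ultimately have po1': "cpo J C1' E C1 j1 e t1 e1"
    unfolding cpo_def using j(1) e 1(2) e'(1) by (simp add: len)
  have "set_po (length (fst c2)) (fst j2) (fst e) (fst t2) (fst e2)"
  proof (rule set_po_context[OF s(2) 2(3) t(3,1) m(3) c'(3) m(1) c'(1) set_pb_swap[OF e'(6)] set_pb_swap[OF j(6)] em(3,1) er(3)])
    show "\<exists>y' < length (fst c1). fst c1 ! y' = fst c2 ! y" if "y < length (fst c2)" "fst c2 ! y \<notin> set (fst s)" for y
      using other[OF p1(6) rng2, of y] that sub(1) unfolding len by blast
    show "y = y'" if "y < length (fst c1)" "y' < length (fst c1)" "fst c1 ! y = fst c1 ! y'" "fst c1 ! y \<notin> set (fst s)" for y y'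
      using set_po_off_image[OF p1(6) r(1,2) comm(1) that(1-3)] that(4) sub by blast
  qed
  moreover have "set_po (length (snd c2)) (snd j2) (snd e) (snd t2) (snd e2)"
  proof (rule set_po_context[OF s(3) 2(4) t(4,2) m(4) c'(4) m(2) c'(2) set_pb_swap[OF e'(7)] set_pb_swap[OF j(7)] em(4,2) er(4)])
    show "\<exists>y' < length (snd c1). snd c1 ! y' = snd c2 ! y" if "y < length (snd c2)" "snd c2 ! y \<notin> set (snd s)" for y
      using other[OF p1(7) rng2E, of y] that sub(2) unfolding len by blast
    show "y = y'" if "y < length (snd c1)" "y' < length (snd c1)" "snd c1 ! y = snd c1 ! y'" "snd c1 ! y \<notin> set (snd s)" for y y'
      using set_po_off_image[OF p1(7) r(3,4) comm(2) that(1-3)] that(4) sub by blast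
  qed
  ultimately have po2': "cpo J C2' E C2 j2 e t2 e2"
    unfolding cpo_def using j(2) e 2(2) e'(2) by (simp add: len)
  \<comment> \<open>Joint surjectivity onto \<open>S\<close> is read off after the injective
    \<open>s\<close>, whose image was chosen as the union of the images of the two matches.\<close>
  have img: "(!) (fst s) ` (set (fst f1') \<union> set (fst f2')) = (!) (fst s) ` {..<nv S}"
    "(!) (snd s) ` (set (snd f1') \<union> set (snd f2')) = (!) (snd s) ` {..<ne S}"
  proof -
    have "set (fst s) = set (fst (f1' ;; s)) \<union> set (fst (f2' ;; s))"
      "set (snd s) = set (snd (f1' ;; s)) \<union> set (snd (f2' ;; s))"
      unfolding 1(10) 2(10) sV sE by simp_all
    moreover have "set (fst s) = (!) (fst s) ` {..<nv S}" "set (snd s) = (!) (snd s) ` {..<ne S}"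
      unfolding len(5,6)[symmetric] by (auto simp: set_conv_nth)
    ultimately show "(!) (fst s) ` (set (fst f1') \<union> set (fst f2')) = (!) (fst s) ` {..<nv S}"
      "(!) (snd s) ` (set (snd f1') \<union> set (snd f2')) = (!) (snd s) ` {..<ne S}"
      unfolding fst_hcomp snd_hcomp set_map image_Un by simp_all
  qed
  have injs: "inj_on ((!) (fst s)) {..<nv S}" "inj_on ((!) (snd s)) {..<ne S}"
    using s len by (auto simp: inj_on_def nth_eq_iff_index_eq)
  have "set (fst f1') \<union> set (fst f2') = {..<nv S}" "set (snd f1') \<union> set (snd f2') = {..<ne S}"
    using inj_on_image_eq_iff[OF injs(1) _ subset_refl, THEN iffD1, OF _ img(1)]
      inj_on_image_eq_iff[OF injs(2) _ subset_refl, THEN iffD1, OF _ img(2)]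
      hmors_range[OF 1(9)] hmors_range[OF 2(9)] by simp_all
  then show thesis
    using that[OF S 1(1) 2(1) J E _ _ 1(13) 1(2) 1(12) 2(13) 2(2) 2(12) Jpb Epb po1' po2'] by blast
qed

section \<open>Extension of rewriting along an interface\<close>

lemma is_stepD:
  assumes "is_step T I X \<sigma> Y"
  obtains L K R l r f h D k q g g' where "\<sigma> = Step (Rule L K R l r) f h D k q g g'"
    "X \<in> iobjs T I" "Y \<in> iobjs T I" "D \<in> hyp T" "q \<in> hmors I D"
    "pushout T K L D (fst X) l k f g" "pushout T K R D (fst Y) r k h g'"
    "snd X = q ;; g" "snd Y = q ;; g'"
  using assms unfolding is_step_def
  by (cases X; cases Y; cases \<sigma>; cases "srule \<sigma>") auto

lemma is_stepI:
  assumes "X \<in> iobjs T I" "Y \<in> iobjs T I" "D \<in> hyp T" "q \<in> hmors I D"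
    "pushout T K L D (fst X) l k f g" "pushout T K R D (fst Y) r k h g'"
    "snd X = q ;; g" "snd Y = q ;; g'"
  shows "is_step T I X (Step (Rule L K R l r) f h D k q g g') Y"
  using assms unfolding is_step_def by (cases X; cases Y) simp

text \<open>\<open>X'\<close> is \<open>X\<close> plugged into a context \<open>E\<close> along
  \<open>J\<close>, seen from a new interface \<open>i : I -> E\<close>. A relation is used because
  the pushout is determined only up to isomorphism.\<close>

definition extends :: "('c, 'o) monoidal_theory \<Rightarrow> ('c, 'o) hgraph \<Rightarrow> ('c, 'o) hgraph \<Rightarrow> hmor \<Rightarrow> hmor \<Rightarrow>
    ('c, 'o) iobj \<Rightarrow> ('c, 'o) iobj \<Rightarrow> bool" where
  "extends T J E e i X X' \<longleftrightarrow> fst X' \<in> hyp T \<and>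
     (\<exists>\<gamma> \<epsilon>. pushout T J (fst X) E (fst X') (snd X) e \<gamma> \<epsilon> \<and> snd X' = i ;; \<epsilon>)"

lemma extends_exists:
  assumes "X \<in> iobjs T J" "e \<in> hmors J E" "J \<in> hyp T" "E \<in> hyp T"
  shows "\<exists>X'. extends T J E e i X X'"
proof -
  have X: "fst X \<in> hyp T" "snd X \<in> hmors J (fst X)"
    using assms(1) by (auto simp: iobjs_def)
  obtain G f d where "G \<in> hyp T" "pushout T J (fst X) E G (snd X) e f d"
    using pushout_exists[OF X(2) assms(2,3) X(1) assms(4)] .
  then show ?thesis
    unfolding extends_def by (intro exI[of _ "(G, i ;; d)"]) (simp only: fst_conv snd_conv, blast)
qed

lemma extends_iobj:
  assumes "extends T J E e i X X'" "i \<in> hmors I E" "I \<in> hyp T"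
  shows "X' \<in> iobjs T I"
  using assms hcomp_hmors[OF hyp_valid[OF assms(3)] assms(2)]
  unfolding extends_def iobjs_def by (cases X') (auto dest: pushoutD)

text \<open>Cancelling the square of \<open>D'\<close> against that of \<open>G'\<close> makes the
  square on \<open>\<delta>\<close> and \<open>g\<close> a pushout, and pasting it to the rewriting
  square extends the match.\<close>

lemma extend_pushout:
  assumes po: "pushout T K L D G l k f g" and q: "q \<in> hmors J D"
    and D': "pushout T J D E D' q e \<delta> \<epsilon>" and G': "pushout T J G E G' (q ;; g) e \<gamma> \<epsilon>'"
    and h: "K \<in> hyp T" "L \<in> hyp T" "D \<in> hyp T" "G \<in> hyp T" "J \<in> hyp T" "E \<in> hyp T" "D' \<in> hyp T" "G' \<in> hyp T"
  obtains u where "u \<in> hmors D' G'" "\<epsilon> ;; u = \<epsilon>'" "pushout T K L D' G' l (k ;; \<delta>) (f ;; \<gamma>) u"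
    "\<delta> ;; u = g ;; \<gamma>"
proof -
  note p = pushoutD[OF po] and d = pushoutD[OF D'] and g = pushoutD[OF G']
  have "g ;; \<gamma> \<in> hmors D G'" using hcomp_hmors[OF hyp_valid[OF h(3)] p(4) g(3)] .
  moreover have "q ;; (g ;; \<gamma>) = e ;; \<epsilon>'" using g(5) hcomp_assoc[OF q p(4)] by simp
  ultimately obtain u where u: "u \<in> hmors D' G'" "\<delta> ;; u = g ;; \<gamma>" "\<epsilon> ;; u = \<epsilon>'"
    using pushout_lift[OF D' h(8) _ g(4)] by blast
  have "pushout T D D' G G' \<delta> g u \<gamma>"
    by (rule pushout_cancel[OF pushout_swap[OF D'] pushout_swap[OF G'] p(4) u(1,3,2) h(5,6,3,7,4,8)])
  then have "pushout T K L D' G' l (k ;; \<delta>) (f ;; \<gamma>) u"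
    by (rule pushout_paste[OF po pushout_swap h(1-4,7,8)])
  then show thesis using that u by blast
qed

text \<open>The two squares of a step share the context \<open>D\<close>, so the single pushout
  \<open>D'\<close> of \<open>D\<close> along \<open>e\<close> serves for both.\<close>

lemma step_extend:
  assumes st: "is_step T J X \<sigma> Y" and wf: "wf_rule T \<I> (srule \<sigma>)"
    and X': "extends T J E e i X X'" and Y': "extends T J E e i Y Y'"
    and h: "J \<in> hyp T" "E \<in> hyp T" "I \<in> hyp T" and e: "e \<in> hmors J E" and i: "i \<in> hmors I E"
  shows "\<exists>\<sigma>'. srule \<sigma>' = srule \<sigma> \<and> is_step T I X' \<sigma>' Y'"
proof -
  obtain L K R l r f hh D k q g g' where \<sigma>: "\<sigma> = Step (Rule L K R l r) f hh D k q g g'"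
    and st': "X \<in> iobjs T J" "Y \<in> iobjs T J" "D \<in> hyp T" "q \<in> hmors J D"
    "pushout T K L D (fst X) l k f g" "pushout T K R D (fst Y) r k hh g'"
    "snd X = q ;; g" "snd Y = q ;; g'"
    using is_stepD[OF st] .
  have XY: "fst X \<in> hyp T" "fst Y \<in> hyp T" using st'(1,2) by (auto simp: iobjs_def)
  have rule: "L \<in> hyp T" "K \<in> hyp T" "R \<in> hyp T" using wf by (auto simp: wf_rule_def \<sigma>)
  obtain \<gamma> \<epsilon> where \<gamma>: "fst X' \<in> hyp T" "pushout T J (fst X) E (fst X') (q ;; g) e \<gamma> \<epsilon>" "snd X' = i ;; \<epsilon>"
    using X' unfolding extends_def st'(7) by blast
  obtain \<gamma>' \<epsilon>' where \<gamma>': "fst Y' \<in> hyp T" "pushout T J (fst Y) E (fst Y') (q ;; g') e \<gamma>' \<epsilon>'" "snd Y' = i ;; \<epsilon>'"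
    using Y' unfolding extends_def st'(8) by blast
  obtain D' \<delta> \<zeta> where D': "D' \<in> hyp T" "pushout T J D E D' q e \<delta> \<zeta>"
    using pushout_exists[OF st'(4) e h(1) st'(3) h(2)] .
  note d = pushoutD[OF D'(2)]
  obtain u where u: "u \<in> hmors D' (fst X')" "\<zeta> ;; u = \<epsilon>" "pushout T K L D' (fst X') l (k ;; \<delta>) (f ;; \<gamma>) u"
    using extend_pushout[OF st'(5,4) D'(2) \<gamma>(2) rule(2,1) st'(3) XY(1) h(1,2) D'(1) \<gamma>(1)] .
  obtain u' where u': "u' \<in> hmors D' (fst Y')" "\<zeta> ;; u' = \<epsilon>'" "pushout T K R D' (fst Y') r (k ;; \<delta>) (hh ;; \<gamma>') u'"
    using extend_pushout[OF st'(6,4) D'(2) \<gamma>'(2) rule(2,3) st'(3) XY(2) h(1,2) D'(1) \<gamma>'(1)] .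
  have "is_step T I X' (Step (Rule L K R l r) (f ;; \<gamma>) (hh ;; \<gamma>') D' (k ;; \<delta>) (i ;; \<zeta>) u u') Y'"
  proof (rule is_stepI)
    show "X' \<in> iobjs T I" "Y' \<in> iobjs T I"
      using extends_iobj[OF X' i h(3)] extends_iobj[OF Y' i h(3)] .
    show "i ;; \<zeta> \<in> hmors I D'" using hcomp_hmors[OF hyp_valid[OF h(3)] i d(4)] .
    show "snd X' = i ;; \<zeta> ;; u" "snd Y' = i ;; \<zeta> ;; u'"
      using hcomp_assoc[OF i d(4)] u(2) u'(2) \<gamma>(3) \<gamma>'(3) by simp_all
  qed (fact D'(1) u(3) u'(3))+
  then show ?thesis by (intro exI conjI) (auto simp: \<sigma>)
qed

text \<open>The mediating maps between the two pushouts are mutually inverse by uniqueness, and they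
  fix \<open>E\<close>, through which the new interface is mapped.\<close>

lemma iso_extend:
  assumes iso: "iobj_iso T J X Y" and X': "extends T J E e i X X'" and Y': "extends T J E e i Y Y'"
    and h: "J \<in> hyp T" "E \<in> hyp T" "I \<in> hyp T" and e: "e \<in> hmors J E" and i: "i \<in> hmors I E"
  shows "iobj_iso T I X' Y'"
proof -
  obtain u v where u: "u \<in> hmors (fst X) (fst Y)" "v \<in> hmors (fst Y) (fst X)" "u ;; v = hid (fst X)"
    "v ;; u = hid (fst Y)" "snd X ;; u = snd Y" and XY: "X \<in> iobjs T J" "Y \<in> iobjs T J"
    using iso unfolding iobj_iso_def by blast
  have hX: "fst X \<in> hyp T" "snd X \<in> hmors J (fst X)" "fst Y \<in> hyp T"
    using XY by (auto simp: iobjs_def)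
  obtain \<gamma> \<epsilon> where \<gamma>: "fst X' \<in> hyp T" "pushout T J (fst X) E (fst X') (snd X) e \<gamma> \<epsilon>" "snd X' = i ;; \<epsilon>"
    using X' unfolding extends_def by blast
  obtain \<gamma>' \<epsilon>' where \<gamma>': "fst Y' \<in> hyp T" "pushout T J (fst Y) E (fst Y') (snd Y) e \<gamma>' \<epsilon>'" "snd Y' = i ;; \<epsilon>'"
    using Y' unfolding extends_def by blast
  note p = pushoutD[OF \<gamma>(2)] and p' = pushoutD[OF \<gamma>'(2)]
  have v: "valid (fst X)" "valid (fst Y)" using hX hyp_valid by auto
  have snd: "snd Y ;; v = snd X"
    using hcomp_assoc[OF hX(2) u(1), of v] u(3,5) hcomp_hid_right[OF hX(2)] by simp
  have c1: "u ;; \<gamma>' \<in> hmors (fst X) (fst Y')" "snd X ;; (u ;; \<gamma>') = e ;; \<epsilon>'"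
    using hcomp_hmors[OF v(1) u(1) p'(3)] hcomp_assoc[OF hX(2) u(1), of \<gamma>'] u(5) p'(5) by simp_all
  obtain a where a: "a \<in> hmors (fst X') (fst Y')" "\<gamma> ;; a = u ;; \<gamma>'" "\<epsilon> ;; a = \<epsilon>'"
    using pushout_lift[OF \<gamma>(2) \<gamma>'(1) c1(1) p'(4) c1(2)] .
  have c2: "v ;; \<gamma> \<in> hmors (fst Y) (fst X')" "snd Y ;; (v ;; \<gamma>) = e ;; \<epsilon>"
    using hcomp_hmors[OF v(2) u(2) p(3)] hcomp_assoc[OF p'(1) u(2), of \<gamma>] snd p(5) by simp_all
  obtain b where b: "b \<in> hmors (fst Y') (fst X')" "\<gamma>' ;; b = v ;; \<gamma>" "\<epsilon>' ;; b = \<epsilon>"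
    using pushout_lift[OF \<gamma>'(2) \<gamma>(1) c2(1) p(4) c2(2)] .
  have "a ;; b = hid (fst X')"
  proof (rule pushout_unique[OF \<gamma>(2) h(1) hX(1) h(2) \<gamma>(1)])
    show "a ;; b \<in> hmors (fst X') (fst X')" "hid (fst X') \<in> hmors (fst X') (fst X')"
      using hcomp_hmors[OF hyp_valid[OF \<gamma>(1)] a(1) b(1)] hid_hmors[OF hyp_valid[OF \<gamma>(1)]] .
    show "\<gamma> ;; (a ;; b) = \<gamma> ;; hid (fst X')"
      using hcomp_assoc[OF p(3) a(1), of b] hcomp_assoc[OF u(1) p'(3), of b] hcomp_assoc[OF u(1,2), of \<gamma>]
        a(2) b(2) u(3) hcomp_hid_left[OF p(3)] hcomp_hid_right[OF p(3)] by simp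
    show "\<epsilon> ;; (a ;; b) = \<epsilon> ;; hid (fst X')"
      using hcomp_assoc[OF p(4) a(1), of b] a(3) b(3) hcomp_hid_right[OF p(4)] by simp
  qed
  moreover have "b ;; a = hid (fst Y')"
  proof (rule pushout_unique[OF \<gamma>'(2) h(1) hX(3) h(2) \<gamma>'(1)])
    show "b ;; a \<in> hmors (fst Y') (fst Y')" "hid (fst Y') \<in> hmors (fst Y') (fst Y')"
      using hcomp_hmors[OF hyp_valid[OF \<gamma>'(1)] b(1) a(1)] hid_hmors[OF hyp_valid[OF \<gamma>'(1)]] .
    show "\<gamma>' ;; (b ;; a) = \<gamma>' ;; hid (fst Y')"
      using hcomp_assoc[OF p'(3) b(1), of a] hcomp_assoc[OF u(2) p(3), of a] hcomp_assoc[OF u(2,1), of \<gamma>']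
        a(2) b(2) u(4) hcomp_hid_left[OF p'(3)] hcomp_hid_right[OF p'(3)] by simp
    show "\<epsilon>' ;; (b ;; a) = \<epsilon>' ;; hid (fst Y')"
      using hcomp_assoc[OF p'(4) b(1), of a] a(3) b(3) hcomp_hid_right[OF p'(4)] by simp
  qed
  moreover have "snd X' ;; a = snd Y'"
    unfolding \<gamma>(3) \<gamma>'(3) using hcomp_assoc[OF i p(4), of a] a(3) by simp
  ultimately show ?thesis
    unfolding iobj_iso_def using extends_iobj[OF X' i h(3)] extends_iobj[OF Y' i h(3)] a(1) b(1) by blast
qed

section \<open>Isomorphism of objects with interface, and reduction sequences\<close>

lemma iobj_iso_refl: "X \<in> iobjs T I \<Longrightarrow> iobj_iso T I X X"
proof -
  assume X: "X \<in> iobjs T I"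
  then have "hid (fst X) \<in> hmors (fst X) (fst X)" "snd X \<in> hmors I (fst X)"
    by (auto simp: iobjs_def hid_hmors hyp_valid)
  then show ?thesis
    unfolding iobj_iso_def using X hcomp_hid_left hcomp_hid_right by blast
qed

lemma iobj_iso_sym: "iobj_iso T I X Y \<Longrightarrow> iobj_iso T I Y X"
proof -
  assume "iobj_iso T I X Y"
  then obtain u v where u: "X \<in> iobjs T I" "Y \<in> iobjs T I" "u \<in> hmors (fst X) (fst Y)" "v \<in> hmors (fst Y) (fst X)"
    "u ;; v = hid (fst X)" "v ;; u = hid (fst Y)" "snd X ;; u = snd Y"
    unfolding iobj_iso_def by blast
  have sX: "snd X \<in> hmors I (fst X)" using u(1) by (auto simp: iobjs_def)
  have "snd Y ;; v = snd X"
    using hcomp_assoc[OF sX u(3), of v] u(5,7) hcomp_hid_right[OF sX] by simp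
  then show ?thesis unfolding iobj_iso_def using u by blast
qed

lemma iobj_iso_trans: "iobj_iso T I X Y \<Longrightarrow> iobj_iso T I Y Z \<Longrightarrow> iobj_iso T I X Z"
proof -
  assume "iobj_iso T I X Y" "iobj_iso T I Y Z"
  then obtain u v u' v' where u: "X \<in> iobjs T I" "Y \<in> iobjs T I" "u \<in> hmors (fst X) (fst Y)" "v \<in> hmors (fst Y) (fst X)"
    "u ;; v = hid (fst X)" "v ;; u = hid (fst Y)" "snd X ;; u = snd Y"
    and u': "Z \<in> iobjs T I" "u' \<in> hmors (fst Y) (fst Z)" "v' \<in> hmors (fst Z) (fst Y)"
    "u' ;; v' = hid (fst Y)" "v' ;; u' = hid (fst Z)" "snd Y ;; u' = snd Z"
    unfolding iobj_iso_def by blast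
  have v: "valid (fst X)" "valid (fst Z)" and sX: "snd X \<in> hmors I (fst X)"
    using u(1) u'(1) by (auto simp: iobjs_def hyp_valid)
  have "u ;; u' ;; (v' ;; v) = hid (fst X)"
    using hcomp_assoc[OF u(3) u'(2), of "v' ;; v"] hcomp_assoc[OF u'(2,3), of v] u'(4) u(5) hcomp_hid_left[OF u(4)] by simp
  moreover have "v' ;; v ;; (u ;; u') = hid (fst Z)"
    using hcomp_assoc[OF u'(3) u(4), of "u ;; u'"] hcomp_assoc[OF u(4,3), of u'] u(6) u'(5) hcomp_hid_left[OF u'(2)] by simp
  moreover have "snd X ;; (u ;; u') = snd Z"
    using hcomp_assoc[OF sX u(3), of u'] u(7) u'(6) by simp
  ultimately show ?thesis
    unfolding iobj_iso_def using u(1) u'(1) hcomp_hmors[OF v(1) u(3) u'(2)] hcomp_hmors[OF v(2) u'(3) u(4)] by blast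
qed

text \<open>Lets an isomorphism be absorbed into a following step, as Newman's lemma modulo
  isomorphism demands: the match and the map from the context to the source are composed with
  it.\<close>

lemma iso_reduces:
  assumes iso: "iobj_iso T I X X'" and red: "reduces T \<R> I X' Y" and sys: "dpoi_system T \<I> \<R>"
  shows "reduces T \<R> I X Y"
proof -
  obtain u v where u: "X' \<in> iobjs T I" "X \<in> iobjs T I" "u \<in> hmors (fst X') (fst X)" "v \<in> hmors (fst X) (fst X')"
    "u ;; v = hid (fst X')" "v ;; u = hid (fst X)" "snd X' ;; u = snd X"
    using iobj_iso_sym[OF iso] unfolding iobj_iso_def by blast
  obtain \<sigma> where \<sigma>: "srule \<sigma> \<in> \<R>" "is_step T I X' \<sigma> Y"
    using red unfolding reduces_def by blast
  obtain L K R l r f hh D k q g g' where s: "\<sigma> = Step (Rule L K R l r) f hh D k q g g'"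
    and st: "X' \<in> iobjs T I" "Y \<in> iobjs T I" "D \<in> hyp T" "q \<in> hmors I D"
    "pushout T K L D (fst X') l k f g" "pushout T K R D (fst Y) r k hh g'"
    "snd X' = q ;; g" "snd Y = q ;; g'"
    using is_stepD[OF \<sigma>(2)] .
  have "wf_rule T \<I> (srule \<sigma>)" using sys \<sigma>(1) by (simp add: dpoi_system_def)
  then have rule: "K \<in> hyp T" "L \<in> hyp T" by (auto simp: wf_rule_def s)
  have hX: "fst X' \<in> hyp T" "fst X \<in> hyp T" using u by (auto simp: iobjs_def)
  have "is_step T I X (Step (Rule L K R l r) (f ;; u) hh D k q (g ;; u) g') Y"
  proof (rule is_stepI)
    show "pushout T K L D (fst X) l k (f ;; u) (g ;; u)"
      by (rule pushout_iso[OF st(5) u(3-6) rule st(3) hX])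
    show "snd X = q ;; (g ;; u)"
      using u(7) st(7) hcomp_assoc[OF st(4) pushoutD(4)[OF st(5)]] by simp
  qed (fact u st)+
  then show ?thesis unfolding reduces_def using \<sigma>(1) s by (metis dpoi_step.sel(1))
qed

lemma reduces_iobjs: "reduces T \<R> I X Y \<Longrightarrow> X \<in> iobjs T I \<and> Y \<in> iobjs T I"
  unfolding reduces_def is_step_def by auto

lemma reduces_star_iobjs: "reduces_star T \<R> I X Y \<Longrightarrow> X \<in> iobjs T I \<Longrightarrow> Y \<in> iobjs T I"
  unfolding reduces_star_def
  by (induction rule: rtranclp_induct) (auto dest: reduces_iobjs simp: iobj_iso_def)

lemma reduces_star_trans: "reduces_star T \<R> I X Y \<Longrightarrow> reduces_star T \<R> I Y Z \<Longrightarrow> reduces_star T \<R> I X Z"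
  unfolding reduces_star_def by (rule rtranclp_trans)

lemma reduces_star_step: "reduces T \<R> I X Y \<Longrightarrow> reduces_star T \<R> I X Y"
  and reduces_star_iso: "iobj_iso T I X Y \<Longrightarrow> reduces_star T \<R> I X Y"
  and reduces_star_refl: "reduces_star T \<R> I X X"
  unfolding reduces_star_def by (auto intro: r_into_rtranclp)

text \<open>Even the empty sequence yields only an isomorphism between \<open>X'\<close> and
  \<open>Y'\<close>, since two extensions of one object may differ by one. Each intermediate object
  is given an extension of its own.\<close>

lemma reduces_star_extend:
  assumes star: "reduces_star T \<R> J X Y" and sys: "dpoi_system T \<I> \<R>"
    and X: "X \<in> iobjs T J" and X': "extends T J E e i X X'" and Y': "extends T J E e i Y Y'"
    and h: "J \<in> hyp T" "E \<in> hyp T" "I \<in> hyp T" and e: "e \<in> hmors J E" and i: "i \<in> hmors I E"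
  shows "reduces_star T \<R> I X' Y'"
  using star Y' unfolding reduces_star_def
proof (induction arbitrary: Y' rule: rtranclp_induct)
  case base
  have "iobj_iso T I X' Y'"
    using iso_extend[OF iobj_iso_refl[OF X] X' base h e i] .
  then show ?case by (auto intro: r_into_rtranclp)
next
  case (step Y Z)
  have Y: "Y \<in> iobjs T J"
    using step.hyps(2) by (auto dest: reduces_iobjs simp: iobj_iso_def)
  obtain Y1 where Y1: "extends T J E e i Y Y1"
    using extends_exists[OF Y e h(1,2)] by blast
  have "reduces T \<R> I Y1 Y' \<or> iobj_iso T I Y1 Y'"
  proof (cases "reduces T \<R> J Y Z")
    case True
    then obtain \<sigma> where \<sigma>: "srule \<sigma> \<in> \<R>" "is_step T J Y \<sigma> Z" unfolding reduces_def by blast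
    then have "wf_rule T \<I> (srule \<sigma>)" using sys by (simp add: dpoi_system_def)
    then show ?thesis
      using step_extend[OF \<sigma>(2) _ Y1 step.prems h e i] \<sigma>(1) unfolding reduces_def by metis
  next
    case False
    then show ?thesis using step.hyps(2) iso_extend[OF _ Y1 step.prems h e i] by blast
  qed
  then show ?case using step.IH[OF Y1] by (rule rtranclp.rtrancl_into_rtrancl[rotated])
qed


section \<open>The critical pair lemma\<close>

text \<open>The two injections are homomorphisms and cover the coproduct, so
  \<open>cover_hyp\<close> applies.\<close>

lemma coproduct_hyp: "G \<in> hyp T \<Longrightarrow> H \<in> hyp T \<Longrightarrow> coproduct G H \<in> hyp T"
proof -
  assume G: "G \<in> hyp T" and H: "H \<in> hyp T"
  let ?inl = "([0..<nv G], [0..<ne G])" and ?inr = "(map ((+) (nv G)) [0..<nv H], map ((+) (ne G)) [0..<ne H])"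
  have sh: "act (map ((+) (nv G)) [0..<nv H]) x = (fst x, map ((+) (nv G)) (fst (snd x)), map ((+) (nv G)) (snd (snd x)))"
    if "edge_in (nv H) x" for x
    using that unfolding edge_in_def act_def by (auto simp: subset_iff)
  have einG: "edge_in (nv G) x" if "x \<in> set (edg G)" for x
    using G that unfolding hyp_iff valid_def by blast
  have einH: "edge_in (nv H) x" if "x \<in> set (edg H)" for x
    using H that unfolding hyp_iff valid_def by blast
  have l: "?inl \<in> hmors G (coproduct G H)"
    unfolding hmors_iff by (auto simp: coproduct_def Let_def nth_append act_upt[OF einG] intro!: nth_equalityI)
  have r: "?inr \<in> hmors H (coproduct G H)"
    unfolding hmors_iff
    by (auto simp: coproduct_def Let_def nth_append sh[OF einH] case_prod_beta' intro!: nth_equalityI)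
  have cov: "{..<n} \<union> (+) n ` {..<m} = {..<n + m}" for n m :: nat
  proof -
    have "x \<in> (+) n ` {..<m}" if "x < n + m" "\<not> x < n" for x
      using that by (intro image_eqI[of _ _ "x - n"]) auto
    then show ?thesis by auto
  qed
  show ?thesis
    by (rule cover_hyp[OF l r G H])
      (simp_all add: coproduct_def Let_def atLeast0LessThan cov)
qed

lemma copair_hmors:
  assumes G: "G \<in> hyp T" and H: "H \<in> hyp T" and f: "f \<in> hmors G S" and g: "g \<in> hmors H S"
  shows "copair f g \<in> hmors (coproduct G H) S"
proof -
  have "act (fst f @ fst g) x = act (fst f) x" if "x \<in> set (edg G)" for x
  proof -
    have "edge_in (nv G) x" using G that unfolding hyp_iff valid_def by blast
    then show ?thesis
      using hmors_len[OF f] unfolding edge_in_def act_def by (auto simp: nth_append)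
  qed
  then have 1: "map (act (fst f @ fst g)) (edg G) = map (act (fst f)) (edg G)"
    by simp
  have "act (fst f @ fst g) (fst x, map ((+) (nv G)) (fst (snd x)), map ((+) (nv G)) (snd (snd x))) = act (fst g) x"
    if "x \<in> set (edg H)" for x
    using hmors_len[OF f] unfolding act_def by (simp add: nth_append comp_def)
  then have 2: "map (act (fst f @ fst g)) (map (\<lambda>(f, s, t). (f, map ((+) (nv G)) s, map ((+) (nv G)) t)) (edg H)) =
      map (act (fst g)) (edg H)"
    by (simp add: case_prod_beta')
  show ?thesis
    using f g unfolding hmors_iff coproduct_def copair_def Let_def fst_conv snd_conv hgraph.sel map_append 1 2
    by simp
qed

lemma epi_copair_iff:
  assumes h: "L1 \<in> hyp T" "L2 \<in> hyp T" "S \<in> hyp T" and f: "f1 \<in> hmors L1 S" "f2 \<in> hmors L2 S"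
  shows "epi T (coproduct L1 L2) S (copair f1 f2) \<longleftrightarrow>
    set (fst f1) \<union> set (fst f2) = {..<nv S} \<and> set (snd f1) \<union> set (snd f2) = {..<ne S}"
  unfolding epi_iff[OF coproduct_hyp[OF h(1,2)] h(3)]
  using copair_hmors[OF h(1,2) f] by (simp add: copair_def)

text \<open>Cancelling the square of \<open>H'\<close> against that of \<open>H\<close> makes
  \<open>H\<close> a pushout of \<open>H'\<close> and \<open>C\<close> over \<open>C'\<close>.
  Pasting with the square of contexts presents it as a pushout of \<open>H'\<close> and
  \<open>E\<close> over \<open>J\<close>.\<close>

lemma extended_result:
  assumes C: "pushout T J C' E C j e t e1" and t: "k' ;; t = k" and k': "k' \<in> hmors K C'"
    and H: "pushout T K R C H r k h g" and H': "pushout T K R C' H' r k' h' g'"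
    and hyp: "J \<in> hyp T" "C' \<in> hyp T" "E \<in> hyp T" "C \<in> hyp T" "K \<in> hyp T" "R \<in> hyp T" "H \<in> hyp T" "H' \<in> hyp T"
    and i: "i \<in> hmors I E"
  shows "extends T J E e i (H', j ;; g') (H, (i ;; e1) ;; g)"
proof -
  note c = pushoutD[OF C] and p = pushoutD[OF H] and p' = pushoutD[OF H']
  have "t ;; g \<in> hmors C' H" using hcomp_hmors[OF hyp_valid[OF hyp(2)] c(3) p(4)] .
  moreover have "r ;; h = k' ;; (t ;; g)" using p(5) t hcomp_assoc[OF k' c(3), of g] by simp
  ultimately obtain v where v: "v \<in> hmors H' H" "h' ;; v = h" "g' ;; v = t ;; g"
    using pushout_lift[OF H' hyp(7) p(3)] by blast
  have "pushout T K R C H r (k' ;; t) h g" using H t by simp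
  from pushout_cancel[OF H' this c(3) v(1,2,3) hyp(5,6,2,8,4,7)]
  have "pushout T C' H' C H g' t v g" .
  then have "pushout T C' C H' H t g' g v" by (rule pushout_swap)
  from pushout_paste[OF pushout_swap[OF C] this hyp(1,3,2,4,8,7)]
  have "pushout T J E H' H e (j ;; g') (e1 ;; g) v" .
  then have "pushout T J H' E H (j ;; g') e v (e1 ;; g)" by (rule pushout_swap)
  then show ?thesis
    unfolding extends_def fst_conv snd_conv using hyp(7) hcomp_assoc[OF i c(4), of g] by blast
qed

lemma local_confluence:
  assumes sys: "dpoi_system T \<I> \<R>" and cps: "\<forall>cp \<in> critical_pairs T \<R>. cpair_joinable T \<R> cp"
    and I: "I \<in> hyp T" and Y: "reduces T \<R> I X Y" and Z: "reduces T \<R> I X Z"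
  shows "joinable T \<R> I Y Z"
proof -
  obtain \<sigma>1 \<sigma>2 where \<sigma>: "srule \<sigma>1 \<in> \<R>" "is_step T I X \<sigma>1 Y" "srule \<sigma>2 \<in> \<R>" "is_step T I X \<sigma>2 Z"
    using Y Z unfolding reduces_def by blast
  obtain L1 K1 R1 l1 r1 f1 h1 C1 k1 q1 c1 g1 where s1: "\<sigma>1 = Step (Rule L1 K1 R1 l1 r1) f1 h1 C1 k1 q1 c1 g1"
    and st1: "X \<in> iobjs T I" "Y \<in> iobjs T I" "C1 \<in> hyp T" "q1 \<in> hmors I C1"
    "pushout T K1 L1 C1 (fst X) l1 k1 f1 c1" "pushout T K1 R1 C1 (fst Y) r1 k1 h1 g1"
    "snd X = q1 ;; c1" "snd Y = q1 ;; g1"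
    using is_stepD[OF \<sigma>(2)] .
  obtain L2 K2 R2 l2 r2 f2 h2 C2 k2 q2 c2 g2 where s2: "\<sigma>2 = Step (Rule L2 K2 R2 l2 r2) f2 h2 C2 k2 q2 c2 g2"
    and st2: "X \<in> iobjs T I" "Z \<in> iobjs T I" "C2 \<in> hyp T" "q2 \<in> hmors I C2"
    "pushout T K2 L2 C2 (fst X) l2 k2 f2 c2" "pushout T K2 R2 C2 (fst Z) r2 k2 h2 g2"
    "snd X = q2 ;; c2" "snd Z = q2 ;; g2"
    using is_stepD[OF \<sigma>(4)] .
  have "wf_rule T \<I> (srule \<sigma>1)" "wf_rule T \<I> (srule \<sigma>2)" using sys \<sigma>(1,3) by (simp_all add: dpoi_system_def)
  then have rules: "L1 \<in> hyp T" "K1 \<in> hyp T" "R1 \<in> hyp T" "L2 \<in> hyp T" "K2 \<in> hyp T" "R2 \<in> hyp T"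
    "r1 \<in> hmors K1 R1" "r2 \<in> hmors K2 R2"
    by (auto simp: wf_rule_def s1 s2)
  have XYZ: "fst X \<in> hyp T" "fst Y \<in> hyp T" "fst Z \<in> hyp T" using st1 st2 by (auto simp: iobjs_def)
  obtain S f1' f2' C1' t1 c1' k1' C2' t2 c2' k2' J j1 j2 E e1 e2 e
    where h: "S \<in> hyp T" "C1' \<in> hyp T" "C2' \<in> hyp T" "J \<in> hyp T" "E \<in> hyp T"
    and cov: "set (fst f1') \<union> set (fst f2') = {..<nv S}" "set (snd f1') \<union> set (snd f2') = {..<ne S}"
    and 1: "cpo K1 L1 C1' S l1 k1' f1' c1'" "t1 \<in> hmors C1' C1" "k1' ;; t1 = k1"
    and 2: "cpo K2 L2 C2' S l2 k2' f2' c2'" "t2 \<in> hmors C2' C2" "k2' ;; t2 = k2"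
    and pb: "cpb J C1' C2' S j1 j2 c1' c2'" "cpb E C1 C2 (fst X) e1 e2 c1 c2"
    and ext: "cpo J C1' E C1 j1 e t1 e1" "cpo J C2' E C2 j2 e t2 e2"
    using overlap[OF pushout_cpo[OF st1(5) rules(2,1) st1(3) XYZ(1)] pushout_cpo[OF st2(5) rules(5,4) st2(3) XYZ(1)]
        rules(2,1) st1(3) rules(5,4) st2(3) XYZ(1)] .
  note p1 = cpoD[OF 1(1)] and p2 = cpoD[OF 2(1)] and j = cpbD[OF pb(1)] and e = cpoD[OF ext(1)]
  \<comment> \<open>\<open>q1\<close> and \<open>q2\<close> have the same composite into
    \<open>fst X\<close>, namely the given interface map, and so factor through the pullback
    \<open>E\<close> of the contexts. Hence the interface survives in the common part of the two
    steps.\<close>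
  obtain i where i: "i \<in> hmors I E" "i ;; e1 = q1" "i ;; e2 = q2"
    using cpb_lift[OF pb(2) hyp_valid[OF I] hyp_valid[OF h(5)] st1(4) st2(4)] st1(7) st2(7) by auto
  obtain H1' h1' g1' where H1: "H1' \<in> hyp T" "pushout T K1 R1 C1' H1' r1 k1' h1' g1'"
    using pushout_exists[OF rules(7) p1(2) rules(2,3) h(2)] .
  obtain H2' h2' g2' where H2: "H2' \<in> hyp T" "pushout T K2 R2 C2' H2' r2 k2' h2' g2'"
    using pushout_exists[OF rules(8) p2(2) rules(5,6) h(3)] .
  let ?\<sigma>1 = "Step (Rule L1 K1 R1 l1 r1) f1' h1' C1' k1' j1 c1' g1'"
  let ?\<sigma>2 = "Step (Rule L2 K2 R2 l2 r2) f2' h2' C2' k2' j2 c2' g2'"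
  let ?Y = "(H1', j1 ;; g1')" and ?Z = "(H2', j2 ;; g2')" and ?S = "(S, j1 ;; c1')"
  have vJ: "valid J" using h(4) by (rule hyp_valid)
  have objs: "?S \<in> iobjs T J" "?Y \<in> iobjs T J" "?Z \<in> iobjs T J"
    using h H1(1) H2(1) hcomp_hmors[OF vJ j(1,3)] hcomp_hmors[OF vJ j(1) pushoutD(4)[OF H1(2)]]
      hcomp_hmors[OF vJ j(2) pushoutD(4)[OF H2(2)]] by (simp_all add: iobjs_def)
  have v: "valid L1" "valid L2" "valid C1'" "valid C2'" "valid E" using rules h hyp_valid by blast+
  have "is_step T J ?S ?\<sigma>1 ?Y"
    using cpo_pushout[OF 1(1) v(1,3)] by (intro is_stepI objs h(2) j(1)) (simp_all add: H1)
  moreover have "is_step T J ?S ?\<sigma>2 ?Z"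
    using cpo_pushout[OF 2(1) v(2,4)] by (intro is_stepI objs h(3) j(2)) (simp_all add: H2 j(5))
  moreover have "epi T (coproduct L1 L2) S (copair f1' f2')"
    using epi_copair_iff[OF rules(1,4) h(1) p1(3) p2(3)] cov by simp
  moreover have "pullback T J C1' C2' S j1 j2 c1' c2'" by (rule cpb_pullback[OF pb(1) vJ])
  ultimately have "CPair J ?S ?\<sigma>1 ?Y ?\<sigma>2 ?Z \<in> critical_pairs T \<R>"
    unfolding critical_pairs_def using h(4) \<sigma>(1,3) s1 s2 by force
  then have "joinable T \<R> J ?Y ?Z"
    using cps unfolding cpair_joinable_def by fastforce
  then obtain W where W: "W \<in> iobjs T J" "reduces_star T \<R> J ?Y W" "reduces_star T \<R> J ?Z W"
    unfolding joinable_def by blast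
  have eJ: "e \<in> hmors J E" by (rule e(2))
  obtain W' where W': "extends T J E e i W W'"
    using extends_exists[OF W(1) eJ h(4,5)] by blast
  \<comment> \<open>The extensions of the two results carry the interface maps
    \<open>i ;; e1 ;; g1\<close> and \<open>i ;; e2 ;; g2\<close>, which are those of
    \<open>Y\<close> and \<open>Z\<close> themselves.\<close>
  have Yeq: "(fst Y, i ;; e1 ;; g1) = Y" "(fst Z, i ;; e2 ;; g2) = Z"
    using i(2,3) by (simp_all only: st1(8)[symmetric] st2(8)[symmetric] prod.collapse)
  have "extends T J E e i ?Y (fst Y, i ;; e1 ;; g1)"
    by (rule extended_result[OF cpo_pushout[OF ext(1) v(3,5)] 1(3) p1(2) st1(6) H1(2) h(4,2,5) st1(3) rules(2,3) XYZ(2) H1(1) i(1)])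
  moreover have "extends T J E e i ?Z (fst Z, i ;; e2 ;; g2)"
    by (rule extended_result[OF cpo_pushout[OF ext(2) v(4,5)] 2(3) p2(2) st2(6) H2(2) h(4,3,5) st2(3) rules(5,6) XYZ(3) H2(1) i(1)])
  ultimately have "reduces_star T \<R> I Y W'" "reduces_star T \<R> I Z W'"
    unfolding Yeq
    using reduces_star_extend[OF W(2) sys objs(2) _ W' h(4,5) I eJ i(1)]
      reduces_star_extend[OF W(3) sys objs(3) _ W' h(4,5) I eJ i(1)] by blast+
  then show ?thesis
    unfolding joinable_def using extends_iobj[OF W' i(1) I] by blast
qed

text \<open>Steps of \<open>e\<close> are absorbed in front of an \<open>r\<close> step, so
  induction along \<open>r\<close> still works: a peak is either trivial because one side leads back
  to the top, or can be taken to start with two \<open>r\<close> steps.\<close>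

lemma newman_modulo:
  fixes r e :: "'a \<Rightarrow> 'a \<Rightarrow> bool"
  defines "s \<equiv> (\<lambda>x y. r x y \<or> e x y)\<^sup>*\<^sup>*"
  assumes wf: "wf {(y, x). r x y}" and er: "\<And>x y z. e x y \<Longrightarrow> r y z \<Longrightarrow> r x z"
    and esym: "\<And>x y. e x y \<Longrightarrow> e y x"
    and loc: "\<And>x y z. r x y \<Longrightarrow> r x z \<Longrightarrow> \<exists>w. s y w \<and> s z w"
  shows "s x y \<Longrightarrow> s x z \<Longrightarrow> \<exists>w. s y w \<and> s z w"
proof (induction x arbitrary: y z rule: wf_induct_rule[OF wf])
  case (1 x)
  have strans: "s a b \<Longrightarrow> s b c \<Longrightarrow> s a c" for a b c
    unfolding s_def by (rule rtranclp_trans)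
  have srefl: "s a a" for a unfolding s_def by simp
  \<comment> \<open>A chain that contains an \<open>r\<close> step can be made to begin with one by
    absorbing the \<open>e\<close> steps before it; a chain of \<open>e\<close> steps alone can be
    run backwards.\<close>
  have first: "s b a \<or> (\<exists>a'. r a a' \<and> s a' b)" if "s a b" for a b
    using that unfolding s_def
  proof (induction rule: converse_rtranclp_induct)
    case (step a a1)
    then show ?case
      using er esym by (metis (no_types, lifting) rtranclp.rtrancl_into_rtrancl)
  qed simp
  consider "s y x" | "s z x" | y' z' where "r x y'" "s y' y" "r x z'" "s z' z"
    using first[OF 1(2)] first[OF 1(3)] by blast
  then show ?case
  proof cases
    assume "s y x"
    then show ?thesis using strans[OF _ 1(3)] srefl by blast
  next
    assume "s z x"
    then show ?thesis using strans[OF _ 1(2)] srefl by blast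
  next
    fix y' z'
    assume *: "r x y'" "s y' y" "r x z'" "s z' z"
    then obtain w where w: "s y' w" "s z' w" using loc by blast
    \<comment> \<open>The usual diamond chase: the induction hypothesis at \<open>y'\<close> and
      then at \<open>z'\<close> closes the two remaining peaks.\<close>
    obtain v where v: "s y v" "s w v" using 1(1)[of y' y w] * w by blast
    obtain u where u: "s v u" "s z u" using 1(1)[of z' v z] * strans[OF w(2) v(2)] by blast
    show ?thesis using strans[OF v(1) u(1)] u(2) by blast
  qed
qed

lemma terminating_wf:
  assumes "terminating T \<I> \<R>" "I \<in> hyp T \<inter> \<I>"
  shows "wf {(Y, X). reduces T \<R> I X Y}"
  using assms unfolding terminating_def wf_iff_no_infinite_down_chain by simp

lemma confluent_if_joinable:
  assumes sys: "dpoi_system T \<I> \<R>" and trm: "terminating T \<I> \<R>"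
    and cps: "\<forall>cp \<in> critical_pairs T \<R>. cpair_joinable T \<R> cp"
  shows "confluent T \<I> \<R>"
  unfolding confluent_def
proof (intro ballI impI)
  fix I X Y Z
  assume I: "I \<in> hyp T \<inter> \<I>" and X: "X \<in> iobjs T I" and Y: "Y \<in> iobjs T I" and Z: "Z \<in> iobjs T I"
    and star: "reduces_star T \<R> I X Y \<and> reduces_star T \<R> I X Z"
  have "\<exists>W. reduces_star T \<R> I Y W \<and> reduces_star T \<R> I Z W"
    unfolding reduces_star_def
  proof (rule newman_modulo[OF terminating_wf[OF trm I]])
    show "reduces T \<R> I x z" if "iobj_iso T I x y" "reduces T \<R> I y z" for x y z
      using iso_reduces[OF that sys] .
    show "\<exists>w. (\<lambda>x y. reduces T \<R> I x y \<or> iobj_iso T I x y)\<^sup>*\<^sup>* y w \<and>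
        (\<lambda>x y. reduces T \<R> I x y \<or> iobj_iso T I x y)\<^sup>*\<^sup>* z w" if "reduces T \<R> I x y" "reduces T \<R> I x z" for x y z
      using local_confluence[OF sys cps _ that] I unfolding joinable_def reduces_star_def by blast
  qed (use star in \<open>auto simp: reduces_star_def intro: iobj_iso_sym\<close>)
  then show "joinable T \<R> I Y Z"
    unfolding joinable_def using reduces_star_iobjs Y by blast
qed

lemma joinable_if_confluent:
  assumes conf: "confluent T \<I> \<R>" and I: "I \<in> hyp T \<inter> \<I>" and X: "reduces T \<R> I X Y" "reduces T \<R> I X Z"
  shows "joinable T \<R> I Y Z"
  using conf I reduces_iobjs[OF X(1)] reduces_iobjs[OF X(2)] reduces_star_step[OF X(1)] reduces_star_step[OF X(2)]
  unfolding confluent_def by blast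

section \<open>Rewriting steps without reference to the theory\<close>

text \<open>
  Membership in \<open>hyp T\<close> is inherited along homomorphisms and jointly surjective families, so that
  relative to well-formed rules and a well-formed source the steps, and the critical pairs, can be
  described by conditions that mention neither the theory nor a quantification over all
  hypergraphs.
\<close>

definition cstep :: "('c, 'o) hgraph \<Rightarrow> ('c, 'o) iobj \<Rightarrow> ('c, 'o) dpoi_step \<Rightarrow> ('c, 'o) iobj \<Rightarrow> bool" where
  "cstep I X \<sigma> Y \<longleftrightarrow> snd X \<in> hmors I (fst X) \<and> snd Y \<in> hmors I (fst Y) \<and>
     valid (sctxt \<sigma>) \<and> si \<sigma> \<in> hmors I (sctxt \<sigma>) \<and>
     cpo (rk (srule \<sigma>)) (rl (srule \<sigma>)) (sctxt \<sigma>) (fst X) (lleg (srule \<sigma>)) (sk \<sigma>) (smatch \<sigma>) (sg \<sigma>) \<and>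
     cpo (rk (srule \<sigma>)) (rr (srule \<sigma>)) (sctxt \<sigma>) (fst Y) (rleg (srule \<sigma>)) (sk \<sigma>) (scomatch \<sigma>) (sh \<sigma>) \<and>
     snd X = si \<sigma> ;; sg \<sigma> \<and> snd Y = si \<sigma> ;; sh \<sigma>"

lemma is_step_iff:
  assumes X: "X \<in> iobjs T I" and wf: "wf_rule T \<I> (srule \<sigma>)"
  shows "is_step T I X \<sigma> Y \<longleftrightarrow> cstep I X \<sigma> Y"
proof
  assume "is_step T I X \<sigma> Y"
  then obtain L K R l r f h D k q g g' where \<sigma>: "\<sigma> = Step (Rule L K R l r) f h D k q g g'"
    and st: "X \<in> iobjs T I" "Y \<in> iobjs T I" "D \<in> hyp T" "q \<in> hmors I D"
    "pushout T K L D (fst X) l k f g" "pushout T K R D (fst Y) r k h g'"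
    "snd X = q ;; g" "snd Y = q ;; g'"
    by (rule is_stepD)
  have rules: "K \<in> hyp T" "L \<in> hyp T" "R \<in> hyp T" using wf by (auto simp: wf_rule_def \<sigma>)
  have objs: "fst X \<in> hyp T" "snd X \<in> hmors I (fst X)" "fst Y \<in> hyp T" "snd Y \<in> hmors I (fst Y)"
    using st(1,2) by (auto simp: iobjs_def)
  show "cstep I X \<sigma> Y"
    unfolding cstep_def \<sigma> dpoi_step.sel dpoi_rule.sel
    using pushout_cpo[OF st(5) rules(1,2) st(3) objs(1)] pushout_cpo[OF st(6) rules(1,3) st(3) objs(3)]
      objs st(3,4,7,8) hyp_valid by blast
next
  assume c: "cstep I X \<sigma> Y"
  obtain L K R l r f h D k q g g' where \<sigma>: "\<sigma> = Step (Rule L K R l r) f h D k q g g'"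
  proof -
    obtain \<rho> f h D k q g g' where "\<sigma> = Step \<rho> f h D k q g g'" by (cases \<sigma>)
    moreover obtain L K R l r where "\<rho> = Rule L K R l r" by (cases \<rho>)
    ultimately show thesis using that by simp
  qed
  have rules: "K \<in> hyp T" "L \<in> hyp T" "R \<in> hyp T" using wf by (auto simp: wf_rule_def \<sigma>)
  have st: "snd X \<in> hmors I (fst X)" "snd Y \<in> hmors I (fst Y)" "valid D" "q \<in> hmors I D"
    "cpo K L D (fst X) l k f g" "cpo K R D (fst Y) r k h g'" "snd X = q ;; g" "snd Y = q ;; g'"
    using c unfolding cstep_def \<sigma> dpoi_step.sel dpoi_rule.sel by blast+
  \<comment> \<open>The context maps to the typed source and is therefore typed; the result is then
    covered by the right-hand side and the context.\<close>
  have D: "D \<in> hyp T"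
    using hyp_source[OF cpoD(4)[OF st(5)] _ st(3)] X by (auto simp: iobjs_def)
  have "fst Y \<in> hyp T"
    using cover_hyp[OF cpoD(3,4)[OF st(6)] rules(3) D cpoD(8,9)[OF st(6)]] .
  then have "Y \<in> iobjs T I" using st(2) by (cases Y) (simp add: iobjs_def)
  then show "is_step T I X \<sigma> Y"
    unfolding \<sigma>
  proof (rule is_stepI[OF X _ D st(4) _ _ st(7,8)])
    show "pushout T K L D (fst X) l k f g" "pushout T K R D (fst Y) r k h g'"
      using cpo_pushout[OF st(5) hyp_valid[OF rules(2)] st(3)] cpo_pushout[OF st(6) hyp_valid[OF rules(3)] st(3)] .
  qed
qed

definition ccrit :: "('c, 'o) dpoi_rule set \<Rightarrow> ('c, 'o) cpair \<Rightarrow> bool" where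
  "ccrit \<R> cp \<longleftrightarrow> srule (cstep1 cp) \<in> \<R> \<and> srule (cstep2 cp) \<in> \<R> \<and> valid (cifc cp) \<and>
     cstep (cifc cp) (csrc cp) (cstep1 cp) (ctgt1 cp) \<and> cstep (cifc cp) (csrc cp) (cstep2 cp) (ctgt2 cp) \<and>
     set (fst (smatch (cstep1 cp)) @ fst (smatch (cstep2 cp))) = {..<nv (fst (csrc cp))} \<and>
     set (snd (smatch (cstep1 cp)) @ snd (smatch (cstep2 cp))) = {..<ne (fst (csrc cp))} \<and>
     cpb (cifc cp) (sctxt (cstep1 cp)) (sctxt (cstep2 cp)) (fst (csrc cp))
       (si (cstep1 cp)) (si (cstep2 cp)) (sg (cstep1 cp)) (sg (cstep2 cp))"

lemma cstep_hyp:
  assumes "cstep I X \<sigma> Y" "fst X \<in> hyp T" "rl (srule \<sigma>) \<in> hyp T"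
  shows "sctxt \<sigma> \<in> hyp T" "smatch \<sigma> \<in> hmors (rl (srule \<sigma>)) (fst X)"
  using assms hyp_source[of "sg \<sigma>" "sctxt \<sigma>" "fst X" T] unfolding cstep_def by (auto dest: cpoD)

lemma critical_pairs_iff:
  assumes sys: "dpoi_system T \<I> \<R>"
  shows "cp \<in> critical_pairs T \<R> \<longleftrightarrow> ccrit \<R> cp"
proof -
  obtain J X \<sigma>1 Y1 \<sigma>2 Y2 where cp: "cp = CPair J X \<sigma>1 Y1 \<sigma>2 Y2" by (cases cp)
  have wf: "wf_rule T \<I> (srule \<sigma>)" if "srule \<sigma> \<in> \<R>" for \<sigma>
    using sys that by (simp add: dpoi_system_def)
  have L: "rl (srule \<sigma>) \<in> hyp T" if "srule \<sigma> \<in> \<R>" for \<sigma>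
    using wf[OF that] by (simp add: wf_rule_def)
  have crit: "cp \<in> critical_pairs T \<R> \<longleftrightarrow> J \<in> hyp T \<and> srule \<sigma>1 \<in> \<R> \<and> srule \<sigma>2 \<in> \<R> \<and>
     is_step T J X \<sigma>1 Y1 \<and> is_step T J X \<sigma>2 Y2 \<and>
     epi T (coproduct (rl (srule \<sigma>1)) (rl (srule \<sigma>2))) (fst X) (copair (smatch \<sigma>1) (smatch \<sigma>2)) \<and>
     pullback T J (sctxt \<sigma>1) (sctxt \<sigma>2) (fst X) (si \<sigma>1) (si \<sigma>2) (sg \<sigma>1) (sg \<sigma>2)"
    unfolding critical_pairs_def cp by (cases X; cases Y1; cases Y2) auto
  show ?thesis
  proof
    assume "cp \<in> critical_pairs T \<R>"
    then have *: "J \<in> hyp T" "srule \<sigma>1 \<in> \<R>" "srule \<sigma>2 \<in> \<R>" "is_step T J X \<sigma>1 Y1" "is_step T J X \<sigma>2 Y2"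
      "epi T (coproduct (rl (srule \<sigma>1)) (rl (srule \<sigma>2))) (fst X) (copair (smatch \<sigma>1) (smatch \<sigma>2))"
      "pullback T J (sctxt \<sigma>1) (sctxt \<sigma>2) (fst X) (si \<sigma>1) (si \<sigma>2) (sg \<sigma>1) (sg \<sigma>2)"
      unfolding crit by blast+
    have X: "X \<in> iobjs T J" using *(4) by (simp add: is_step_def)
    then have S: "fst X \<in> hyp T" by (auto simp: iobjs_def)
    note c1 = is_step_iff[OF X wf[OF *(2)], THEN iffD1, OF *(4)]
      and c2 = is_step_iff[OF X wf[OF *(3)], THEN iffD1, OF *(5)]
    show "ccrit \<R> cp"
      unfolding ccrit_def cp cpair.sel set_append
      using * c1 c2 hyp_valid epi_copair_iff[OF L[OF *(2)] L[OF *(3)] S cstep_hyp(2)[OF c1 S L[OF *(2)]]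
          cstep_hyp(2)[OF c2 S L[OF *(3)]]]
        pullback_cpb[OF *(7,1) cstep_hyp(1)[OF c1 S L[OF *(2)]] cstep_hyp(1)[OF c2 S L[OF *(3)]]] by blast
  next
    assume "ccrit \<R> cp"
    then have *: "srule \<sigma>1 \<in> \<R>" "srule \<sigma>2 \<in> \<R>" "valid J" "cstep J X \<sigma>1 Y1" "cstep J X \<sigma>2 Y2"
      "set (fst (smatch \<sigma>1) @ fst (smatch \<sigma>2)) = {..<nv (fst X)}"
      "set (snd (smatch \<sigma>1) @ snd (smatch \<sigma>2)) = {..<ne (fst X)}"
      "cpb J (sctxt \<sigma>1) (sctxt \<sigma>2) (fst X) (si \<sigma>1) (si \<sigma>2) (sg \<sigma>1) (sg \<sigma>2)"
      unfolding ccrit_def cp cpair.sel by blast+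
    have f: "smatch \<sigma>1 \<in> hmors (rl (srule \<sigma>1)) (fst X)" "smatch \<sigma>2 \<in> hmors (rl (srule \<sigma>2)) (fst X)"
      using *(4,5) unfolding cstep_def by (auto dest: cpoD)
    \<comment> \<open>The source is covered by two typed left-hand sides, and the interface maps
      into it; this recovers membership in \<open>hyp T\<close> from the description without
      \<open>T\<close>.\<close>
    have S: "fst X \<in> hyp T"
      using cover_hyp[OF f L[OF *(1)] L[OF *(2)] *(6,7)] .
    have snd: "snd X \<in> hmors J (fst X)" using *(4) unfolding cstep_def by blast
    have J: "J \<in> hyp T" using hyp_source[OF snd S *(3)] .
    have X: "X \<in> iobjs T J" using S snd by (cases X) (simp add: iobjs_def)
    show "cp \<in> critical_pairs T \<R>"
      unfolding crit using J *(1,2) is_step_iff[OF X wf[OF *(1)], THEN iffD2, OF *(4)]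
        is_step_iff[OF X wf[OF *(2)], THEN iffD2, OF *(5)]
        epi_copair_iff[OF L[OF *(1)] L[OF *(2)] S f, THEN iffD2] *(6,7)
        cpb_pullback[OF *(8,3)] by (simp only: set_append simp_thms)
  qed
qed

lemma critical_pair_discrete:
  assumes sys: "dpoi_system T (discrete_hyp T) \<R>" and cp: "cp \<in> critical_pairs T \<R>"
  shows "cifc cp \<in> discrete_hyp T"
proof -
  obtain J X \<sigma>1 Y1 \<sigma>2 Y2 where cp': "cp = CPair J X \<sigma>1 Y1 \<sigma>2 Y2" by (cases cp)
  have J: "J \<in> hyp T" using cp unfolding critical_pairs_def cp' by auto
  have *: "srule \<sigma>1 \<in> \<R>" "srule \<sigma>2 \<in> \<R>" "cstep J X \<sigma>1 Y1" "cstep J X \<sigma>2 Y2"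
    "set (snd (smatch \<sigma>1) @ snd (smatch \<sigma>2)) = {..<ne (fst X)}"
    "cpb J (sctxt \<sigma>1) (sctxt \<sigma>2) (fst X) (si \<sigma>1) (si \<sigma>2) (sg \<sigma>1) (sg \<sigma>2)"
    using cp unfolding critical_pairs_iff[OF sys] ccrit_def cp' cpair.sel by blast+
  \<comment> \<open>As \<open>K\<close> has no hyperedges, those of the source form a disjoint union
    of match and context; the map that is \<open>True\<close> on the former and \<open>False\<close>
    on the latter exhibits this.\<close>
  have off: "z \<notin> set (snd (smatch \<sigma>))" if \<sigma>: "srule \<sigma> \<in> \<R>" "cstep J X \<sigma> Y" "z \<in> set (snd (sg \<sigma>))" for \<sigma> Y z
  proof
    assume "z \<in> set (snd (smatch \<sigma>))"
    then obtain x where x: "x < length (snd (smatch \<sigma>))" "snd (smatch \<sigma>) ! x = z" by (auto simp: in_set_conv_nth)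
    obtain y where y: "y < length (snd (sg \<sigma>))" "snd (sg \<sigma>) ! y = z" using \<sigma>(3) by (auto simp: in_set_conv_nth)
    have "edg (rk (srule \<sigma>)) = []"
      using sys \<sigma>(1) by (auto simp: dpoi_system_def wf_rule_def discrete_hyp_def)
    then have nil: "snd (lleg (srule \<sigma>)) = []" "snd (sk \<sigma>) = []"
      using \<sigma>(2) hmors_len(2)[of "lleg (srule \<sigma>)"] hmors_len(2)[of "sk \<sigma>"] unfolding cstep_def cpo_def by force+
    have po: "set_po (ne (fst X)) (snd (lleg (srule \<sigma>))) (snd (sk \<sigma>)) (snd (smatch \<sigma>)) (snd (sg \<sigma>))"
      using \<sigma>(2) unfolding cstep_def cpo_def by blast
    have "\<exists>w. length w = ne (fst X) \<and> map ((!) w) (snd (smatch \<sigma>)) = map (\<lambda>_. True) (snd (smatch \<sigma>)) \<and>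
      map ((!) w) (snd (sg \<sigma>)) = map (\<lambda>_. False) (snd (sg \<sigma>))"
      by (rule set_po_lift[OF po]) (simp_all add: nil)
    then obtain w where "map ((!) w) (snd (smatch \<sigma>)) = map (\<lambda>_. True) (snd (smatch \<sigma>))"
      "map ((!) w) (snd (sg \<sigma>)) = map (\<lambda>_. False) (snd (sg \<sigma>))" by blast
    then have "w ! (snd (smatch \<sigma>) ! x)" "\<not> w ! (snd (sg \<sigma>) ! y)"
      using nth_mem[OF x(1)] nth_mem[OF y(1)] by (simp_all add: map_eq_conv)
    then show False using x y by simp
  qed
  \<comment> \<open>A hyperedge of the interface would lie in both contexts and hence be missed by
    both matches, although together they cover the source.\<close>
  have "ne J = 0"
  proof (rule ccontr)
    assume "ne J \<noteq> 0"
    note p = cpbD[OF *(6)]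
    have l: "length (snd (si \<sigma>1)) = ne J" "length (snd (si \<sigma>2)) = ne J" "length (snd (sg \<sigma>1)) = ne (sctxt \<sigma>1)"
      "length (snd (sg \<sigma>2)) = ne (sctxt \<sigma>2)"
      using p(1-4) by (auto dest: hmors_len)
    define y1 y2 where "y1 = snd (si \<sigma>1) ! 0" and "y2 = snd (si \<sigma>2) ! 0"
    have y: "y1 < ne (sctxt \<sigma>1)" "y2 < ne (sctxt \<sigma>2)"
      unfolding y1_def y2_def using nth_in_range[OF hmors_range(2)[OF p(1)], of 0]
        nth_in_range[OF hmors_range(2)[OF p(2)], of 0] l \<open>ne J \<noteq> 0\<close> by simp_all
    have "map ((!) (snd (sg \<sigma>1))) (snd (si \<sigma>1)) ! 0 = map ((!) (snd (sg \<sigma>2))) (snd (si \<sigma>2)) ! 0"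
      using p(5) unfolding hcomp_def prod.inject by simp
    then have eq: "snd (sg \<sigma>1) ! y1 = snd (sg \<sigma>2) ! y2"
      using l \<open>ne J \<noteq> 0\<close> by (simp add: y1_def y2_def)
    have in1: "snd (sg \<sigma>1) ! y1 \<in> set (snd (sg \<sigma>1))" "snd (sg \<sigma>1) ! y1 \<in> set (snd (sg \<sigma>2))"
      using y l nth_mem[of y1 "snd (sg \<sigma>1)"] nth_mem[of y2 "snd (sg \<sigma>2)"] eq by simp_all
    have "snd (sg \<sigma>1) ! y1 < ne (fst X)"
      using nth_in_range[OF hmors_range(2)[OF p(3)]] y l by simp
    then have "snd (sg \<sigma>1) ! y1 \<in> set (snd (smatch \<sigma>1) @ snd (smatch \<sigma>2))" unfolding *(5) by simp
    then show False
      using off[OF *(1,3) in1(1)] off[OF *(2,4) in1(2)] by simp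
  qed
  then show ?thesis using J by (simp add: discrete_hyp_def cp')
qed


section \<open>Relabelling\<close>

text \<open>\<open>C\<close> and \<open>Q\<close> will be the sets on which the numberings of
  colours and operations are injective. Like typing, the property is reflected by homomorphisms and
  inherited along jointly surjective pairs.\<close>

definition labs :: "'c set \<Rightarrow> 'o set \<Rightarrow> ('c, 'o) hgraph \<Rightarrow> bool" where
  "labs C Q G \<longleftrightarrow> set (vcol G) \<subseteq> C \<and> hgraph_ops G \<subseteq> Q"

definition rlabs :: "'c set \<Rightarrow> 'o set \<Rightarrow> ('c, 'o) dpoi_rule \<Rightarrow> bool" where
  "rlabs C Q \<rho> \<longleftrightarrow> labs C Q (rl \<rho>) \<and> labs C Q (rk \<rho>) \<and> labs C Q (rr \<rho>)"

abbreviation map_iobj :: "('c \<Rightarrow> 'd) \<Rightarrow> ('o \<Rightarrow> 'p) \<Rightarrow> ('c, 'o) iobj \<Rightarrow> ('d, 'p) iobj" where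
  "map_iobj \<kappa> \<nu> \<equiv> map_prod (map_hgraph \<kappa> \<nu>) id"

lemma vcol_map_hgraph [simp]: "vcol (map_hgraph \<kappa> \<nu> G) = map \<kappa> (vcol G)"
  and edg_map_hgraph [simp]: "edg (map_hgraph \<kappa> \<nu> G) = map (map_prod \<nu> id) (edg G)"
  by (cases G; simp)+

lemma labs_source:
  assumes a: "a \<in> hmors D G" and G: "labs C Q G"
  shows "labs C Q D"
proof -
  have "set (map ((!) (vcol G)) (fst a)) \<subseteq> set (vcol G)" "set (map ((!) (edg G)) (snd a)) \<subseteq> set (edg G)"
    using hmors_range[OF a] by auto
  then have "set (vcol D) \<subseteq> set (vcol G)" "set (map (act (fst a)) (edg D)) \<subseteq> set (edg G)"
    using a unfolding hmors_iff by simp_all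
  moreover have "hgraph_ops D = fst ` set (map (act (fst a)) (edg D))"
    by (simp add: image_image act_def hgraph_ops_def)
  ultimately have "set (vcol D) \<subseteq> set (vcol G)" "hgraph_ops D \<subseteq> hgraph_ops G"
    unfolding hgraph_ops_def[of G] by (simp_all only: image_mono)
  then show ?thesis using G unfolding labs_def by blast
qed

lemma labs_cover:
  assumes f: "f \<in> hmors L G" and d: "d \<in> hmors D G" and L: "labs C Q L" and D: "labs C Q D"
    and FV: "set (fst f @ fst d) = {..<nv G}" and FE: "set (snd f @ snd d) = {..<ne G}"
  shows "labs C Q G"
proof -
  note 1 = cover_vcol[OF f d FV] and 2 = cover_edg[OF f d FE]
  show ?thesis
    using L D unfolding labs_def hgraph_ops_def 1 2 image_Un image_image act_def by simp
qed

text \<open>Brings hypergraphs found on the numerical side back to the original labels: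
  \<open>inv_into\<close> picks preimages within \<open>C\<close> and \<open>Q\<close>.\<close>

lemma labs_lift:
  assumes "labs (\<kappa> ` C) (\<nu> ` Q) G"
  obtains H where "labs C Q H" "map_hgraph \<kappa> \<nu> H = G"
proof -
  have V: "\<And>c. c \<in> set (vcol G) \<Longrightarrow> inv_into C \<kappa> c \<in> C \<and> \<kappa> (inv_into C \<kappa> c) = c"
    using assms unfolding labs_def by (blast intro: inv_into_into f_inv_into_f)
  have E: "\<And>e. e \<in> set (edg G) \<Longrightarrow> inv_into Q \<nu> (fst e) \<in> Q \<and> \<nu> (inv_into Q \<nu> (fst e)) = fst e"
    using assms unfolding labs_def hgraph_ops_def by (blast intro: inv_into_into f_inv_into_f)
  let ?H = "map_hgraph (inv_into C \<kappa>) (inv_into Q \<nu>) G"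
  have "labs C Q ?H" using V E unfolding labs_def hgraph_ops_def by auto
  moreover have "map_hgraph \<kappa> \<nu> ?H = G"
    by (rule hgraph.expand) (auto simp: V prod_eq_iff dest!: E intro!: map_idI)
  ultimately show thesis by (rule that)
qed

lemma labs_map: "labs C Q G \<Longrightarrow> labs (\<kappa> ` C) (\<nu> ` Q) (map_hgraph \<kappa> \<nu> G)"
  unfolding labs_def hgraph_ops_def by (auto simp: image_image)

lemma valid_map [simp]: "valid (map_hgraph \<kappa> \<nu> G) \<longleftrightarrow> valid G"
  unfolding valid_def edge_in_def by simp

context
  fixes C :: "'c set" and Q :: "'o set" and \<kappa> :: "'c \<Rightarrow> 'd" and \<nu> :: "'o \<Rightarrow> 'p"
  assumes inj_colours: "inj_on \<kappa> C" and inj_ops: "inj_on \<nu> Q"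
begin

text \<open>A homomorphism is given by positions alone, and relabelling leaves these untouched;
  equality of labels is neither gained nor lost under maps injective on the labels involved.\<close>

lemma hmors_map:
  assumes G: "labs C Q G" and H: "labs C Q H"
  shows "f \<in> hmors (map_hgraph \<kappa> \<nu> G) (map_hgraph \<kappa> \<nu> H) \<longleftrightarrow> f \<in> hmors G H"
proof -
  have V: "map ((!) (map \<kappa> (vcol H))) (fst f) = map \<kappa> (vcol G) \<longleftrightarrow> map ((!) (vcol H)) (fst f) = vcol G"
    if r: "set (fst f) \<subseteq> {..<nv H}"
  proof -
    have "set (map ((!) (vcol H)) (fst f)) \<subseteq> set (vcol H)" using r by auto
    then have s: "set (map ((!) (vcol H)) (fst f)) \<union> set (vcol G) \<subseteq> C"
      using G H unfolding labs_def by blast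
    show ?thesis
      unfolding map_nth_comp[OF r] by (rule inj_on_map_eq_map[OF inj_on_subset[OF inj_colours s]])
  qed
  have E: "map ((!) (map (map_prod \<nu> id) (edg H))) (snd f) = map (act (fst f)) (map (map_prod \<nu> id) (edg G)) \<longleftrightarrow>
      map ((!) (edg H)) (snd f) = map (act (fst f)) (edg G)" if r: "set (snd f) \<subseteq> {..<ne H}"
  proof -
    have "set (map ((!) (edg H)) (snd f)) \<subseteq> set (edg H)" using r by auto
    then have "fst ` set (map ((!) (edg H)) (snd f)) \<subseteq> hgraph_ops H"
      unfolding hgraph_ops_def by (rule image_mono)
    moreover have "fst ` set (map (act (fst f)) (edg G)) = hgraph_ops G"
      by (simp add: image_image act_def hgraph_ops_def)
    ultimately have "fst ` (set (map ((!) (edg H)) (snd f)) \<union> set (map (act (fst f)) (edg G))) \<subseteq> Q"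
      using G H unfolding labs_def image_Un by blast
    then have s: "set (map ((!) (edg H)) (snd f)) \<union> set (map (act (fst f)) (edg G)) \<subseteq> Q \<times> UNIV"
      unfolding image_subset_iff by (intro subsetI) (simp only: mem_Times_iff UNIV_I simp_thms)
    have comm: "map (act (fst f)) (map (map_prod \<nu> id) (edg G)) = map (map_prod \<nu> id) (map (act (fst f)) (edg G))"
      by (simp add: act_def)
    have "inj_on (map_prod \<nu> id) (Q \<times> (UNIV :: (nat list \<times> nat list) set))"
      by (rule map_prod_inj_on[OF inj_ops]) simp
    then show ?thesis
      unfolding comm map_nth_comp[OF r] by (rule inj_on_map_eq_map[OF inj_on_subset[OF _ s]])
  qed
  show ?thesis
    unfolding hmors_iff vcol_map_hgraph edg_map_hgraph length_map using V E by blast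
qed

lemma cpo_map:
  assumes "labs C Q K" "labs C Q L" "labs C Q D" "labs C Q G"
  shows "cpo (map_hgraph \<kappa> \<nu> K) (map_hgraph \<kappa> \<nu> L) (map_hgraph \<kappa> \<nu> D) (map_hgraph \<kappa> \<nu> G) l k f d \<longleftrightarrow>
    cpo K L D G l k f d"
  unfolding cpo_def by (simp add: hmors_map assms)

lemma cpb_map:
  assumes "labs C Q J" "labs C Q C1" "labs C Q C2" "labs C Q G"
  shows "cpb (map_hgraph \<kappa> \<nu> J) (map_hgraph \<kappa> \<nu> C1) (map_hgraph \<kappa> \<nu> C2) (map_hgraph \<kappa> \<nu> G) j1 j2 c1 c2 \<longleftrightarrow>
    cpb J C1 C2 G j1 j2 c1 c2"
  unfolding cpb_def by (simp add: hmors_map assms)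

lemma cstep_map:
  assumes "labs C Q I" "labs C Q (fst X)" "labs C Q (fst Y)" "labs C Q (sctxt \<sigma>)" "rlabs C Q (srule \<sigma>)"
  shows "cstep (map_hgraph \<kappa> \<nu> I) (map_iobj \<kappa> \<nu> X) (map_dpoi_step \<kappa> \<nu> \<sigma>) (map_iobj \<kappa> \<nu> Y) \<longleftrightarrow> cstep I X \<sigma> Y"
  using assms unfolding cstep_def rlabs_def
  by (simp add: hmors_map cpo_map dpoi_step.map_sel dpoi_rule.map_sel)

lemma cstep_labs:
  assumes c: "cstep I X \<sigma> Y" and X: "labs C' Q' (fst X)" and \<rho>: "rlabs C' Q' (srule \<sigma>)"
  shows "labs C' Q' I" "labs C' Q' (sctxt \<sigma>)" "labs C' Q' (fst Y)"
proof -
  have *: "snd X \<in> hmors I (fst X)" and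
    p: "cpo (rk (srule \<sigma>)) (rl (srule \<sigma>)) (sctxt \<sigma>) (fst X) (lleg (srule \<sigma>)) (sk \<sigma>) (smatch \<sigma>) (sg \<sigma>)" and
    p': "cpo (rk (srule \<sigma>)) (rr (srule \<sigma>)) (sctxt \<sigma>) (fst Y) (rleg (srule \<sigma>)) (sk \<sigma>) (scomatch \<sigma>) (sh \<sigma>)"
    using c unfolding cstep_def by blast+
  show "labs C' Q' I" using labs_source[OF * X] .
  show D: "labs C' Q' (sctxt \<sigma>)" using labs_source[OF cpoD(4)[OF p] X] .
  show "labs C' Q' (fst Y)"
    using labs_cover[OF cpoD(3,4)[OF p'] _ D cpoD(8,9)[OF p']] \<rho> by (simp add: rlabs_def)
qed

lemma rlabs_map: "rlabs C Q \<rho> \<Longrightarrow> rlabs (\<kappa> ` C) (\<nu> ` Q) (map_dpoi_rule \<kappa> \<nu> \<rho>)"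
  unfolding rlabs_def by (simp add: dpoi_rule.map_sel labs_map)

text \<open>A step out of a relabelled object introduces no foreign labels: its context maps to the
  source, and its result is covered by that context and the relabelled right-hand side. Hence both
  can be lifted.\<close>

lemma cstep_unmap:
  assumes c: "cstep (map_hgraph \<kappa> \<nu> I) (map_iobj \<kappa> \<nu> X) \<sigma>' Y'" and r: "srule \<sigma>' = map_dpoi_rule \<kappa> \<nu> \<rho>"
    and X: "labs C Q (fst X)" and I: "labs C Q I" and \<rho>: "rlabs C Q \<rho>"
  obtains \<sigma> Y where "\<sigma>' = map_dpoi_step \<kappa> \<nu> \<sigma>" "Y' = map_iobj \<kappa> \<nu> Y" "srule \<sigma> = \<rho>" "cstep I X \<sigma> Y"
    "labs C Q (fst Y)" "labs C Q (sctxt \<sigma>)"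
proof -
  have l: "labs (\<kappa> ` C) (\<nu> ` Q) (fst (map_iobj \<kappa> \<nu> X))" "rlabs (\<kappa> ` C) (\<nu> ` Q) (srule \<sigma>')"
    using labs_map[OF X] rlabs_map[OF \<rho>] r by simp_all
  obtain D where D: "labs C Q D" "map_hgraph \<kappa> \<nu> D = sctxt \<sigma>'"
    using labs_lift[OF cstep_labs(2)[OF c l]] .
  obtain H where H: "labs C Q H" "map_hgraph \<kappa> \<nu> H = fst Y'"
    using labs_lift[OF cstep_labs(3)[OF c l]] .
  obtain f h D' k q g g' where \<sigma>': "\<sigma>' = Step (map_dpoi_rule \<kappa> \<nu> \<rho>) f h D' k q g g'"
    using r by (cases \<sigma>') simp
  obtain H' p where Y': "Y' = (H', p)" by (cases Y')
  have D': "D' = map_hgraph \<kappa> \<nu> D" and H': "H' = map_hgraph \<kappa> \<nu> H" using D H \<sigma>' Y' by simp_all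
  let ?\<sigma> = "Step \<rho> f h D k q g g'" and ?Y = "(H, p)"
  have \<sigma>: "\<sigma>' = map_dpoi_step \<kappa> \<nu> ?\<sigma>" and Y: "Y' = map_iobj \<kappa> \<nu> ?Y" by (simp_all add: \<sigma>' Y' D' H')
  have "cstep I X ?\<sigma> ?Y"
    using c unfolding \<sigma> Y by (subst (asm) cstep_map) (simp_all add: I X D(1) H(1) \<rho>)
  then show thesis using that[OF \<sigma> Y] H(1) D(1) by simp
qed

text \<open>From left to right the source, covered by relabelled left-hand sides, is lifted first;
  the interface and the two steps follow from it.\<close>

lemma ccrit_map:
  assumes R: "\<And>\<rho>. \<rho> \<in> \<R> \<Longrightarrow> rlabs C Q \<rho>"
  shows "ccrit (map_dpoi_rule \<kappa> \<nu> ` \<R>) cp' \<longleftrightarrow> (\<exists>cp. ccrit \<R> cp \<and> cp' = map_cpair \<kappa> \<nu> cp)"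
proof
  assume "\<exists>cp. ccrit \<R> cp \<and> cp' = map_cpair \<kappa> \<nu> cp"
  then obtain cp where cp: "ccrit \<R> cp" "cp' = map_cpair \<kappa> \<nu> cp" by blast
  obtain J X \<sigma>1 Y1 \<sigma>2 Y2 where cp': "cp = CPair J X \<sigma>1 Y1 \<sigma>2 Y2" by (cases cp)
  have *: "srule \<sigma>1 \<in> \<R>" "srule \<sigma>2 \<in> \<R>" "valid J" "cstep J X \<sigma>1 Y1" "cstep J X \<sigma>2 Y2"
    "set (fst (smatch \<sigma>1) @ fst (smatch \<sigma>2)) = {..<nv (fst X)}"
    "set (snd (smatch \<sigma>1) @ snd (smatch \<sigma>2)) = {..<ne (fst X)}"
    "cpb J (sctxt \<sigma>1) (sctxt \<sigma>2) (fst X) (si \<sigma>1) (si \<sigma>2) (sg \<sigma>1) (sg \<sigma>2)"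
    using cp(1) unfolding ccrit_def cp' cpair.sel by blast+
  have f: "smatch \<sigma>1 \<in> hmors (rl (srule \<sigma>1)) (fst X)" "smatch \<sigma>2 \<in> hmors (rl (srule \<sigma>2)) (fst X)"
    using *(4,5) unfolding cstep_def by (auto dest: cpoD)
  have S: "labs C Q (fst X)"
    using labs_cover[OF f _ _ *(6,7)] R[OF *(1)] R[OF *(2)] by (simp add: rlabs_def)
  note l1 = cstep_labs[OF *(4) S R[OF *(1)]] and l2 = cstep_labs[OF *(5) S R[OF *(2)]]
  show "ccrit (map_dpoi_rule \<kappa> \<nu> ` \<R>) cp'"
    unfolding ccrit_def cp(2) cp' cpair.map cpair.sel
    using * by (simp add: cstep_map cpb_map l1 l2 S R dpoi_step.map_sel)
next
  assume c: "ccrit (map_dpoi_rule \<kappa> \<nu> ` \<R>) cp'"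
  obtain J' X' \<sigma>1' Y1' \<sigma>2' Y2' where cp': "cp' = CPair J' X' \<sigma>1' Y1' \<sigma>2' Y2'" by (cases cp')
  have *: "srule \<sigma>1' \<in> map_dpoi_rule \<kappa> \<nu> ` \<R>" "srule \<sigma>2' \<in> map_dpoi_rule \<kappa> \<nu> ` \<R>" "valid J'"
    "cstep J' X' \<sigma>1' Y1'" "cstep J' X' \<sigma>2' Y2'"
    "set (fst (smatch \<sigma>1') @ fst (smatch \<sigma>2')) = {..<nv (fst X')}"
    "set (snd (smatch \<sigma>1') @ snd (smatch \<sigma>2')) = {..<ne (fst X')}"
    "cpb J' (sctxt \<sigma>1') (sctxt \<sigma>2') (fst X') (si \<sigma>1') (si \<sigma>2') (sg \<sigma>1') (sg \<sigma>2')"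
    using c unfolding ccrit_def cp' cpair.sel by blast+
  obtain \<rho>1 \<rho>2 where \<rho>: "\<rho>1 \<in> \<R>" "srule \<sigma>1' = map_dpoi_rule \<kappa> \<nu> \<rho>1" "\<rho>2 \<in> \<R>" "srule \<sigma>2' = map_dpoi_rule \<kappa> \<nu> \<rho>2"
    using *(1,2) by blast
  have rl: "rlabs (\<kappa> ` C) (\<nu> ` Q) (srule \<sigma>1')" "rlabs (\<kappa> ` C) (\<nu> ` Q) (srule \<sigma>2')"
    using \<rho> R rlabs_map by simp_all
  have f: "smatch \<sigma>1' \<in> hmors (rl (srule \<sigma>1')) (fst X')" "smatch \<sigma>2' \<in> hmors (rl (srule \<sigma>2')) (fst X')"
    using *(4,5) unfolding cstep_def by (auto dest: cpoD)
  have S': "labs (\<kappa> ` C) (\<nu> ` Q) (fst X')"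
    using labs_cover[OF f _ _ *(6,7)] rl by (simp add: rlabs_def)
  obtain S where S: "labs C Q S" "map_hgraph \<kappa> \<nu> S = fst X'" using labs_lift[OF S'] .
  obtain J where J: "labs C Q J" "map_hgraph \<kappa> \<nu> J = J'" using labs_lift[OF cstep_labs(1)[OF *(4) S' rl(1)]] .
  define X where "X = (S, snd X')"
  have X: "X' = map_iobj \<kappa> \<nu> X" "labs C Q (fst X)" using S by (cases X'; simp add: X_def)+
  obtain \<sigma>1 Y1 where 1: "\<sigma>1' = map_dpoi_step \<kappa> \<nu> \<sigma>1" "Y1' = map_iobj \<kappa> \<nu> Y1" "srule \<sigma>1 = \<rho>1"
    "cstep J X \<sigma>1 Y1" "labs C Q (fst Y1)" "labs C Q (sctxt \<sigma>1)"
    using cstep_unmap[OF *(4)[folded J(2), unfolded X(1)] \<rho>(2) X(2) J(1) R[OF \<rho>(1)]] .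
  obtain \<sigma>2 Y2 where 2: "\<sigma>2' = map_dpoi_step \<kappa> \<nu> \<sigma>2" "Y2' = map_iobj \<kappa> \<nu> Y2" "srule \<sigma>2 = \<rho>2"
    "cstep J X \<sigma>2 Y2" "labs C Q (fst Y2)" "labs C Q (sctxt \<sigma>2)"
    using cstep_unmap[OF *(5)[folded J(2), unfolded X(1)] \<rho>(4) X(2) J(1) R[OF \<rho>(3)]] .
  have "cpb J (sctxt \<sigma>1) (sctxt \<sigma>2) (fst X) (si \<sigma>1) (si \<sigma>2) (sg \<sigma>1) (sg \<sigma>2)"
    using *(8) cpb_map[OF J(1) 1(6) 2(6) X(2)] unfolding 1(1) 2(1) J(2) X(1)
    by (simp add: dpoi_step.map_sel)
  then have "ccrit \<R> (CPair J X \<sigma>1 Y1 \<sigma>2 Y2)"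
    unfolding ccrit_def cpair.sel using *(3,6,7) 1(1,3,4) 2(1,3,4) \<rho>(1,3) J(2)[symmetric] X(1)
    by (simp add: dpoi_step.map_sel)
  moreover have "cp' = map_cpair \<kappa> \<nu> (CPair J X \<sigma>1 Y1 \<sigma>2 Y2)"
    unfolding cp' by (simp add: 1 2 J X)
  ultimately show "\<exists>cp. ccrit \<R> cp \<and> cp' = map_cpair \<kappa> \<nu> cp" by blast
qed

end

text \<open>A code depends on the labels only through their numbers, so the algorithms may work
  throughout on hypergraphs labelled by numbers.\<close>

lemma code_hgraph_map: "code_hgraph \<kappa> \<nu> G = code_hgraph id id (map_hgraph \<kappa> \<nu> G)"
  unfolding code_hgraph_def by (simp add: case_prod_beta' comp_def)

lemma code_iobj_map: "code_iobj \<kappa> \<nu> X = code_iobj id id (map_iobj \<kappa> \<nu> X)"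
  unfolding code_iobj_def by (simp add: code_hgraph_map[of \<kappa> \<nu>])

lemma code_rule_map: "code_rule \<kappa> \<nu> \<rho> = code_rule id id (map_dpoi_rule \<kappa> \<nu> \<rho>)"
  unfolding code_rule_def by (simp add: code_hgraph_map[of \<kappa> \<nu>] dpoi_rule.map_sel)

lemma code_step_map: "code_step \<kappa> \<nu> \<sigma> = code_step id id (map_dpoi_step \<kappa> \<nu> \<sigma>)"
  unfolding code_step_def by (simp add: code_hgraph_map[of \<kappa> \<nu>] code_rule_map[of \<kappa> \<nu>] dpoi_step.map_sel)

lemma code_cpair_map: "code_cpair \<kappa> \<nu> cp = code_cpair id id (map_cpair \<kappa> \<nu> cp)"
  unfolding code_cpair_def
  by (simp add: code_hgraph_map[of \<kappa> \<nu>] code_step_map[of \<kappa> \<nu>] code_iobj_map[of \<kappa> \<nu>] cpair.map_sel)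

lemma code_system_map: "code_system \<kappa> \<nu> \<rho>s = code_system id id (map (map_dpoi_rule \<kappa> \<nu>) \<rho>s)"
  unfolding code_system_def map_map comp_def code_rule_map[of \<kappa> \<nu>, symmetric] ..

section \<open>Decidability of the description of rewriting steps\<close>

lemma bij_encode_comp: "bij t \<Longrightarrow> bij (\<lambda>x. encode (t x))"
  using bij_comp[of t encode] bij_encode by (simp add: comp_def)

text \<open>Tuples transfer the coding of products and lists to the datatypes. A value and its tuple
  receive the same code, so that constructors and selectors become computable through the identity
  on codes.\<close>

definition hgraph_tuple :: "('c, 'o) hgraph \<Rightarrow> _" where
  "hgraph_tuple G = (vcol G, edg G)"

definition rule_tuple :: "('c, 'o) dpoi_rule \<Rightarrow> _" where
  "rule_tuple \<rho> = (rl \<rho>, rk \<rho>, rr \<rho>, lleg \<rho>, rleg \<rho>)"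

definition step_tuple :: "('c, 'o) dpoi_step \<Rightarrow> _" where
  "step_tuple \<sigma> = (srule \<sigma>, smatch \<sigma>, scomatch \<sigma>, sctxt \<sigma>, sk \<sigma>, si \<sigma>, sg \<sigma>, sh \<sigma>)"

definition cpair_tuple :: "('c, 'o) cpair \<Rightarrow> _" where
  "cpair_tuple cp = (cifc cp, csrc cp, cstep1 cp, ctgt1 cp, cstep2 cp, ctgt2 cp)"

lemma bij_hgraph_tuple: "bij hgraph_tuple"
  by (rule o_bij[of "\<lambda>(a, b). HGraph a b"]) (auto simp: hgraph_tuple_def)

lemma bij_rule_tuple: "bij rule_tuple"
  by (rule o_bij[of "\<lambda>(a, b, c, d, e). Rule a b c d e"]) (auto simp: rule_tuple_def)

lemma bij_step_tuple: "bij step_tuple"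
  by (rule o_bij[of "\<lambda>(a, b, c, d, e, f, g, h). Step a b c d e f g h"]) (auto simp: step_tuple_def)

lemma bij_cpair_tuple: "bij cpair_tuple"
  by (rule o_bij[of "\<lambda>(a, b, c, d, e, f). CPair a b c d e f"]) (auto simp: cpair_tuple_def)

instantiation hgraph :: (coded, coded) coded
begin
definition "encode G = encode (hgraph_tuple G)"
definition "bdd m G = bdd m (hgraph_tuple G)"
instance
proof
  show "bij (encode :: ('a, 'b) hgraph \<Rightarrow> nat)"
    unfolding encode_hgraph_def[abs_def] by (rule bij_encode_comp[OF bij_hgraph_tuple])
  show "bdd m x \<Longrightarrow> m \<le> n \<Longrightarrow> bdd n x" "bdd (encode x) x" for m n and x :: "('a, 'b) hgraph"
    unfolding bdd_hgraph_def encode_hgraph_def by (fact bdd_mono bdd_encode)+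
  show "\<exists>b. recursive b \<and> (\<forall>m x :: ('a, 'b) hgraph. bdd m x \<longrightarrow> encode x \<le> b m)"
    unfolding bdd_hgraph_def encode_hgraph_def using recursive_code_bound encode_le_code_bound by blast
qed
end

instantiation dpoi_rule :: (coded, coded) coded
begin
definition "encode \<rho> = encode (rule_tuple \<rho>)"
definition "bdd m \<rho> = bdd m (rule_tuple \<rho>)"
instance
proof
  show "bij (encode :: ('a, 'b) dpoi_rule \<Rightarrow> nat)"
    unfolding encode_dpoi_rule_def[abs_def] by (rule bij_encode_comp[OF bij_rule_tuple])
  show "bdd m x \<Longrightarrow> m \<le> n \<Longrightarrow> bdd n x" "bdd (encode x) x" for m n and x :: "('a, 'b) dpoi_rule"
    unfolding bdd_dpoi_rule_def encode_dpoi_rule_def by (fact bdd_mono bdd_encode)+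
  show "\<exists>b. recursive b \<and> (\<forall>m x :: ('a, 'b) dpoi_rule. bdd m x \<longrightarrow> encode x \<le> b m)"
    unfolding bdd_dpoi_rule_def encode_dpoi_rule_def using recursive_code_bound encode_le_code_bound by blast
qed
end

instantiation dpoi_step :: (coded, coded) coded
begin
definition "encode \<sigma> = encode (step_tuple \<sigma>)"
definition "bdd m \<sigma> = bdd m (step_tuple \<sigma>)"
instance
proof
  show "bij (encode :: ('a, 'b) dpoi_step \<Rightarrow> nat)"
    unfolding encode_dpoi_step_def[abs_def] by (rule bij_encode_comp[OF bij_step_tuple])
  show "bdd m x \<Longrightarrow> m \<le> n \<Longrightarrow> bdd n x" "bdd (encode x) x" for m n and x :: "('a, 'b) dpoi_step"
    unfolding bdd_dpoi_step_def encode_dpoi_step_def by (fact bdd_mono bdd_encode)+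
  show "\<exists>b. recursive b \<and> (\<forall>m x :: ('a, 'b) dpoi_step. bdd m x \<longrightarrow> encode x \<le> b m)"
    unfolding bdd_dpoi_step_def encode_dpoi_step_def using recursive_code_bound encode_le_code_bound by blast
qed
end

instantiation cpair :: (coded, coded) coded
begin
definition "encode cp = encode (cpair_tuple cp)"
definition "bdd m cp = bdd m (cpair_tuple cp)"
instance
proof
  show "bij (encode :: ('a, 'b) cpair \<Rightarrow> nat)"
    unfolding encode_cpair_def[abs_def] by (rule bij_encode_comp[OF bij_cpair_tuple])
  show "bdd m x \<Longrightarrow> m \<le> n \<Longrightarrow> bdd n x" "bdd (encode x) x" for m n and x :: "('a, 'b) cpair"
    unfolding bdd_cpair_def encode_cpair_def by (fact bdd_mono bdd_encode)+
  show "\<exists>b. recursive b \<and> (\<forall>m x :: ('a, 'b) cpair. bdd m x \<longrightarrow> encode x \<le> b m)"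
    unfolding bdd_cpair_def encode_cpair_def using recursive_code_bound encode_le_code_bound by blast
qed
end

lemma computable_retype:
  assumes "\<And>y. encode (t y) = encode y" and "computable f"
  shows "computable (\<lambda>x. t (f x))"
  by (rule computable_comp[OF computableI[OF recursive_id assms(1)] assms(2)])

lemma computable_tuples:
  "computable f \<Longrightarrow> computable (\<lambda>x. hgraph_tuple (f x))"
  "computable g \<Longrightarrow> computable (\<lambda>x. rule_tuple (g x))"
  "computable h \<Longrightarrow> computable (\<lambda>x. step_tuple (h x))"
  "computable k \<Longrightarrow> computable (\<lambda>x. cpair_tuple (k x))"
  by (rule computable_retype; simp add: encode_hgraph_def encode_dpoi_rule_def encode_dpoi_step_def encode_cpair_def)+

lemma computable_hgraph [comp_intros]:
  assumes "computable f"
  shows "computable (\<lambda>x. vcol (f x))" "computable (\<lambda>x. edg (f x))"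
  using computable_fst[OF computable_tuples(1)[OF assms]] computable_snd[OF computable_tuples(1)[OF assms]]
  by (simp_all add: hgraph_tuple_def)

lemma computable_rule [comp_intros]:
  assumes "computable f"
  shows "computable (\<lambda>x. rl (f x))" "computable (\<lambda>x. rk (f x))" "computable (\<lambda>x. rr (f x))"
    "computable (\<lambda>x. lleg (f x))" "computable (\<lambda>x. rleg (f x))"
proof -
  note t = computable_tuples(2)[OF assms]
  note t1 = computable_snd[OF t] note t2 = computable_snd[OF t1] note t3 = computable_snd[OF t2]
  show "computable (\<lambda>x. rl (f x))" "computable (\<lambda>x. rk (f x))" "computable (\<lambda>x. rr (f x))"
    "computable (\<lambda>x. lleg (f x))" "computable (\<lambda>x. rleg (f x))"
    using computable_fst[OF t] computable_fst[OF t1] computable_fst[OF t2] computable_fst[OF t3] computable_snd[OF t3]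
    by (simp_all add: rule_tuple_def)
qed

lemma computable_step [comp_intros]:
  assumes "computable f"
  shows "computable (\<lambda>x. srule (f x))" "computable (\<lambda>x. smatch (f x))" "computable (\<lambda>x. scomatch (f x))"
    "computable (\<lambda>x. sctxt (f x))" "computable (\<lambda>x. sk (f x))" "computable (\<lambda>x. si (f x))"
    "computable (\<lambda>x. sg (f x))" "computable (\<lambda>x. sh (f x))"
proof -
  note t = computable_tuples(3)[OF assms]
  note t1 = computable_snd[OF t] note t2 = computable_snd[OF t1] note t3 = computable_snd[OF t2]
  note t4 = computable_snd[OF t3] note t5 = computable_snd[OF t4] note t6 = computable_snd[OF t5]
  show "computable (\<lambda>x. srule (f x))" "computable (\<lambda>x. smatch (f x))" "computable (\<lambda>x. scomatch (f x))"
    "computable (\<lambda>x. sctxt (f x))" "computable (\<lambda>x. sk (f x))" "computable (\<lambda>x. si (f x))"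
    "computable (\<lambda>x. sg (f x))" "computable (\<lambda>x. sh (f x))"
    using computable_fst[OF t] computable_fst[OF t1] computable_fst[OF t2] computable_fst[OF t3]
      computable_fst[OF t4] computable_fst[OF t5] computable_fst[OF t6] computable_snd[OF t6]
    by (simp_all add: step_tuple_def)
qed

lemma computable_cpair [comp_intros]:
  assumes "computable f"
  shows "computable (\<lambda>x. cifc (f x))" "computable (\<lambda>x. csrc (f x))" "computable (\<lambda>x. cstep1 (f x))"
    "computable (\<lambda>x. ctgt1 (f x))" "computable (\<lambda>x. cstep2 (f x))" "computable (\<lambda>x. ctgt2 (f x))"
proof -
  note t = computable_tuples(4)[OF assms]
  note t1 = computable_snd[OF t] note t2 = computable_snd[OF t1] note t3 = computable_snd[OF t2]
  note t4 = computable_snd[OF t3]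
  show "computable (\<lambda>x. cifc (f x))" "computable (\<lambda>x. csrc (f x))" "computable (\<lambda>x. cstep1 (f x))"
    "computable (\<lambda>x. ctgt1 (f x))" "computable (\<lambda>x. cstep2 (f x))" "computable (\<lambda>x. ctgt2 (f x))"
    using computable_fst[OF t] computable_fst[OF t1] computable_fst[OF t2] computable_fst[OF t3]
      computable_fst[OF t4] computable_snd[OF t4]
    by (simp_all add: cpair_tuple_def)
qed

lemma computable_HGraph [comp_intros]:
  assumes "computable f" "computable g"
  shows "computable (\<lambda>x. HGraph (f x) (g x))"
  using computable_retype[of "\<lambda>p. HGraph (fst p) (snd p)", OF _ computable_Pair[OF assms]]
  by (simp add: encode_hgraph_def hgraph_tuple_def)

lemma computable_Rule [comp_intros]:
  assumes "computable f" "computable g" "computable h" "computable k" "computable m"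
  shows "computable (\<lambda>x. Rule (f x) (g x) (h x) (k x) (m x))"
  using computable_retype[of "\<lambda>p. Rule (fst p) (fst (snd p)) (fst (snd (snd p))) (fst (snd (snd (snd p))))
      (snd (snd (snd (snd p))))",
      OF _ computable_Pair[OF assms(1) computable_Pair[OF assms(2) computable_Pair[OF assms(3) computable_Pair[OF assms(4,5)]]]]]
  by (simp add: encode_dpoi_rule_def rule_tuple_def)


subsection \<open>Formulations with bounded quantifiers\<close>

text \<open>
  The notions with prefix \<open>x\<close> index by \<open>item\<close>, which is computable also out of range, and quantify
  over lists only; on valid hypergraphs they agree with those without the prefix.
\<close>

lemma map_item: "set xs \<subseteq> {..<length ys} \<Longrightarrow> map (item ys) xs = map ((!) ys) xs"
  by (rule map_cong[OF refl]) (auto intro: item_eq_nth)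

definition xcomp :: "hmor \<Rightarrow> hmor \<Rightarrow> hmor" where
  "xcomp f g = (map (item (fst g)) (fst f), map (item (snd g)) (snd f))"

definition xact :: "nat list \<Rightarrow> 'o \<times> nat list \<times> nat list \<Rightarrow> 'o \<times> nat list \<times> nat list" where
  "xact a e = (fst e, map (item a) (fst (snd e)), map (item a) (snd (snd e)))"

definition xvalid :: "('c, 'o) hgraph \<Rightarrow> bool" where
  "xvalid G \<longleftrightarrow> (\<forall>e \<in> set (edg G). (\<forall>x \<in> set (fst (snd e)). x < nv G) \<and> (\<forall>x \<in> set (snd (snd e)). x < nv G))"

definition xhom :: "('c::coded, 'o::coded) hgraph \<Rightarrow> ('c, 'o) hgraph \<Rightarrow> hmor \<Rightarrow> bool" where
  "xhom G H f \<longleftrightarrow> (\<forall>x \<in> set (fst f). x < nv H) \<and> map (item (vcol H)) (fst f) = vcol G \<and>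
     (\<forall>x \<in> set (snd f). x < ne H) \<and> map (item (edg H)) (snd f) = map (xact (fst f)) (edg G)"

definition xpo :: "nat \<Rightarrow> nat list \<Rightarrow> nat list \<Rightarrow> nat list \<Rightarrow> nat list \<Rightarrow> bool" where
  "xpo n l k f d \<longleftrightarrow> (\<forall>x \<in> set (f @ d). x < n) \<and> (\<forall>z < n. \<exists>x \<in> set (f @ d). x = z) \<and>
     (\<forall>a \<in> set (candidates (Suc (n + length f + length d)) :: nat list list).
      \<forall>b \<in> set (candidates (Suc (n + length f + length d)) :: nat list list).
        length a = length f \<and> length b = length d \<and> (\<forall>x \<in> set (a @ b). x \<le> 1) \<and>
        map (item a) l = map (item b) k \<longrightarrow>
        (\<exists>c \<in> set (candidates (Suc (n + length f + length d))). length c = n \<and> map (item c) f = a \<and> map (item c) d = b))"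

definition xpb :: "nat list \<Rightarrow> nat list \<Rightarrow> nat list \<Rightarrow> nat list \<Rightarrow> bool" where
  "xpb j1 j2 c1 c2 \<longleftrightarrow> length j1 = length j2 \<and>
     (\<forall>i < length j1. item j1 i < length c1 \<and> item j2 i < length c2 \<and> item c1 (item j1 i) = item c2 (item j2 i) \<and>
        (\<forall>i' < i. \<not> (item j1 i = item j1 i' \<and> item j2 i = item j2 i'))) \<and>
     (\<forall>x < length c1. \<forall>y < length c2. item c1 x = item c2 y \<longrightarrow>
        (\<exists>i < length j1. item j1 i = x \<and> item j2 i = y))"

definition xcpo where
  "xcpo K L D G l k f d \<longleftrightarrow> xhom K L l \<and> xhom K D k \<and> xhom L G f \<and> xhom D G d \<and> xcomp l f = xcomp k d \<and>
     xpo (nv G) (fst l) (fst k) (fst f) (fst d) \<and> xpo (ne G) (snd l) (snd k) (snd f) (snd d)"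

definition xcpb where
  "xcpb J C1 C2 S j1 j2 c1 c2 \<longleftrightarrow> xhom J C1 j1 \<and> xhom J C2 j2 \<and> xhom C1 S c1 \<and> xhom C2 S c2 \<and>
     xcomp j1 c1 = xcomp j2 c2 \<and> xpb (fst j1) (fst j2) (fst c1) (fst c2) \<and> xpb (snd j1) (snd j2) (snd c1) (snd c2)"

definition xstep :: "('c::coded, 'o::coded) hgraph \<Rightarrow> ('c, 'o) iobj \<Rightarrow> ('c, 'o) dpoi_step \<Rightarrow> ('c, 'o) iobj \<Rightarrow> bool" where
  "xstep I X \<sigma> Y \<longleftrightarrow> xhom I (fst X) (snd X) \<and> xhom I (fst Y) (snd Y) \<and>
     xvalid (sctxt \<sigma>) \<and> xhom I (sctxt \<sigma>) (si \<sigma>) \<and>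
     xcpo (rk (srule \<sigma>)) (rl (srule \<sigma>)) (sctxt \<sigma>) (fst X) (lleg (srule \<sigma>)) (sk \<sigma>) (smatch \<sigma>) (sg \<sigma>) \<and>
     xcpo (rk (srule \<sigma>)) (rr (srule \<sigma>)) (sctxt \<sigma>) (fst Y) (rleg (srule \<sigma>)) (sk \<sigma>) (scomatch \<sigma>) (sh \<sigma>) \<and>
     snd X = xcomp (si \<sigma>) (sg \<sigma>) \<and> snd Y = xcomp (si \<sigma>) (sh \<sigma>)"

text \<open>Membership of a rule in the list is phrased by a bounded quantifier and an equation, the
  shape that the closure rules for \<open>decidable\<close> handle; surjectivity of the matches is
  phrased likewise.\<close>

definition xcrit :: "('c::coded, 'o::coded) dpoi_rule list \<Rightarrow> ('c, 'o) cpair \<Rightarrow> bool" where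
  "xcrit \<rho>s cp \<longleftrightarrow> (\<exists>\<rho> \<in> set \<rho>s. srule (cstep1 cp) = \<rho>) \<and> (\<exists>\<rho> \<in> set \<rho>s. srule (cstep2 cp) = \<rho>) \<and> xvalid (cifc cp) \<and>
     xstep (cifc cp) (csrc cp) (cstep1 cp) (ctgt1 cp) \<and> xstep (cifc cp) (csrc cp) (cstep2 cp) (ctgt2 cp) \<and>
     (\<forall>z < nv (fst (csrc cp)). \<exists>x \<in> set (fst (smatch (cstep1 cp)) @ fst (smatch (cstep2 cp))). x = z) \<and>
     (\<forall>z < ne (fst (csrc cp)). \<exists>x \<in> set (snd (smatch (cstep1 cp)) @ snd (smatch (cstep2 cp))). x = z) \<and>
     xcpb (cifc cp) (sctxt (cstep1 cp)) (sctxt (cstep2 cp)) (fst (csrc cp))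
       (si (cstep1 cp)) (si (cstep2 cp)) (sg (cstep1 cp)) (sg (cstep2 cp))"

definition xid :: "('c, 'o) hgraph \<Rightarrow> hmor" where
  "xid G = ([0..<nv G], [0..<ne G])"

definition xiso :: "('c::coded, 'o::coded) iobj \<Rightarrow> ('c, 'o) iobj \<Rightarrow> bool" where
  "xiso X Y \<longleftrightarrow> (\<exists>u \<in> set (candidates (nv (fst X) + ne (fst X) + nv (fst Y) + ne (fst Y))).
     \<exists>v \<in> set (candidates (nv (fst X) + ne (fst X) + nv (fst Y) + ne (fst Y))).
     xhom (fst X) (fst Y) u \<and> xhom (fst Y) (fst X) v \<and> xcomp u v = xid (fst X) \<and> xcomp v u = xid (fst Y) \<and>
     xcomp (snd X) u = snd Y)"

lemma computable_xact [comp_intros]: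
  assumes "computable f" "computable g"
  shows "computable (\<lambda>x. xact (f x) (g x))"
proof -
  have "computable (\<lambda>p. xact (fst p) (snd p))"
    unfolding xact_def by (intro comp_intros)
  from computable_comp[OF this computable_Pair[OF assms]] show ?thesis by simp
qed

lemma computable_xcomp [comp_intros]:
  assumes "computable f" "computable g"
  shows "computable (\<lambda>x. xcomp (f x) (g x))"
proof -
  have "computable (\<lambda>p. xcomp (fst p) (snd p))"
    unfolding xcomp_def by (intro comp_intros)
  from computable_comp[OF this computable_Pair[OF assms]] show ?thesis by simp
qed

lemma computable_xid [comp_intros]: "computable f \<Longrightarrow> computable (\<lambda>x. xid (f x))"
  unfolding xid_def by (intro comp_intros)

lemma decidable_xvalid [comp_intros]:
  assumes "computable f"
  shows "decidable (\<lambda>x. xvalid (f x))"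
proof -
  have "decidable (\<lambda>G. xvalid G)"
    unfolding xvalid_def by (intro comp_intros)
  from decidable_comp[OF this assms] show ?thesis .
qed

lemma decidable_xhom [comp_intros]:
  assumes "computable G" "computable H" "computable f"
  shows "decidable (\<lambda>x. xhom (G x) (H x) (f x))"
proof -
  have "decidable (\<lambda>p. xhom (fst p) (fst (snd p)) (snd (snd p)))"
    unfolding xhom_def by (intro comp_intros)
  from decidable_comp[OF this computable_Pair[OF assms(1) computable_Pair[OF assms(2,3)]]] show ?thesis by simp
qed

lemma decidable_xpo [comp_intros]:
  assumes "computable n" "computable l" "computable k" "computable f" "computable d"
  shows "decidable (\<lambda>x. xpo (n x) (l x) (k x) (f x) (d x))"
proof -
  have "decidable (\<lambda>p. xpo (fst p) (fst (snd p)) (fst (snd (snd p))) (fst (snd (snd (snd p)))) (snd (snd (snd (snd p)))))"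
    unfolding xpo_def by (intro comp_intros)
  from decidable_comp[OF this computable_Pair[OF assms(1) computable_Pair[OF assms(2)
      computable_Pair[OF assms(3) computable_Pair[OF assms(4,5)]]]]] show ?thesis by simp
qed

lemma decidable_xpb [comp_intros]:
  assumes "computable j1" "computable j2" "computable c1" "computable c2"
  shows "decidable (\<lambda>x. xpb (j1 x) (j2 x) (c1 x) (c2 x))"
proof -
  have "decidable (\<lambda>p. xpb (fst p) (fst (snd p)) (fst (snd (snd p))) (snd (snd (snd p))))"
    unfolding xpb_def by (intro comp_intros)
  from decidable_comp[OF this computable_Pair[OF assms(1) computable_Pair[OF assms(2)
      computable_Pair[OF assms(3,4)]]]] show ?thesis by simp
qed

lemma decidable_xcpo [comp_intros]:
  assumes "computable K" "computable L" "computable D" "computable G"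
    "computable l" "computable k" "computable f" "computable d"
  shows "decidable (\<lambda>x. xcpo (K x) (L x) (D x) (G x) (l x) (k x) (f x) (d x))"
  unfolding xcpo_def by (intro comp_intros assms)

lemma decidable_xcpb [comp_intros]:
  assumes "computable J" "computable C1" "computable C2" "computable S"
    "computable j1" "computable j2" "computable c1" "computable c2"
  shows "decidable (\<lambda>x. xcpb (J x) (C1 x) (C2 x) (S x) (j1 x) (j2 x) (c1 x) (c2 x))"
  unfolding xcpb_def by (intro comp_intros assms)

lemma decidable_xstep [comp_intros]:
  assumes "computable I" "computable X" "computable \<sigma>" "computable Y"
  shows "decidable (\<lambda>x. xstep (I x) (X x) (\<sigma> x) (Y x))"
  unfolding xstep_def by (intro comp_intros assms)

lemma decidable_xcrit [comp_intros]:
  assumes "computable \<rho>s" "computable cp"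
  shows "decidable (\<lambda>x. xcrit (\<rho>s x) (cp x))"
proof -
  have "decidable (\<lambda>p. xcrit (fst p) (snd p))"
    unfolding xcrit_def by (intro comp_intros)
  from decidable_comp[OF this computable_Pair[OF assms]] show ?thesis by simp
qed

lemma decidable_xiso [comp_intros]:
  assumes "computable X" "computable Y"
  shows "decidable (\<lambda>x. xiso (X x) (Y x))"
proof -
  have "decidable (\<lambda>p. xiso (fst p) (snd p))"
    unfolding xiso_def by (intro comp_intros)
  from decidable_comp[OF this computable_Pair[OF assms]] show ?thesis by simp
qed

section \<open>Agreement with the unbounded formulations\<close>

lemma xvalid_iff: "xvalid G \<longleftrightarrow> valid G"
  unfolding xvalid_def valid_def edge_in_def by auto

lemma xact_eq: "edge_in (length a) e \<Longrightarrow> xact a e = act a e"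
  unfolding xact_def act_def edge_in_def by (auto simp: item_eq_nth)

lemma xhom_iff:
  assumes "valid G"
  shows "xhom G H f \<longleftrightarrow> f \<in> hmors G H"
proof -
  have *: "map (xact (fst f)) (edg G) = map (act (fst f)) (edg G)" if "length (fst f) = nv G"
    using assms that unfolding valid_def by (auto intro: xact_eq)
  show ?thesis
  proof
    assume x: "xhom G H f"
    then have r: "set (fst f) \<subseteq> {..<nv H}" "set (snd f) \<subseteq> {..<ne H}" unfolding xhom_def by auto
    moreover have "length (fst f) = nv G" using x unfolding xhom_def by (metis length_map)
    ultimately show "f \<in> hmors G H" using x * unfolding xhom_def hmors_iff by (simp add: map_item)
  next
    assume f: "f \<in> hmors G H"
    then show "xhom G H f"
      using * hmors_len[OF f] hmors_range[OF f] unfolding xhom_def hmors_iff by (auto simp: map_item)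
  qed
qed

lemma xcomp_eq: "f \<in> hmors G H \<Longrightarrow> g \<in> hmors H X \<Longrightarrow> xcomp f g = f ;; g"
  unfolding xcomp_def hcomp_def using hmors_range[of f G H] hmors_len[of g H X] by (simp add: map_item)

lemma bdd_nat_list: "bdd m (xs :: nat list) \<longleftrightarrow> length xs \<le> m \<and> (\<forall>x \<in> set xs. x \<le> m)"
  by (simp add: bdd_list_def bdd_nat_def)

lemma xpo_iff:
  assumes l: "set l \<subseteq> {..<length f}" and k: "set k \<subseteq> {..<length d}"
  shows "xpo n l k f d \<longleftrightarrow> set_po n l k f d"
proof -
  let ?N = "Suc (n + length f + length d)"
  have cover: "(\<forall>x \<in> set (f @ d). x < n) \<and> (\<forall>z < n. \<exists>x \<in> set (f @ d). x = z) \<longleftrightarrow> set (f @ d) = {..<n}"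
    by (auto simp: set_eq_iff)
  have exc: "(\<exists>c \<in> set (candidates ?N). length c = n \<and> map (item c) f = a \<and> map (item c) d = b) \<longleftrightarrow>
      (\<exists>c. length c = n \<and> map ((!) c) f = a \<and> map ((!) c) d = b)"
    if cov: "set (f @ d) = {..<n}" and ab: "set a \<union> set b \<subseteq> {0, 1 :: nat}" for a b
  proof -
    have r: "set f \<subseteq> {..<n}" "set d \<subseteq> {..<n}" using cov by auto
    have "c \<in> set (candidates ?N)" if c: "length c = n" "map ((!) c) f = a" "map ((!) c) d = b" for c
    proof (rule bdd_in_candidates)
      \<comment> \<open>Every index of \<open>c\<close> is hit by \<open>f\<close> or
        \<open>d\<close>, so the entries of \<open>c\<close> occur among those of \<open>a\<close>
        and \<open>b\<close> and obey the same bound.\<close>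
      have "x \<le> 1" if x: "x \<in> set c" for x
      proof -
        obtain z where z: "z < n" "c ! z = x" using x c(1) by (auto simp: in_set_conv_nth)
        then have "z \<in> set (f @ d)" using cov by simp
        then have "x \<in> set (map ((!) c) f) \<union> set (map ((!) c) d)" using z by auto
        then show ?thesis using c ab by auto
      qed
      then show "bdd ?N c" unfolding bdd_nat_list using c(1) by fastforce
    qed
    then show ?thesis using r by (auto simp: map_item)
  qed
  have mp: "map (item a) l = map (item b) k \<longleftrightarrow> map ((!) a) l = map ((!) b) k"
    if "length a = length f" "length b = length d" for a b :: "nat list"
    using l k that by (simp add: map_item)
  have cand: "a \<in> set (candidates ?N)" "b \<in> set (candidates ?N)"
    if "length a = length f" "length b = length d" "set a \<union> set b \<subseteq> {0, 1}" for a b :: "nat list"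
    using that by (auto intro!: bdd_in_candidates simp: bdd_nat_list)
  have le1: "(\<forall>x \<in> set (a @ b). x \<le> 1) \<longleftrightarrow> set a \<union> set b \<subseteq> {0, 1}" for a b :: "nat list"
    by (auto simp: subset_iff le_Suc_eq)
  show ?thesis
  proof
    assume x: "xpo n l k f d"
    then have cov: "set (f @ d) = {..<n}" using cover unfolding xpo_def by blast
    show "set_po n l k f d"
      unfolding set_po_def
    proof (intro conjI allI impI)
      fix a b :: "nat list"
      assume *: "length a = length f \<and> length b = length d \<and> set a \<union> set b \<subseteq> {0, 1} \<and> map ((!) a) l = map ((!) b) k"
      then have "\<exists>c \<in> set (candidates ?N). length c = n \<and> map (item c) f = a \<and> map (item c) d = b"
        using x cand[of a b] mp[of a b] le1[of a b] unfolding xpo_def by blast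
      then show "\<exists>c. length c = n \<and> map ((!) c) f = a \<and> map ((!) c) d = b"
        using exc[OF cov, of a b] * by blast
    qed (fact cov)
  next
    assume x: "set_po n l k f d"
    then have cov: "set (f @ d) = {..<n}" unfolding set_po_def by blast
    show "xpo n l k f d"
      unfolding xpo_def
    proof (intro conjI ballI impI)
      show "\<forall>z < n. \<exists>x \<in> set (f @ d). x = z" "\<And>x. x \<in> set (f @ d) \<Longrightarrow> x < n" using cov by auto
      fix a b :: "nat list"
      assume *: "length a = length f \<and> length b = length d \<and> (\<forall>x \<in> set (a @ b). x \<le> 1) \<and> map (item a) l = map (item b) k"
      then have ab: "set a \<union> set b \<subseteq> {0, 1}" using le1 by blast
      have "\<exists>c. length c = n \<and> map ((!) c) f = a \<and> map ((!) c) d = b"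
        using x ab * mp[of a b] unfolding set_po_def by blast
      then show "\<exists>c \<in> set (candidates ?N). length c = n \<and> map (item c) f = a \<and> map (item c) d = b"
        using exc[OF cov ab] by blast
    qed
  qed
qed

lemma xpb_iff: "xpb j1 j2 c1 c2 \<longleftrightarrow> set_pb j1 j2 c1 c2"
proof (cases "length j1 = length j2")
  case len: True
  have 1: "(\<forall>i < length j1. item j1 i < length c1 \<and> item j2 i < length c2 \<and> item c1 (item j1 i) = item c2 (item j2 i) \<and>
        (\<forall>i' < i. \<not> (item j1 i = item j1 i' \<and> item j2 i = item j2 i'))) \<longleftrightarrow>
      (\<forall>i < length j1. j1 ! i < length c1 \<and> j2 ! i < length c2 \<and> c1 ! (j1 ! i) = c2 ! (j2 ! i)) \<and>
      (\<forall>i < length j1. \<forall>i' < i. \<not> (j1 ! i = j1 ! i' \<and> j2 ! i = j2 ! i'))"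
    using len by (auto simp: item_eq_nth)
  have 2: "(\<forall>i < length j1. j1 ! i < length c1 \<and> j2 ! i < length c2 \<and> c1 ! (j1 ! i) = c2 ! (j2 ! i)) \<longleftrightarrow>
      set (zip j1 j2) \<subseteq> {(x, y). x < length c1 \<and> y < length c2 \<and> c1 ! x = c2 ! y}"
    using len by (auto simp: set_zip)
  have 3: "(\<forall>i < length j1. \<forall>i' < i. \<not> (j1 ! i = j1 ! i' \<and> j2 ! i = j2 ! i')) \<longleftrightarrow> distinct (zip j1 j2)"
    unfolding distinct_conv_nth using len by auto (metis linorder_neqE_nat)
  have 4: "(\<forall>x < length c1. \<forall>y < length c2. item c1 x = item c2 y \<longrightarrow>
        (\<exists>i < length j1. item j1 i = x \<and> item j2 i = y)) \<longleftrightarrow>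
      {(x, y). x < length c1 \<and> y < length c2 \<and> c1 ! x = c2 ! y} \<subseteq> set (zip j1 j2)"
    using len by (fastforce simp: set_zip item_eq_nth)
  show ?thesis
    unfolding xpb_def set_pb_def 1 2 3 4 using len by blast
qed (simp add: xpb_def set_pb_def)

text \<open>Out of range \<open>item\<close> and \<open>nth\<close> may differ, so composites and
  gluing can be compared only once the four maps are known to be homomorphisms; if one of them is
  not, both sides fail.\<close>

lemma xcpo_iff:
  assumes v: "valid K" "valid L" "valid D"
  shows "xcpo K L D G l k f d \<longleftrightarrow> cpo K L D G l k f d"
proof (cases "l \<in> hmors K L \<and> k \<in> hmors K D \<and> f \<in> hmors L G \<and> d \<in> hmors D G")
  case True
  then have h: "l \<in> hmors K L" "k \<in> hmors K D" "f \<in> hmors L G" "d \<in> hmors D G" by blast+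
  show ?thesis
    unfolding xcpo_def cpo_def xhom_iff[OF v(1)] xhom_iff[OF v(2)] xhom_iff[OF v(3)]
      xcomp_eq[OF h(1,3)] xcomp_eq[OF h(2,4)]
    using h hmors_range[OF h(1)] hmors_range[OF h(2)] hmors_len[OF h(3)] hmors_len[OF h(4)]
    by (simp add: xpo_iff)
next
  case False
  then show ?thesis
    unfolding xcpo_def cpo_def xhom_iff[OF v(1)] xhom_iff[OF v(2)] xhom_iff[OF v(3)] by blast
qed

lemma xcpb_iff:
  assumes v: "valid J" "valid C1" "valid C2"
  shows "xcpb J C1 C2 S j1 j2 c1 c2 \<longleftrightarrow> cpb J C1 C2 S j1 j2 c1 c2"
proof (cases "j1 \<in> hmors J C1 \<and> j2 \<in> hmors J C2 \<and> c1 \<in> hmors C1 S \<and> c2 \<in> hmors C2 S")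
  case True
  then have h: "j1 \<in> hmors J C1" "c1 \<in> hmors C1 S" "j2 \<in> hmors J C2" "c2 \<in> hmors C2 S" by blast+
  show ?thesis
    unfolding xcpb_def cpb_def xhom_iff[OF v(1)] xhom_iff[OF v(2)] xhom_iff[OF v(3)]
      xcomp_eq[OF h(1,2)] xcomp_eq[OF h(3,4)] xpb_iff ..
next
  case False
  then show ?thesis
    unfolding xcpb_def cpb_def xhom_iff[OF v(1)] xhom_iff[OF v(2)] xhom_iff[OF v(3)] by blast
qed

definition rvalid :: "('c, 'o) dpoi_rule \<Rightarrow> bool" where
  "rvalid \<rho> \<longleftrightarrow> valid (rl \<rho>) \<and> valid (rk \<rho>) \<and> valid (rr \<rho>)"

lemma xstep_iff:
  assumes v: "valid I" "rvalid (srule \<sigma>)"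
  shows "xstep I X \<sigma> Y \<longleftrightarrow> cstep I X \<sigma> Y"
proof (cases "valid (sctxt \<sigma>) \<and> si \<sigma> \<in> hmors I (sctxt \<sigma>) \<and> sg \<sigma> \<in> hmors (sctxt \<sigma>) (fst X) \<and> sh \<sigma> \<in> hmors (sctxt \<sigma>) (fst Y)")
  case True
  then have h: "valid (sctxt \<sigma>)" "si \<sigma> \<in> hmors I (sctxt \<sigma>)" "sg \<sigma> \<in> hmors (sctxt \<sigma>) (fst X)" "sh \<sigma> \<in> hmors (sctxt \<sigma>) (fst Y)"
    by blast+
  have r: "valid (rl (srule \<sigma>))" "valid (rk (srule \<sigma>))" "valid (rr (srule \<sigma>))" using v(2) by (simp_all add: rvalid_def)
  show ?thesis
    unfolding xstep_def cstep_def xhom_iff[OF v(1)] xvalid_iff xcomp_eq[OF h(2,3)] xcomp_eq[OF h(2,4)]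
      xcpo_iff[OF r(2,1) h(1)] xcpo_iff[OF r(2,3) h(1)] ..
next
  case False
  then show ?thesis
    unfolding xstep_def cstep_def xhom_iff[OF v(1)] xvalid_iff xcpo_def cpo_def
    using xhom_iff[of "sctxt \<sigma>"] by blast
qed

lemma xcrit_iff:
  assumes R: "\<And>\<rho>. \<rho> \<in> set \<rho>s \<Longrightarrow> rvalid \<rho>"
  shows "xcrit \<rho>s cp \<longleftrightarrow> ccrit (set \<rho>s) cp"
proof (cases "srule (cstep1 cp) \<in> set \<rho>s \<and> srule (cstep2 cp) \<in> set \<rho>s \<and> valid (cifc cp) \<and>
    cstep (cifc cp) (csrc cp) (cstep1 cp) (ctgt1 cp) \<and> cstep (cifc cp) (csrc cp) (cstep2 cp) (ctgt2 cp)")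
  case True
  then have h: "valid (cifc cp)" "rvalid (srule (cstep1 cp))" "rvalid (srule (cstep2 cp))"
    and c: "cstep (cifc cp) (csrc cp) (cstep1 cp) (ctgt1 cp)" "cstep (cifc cp) (csrc cp) (cstep2 cp) (ctgt2 cp)"
    using R by blast+
  have v: "valid (sctxt (cstep1 cp))" "valid (sctxt (cstep2 cp))" using c unfolding cstep_def by blast+
  have f: "smatch (cstep1 cp) \<in> hmors (rl (srule (cstep1 cp))) (fst (csrc cp))"
    "smatch (cstep2 cp) \<in> hmors (rl (srule (cstep2 cp))) (fst (csrc cp))"
    using c unfolding cstep_def by (auto dest: cpoD)
  have cov: "(\<forall>z < n. \<exists>x \<in> set (a @ b). x = z) \<longleftrightarrow> set (a @ b) = {..<n}"
    if "set a \<subseteq> {..<n}" "set b \<subseteq> {..<n}" for n and a b :: "nat list"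
    using that by (auto simp: set_eq_iff)
  show ?thesis
    unfolding xcrit_def ccrit_def xvalid_iff xstep_iff[OF h(1,2)] xstep_iff[OF h(1,3)] xcpb_iff[OF h(1) v]
      cov[OF hmors_range(1)[OF f(1)] hmors_range(1)[OF f(2)]] cov[OF hmors_range(2)[OF f(1)] hmors_range(2)[OF f(2)]]
    by simp
next
  case False
  then show ?thesis
    unfolding xcrit_def ccrit_def xvalid_iff using xstep_iff[of "cifc cp"] R by blast
qed

lemma bdd_hmor:
  assumes f: "f \<in> hmors A B" and m: "nv A \<le> m" "ne A \<le> m" "nv B \<le> m" "ne B \<le> m"
  shows "bdd m f"
proof -
  have "\<forall>x \<in> set (fst f). x \<le> m" "\<forall>x \<in> set (snd f). x \<le> m"
    using hmors_range[OF f] m by fastforce+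
  then show ?thesis
    unfolding bdd_prod_def bdd_nat_list using hmors_len[OF f] m by simp
qed

lemma xiso_iff:
  assumes v: "valid (fst X)" "valid (fst Y)" and r: "snd X \<in> hmors I (fst X)"
  shows "xiso X Y \<longleftrightarrow> (\<exists>u \<in> hmors (fst X) (fst Y). \<exists>v \<in> hmors (fst Y) (fst X).
    u ;; v = hid (fst X) \<and> v ;; u = hid (fst Y) \<and> snd X ;; u = snd Y)"
proof -
  let ?m = "nv (fst X) + ne (fst X) + nv (fst Y) + ne (fst Y)"
  have cand: "u \<in> set (candidates ?m)" if "u \<in> hmors (fst X) (fst Y) \<or> u \<in> hmors (fst Y) (fst X)" for u
    using that by (auto intro!: bdd_in_candidates elim: bdd_hmor)
  have eq: "xcomp u v = u ;; v" "xcomp v u = v ;; u" "xcomp (snd X) u = snd X ;; u"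
    if "u \<in> hmors (fst X) (fst Y)" "v \<in> hmors (fst Y) (fst X)" for u v
    using xcomp_eq[OF that] xcomp_eq[OF that(2,1)] xcomp_eq[OF r that(1)] .
  have xid: "xid G = hid G" for G :: "('a, 'b) hgraph" by (simp add: xid_def hid_def)
  show ?thesis
  proof
    assume "xiso X Y"
    then obtain u v where u: "u \<in> hmors (fst X) (fst Y)" "v \<in> hmors (fst Y) (fst X)"
      and uv: "xcomp u v = hid (fst X)" "xcomp v u = hid (fst Y)" "xcomp (snd X) u = snd Y"
      unfolding xiso_def xhom_iff[OF v(1)] xhom_iff[OF v(2)] xid by blast
    show "\<exists>u \<in> hmors (fst X) (fst Y). \<exists>v \<in> hmors (fst Y) (fst X).
        u ;; v = hid (fst X) \<and> v ;; u = hid (fst Y) \<and> snd X ;; u = snd Y"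
      using u uv[unfolded eq[OF u]] by blast
  next
    assume "\<exists>u \<in> hmors (fst X) (fst Y). \<exists>v \<in> hmors (fst Y) (fst X).
        u ;; v = hid (fst X) \<and> v ;; u = hid (fst Y) \<and> snd X ;; u = snd Y"
    then obtain u v where u: "u \<in> hmors (fst X) (fst Y)" "v \<in> hmors (fst Y) (fst X)"
      and uv: "u ;; v = hid (fst X)" "v ;; u = hid (fst Y)" "snd X ;; u = snd Y"
      by blast
    show "xiso X Y"
      unfolding xiso_def xhom_iff[OF v(1)] xhom_iff[OF v(2)] xid
      using u uv[folded eq[OF u]] cand by blast
  qed
qed

section \<open>Bounds\<close>

lemma set_po_card: "set_po n l k f d \<Longrightarrow> n \<le> length f + length d"
  unfolding set_po_def using card_length[of "f @ d"] by simp

text \<open>Off the image of \<open>k\<close> the context embeds into the apex, by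
  \<open>set_po_inj\<close>. This bounds all pushout complements of a match, also for rules with a
  non-injective left leg.\<close>

lemma set_po_card_context:
  assumes po: "set_po n l k f c" and k: "set k \<subseteq> {..<length c}" and l: "set l \<subseteq> {..<length f}"
    and len: "length l = length k"
  shows "length c \<le> length k + n"
proof -
  let ?Y = "{..<length c} - set k"
  have "inj_on ((!) c) ?Y"
    using set_po_inj[OF po k len l] by (auto simp: inj_on_def)
  moreover have "(!) c ` ?Y \<subseteq> {..<n}"
    using po unfolding set_po_def by auto
  ultimately have "card ?Y \<le> n"
    using card_inj_on_le[of "(!) c" ?Y "{..<n}"] by simp
  moreover have "length c \<le> card (set k) + card ?Y"
    using card_mono[of "set k \<union> ?Y" "{..<length c}"] card_Un_le[of "set k" ?Y] by simp
  ultimately show ?thesis using card_length[of k] by linarith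
qed

lemma set_pb_card:
  assumes "set_pb j1 j2 c1 c2"
  shows "length j1 \<le> length c1 * length c2"
proof -
  have "length j1 = card (set (zip j1 j2))"
    using assms distinct_card[of "zip j1 j2"] unfolding set_pb_def by simp
  also have "\<dots> \<le> card ({..<length c1} \<times> {..<length c2})"
    using assms unfolding set_pb_def by (intro card_mono) auto
  finally show ?thesis by simp
qed

lemma bdd_hgraph_iff:
  fixes G :: "(nat, nat) hgraph"
  shows "bdd m G \<longleftrightarrow> nv G \<le> m \<and> ne G \<le> m \<and> (\<forall>c \<in> set (vcol G). c \<le> m) \<and>
    (\<forall>e \<in> set (edg G). fst e \<le> m \<and> bdd m (fst (snd e)) \<and> bdd m (snd (snd e)))"
  unfolding bdd_hgraph_def hgraph_tuple_def bdd_prod_def bdd_list_def[of m "vcol G"] bdd_list_def[of m "edg G"]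
    bdd_nat_def fst_conv snd_conv by blast

text \<open>Colours, labels and the lengths of source and target lists are those of the images in
  \<open>G\<close>, while the positions in these lists are bounded by the number of nodes of
  \<open>D\<close>.\<close>

lemma bdd_source:
  fixes G :: "(nat, nat) hgraph"
  assumes h: "h \<in> hmors D G" and D: "valid D" and G: "bdd m G" and n: "nv D \<le> n" "ne D \<le> n" "m \<le> n"
  shows "bdd n D"
proof -
  have len: "length (fst h) = nv D" using hmors_len[OF h] by simp
  have "set (map ((!) (vcol G)) (fst h)) \<subseteq> set (vcol G)" "set (map ((!) (edg G)) (snd h)) \<subseteq> set (edg G)"
    using hmors_range[OF h] by auto
  then have sub: "set (vcol D) \<subseteq> set (vcol G)" "\<And>e. e \<in> set (edg D) \<Longrightarrow> act (fst h) e \<in> set (edg G)"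
    using h unfolding hmors_iff by auto
  have "fst e \<le> n \<and> bdd n (fst (snd e)) \<and> bdd n (snd (snd e))" if e: "e \<in> set (edg D)" for e
  proof -
    have "fst (act (fst h) e) \<le> m" "bdd m (fst (snd (act (fst h) e)))" "bdd m (snd (snd (act (fst h) e)))"
      using G sub(2)[OF e] unfolding bdd_hgraph_iff by blast+
    then have "fst e \<le> m" "length (fst (snd e)) \<le> m" "length (snd (snd e)) \<le> m"
      by (simp_all add: act_def bdd_nat_list)
    moreover have "edge_in (nv D) e" using D e by (simp add: valid_def)
    ultimately show ?thesis using n unfolding edge_in_def bdd_nat_list by fastforce
  qed
  moreover have "\<forall>c \<in> set (vcol D). c \<le> n" using G sub(1) n(3) unfolding bdd_hgraph_iff by fastforce
  ultimately show ?thesis unfolding bdd_hgraph_iff using n by blast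
qed

lemma bdd_cover:
  fixes G :: "(nat, nat) hgraph"
  assumes f: "f \<in> hmors L G" and d: "d \<in> hmors D G" and v: "valid L" "valid D" and b: "bdd m L" "bdd m D"
    and FV: "set (fst f @ fst d) = {..<nv G}" and FE: "set (snd f @ snd d) = {..<ne G}"
    and n: "nv G \<le> n" "ne G \<le> n" "m \<le> n"
  shows "bdd n G"
proof -
  note 1 = cover_vcol[OF f d FV] and 2 = cover_edg[OF f d FE]
  have "fst (act (fst a) e) \<le> n \<and> bdd n (fst (snd (act (fst a) e))) \<and> bdd n (snd (snd (act (fst a) e)))"
    if a: "a \<in> hmors A G" and A: "valid A" "bdd m A" and e: "e \<in> set (edg A)" for a e and A :: "(nat, nat) hgraph"
  proof -
    have "fst e \<le> m" "length (fst (snd e)) \<le> m" "length (snd (snd e)) \<le> m"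
      using A(2) e unfolding bdd_hgraph_iff bdd_nat_list by blast+
    moreover have "edge_in (nv G) (act (fst a) e)"
      using A(1) e hmors_len[OF a] hmors_range[OF a] by (intro act_in) (simp_all add: valid_def)
    ultimately show ?thesis using n unfolding edge_in_def bdd_nat_list act_def by fastforce
  qed
  then have "\<forall>e \<in> set (edg G). fst e \<le> n \<and> bdd n (fst (snd e)) \<and> bdd n (snd (snd e))"
    unfolding 2 using f d v b by blast
  moreover have "\<forall>c \<in> set (vcol G). c \<le> n" unfolding 1 using b n(3) unfolding bdd_hgraph_iff by fastforce
  ultimately show ?thesis unfolding bdd_hgraph_iff using n by blast
qed

lemma bdd_rule: "bdd m \<rho> \<longleftrightarrow> bdd m (rl \<rho>) \<and> bdd m (rk \<rho>) \<and> bdd m (rr \<rho>) \<and> bdd m (lleg \<rho>) \<and> bdd m (rleg \<rho>)"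
  by (simp add: bdd_dpoi_rule_def rule_tuple_def bdd_prod_def)

lemma bdd_step: "bdd m \<sigma> \<longleftrightarrow> bdd m (srule \<sigma>) \<and> bdd m (smatch \<sigma>) \<and> bdd m (scomatch \<sigma>) \<and> bdd m (sctxt \<sigma>) \<and>
    bdd m (sk \<sigma>) \<and> bdd m (si \<sigma>) \<and> bdd m (sg \<sigma>) \<and> bdd m (sh \<sigma>)"
  by (simp add: bdd_dpoi_step_def step_tuple_def bdd_prod_def)

lemma bdd_cpair: "bdd m cp \<longleftrightarrow> bdd m (cifc cp) \<and> bdd m (csrc cp) \<and> bdd m (cstep1 cp) \<and> bdd m (ctgt1 cp) \<and>
    bdd m (cstep2 cp) \<and> bdd m (ctgt2 cp)"
  by (simp add: bdd_cpair_def cpair_tuple_def bdd_prod_def)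

lemma bdd_sizes: "bdd m G \<Longrightarrow> nv G \<le> m" "bdd m G \<Longrightarrow> ne G \<le> m"
  for G :: "(nat, nat) hgraph"
  unfolding bdd_hgraph_iff by simp_all

lemma context_size:
  assumes po: "cpo K L D G l k f d"
  shows "nv D \<le> nv K + nv G" "ne D \<le> ne K + ne G" "nv G \<le> nv L + nv D" "ne G \<le> ne L + ne D"
proof -
  note p = cpoD[OF po]
  note r = hmors_range[OF p(1)] hmors_range[OF p(2)] and n = hmors_len[OF p(1)] hmors_len[OF p(2)] hmors_len[OF p(3)] hmors_len[OF p(4)]
  show "nv D \<le> nv K + nv G" using set_po_card_context[OF p(6)] r n by simp
  show "ne D \<le> ne K + ne G" using set_po_card_context[OF p(7)] r n by simp
  show "nv G \<le> nv L + nv D" using set_po_card[OF p(6)] n by simp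
  show "ne G \<le> ne L + ne D" using set_po_card[OF p(7)] n by simp
qed

text \<open>The context receives at most \<open>m\<close> from the apex of the rule and
  \<open>m\<close> from the source, the result at most \<open>m\<close> from the right-hand side and
  \<open>2 * m\<close> from the context.\<close>

lemma cstep_bdd:
  fixes X :: "(nat, nat) iobj"
  assumes c: "cstep I X \<sigma> Y" and \<rho>: "bdd m (srule \<sigma>)" "rvalid (srule \<sigma>)" and X: "bdd m (fst X)"
    and I: "nv I \<le> m" "ne I \<le> m"
  shows "bdd (3 * m) \<sigma>" "bdd (3 * m) Y"
proof -
  let ?\<rho> = "srule \<sigma>" and ?D = "sctxt \<sigma>"
  have st: "snd Y \<in> hmors I (fst Y)" "valid ?D" "si \<sigma> \<in> hmors I ?D"
    and p: "cpo (rk ?\<rho>) (rl ?\<rho>) ?D (fst X) (lleg ?\<rho>) (sk \<sigma>) (smatch \<sigma>) (sg \<sigma>)"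
    and p': "cpo (rk ?\<rho>) (rr ?\<rho>) ?D (fst Y) (rleg ?\<rho>) (sk \<sigma>) (scomatch \<sigma>) (sh \<sigma>)"
    using c unfolding cstep_def by blast+
  have r: "bdd m (rl ?\<rho>)" "bdd m (rk ?\<rho>)" "bdd m (rr ?\<rho>)" using \<rho>(1) by (simp_all add: bdd_rule)
  note s = bdd_sizes[OF r(1)] bdd_sizes[OF r(2)] bdd_sizes[OF r(3)] bdd_sizes[OF X]
  have D: "nv ?D \<le> 2 * m" "ne ?D \<le> 2 * m" using context_size(1,2)[OF p] s by linarith+
  have H: "nv (fst Y) \<le> 3 * m" "ne (fst Y) \<le> 3 * m" using context_size(3,4)[OF p'] s D by linarith+
  have bD: "bdd (2 * m) ?D" by (rule bdd_source[OF cpoD(4)[OF p] st(2) X D]) simp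
  have "bdd (3 * m) (fst Y)"
    by (rule bdd_cover[OF cpoD(3,4)[OF p'] _ st(2) bdd_mono[OF r(3)] bD cpoD(8,9)[OF p'] H])
      (use \<rho>(2) in \<open>simp_all add: rvalid_def\<close>)
  moreover have "bdd (3 * m) (snd Y)" by (rule bdd_hmor[OF st(1)]) (use H I in simp_all)
  ultimately show "bdd (3 * m) Y" by (simp add: bdd_prod_def)
  have "bdd (3 * m) (srule \<sigma>)" "bdd (3 * m) ?D" by (rule bdd_mono[OF \<rho>(1)] bdd_mono[OF bD]; simp)+
  moreover have "bdd (3 * m) (smatch \<sigma>)" by (rule bdd_hmor[OF cpoD(3)[OF p]]) (use s in simp_all)
  moreover have "bdd (3 * m) (scomatch \<sigma>)" by (rule bdd_hmor[OF cpoD(3)[OF p']]) (use s H in simp_all)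
  moreover have "bdd (3 * m) (sk \<sigma>)" by (rule bdd_hmor[OF cpoD(2)[OF p]]) (use s D in simp_all)
  moreover have "bdd (3 * m) (si \<sigma>)" by (rule bdd_hmor[OF st(3)]) (use I D in simp_all)
  moreover have "bdd (3 * m) (sg \<sigma>)" by (rule bdd_hmor[OF cpoD(4)[OF p]]) (use s D in simp_all)
  moreover have "bdd (3 * m) (sh \<sigma>)" by (rule bdd_hmor[OF cpoD(4)[OF p']]) (use H D in simp_all)
  ultimately show "bdd (3 * m) \<sigma>" by (simp add: bdd_step)
qed

text \<open>
  With rules of size \<open>m\<close>, the source of a critical pair has size at most \<open>2 * m\<close>, its contexts at most
  \<open>3 * m\<close>, and the pullback of the contexts at most \<open>9 * m * m\<close>; a step multiplies sizes by at most 3.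
\<close>

lemma ccrit_bdd:
  fixes cp :: "(nat, nat) cpair"
  assumes cp: "ccrit \<R> cp" and R: "\<And>\<rho>. \<rho> \<in> \<R> \<Longrightarrow> bdd m \<rho> \<and> rvalid \<rho>"
  shows "bdd (3 * (9 * m * m + 2 * m)) cp"
proof -
  obtain J X \<sigma>1 Y1 \<sigma>2 Y2 where cp': "cp = CPair J X \<sigma>1 Y1 \<sigma>2 Y2" by (cases cp)
  have *: "srule \<sigma>1 \<in> \<R>" "srule \<sigma>2 \<in> \<R>" "valid J" "cstep J X \<sigma>1 Y1" "cstep J X \<sigma>2 Y2"
    "set (fst (smatch \<sigma>1) @ fst (smatch \<sigma>2)) = {..<nv (fst X)}"
    "set (snd (smatch \<sigma>1) @ snd (smatch \<sigma>2)) = {..<ne (fst X)}"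
    "cpb J (sctxt \<sigma>1) (sctxt \<sigma>2) (fst X) (si \<sigma>1) (si \<sigma>2) (sg \<sigma>1) (sg \<sigma>2)"
    using cp(1) unfolding ccrit_def cp' cpair.sel by blast+
  have p1: "cpo (rk (srule \<sigma>1)) (rl (srule \<sigma>1)) (sctxt \<sigma>1) (fst X) (lleg (srule \<sigma>1)) (sk \<sigma>1) (smatch \<sigma>1) (sg \<sigma>1)"
    and p2: "cpo (rk (srule \<sigma>2)) (rl (srule \<sigma>2)) (sctxt \<sigma>2) (fst X) (lleg (srule \<sigma>2)) (sk \<sigma>2) (smatch \<sigma>2) (sg \<sigma>2)"
    and sX: "snd X \<in> hmors J (fst X)"
    using *(4,5) unfolding cstep_def by blast+
  note f1 = cpoD(3)[OF p1] and f2 = cpoD(3)[OF p2] and pb = cpbD[OF *(8)]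
  have r: "bdd m (rl (srule \<sigma>1))" "bdd m (rk (srule \<sigma>1))" "bdd m (rl (srule \<sigma>2))" "bdd m (rk (srule \<sigma>2))"
    "valid (rl (srule \<sigma>1))" "valid (rl (srule \<sigma>2))"
    using R[OF *(1)] R[OF *(2)] by (simp_all add: bdd_rule rvalid_def)
  note s = bdd_sizes[OF r(1)] bdd_sizes[OF r(2)] bdd_sizes[OF r(3)] bdd_sizes[OF r(4)]
  have S: "nv (fst X) \<le> 2 * m" "ne (fst X) \<le> 2 * m"
    using card_length[of "fst (smatch \<sigma>1) @ fst (smatch \<sigma>2)"] card_length[of "snd (smatch \<sigma>1) @ snd (smatch \<sigma>2)"]
      hmors_len[OF f1] hmors_len[OF f2] s unfolding *(6,7) by simp_all
  have bX: "bdd (2 * m) (fst X)" by (rule bdd_cover[OF f1 f2 r(5,6,1,3) *(6,7) S]) simp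
  have D: "nv (sctxt \<sigma>1) \<le> 3 * m" "ne (sctxt \<sigma>1) \<le> 3 * m" "nv (sctxt \<sigma>2) \<le> 3 * m" "ne (sctxt \<sigma>2) \<le> 3 * m"
    using context_size(1,2)[OF p1] context_size(1,2)[OF p2] s S by linarith+
  let ?M = "9 * m * m + 2 * m"
  have "nv J \<le> nv (sctxt \<sigma>1) * nv (sctxt \<sigma>2)" "ne J \<le> ne (sctxt \<sigma>1) * ne (sctxt \<sigma>2)"
    using set_pb_card[OF pb(6)] set_pb_card[OF pb(7)] hmors_len[OF pb(1)] hmors_len[OF pb(3)] hmors_len[OF pb(4)] by simp_all
  moreover have "nv (sctxt \<sigma>1) * nv (sctxt \<sigma>2) \<le> 3 * m * (3 * m)" "ne (sctxt \<sigma>1) * ne (sctxt \<sigma>2) \<le> 3 * m * (3 * m)"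
    using D by (intro mult_le_mono; simp)+
  ultimately have J: "nv J \<le> ?M" "ne J \<le> ?M" by simp_all
  have bJ: "bdd ?M J" by (rule bdd_source[OF sX *(3) bX J]) simp
  have bX': "bdd ?M (fst X)" by (rule bdd_mono[OF bX]) simp
  have bR: "bdd ?M (srule \<sigma>1)" "bdd ?M (srule \<sigma>2)"
    using R[OF *(1)] R[OF *(2)] by (auto elim: bdd_mono)
  have "bdd ?M (snd X)" by (rule bdd_hmor[OF sX J]) (use S in simp_all)
  then have "bdd ?M X" using bX' by (simp add: bdd_prod_def)
  then have "bdd (3 * ?M) X" "bdd (3 * ?M) J" using bJ by (auto elim: bdd_mono)
  then show ?thesis
    unfolding cp' bdd_cpair cpair.sel
    using cstep_bdd[OF *(4) bR(1) _ bX' J] cstep_bdd[OF *(5) bR(2) _ bX' J] R[OF *(1)] R[OF *(2)] by blast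
qed


section \<open>The algorithms\<close>

text \<open>By \<open>bdd_encode\<close> the code of the system bounds the size of each of its
  rules; the polynomial is that of \<open>ccrit_bdd\<close>.\<close>

definition crit_list :: "(nat, nat) dpoi_rule list \<Rightarrow> (nat, nat) cpair list" where
  "crit_list \<rho>s = filter (xcrit \<rho>s) (candidates (3 * (9 * encode \<rho>s * encode \<rho>s + 2 * encode \<rho>s)))"

definition successors :: "(nat, nat) dpoi_rule list \<Rightarrow> (nat, nat) hgraph \<Rightarrow> (nat, nat) iobj \<Rightarrow> (nat, nat) iobj list" where
  "successors \<rho>s I X = filter (\<lambda>Y. \<exists>\<sigma> \<in> set (candidates (3 * (encode \<rho>s + encode I + encode X))).
     (\<exists>\<rho> \<in> set \<rho>s. srule \<sigma> = \<rho>) \<and> xstep I X \<sigma> Y) (candidates (3 * (encode \<rho>s + encode I + encode X)))"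

text \<open>One successor is fixed for each reducible object. A normal form is left in place, so
  surplus rounds of \<open>normalise\<close> do no harm and a single number of rounds can serve all
  critical pairs.\<close>

definition follow :: "(nat, nat) dpoi_rule list \<Rightarrow> (nat, nat) hgraph \<Rightarrow> (nat, nat) iobj \<Rightarrow> (nat, nat) iobj" where
  "follow \<rho>s I X = (if successors \<rho>s I X = [] then X else head (successors \<rho>s I X))"

definition normalise :: "(nat, nat) dpoi_rule list \<Rightarrow> (nat, nat) hgraph \<Rightarrow> nat \<Rightarrow> (nat, nat) iobj \<Rightarrow> (nat, nat) iobj" where
  "normalise \<rho>s I n X = rec_nat X (\<lambda>_. follow \<rho>s I) n"

text \<open>For each \<open>n\<close> this is decidable, and termination guarantees that some
  \<open>n\<close> qualifies, so unbounded search finds one.\<close>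

definition settled :: "(nat, nat) dpoi_rule list \<Rightarrow> nat \<Rightarrow> bool" where
  "settled \<rho>s n \<longleftrightarrow> (\<forall>cp \<in> set (crit_list \<rho>s).
     successors \<rho>s (cifc cp) (normalise \<rho>s (cifc cp) n (ctgt1 cp)) = [] \<and>
     successors \<rho>s (cifc cp) (normalise \<rho>s (cifc cp) n (ctgt2 cp)) = [])"

definition agree :: "(nat, nat) dpoi_rule list \<Rightarrow> nat \<Rightarrow> bool" where
  "agree \<rho>s n \<longleftrightarrow> (\<forall>cp \<in> set (crit_list \<rho>s).
     xiso (normalise \<rho>s (cifc cp) n (ctgt1 cp)) (normalise \<rho>s (cifc cp) n (ctgt2 cp)))"

section \<open>Computability of the algorithms\<close>

lemma computable_crit_list [comp_intros]:
  assumes "computable f"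
  shows "computable (\<lambda>x. crit_list (f x))"
proof -
  have "computable crit_list"
    unfolding crit_list_def[abs_def] by (intro comp_intros)
  from computable_comp[OF this assms] show ?thesis .
qed

lemma computable_successors [comp_intros]:
  assumes "computable \<rho>s" "computable I" "computable X"
  shows "computable (\<lambda>x. successors (\<rho>s x) (I x) (X x))"
proof -
  have "computable (\<lambda>p. successors (fst p) (fst (snd p)) (snd (snd p)))"
    unfolding successors_def by (intro comp_intros)
  from computable_comp[OF this computable_Pair[OF assms(1) computable_Pair[OF assms(2,3)]]] show ?thesis by simp
qed

lemma computable_follow [comp_intros]:
  assumes "computable \<rho>s" "computable I" "computable X"
  shows "computable (\<lambda>x. follow (\<rho>s x) (I x) (X x))"
  unfolding follow_def by (intro comp_intros assms)

lemma computable_normalise [comp_intros]: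
  assumes "computable \<rho>s" "computable I" "computable n" "computable X"
  shows "computable (\<lambda>x. normalise (\<rho>s x) (I x) (n x) (X x))"
proof -
  have "computable (\<lambda>p. normalise (fst p) (fst (snd p)) (fst (snd (snd p))) (snd (snd (snd p))))"
    unfolding normalise_def by (intro comp_intros)
  from computable_comp[OF this computable_Pair[OF assms(1) computable_Pair[OF assms(2) computable_Pair[OF assms(3,4)]]]]
  show ?thesis by simp
qed

lemma decidable_settled [comp_intros]:
  assumes "computable \<rho>s" "computable n"
  shows "decidable (\<lambda>x. settled (\<rho>s x) (n x))"
proof -
  have "decidable (\<lambda>p. settled (fst p) (snd p))"
    unfolding settled_def by (intro comp_intros)
  from decidable_comp[OF this computable_Pair[OF assms]] show ?thesis by simp
qed

lemma decidable_agree [comp_intros]: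
  assumes "computable \<rho>s" "computable n"
  shows "decidable (\<lambda>x. agree (\<rho>s x) (n x))"
proof -
  have "decidable (\<lambda>p. agree (fst p) (snd p))"
    unfolding agree_def by (intro comp_intros)
  from decidable_comp[OF this computable_Pair[OF assms]] show ?thesis by simp
qed

section \<open>Translation from and to the codes of the specification\<close>

lemma computable_list_encode [comp_intros]:
  "computable f \<Longrightarrow> computable (\<lambda>x. list_encode (f x))"
  by (rule computable_retype) (simp add: encode_nat_list)

lemma computable_list_decode [comp_intros]:
  "computable f \<Longrightarrow> computable (\<lambda>x. list_decode (f x))"
  by (rule computable_retype) (simp add: encode_nat_list)

definition parse_hgraph :: "nat \<Rightarrow> (nat, nat) hgraph" where
  "parse_hgraph g = HGraph (list_decode (item (list_decode g) 0))
     (map (\<lambda>e. (item (list_decode e) 0, list_decode (item (list_decode e) 1), list_decode (item (list_decode e) 2)))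
       (list_decode (item (list_decode g) 1)))"

definition parse_hmor :: "nat \<Rightarrow> hmor" where
  "parse_hmor f = (list_decode (item (list_decode f) 0), list_decode (item (list_decode f) 1))"

definition parse_rule :: "nat \<Rightarrow> (nat, nat) dpoi_rule" where
  "parse_rule r = Rule (parse_hgraph (item (list_decode r) 0)) (parse_hgraph (item (list_decode r) 1))
     (parse_hgraph (item (list_decode r) 2)) (parse_hmor (item (list_decode r) 3)) (parse_hmor (item (list_decode r) 4))"

definition parse_system :: "nat \<Rightarrow> (nat, nat) dpoi_rule list" where
  "parse_system s = map parse_rule (list_decode s)"

lemma computable_parse_hgraph [comp_intros]:
  "computable f \<Longrightarrow> computable (\<lambda>x. parse_hgraph (f x))"
proof -
  have "computable parse_hgraph"
    unfolding parse_hgraph_def[abs_def] by (intro comp_intros)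
  then show "computable f \<Longrightarrow> computable (\<lambda>x. parse_hgraph (f x))" by (rule computable_comp)
qed

lemma computable_parse_hmor [comp_intros]:
  "computable f \<Longrightarrow> computable (\<lambda>x. parse_hmor (f x))"
  unfolding parse_hmor_def by (intro comp_intros)

lemma computable_parse_rule [comp_intros]:
  "computable f \<Longrightarrow> computable (\<lambda>x. parse_rule (f x))"
  unfolding parse_rule_def by (intro comp_intros)

lemma computable_parse_system [comp_intros]:
  assumes "computable f"
  shows "computable (\<lambda>x. parse_system (f x))"
proof -
  have "computable parse_system"
    unfolding parse_system_def[abs_def] by (intro comp_intros)
  from computable_comp[OF this assms] show ?thesis .
qed

lemma parse_system_code: "parse_system (code_system id id \<rho>s) = \<rho>s"
proof -
  have i: "item [a, b] 0 = a" "item [a, b] (Suc 0) = b" "item [a, b, c] 0 = a" "item [a, b, c] (Suc 0) = b" "item [a, b, c] 2 = c"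
    "item [a, b, c, d, e] 0 = a" "item [a, b, c, d, e] (Suc 0) = b" "item [a, b, c, d, e] 2 = c" "item [a, b, c, d, e] 3 = d"
    "item [a, b, c, d, e] 4 = e"
    for a b c d e :: nat
    by (simp_all add: item_eq_nth numeral_eq_Suc)
  have g: "parse_hgraph (code_hgraph id id G) = G" for G
    unfolding parse_hgraph_def code_hgraph_def
    by (cases G) (simp add: i case_prod_beta' comp_def)
  have h: "parse_hmor (code_hmor f) = f" for f
    unfolding parse_hmor_def code_hmor_def by (simp add: i)
  have r: "parse_rule (code_rule id id \<rho>) = \<rho>" for \<rho>
    unfolding parse_rule_def code_rule_def by (cases \<rho>) (simp add: i g h)
  show ?thesis
    unfolding parse_system_def code_system_def by (simp add: comp_def r)
qed

lemma computable_codes [comp_intros]: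
  "computable f1 \<Longrightarrow> computable (\<lambda>x. code_hgraph id id (f1 x :: (nat, nat) hgraph))"
  "computable f2 \<Longrightarrow> computable (\<lambda>x. code_hmor (f2 x))"
proof -
  have "computable (\<lambda>G :: (nat, nat) hgraph. code_hgraph id id G)"
    unfolding code_hgraph_def case_prod_beta' list.map_id id_apply by (intro comp_intros)
  then show "computable f1 \<Longrightarrow> computable (\<lambda>x. code_hgraph id id (f1 x))" by (rule computable_comp)
  show "computable f2 \<Longrightarrow> computable (\<lambda>x. code_hmor (f2 x))"
    unfolding code_hmor_def by (intro comp_intros)
qed

lemma computable_code_cpair [comp_intros]:
  "computable f \<Longrightarrow> computable (\<lambda>x. code_cpair id id (f x :: (nat, nat) cpair))"
  unfolding code_cpair_def code_step_def code_iobj_def code_rule_def by (intro comp_intros)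

text \<open>Minimisation is followed by the total function \<open>f\<close>, so only the first stage
  can diverge.\<close>

lemma evalr_search:
  fixes P :: "'x::coded \<Rightarrow> nat \<Rightarrow> bool" and f :: "'x \<Rightarrow> nat \<Rightarrow> 'y::coded"
  assumes P: "decidable (\<lambda>p. P (fst p) (snd p))" and f: "computable (\<lambda>p. f (fst p) (snd p))"
  obtains R where "\<And>x n. P x n \<Longrightarrow> evalr R [encode x] (encode (f x (LEAST n. P x n)))"
proof -
  obtain M where M: "\<And>x n. P x n \<Longrightarrow> evalr M [encode x] (LEAST n. P x n)"
    using evalr_Least[OF P] by blast
  obtain F where F: "\<And>p. evalr F [encode p] (encode (f (fst p) (snd p)))"
    using evalr_computable[OF f] by blast
  have "recursive_in 2 (\<lambda>xs. prod_encode (xs ! 0, xs ! 1))"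
    by (intro recursive_in_prod_encode recursive_in_proj) simp_all
  then obtain Q where Q: "\<And>xs. length xs = 2 \<Longrightarrow> evalr Q xs (prod_encode (xs ! 0, xs ! 1))"
    unfolding recursive_in_def by blast
  have "evalr (Comp F [Comp Q [Proj 0, M]]) [encode x] (encode (f x (LEAST n. P x n)))" if "P x n" for x n
  proof (rule evalr.comp)
    show "evalr F [encode (x, LEAST n. P x n)] (encode (f x (LEAST n. P x n)))"
      using F[of "(x, LEAST n. P x n)"] by simp
    have "evalr (Comp Q [Proj 0, M]) [encode x] (encode (x, LEAST n. P x n))"
    proof (rule evalr.comp)
      show "list_all2 (\<lambda>g y. evalr g [encode x] y) [Proj 0, M] [encode x, LEAST n. P x n]"
        using M[OF that] evalr.proj[of 0 "[encode x]"] by simp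
      show "evalr Q [encode x, LEAST n. P x n] (encode (x, LEAST n. P x n))"
        using Q[of "[encode x, LEAST n. P x n]"] by (simp add: encode_prod_def)
    qed
    then show "list_all2 (\<lambda>g y. evalr g [encode x] y) [Comp Q [Proj 0, M]] [encode (x, LEAST n. P x n)]"
      by simp
  qed
  then show thesis by (rule that)
qed

section \<open>Completeness of the enumerations\<close>

lemma set_crit_list:
  assumes "\<And>\<rho>. \<rho> \<in> set \<rho>s \<Longrightarrow> rvalid \<rho>"
  shows "set (crit_list \<rho>s) = {cp. ccrit (set \<rho>s) cp}"
proof -
  have "bdd (encode \<rho>s) \<rho>" if "\<rho> \<in> set \<rho>s" for \<rho>
    using bdd_encode[of \<rho>s] that by (simp add: bdd_list_def)
  then have "ccrit (set \<rho>s) cp \<Longrightarrow> cp \<in> set (candidates (3 * (9 * encode \<rho>s * encode \<rho>s + 2 * encode \<rho>s)))" for cp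
    by (intro bdd_in_candidates ccrit_bdd[of "set \<rho>s"]) (use assms in blast)+
  then show ?thesis
    unfolding crit_list_def set_filter using xcrit_iff[OF assms] by blast
qed

lemma set_successors:
  assumes R: "\<And>\<rho>. \<rho> \<in> set \<rho>s \<Longrightarrow> rvalid \<rho>" and I: "valid I"
  shows "set (successors \<rho>s I X) = {Y. \<exists>\<sigma>. srule \<sigma> \<in> set \<rho>s \<and> cstep I X \<sigma> Y}"
proof -
  let ?m = "encode \<rho>s + encode I + encode X"
  have b: "bdd (3 * ?m) \<sigma>" "bdd (3 * ?m) Y" if c: "cstep I X \<sigma> Y" and s: "srule \<sigma> \<in> set \<rho>s" for \<sigma> Y
  proof -
    have 1: "bdd ?m (srule \<sigma>)"
      using bdd_mono[OF bdd_encode[of \<rho>s], of ?m] s by (simp add: bdd_list_def)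
    have 2: "bdd ?m (fst X)"
      using bdd_mono[OF bdd_encode[of X], of ?m] by (simp add: bdd_prod_def)
    have "bdd ?m I" using bdd_mono[OF bdd_encode[of I], of ?m] by simp
    then have 3: "nv I \<le> ?m" "ne I \<le> ?m" by (rule bdd_sizes)+
    show "bdd (3 * ?m) \<sigma>" "bdd (3 * ?m) Y" using cstep_bdd[OF c 1 R[OF s] 2 3] .
  qed
  have x: "xstep I X \<sigma> Y \<longleftrightarrow> cstep I X \<sigma> Y" if "srule \<sigma> \<in> set \<rho>s" for \<sigma> Y
    by (rule xstep_iff[OF I R[OF that]])
  show ?thesis
  proof (intro set_eqI iffI)
    fix Y
    assume "Y \<in> set (successors \<rho>s I X)"
    then obtain \<sigma> where "srule \<sigma> \<in> set \<rho>s" "xstep I X \<sigma> Y"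
      unfolding successors_def by auto
    then show "Y \<in> {Y. \<exists>\<sigma>. srule \<sigma> \<in> set \<rho>s \<and> cstep I X \<sigma> Y}" using x by blast
  next
    fix Y
    assume "Y \<in> {Y. \<exists>\<sigma>. srule \<sigma> \<in> set \<rho>s \<and> cstep I X \<sigma> Y}"
    then obtain \<sigma> where \<sigma>: "srule \<sigma> \<in> set \<rho>s" "cstep I X \<sigma> Y" by blast
    then show "Y \<in> set (successors \<rho>s I X)"
      unfolding successors_def set_filter mem_Collect_eq
      using b[OF \<sigma>(2,1), THEN bdd_in_candidates] x by blast
  qed
qed

section \<open>Correctness of the algorithms\<close>

lemma set_hgraph_labs: "labs C Q G \<Longrightarrow> set1_hgraph G \<subseteq> C \<and> set2_hgraph G \<subseteq> Q"
  by (cases G) (auto simp: labs_def hgraph_ops_def)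

lemma set_cpair_labs:
  assumes cp: "ccrit \<R> cp" and R: "\<And>\<rho>. \<rho> \<in> \<R> \<Longrightarrow> rlabs C Q \<rho>"
  shows "set1_cpair cp \<subseteq> C \<and> set2_cpair cp \<subseteq> Q"
    and "labs C Q (cifc cp)" and "labs C Q (fst (ctgt1 cp))" and "labs C Q (fst (ctgt2 cp))"
proof -
  obtain J X \<sigma>1 Y1 \<sigma>2 Y2 where cp': "cp = CPair J X \<sigma>1 Y1 \<sigma>2 Y2" by (cases cp)
  have *: "srule \<sigma>1 \<in> \<R>" "srule \<sigma>2 \<in> \<R>" "cstep J X \<sigma>1 Y1" "cstep J X \<sigma>2 Y2"
    "set (fst (smatch \<sigma>1) @ fst (smatch \<sigma>2)) = {..<nv (fst X)}"
    "set (snd (smatch \<sigma>1) @ snd (smatch \<sigma>2)) = {..<ne (fst X)}"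
    using cp(1) unfolding ccrit_def cp' cpair.sel by blast+
  have f: "smatch \<sigma>1 \<in> hmors (rl (srule \<sigma>1)) (fst X)" "smatch \<sigma>2 \<in> hmors (rl (srule \<sigma>2)) (fst X)"
    using *(3,4) unfolding cstep_def by (auto dest: cpoD)
  have X: "labs C Q (fst X)"
    using labs_cover[OF f _ _ *(5,6)] R[OF *(1)] R[OF *(2)] by (simp add: rlabs_def)
  note l1 = cstep_labs[OF inj_on_empty inj_on_empty *(3) X R[OF *(1)]]
    and l2 = cstep_labs[OF inj_on_empty inj_on_empty *(4) X R[OF *(2)]]
  have r: "set1_dpoi_rule \<rho> \<subseteq> C \<and> set2_dpoi_rule \<rho> \<subseteq> Q" if "\<rho> \<in> \<R>" for \<rho>
    using R[OF that] set_hgraph_labs unfolding rlabs_def by (cases \<rho>) fastforce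
  have st: "set1_dpoi_step \<sigma> \<subseteq> C \<and> set2_dpoi_step \<sigma> \<subseteq> Q" if "srule \<sigma> \<in> \<R>" "labs C Q (sctxt \<sigma>)" for \<sigma>
    using r[OF that(1)] set_hgraph_labs[OF that(2)] by (cases \<sigma>) simp
  have o: "set1_cpair (CPair J X \<sigma>1 Y1 \<sigma>2 Y2) = set1_hgraph J \<union> set1_hgraph (fst X) \<union> set1_dpoi_step \<sigma>1 \<union>
      set1_hgraph (fst Y1) \<union> set1_dpoi_step \<sigma>2 \<union> set1_hgraph (fst Y2)"
    "set2_cpair (CPair J X \<sigma>1 Y1 \<sigma>2 Y2) = set2_hgraph J \<union> set2_hgraph (fst X) \<union> set2_dpoi_step \<sigma>1 \<union>
      set2_hgraph (fst Y1) \<union> set2_dpoi_step \<sigma>2 \<union> set2_hgraph (fst Y2)"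
    by (cases X; cases Y1; cases Y2; auto)+
  show "set1_cpair cp \<subseteq> C \<and> set2_cpair cp \<subseteq> Q"
    unfolding cp' o using set_hgraph_labs[OF X] set_hgraph_labs[OF l1(1)] set_hgraph_labs[OF l1(3)]
      set_hgraph_labs[OF l2(3)] st[OF *(1) l1(2)] st[OF *(2) l2(2)] by blast
  show "labs C Q (cifc cp)" "labs C Q (fst (ctgt1 cp))" "labs C Q (fst (ctgt2 cp))"
    using l1 l2 by (simp_all add: cp')
qed

text \<open>Isomorphic copies of a normal form are normal forms by \<open>iso_reduces\<close>, so
  every link of the sequence is an isomorphism.\<close>

lemma normal_form_iso:
  assumes sys: "dpoi_system T \<I> \<R>" and N: "N \<in> iobjs T I" "\<nexists>Y. reduces T \<R> I N Y" and star: "reduces_star T \<R> I N W"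
  shows "iobj_iso T I N W"
  using star unfolding reduces_star_def
proof (induction rule: rtranclp_induct)
  case base
  show ?case by (rule iobj_iso_refl[OF N(1)])
next
  case (step Y Z)
  then show ?case using iso_reduces[OF _ _ sys] N(2) iobj_iso_trans by blast
qed

context
  fixes T :: "('c, 'o) monoidal_theory" and \<I> \<kappa> \<nu> \<rho>s \<R>
  assumes pres: "presents T \<I> \<kappa> \<nu> \<rho>s \<R>"
begin

abbreviation "relabelled_rules \<equiv> map (map_dpoi_rule \<kappa> \<nu>) \<rho>s"

lemma presented_system: "dpoi_system T \<I> \<R>" and presented_rules: "set \<rho>s = \<R>"
  and presented_inj: "inj_on \<kappa> (colours T)" "inj_on \<nu> (system_ops \<R>)"
  using pres by (simp_all add: presents_def)

lemma presented_wf: "\<rho> \<in> \<R> \<Longrightarrow> wf_rule T \<I> \<rho>"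
  using presented_system by (simp add: dpoi_system_def)

lemma rule_hyp: "\<rho> \<in> \<R> \<Longrightarrow> rl \<rho> \<in> hyp T \<and> rk \<rho> \<in> hyp T \<and> rr \<rho> \<in> hyp T"
  using presented_wf[of \<rho>] by (simp add: wf_rule_def)

lemma rule_labs: "\<rho> \<in> \<R> \<Longrightarrow> rlabs (colours T) (system_ops \<R>) \<rho>"
proof -
  assume \<rho>: "\<rho> \<in> \<R>"
  have "labs (colours T) (system_ops \<R>) G" if "G \<in> hyp T" "hgraph_ops G \<subseteq> (system_ops \<R>)" for G
    using that by (simp add: labs_def hyp_iff)
  moreover have "hgraph_ops (rl \<rho>) \<subseteq> (system_ops \<R>)" "hgraph_ops (rk \<rho>) \<subseteq> (system_ops \<R>)" "hgraph_ops (rr \<rho>) \<subseteq> (system_ops \<R>)"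
    using \<rho> unfolding system_ops_def by blast+
  ultimately show ?thesis using rule_hyp[OF \<rho>] unfolding rlabs_def by blast
qed

lemma rule_valid: "\<rho> \<in> set relabelled_rules \<Longrightarrow> rvalid \<rho>"
proof -
  assume "\<rho> \<in> set relabelled_rules"
  then obtain \<rho>0 where "\<rho>0 \<in> \<R>" "\<rho> = map_dpoi_rule \<kappa> \<nu> \<rho>0" using presented_rules by auto
  then show ?thesis
    using rule_hyp[of \<rho>0] hyp_valid unfolding rvalid_def by (auto simp: dpoi_rule.map_sel)
qed

text \<open>The computed list is pulled back along inverses of the numberings. These undo the
  relabelling on critical pairs, in which only colours of \<open>T\<close> and operations of the
  rules occur.\<close>

lemma crit_list_correct: "\<exists>cps. set cps = critical_pairs T \<R> \<and> map (map_cpair \<kappa> \<nu>) cps = crit_list relabelled_rules"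
proof -
  let ?inv = "map_cpair (inv_into (colours T) \<kappa>) (inv_into (system_ops \<R>) \<nu>)"
  have inv: "?inv (map_cpair \<kappa> \<nu> cp) = cp" if "cp \<in> critical_pairs T \<R>" for cp
  proof -
    have "ccrit \<R> cp" using that critical_pairs_iff[OF presented_system] by blast
    then have s: "set1_cpair cp \<subseteq> (colours T)" "set2_cpair cp \<subseteq> (system_ops \<R>)" using set_cpair_labs(1) rule_labs by blast+
    have "?inv (map_cpair \<kappa> \<nu> cp) = map_cpair id id cp"
      unfolding cpair.map_comp using s presented_inj by (intro cpair.map_cong refl) auto
    then show ?thesis by (simp add: cpair.map_id)
  qed
  have set: "set (crit_list relabelled_rules) = map_cpair \<kappa> \<nu> ` critical_pairs T \<R>"
  proof (rule set_eqI)
    fix cp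
    have eq: "set (crit_list relabelled_rules) = {cp. ccrit (set relabelled_rules) cp}"
      by (rule set_crit_list[OF rule_valid])
    have "cp \<in> set (crit_list relabelled_rules) \<longleftrightarrow> ccrit (map_dpoi_rule \<kappa> \<nu> ` \<R>) cp"
      unfolding eq mem_Collect_eq set_map presented_rules ..
    also have "\<dots> \<longleftrightarrow> (\<exists>cp0. ccrit \<R> cp0 \<and> cp = map_cpair \<kappa> \<nu> cp0)"
      by (rule ccrit_map[OF presented_inj rule_labs])
    finally show "cp \<in> set (crit_list relabelled_rules) \<longleftrightarrow> cp \<in> map_cpair \<kappa> \<nu> ` critical_pairs T \<R>"
      using critical_pairs_iff[OF presented_system] by (auto simp: image_iff)
  qed
  show ?thesis
  proof (intro exI conjI)
    show "set (map ?inv (crit_list relabelled_rules)) = critical_pairs T \<R>"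
      unfolding set_map set image_image using inv by simp
    show "map (map_cpair \<kappa> \<nu>) (map ?inv (crit_list relabelled_rules)) = crit_list relabelled_rules"
      unfolding map_map using inv by (intro map_idI) (auto simp: set)
  qed
qed

text \<open>Rewriting does not leave this set, and on it relabelling is faithful for steps and
  isomorphisms.\<close>

definition objs :: "('c, 'o) hgraph \<Rightarrow> ('c, 'o) iobj set" where
  "objs I = {X \<in> iobjs T I. labs (colours T) (system_ops \<R>) (fst X)}"

lemma successors_correct:
  assumes I: "I \<in> hyp T" "labs (colours T) (system_ops \<R>) I" and X: "X \<in> objs I"
  shows "set (successors relabelled_rules (map_hgraph \<kappa> \<nu> I) (map_iobj \<kappa> \<nu> X)) = map_iobj \<kappa> \<nu> ` {Y \<in> objs I. reduces T \<R> I X Y}"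
    and "reduces T \<R> I X Y \<Longrightarrow> Y \<in> objs I"
proof -
  have X': "X \<in> iobjs T I" "labs (colours T) (system_ops \<R>) (fst X)" using X by (simp_all add: objs_def)
  have red: "reduces T \<R> I X Y \<longleftrightarrow> (\<exists>\<sigma>. srule \<sigma> \<in> \<R> \<and> cstep I X \<sigma> Y)" for Y
    unfolding reduces_def using is_step_iff[OF X'(1) presented_wf] by blast
  have obj: "Y \<in> objs I" if r: "reduces T \<R> I X Y" for Y
  proof -
    obtain \<sigma> where \<sigma>: "srule \<sigma> \<in> \<R>" "cstep I X \<sigma> Y" using red[THEN iffD1, OF r] by blast
    then have "labs (colours T) (system_ops \<R>) (fst Y)" using cstep_labs(3)[OF presented_inj \<sigma>(2) X'(2) rule_labs] by blast
    then show ?thesis using reduces_iobjs[OF r] by (simp add: objs_def)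
  qed
  then show "reduces T \<R> I X Y \<Longrightarrow> Y \<in> objs I" .
  have v: "valid (map_hgraph \<kappa> \<nu> I)" using hyp_valid[OF I(1)] by simp
  have eq: "set (successors relabelled_rules (map_hgraph \<kappa> \<nu> I) (map_iobj \<kappa> \<nu> X)) =
      {Y. \<exists>\<sigma>. srule \<sigma> \<in> set relabelled_rules \<and> cstep (map_hgraph \<kappa> \<nu> I) (map_iobj \<kappa> \<nu> X) \<sigma> Y}"
    by (rule set_successors[OF rule_valid v])
  show "set (successors relabelled_rules (map_hgraph \<kappa> \<nu> I) (map_iobj \<kappa> \<nu> X)) = map_iobj \<kappa> \<nu> ` {Y \<in> objs I. reduces T \<R> I X Y}"
    unfolding eq
  proof (intro set_eqI iffI)
    fix Y'
    assume "Y' \<in> {Y. \<exists>\<sigma>. srule \<sigma> \<in> set relabelled_rules \<and> cstep (map_hgraph \<kappa> \<nu> I) (map_iobj \<kappa> \<nu> X) \<sigma> Y}"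
    then obtain \<sigma>' \<rho> where \<sigma>': "cstep (map_hgraph \<kappa> \<nu> I) (map_iobj \<kappa> \<nu> X) \<sigma>' Y'" "srule \<sigma>' = map_dpoi_rule \<kappa> \<nu> \<rho>"
      and \<rho>: "\<rho> \<in> \<R>"
      using presented_rules by auto
    obtain \<sigma> Y where "Y' = map_iobj \<kappa> \<nu> Y" "srule \<sigma> = \<rho>" "cstep I X \<sigma> Y"
      using cstep_unmap[OF presented_inj \<sigma>' X'(2) I(2) rule_labs[OF \<rho>]] .
    moreover from this have "reduces T \<R> I X Y" using red[THEN iffD2] \<rho> by blast
    ultimately show "Y' \<in> map_iobj \<kappa> \<nu> ` {Y \<in> objs I. reduces T \<R> I X Y}" using obj by blast
  next
    fix Y'
    assume "Y' \<in> map_iobj \<kappa> \<nu> ` {Y \<in> objs I. reduces T \<R> I X Y}"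
    then obtain Y where Y: "Y' = map_iobj \<kappa> \<nu> Y" "Y \<in> objs I" "reduces T \<R> I X Y"
      unfolding image_iff mem_Collect_eq by blast
    obtain \<sigma> where \<sigma>: "srule \<sigma> \<in> \<R>" "cstep I X \<sigma> Y" using red[THEN iffD1, OF Y(3)] by blast
    note l = cstep_labs[OF presented_inj \<sigma>(2) X'(2) rule_labs[OF \<sigma>(1)]]
    have "cstep (map_hgraph \<kappa> \<nu> I) (map_iobj \<kappa> \<nu> X) (map_dpoi_step \<kappa> \<nu> \<sigma>) Y'"
      unfolding Y(1) using cstep_map[OF presented_inj I(2) X'(2) l(3,2) rule_labs[OF \<sigma>(1)]] \<sigma>(2) by blast
    moreover have "srule (map_dpoi_step \<kappa> \<nu> \<sigma>) \<in> set relabelled_rules"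
      using \<sigma>(1) by (simp add: dpoi_step.map_sel presented_rules)
    ultimately show "Y' \<in> {Y. \<exists>\<sigma>. srule \<sigma> \<in> set relabelled_rules \<and> cstep (map_hgraph \<kappa> \<nu> I) (map_iobj \<kappa> \<nu> X) \<sigma> Y}" by blast
  qed
qed

text \<open>\<open>F\<close> is the choice made by \<open>follow\<close>, pulled back to the
  original labels; iterating the program thereby becomes iterating \<open>F\<close> on genuine
  objects of the rewriting system.\<close>

lemma follow_correct:
  assumes I: "I \<in> hyp T" "labs (colours T) (system_ops \<R>) I"
  obtains F where "\<And>X. X \<in> objs I \<Longrightarrow> F X \<in> objs I"
    "\<And>X. X \<in> objs I \<Longrightarrow> follow relabelled_rules (map_hgraph \<kappa> \<nu> I) (map_iobj \<kappa> \<nu> X) = map_iobj \<kappa> \<nu> (F X)"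
    "\<And>X. X \<in> objs I \<Longrightarrow> \<exists>Y. reduces T \<R> I X Y \<Longrightarrow> reduces T \<R> I X (F X)"
    "\<And>X. X \<in> objs I \<Longrightarrow> \<nexists>Y. reduces T \<R> I X Y \<Longrightarrow> F X = X"
proof -
  have "\<exists>Z. Z \<in> objs I \<and> follow relabelled_rules (map_hgraph \<kappa> \<nu> I) (map_iobj \<kappa> \<nu> X) = map_iobj \<kappa> \<nu> Z \<and>
      ((\<exists>Y. reduces T \<R> I X Y) \<longrightarrow> reduces T \<R> I X Z) \<and> ((\<nexists>Y. reduces T \<R> I X Y) \<longrightarrow> Z = X)" if X: "X \<in> objs I" for X
  proof (cases "\<exists>Y. reduces T \<R> I X Y")
    case False
    then have "successors relabelled_rules (map_hgraph \<kappa> \<nu> I) (map_iobj \<kappa> \<nu> X) = []"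
      using successors_correct(1)[OF I X] by (simp add: set_empty[symmetric] del: set_empty)
    then show ?thesis using False X by (intro exI[of _ X]) (simp add: follow_def)
  next
    case True
    then obtain Y where "reduces T \<R> I X Y" by blast
    then have "map_iobj \<kappa> \<nu> Y \<in> set (successors relabelled_rules (map_hgraph \<kappa> \<nu> I) (map_iobj \<kappa> \<nu> X))"
      using successors_correct[OF I X] by blast
    then obtain y ys where ys: "successors relabelled_rules (map_hgraph \<kappa> \<nu> I) (map_iobj \<kappa> \<nu> X) = y # ys"
      by (cases "successors relabelled_rules (map_hgraph \<kappa> \<nu> I) (map_iobj \<kappa> \<nu> X)") auto
    then have "y \<in> map_iobj \<kappa> \<nu> ` {Y \<in> objs I. reduces T \<R> I X Y}"
      using successors_correct(1)[OF I X] by (metis list.set_intros(1))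
    then obtain Z where Z: "y = map_iobj \<kappa> \<nu> Z" "Z \<in> objs I" "reduces T \<R> I X Z"
      unfolding image_iff mem_Collect_eq by blast
    then show ?thesis using True ys by (intro exI[of _ Z]) (simp add: follow_def head_def)
  qed
  then show thesis using that by metis
qed

lemma normalise_correct:
  assumes I: "I \<in> hyp T" "labs (colours T) (system_ops \<R>) I" and X: "X \<in> objs I"
  shows "\<exists>Z \<in> objs I. normalise relabelled_rules (map_hgraph \<kappa> \<nu> I) n (map_iobj \<kappa> \<nu> X) = map_iobj \<kappa> \<nu> Z \<and> reduces_star T \<R> I X Z"
    and "terminating T \<I> \<R> \<Longrightarrow> I \<in> \<I> \<Longrightarrow> \<exists>n. \<forall>m \<ge> n.
      successors relabelled_rules (map_hgraph \<kappa> \<nu> I) (normalise relabelled_rules (map_hgraph \<kappa> \<nu> I) m (map_iobj \<kappa> \<nu> X)) = []"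
proof -
  obtain F where F: "\<And>X. X \<in> objs I \<Longrightarrow> F X \<in> objs I"
    "\<And>X. X \<in> objs I \<Longrightarrow> follow relabelled_rules (map_hgraph \<kappa> \<nu> I) (map_iobj \<kappa> \<nu> X) = map_iobj \<kappa> \<nu> (F X)"
    "\<And>X. X \<in> objs I \<Longrightarrow> \<exists>Y. reduces T \<R> I X Y \<Longrightarrow> reduces T \<R> I X (F X)"
    "\<And>X. X \<in> objs I \<Longrightarrow> \<nexists>Y. reduces T \<R> I X Y \<Longrightarrow> F X = X"
    using follow_correct[OF I] by blast
  have it: "(F ^^ n) X \<in> objs I \<and> normalise relabelled_rules (map_hgraph \<kappa> \<nu> I) n (map_iobj \<kappa> \<nu> X) = map_iobj \<kappa> \<nu> ((F ^^ n) X) \<and>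
      reduces_star T \<R> I X ((F ^^ n) X)" for n
  proof (induction n)
    case 0
    then show ?case using X by (simp add: normalise_def reduces_star_refl)
  next
    case (Suc n)
    then have o: "(F ^^ n) X \<in> objs I" by blast
    have "reduces_star T \<R> I ((F ^^ n) X) (F ((F ^^ n) X))"
      using F(3,4)[OF o] reduces_star_step reduces_star_refl by metis
    moreover have "normalise relabelled_rules (map_hgraph \<kappa> \<nu> I) (Suc n) (map_iobj \<kappa> \<nu> X) = map_iobj \<kappa> \<nu> (F ((F ^^ n) X))"
      using Suc F(2)[OF o] unfolding normalise_def by (simp only: old.nat.rec(2))
    ultimately show ?case
      using Suc F(1)[OF o] reduces_star_trans[of T \<R> I X "(F ^^ n) X"]
      unfolding funpow.simps comp_apply by blast
  qed
  then show "\<exists>Z \<in> objs I. normalise relabelled_rules (map_hgraph \<kappa> \<nu> I) n (map_iobj \<kappa> \<nu> X) = map_iobj \<kappa> \<nu> Z \<and> reduces_star T \<R> I X Z"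
    by blast
  assume trm: "terminating T \<I> \<R>" and "I \<in> \<I>"
  then have "\<not> (\<exists>Z :: nat \<Rightarrow> ('c, 'o) iobj. \<forall>n. reduces T \<R> I (Z n) (Z (Suc n)))"
    using I(1) unfolding terminating_def by blast
  \<comment> \<open>If \<open>F\<close> made a step at every iterate, its orbit would be an infinite
    reduction. An iterate where it makes none is a normal form, and there \<open>F\<close> stays
    fixed.\<close>
  then have "\<not> (\<forall>n. reduces T \<R> I ((F ^^ n) X) ((F ^^ Suc n) X))"
    using exI[of "\<lambda>Z. \<forall>n. reduces T \<R> I (Z n) (Z (Suc n))" "\<lambda>n. (F ^^ n) X"] by argo
  then obtain n where "\<not> reduces T \<R> I ((F ^^ n) X) (F ((F ^^ n) X))" by auto
  then have n: "\<nexists>Y. reduces T \<R> I ((F ^^ n) X) Y" using F(3) it[of n] by blast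
  have "(F ^^ m) X = (F ^^ n) X" if "m \<ge> n" for m
    using that
  proof (induction m rule: dec_induct)
    case (step m)
    then show ?case using F(4)[of "(F ^^ n) X"] n it[of n] by simp
  qed simp
  then have "successors relabelled_rules (map_hgraph \<kappa> \<nu> I) (normalise relabelled_rules (map_hgraph \<kappa> \<nu> I) m (map_iobj \<kappa> \<nu> X)) = []" if "m \<ge> n" for m
  proof -
    have o: "(F ^^ n) X \<in> objs I" and eq: "normalise relabelled_rules (map_hgraph \<kappa> \<nu> I) m (map_iobj \<kappa> \<nu> X) = map_iobj \<kappa> \<nu> ((F ^^ n) X)"
      using it[of n] it[of m] \<open>\<And>m. m \<ge> n \<Longrightarrow> (F ^^ m) X = (F ^^ n) X\<close>[OF that] by (blast, metis)
    have "{Y \<in> objs I. reduces T \<R> I ((F ^^ n) X) Y} = {}" using n by blast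
    then have "set (successors relabelled_rules (map_hgraph \<kappa> \<nu> I) (map_iobj \<kappa> \<nu> ((F ^^ n) X))) = {}"
      unfolding successors_correct(1)[OF I o] by (simp only: image_empty)
    then show ?thesis unfolding eq by (simp only: set_empty)
  qed
  then show "\<exists>n. \<forall>m \<ge> n.
      successors relabelled_rules (map_hgraph \<kappa> \<nu> I) (normalise relabelled_rules (map_hgraph \<kappa> \<nu> I) m (map_iobj \<kappa> \<nu> X)) = []" by blast
qed

lemma xiso_correct:
  assumes X: "X \<in> objs I" and Y: "Y \<in> objs I" and I: "labs (colours T) (system_ops \<R>) I"
  shows "xiso (map_iobj \<kappa> \<nu> X) (map_iobj \<kappa> \<nu> Y) \<longleftrightarrow> iobj_iso T I X Y"
proof -
  have v: "valid (fst X)" "valid (fst Y)" and r: "snd X \<in> hmors I (fst X)" and l: "labs (colours T) (system_ops \<R>) (fst X)" "labs (colours T) (system_ops \<R>) (fst Y)"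
    and o: "X \<in> iobjs T I" "Y \<in> iobjs T I"
    using X Y unfolding objs_def by (auto simp: iobjs_def hyp_valid)
  have hid: "hid (map_hgraph \<kappa> \<nu> G) = hid G" for G by (simp add: hid_def)
  have "snd (map_iobj \<kappa> \<nu> X) \<in> hmors (map_hgraph \<kappa> \<nu> I) (fst (map_iobj \<kappa> \<nu> X))"
    using r hmors_map[OF presented_inj I l(1)] by simp
  then show ?thesis
    by (subst xiso_iff) (use v o in \<open>auto simp: hid iobj_iso_def Bex_def hmors_map[OF presented_inj l] hmors_map[OF presented_inj l(2,1)]\<close>)
qed

lemma critical_pair_targets:
  assumes "cp \<in> critical_pairs T \<R>"
  shows "cifc cp \<in> hyp T" "labs (colours T) (system_ops \<R>) (cifc cp)" "ctgt1 cp \<in> objs (cifc cp)" "ctgt2 cp \<in> objs (cifc cp)"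
    "reduces T \<R> (cifc cp) (csrc cp) (ctgt1 cp)" "reduces T \<R> (cifc cp) (csrc cp) (ctgt2 cp)"
proof -
  have c: "ccrit \<R> cp" using assms critical_pairs_iff[OF presented_system] by blast
  note l = set_cpair_labs[OF c rule_labs]
  have *: "cifc cp \<in> hyp T" "reduces T \<R> (cifc cp) (csrc cp) (ctgt1 cp)" "reduces T \<R> (cifc cp) (csrc cp) (ctgt2 cp)"
    using assms unfolding critical_pairs_def reduces_def by auto
  then show "cifc cp \<in> hyp T" "labs (colours T) (system_ops \<R>) (cifc cp)" "ctgt1 cp \<in> objs (cifc cp)" "ctgt2 cp \<in> objs (cifc cp)"
    "reduces T \<R> (cifc cp) (csrc cp) (ctgt1 cp)" "reduces T \<R> (cifc cp) (csrc cp) (ctgt2 cp)"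
    using l(2-4) reduces_iobjs[OF *(2)] reduces_iobjs[OF *(3)] by (simp_all add: objs_def)
qed

lemma critical_list_ball:
  "(\<forall>cp \<in> set (crit_list relabelled_rules). P cp) \<longleftrightarrow> (\<forall>cp \<in> critical_pairs T \<R>. P (map_cpair \<kappa> \<nu> cp))"
proof -
  obtain cps where "set cps = critical_pairs T \<R>" "map (map_cpair \<kappa> \<nu>) cps = crit_list relabelled_rules"
    using crit_list_correct by blast
  then have "set (crit_list relabelled_rules) = map_cpair \<kappa> \<nu> ` critical_pairs T \<R>" by (metis set_map)
  then show ?thesis by simp
qed

text \<open>Each critical pair has thresholds of its own, and finitely many of them have a maximum;
  the inserted 0 covers a system without critical pairs. Since \<open>terminating\<close> speaks
  only of interfaces in \<open>\<I>\<close>, those of the critical pairs have to be among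
  them.\<close>

lemma ex_settled:
  assumes trm: "terminating T \<I> \<R>" and ifc: "\<forall>cp \<in> critical_pairs T \<R>. cifc cp \<in> \<I>"
  shows "\<exists>n. settled relabelled_rules n"
proof -
  have "\<exists>n. \<forall>m \<ge> n. successors relabelled_rules (map_hgraph \<kappa> \<nu> (cifc cp)) (normalise relabelled_rules (map_hgraph \<kappa> \<nu> (cifc cp)) m (map_iobj \<kappa> \<nu> (ctgt1 cp))) = [] \<and>
      successors relabelled_rules (map_hgraph \<kappa> \<nu> (cifc cp)) (normalise relabelled_rules (map_hgraph \<kappa> \<nu> (cifc cp)) m (map_iobj \<kappa> \<nu> (ctgt2 cp))) = []"
    if cp: "cp \<in> critical_pairs T \<R>" for cp
  proof -
    note t = critical_pair_targets[OF cp]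
    obtain n1 n2 where "\<forall>m \<ge> n1. successors relabelled_rules (map_hgraph \<kappa> \<nu> (cifc cp)) (normalise relabelled_rules (map_hgraph \<kappa> \<nu> (cifc cp)) m (map_iobj \<kappa> \<nu> (ctgt1 cp))) = []"
      "\<forall>m \<ge> n2. successors relabelled_rules (map_hgraph \<kappa> \<nu> (cifc cp)) (normalise relabelled_rules (map_hgraph \<kappa> \<nu> (cifc cp)) m (map_iobj \<kappa> \<nu> (ctgt2 cp))) = []"
      using normalise_correct(2)[OF t(1-3) trm] normalise_correct(2)[OF t(1,2,4) trm] ifc cp by blast
    then show ?thesis by (intro exI[of _ "max n1 n2"]) simp
  qed
  then obtain N where N: "\<And>cp m. cp \<in> critical_pairs T \<R> \<Longrightarrow> m \<ge> N cp \<Longrightarrow>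
      successors relabelled_rules (map_hgraph \<kappa> \<nu> (cifc cp)) (normalise relabelled_rules (map_hgraph \<kappa> \<nu> (cifc cp)) m (map_iobj \<kappa> \<nu> (ctgt1 cp))) = [] \<and>
      successors relabelled_rules (map_hgraph \<kappa> \<nu> (cifc cp)) (normalise relabelled_rules (map_hgraph \<kappa> \<nu> (cifc cp)) m (map_iobj \<kappa> \<nu> (ctgt2 cp))) = []"
    by metis
  have fin: "finite (critical_pairs T \<R>)" using crit_list_correct by (metis List.finite_set)
  have "N cp \<le> Max (insert 0 (N ` critical_pairs T \<R>))" if "cp \<in> critical_pairs T \<R>" for cp
    using fin that by (intro Max_ge) auto
  then have "settled relabelled_rules (Max (insert 0 (N ` critical_pairs T \<R>)))"
    unfolding settled_def critical_list_ball using N by (simp add: cpair.map_sel)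
  then show ?thesis by blast
qed

text \<open>In a confluent system two normal forms of one object are joinable, hence isomorphic by
  \<open>normal_form_iso\<close>, so it does not matter which normal forms \<open>follow\<close>
  happens to reach.\<close>

lemma agree_iff_confluent:
  assumes trm: "terminating T \<I> \<R>" and ifc: "\<forall>cp \<in> critical_pairs T \<R>. cifc cp \<in> \<I>" and n: "settled relabelled_rules n"
  shows "agree relabelled_rules n \<longleftrightarrow> confluent T \<I> \<R>"
proof -
  have nf: "\<exists>N1 \<in> objs (cifc cp). \<exists>N2 \<in> objs (cifc cp). reduces_star T \<R> (cifc cp) (ctgt1 cp) N1 \<and>
      reduces_star T \<R> (cifc cp) (ctgt2 cp) N2 \<and> (\<nexists>Y. reduces T \<R> (cifc cp) N1 Y) \<and> (\<nexists>Y. reduces T \<R> (cifc cp) N2 Y) \<and>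
      (xiso (normalise relabelled_rules (cifc (map_cpair \<kappa> \<nu> cp)) n (ctgt1 (map_cpair \<kappa> \<nu> cp)))
         (normalise relabelled_rules (cifc (map_cpair \<kappa> \<nu> cp)) n (ctgt2 (map_cpair \<kappa> \<nu> cp))) \<longleftrightarrow> iobj_iso T (cifc cp) N1 N2)"
    if cp: "cp \<in> critical_pairs T \<R>" for cp
  proof -
    note t = critical_pair_targets[OF cp]
    let ?J = "map_hgraph \<kappa> \<nu> (cifc cp)"
    obtain N1 where N1: "N1 \<in> objs (cifc cp)" "normalise relabelled_rules ?J n (map_iobj \<kappa> \<nu> (ctgt1 cp)) = map_iobj \<kappa> \<nu> N1"
      "reduces_star T \<R> (cifc cp) (ctgt1 cp) N1"
      using normalise_correct(1)[OF t(1-3)] by blast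
    obtain N2 where N2: "N2 \<in> objs (cifc cp)" "normalise relabelled_rules ?J n (map_iobj \<kappa> \<nu> (ctgt2 cp)) = map_iobj \<kappa> \<nu> N2"
      "reduces_star T \<R> (cifc cp) (ctgt2 cp) N2"
      using normalise_correct(1)[OF t(1,2,4)] by blast
    have "successors relabelled_rules ?J (map_iobj \<kappa> \<nu> N1) = []" "successors relabelled_rules ?J (map_iobj \<kappa> \<nu> N2) = []"
      using bspec[OF n[unfolded settled_def critical_list_ball] cp]
      unfolding cpair.map_sel N1(2) N2(2) by blast+
    then have "{Y \<in> objs (cifc cp). reduces T \<R> (cifc cp) N1 Y} = {}" "{Y \<in> objs (cifc cp). reduces T \<R> (cifc cp) N2 Y} = {}"
      using successors_correct(1)[OF t(1,2) N1(1)] successors_correct(1)[OF t(1,2) N2(1)] by simp_all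
    then have "\<nexists>Y. reduces T \<R> (cifc cp) N1 Y" "\<nexists>Y. reduces T \<R> (cifc cp) N2 Y"
      using successors_correct(2)[OF t(1,2) N1(1)] successors_correct(2)[OF t(1,2) N2(1)] by blast+
    moreover have "xiso (normalise relabelled_rules (cifc (map_cpair \<kappa> \<nu> cp)) n (ctgt1 (map_cpair \<kappa> \<nu> cp)))
         (normalise relabelled_rules (cifc (map_cpair \<kappa> \<nu> cp)) n (ctgt2 (map_cpair \<kappa> \<nu> cp))) \<longleftrightarrow> iobj_iso T (cifc cp) N1 N2"
      unfolding cpair.map_sel N1(2) N2(2) by (rule xiso_correct[OF N1(1) N2(1) t(2)])
    ultimately show ?thesis
      by (intro bexI[OF _ N1(1)] bexI[OF _ N2(1)] conjI N1(3) N2(3))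
  qed
  show ?thesis
  proof
    assume a: "agree relabelled_rules n"
    show "confluent T \<I> \<R>"
    proof (rule confluent_if_joinable[OF presented_system trm], rule ballI)
      fix cp
      assume cp: "cp \<in> critical_pairs T \<R>"
      obtain N1 N2 where N: "N1 \<in> objs (cifc cp)" "N2 \<in> objs (cifc cp)" "reduces_star T \<R> (cifc cp) (ctgt1 cp) N1"
        "reduces_star T \<R> (cifc cp) (ctgt2 cp) N2" "iobj_iso T (cifc cp) N1 N2"
        using nf[OF cp] a cp unfolding agree_def critical_list_ball by blast
      then show "cpair_joinable T \<R> cp"
        unfolding cpair_joinable_def joinable_def objs_def
        using reduces_star_trans[OF N(3) reduces_star_iso[OF N(5)]] by blast
    qed
  next
    assume conf: "confluent T \<I> \<R>"
    show "agree relabelled_rules n"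
      unfolding agree_def critical_list_ball
    proof
      fix cp
      assume cp: "cp \<in> critical_pairs T \<R>"
      note t = critical_pair_targets[OF cp]
      obtain N1 N2 where N: "N1 \<in> objs (cifc cp)" "N2 \<in> objs (cifc cp)" "reduces_star T \<R> (cifc cp) (ctgt1 cp) N1"
        "reduces_star T \<R> (cifc cp) (ctgt2 cp) N2" "\<nexists>Y. reduces T \<R> (cifc cp) N1 Y" "\<nexists>Y. reduces T \<R> (cifc cp) N2 Y"
        and iff: "xiso (normalise relabelled_rules (cifc (map_cpair \<kappa> \<nu> cp)) n (ctgt1 (map_cpair \<kappa> \<nu> cp)))
         (normalise relabelled_rules (cifc (map_cpair \<kappa> \<nu> cp)) n (ctgt2 (map_cpair \<kappa> \<nu> cp))) \<longleftrightarrow> iobj_iso T (cifc cp) N1 N2"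
        using nf[OF cp] by blast
      have o: "csrc cp \<in> iobjs T (cifc cp)" "N1 \<in> iobjs T (cifc cp)" "N2 \<in> iobjs T (cifc cp)"
        using reduces_iobjs[OF t(5)] N(1,2) by (simp_all add: objs_def)
      have "reduces_star T \<R> (cifc cp) (csrc cp) N1" "reduces_star T \<R> (cifc cp) (csrc cp) N2"
        using reduces_star_trans[OF reduces_star_step[OF t(5)] N(3)] reduces_star_trans[OF reduces_star_step[OF t(6)] N(4)] .
      then have "joinable T \<R> (cifc cp) N1 N2"
        using conf o t(1) ifc cp unfolding confluent_def by blast
      then obtain W where "reduces_star T \<R> (cifc cp) N1 W" "reduces_star T \<R> (cifc cp) N2 W"
        unfolding joinable_def by blast
      then have "iobj_iso T (cifc cp) N1 W" "iobj_iso T (cifc cp) N2 W"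
        using normal_form_iso[OF presented_system] o N(5,6) by blast+
      then show "xiso (normalise relabelled_rules (cifc (map_cpair \<kappa> \<nu> cp)) n (ctgt1 (map_cpair \<kappa> \<nu> cp)))
         (normalise relabelled_rules (cifc (map_cpair \<kappa> \<nu> cp)) n (ctgt2 (map_cpair \<kappa> \<nu> cp)))"
        unfolding iff using iobj_iso_sym iobj_iso_trans by blast
    qed
  qed
qed

end

section \<open>The Knuth-Bendix property\<close>

lemma critical_pairs_computable: "critical_pairs_computable T \<I>"
proof -
  have "computable (\<lambda>s. list_encode (map (code_cpair id id) (crit_list (parse_system s))))"
    by (intro comp_intros)
  then obtain P where P: "\<And>s. evalr P [s] (list_encode (map (code_cpair id id) (crit_list (parse_system s))))"
    using evalr_computable by (metis (no_types, lifting) encode_nat)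
  have "\<exists>cps. set cps = critical_pairs T \<R> \<and>
      evalr P [code_system \<kappa> \<nu> \<rho>s] (list_encode (map (code_cpair \<kappa> \<nu>) cps))"
    if pres: "presents T \<I> \<kappa> \<nu> \<rho>s \<R>" for \<kappa> \<nu> \<rho>s \<R>
  proof -
    obtain cps where cps: "set cps = critical_pairs T \<R>"
      "map (map_cpair \<kappa> \<nu>) cps = crit_list (map (map_dpoi_rule \<kappa> \<nu>) \<rho>s)"
      using crit_list_correct[OF pres] by blast
    have "map (code_cpair id id) (crit_list (parse_system (code_system \<kappa> \<nu> \<rho>s))) = map (code_cpair \<kappa> \<nu>) cps"
      unfolding code_system_map[of \<kappa> \<nu>] parse_system_code cps(2)[symmetric] map_map comp_def
        code_cpair_map[of \<kappa> \<nu>, symmetric] ..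
    then show ?thesis using cps(1) P[of "code_system \<kappa> \<nu> \<rho>s"] by auto
  qed
  then show ?thesis unfolding critical_pairs_computable_def by blast
qed

text \<open>Finitely many rules mention finitely many operations, so injective numberings exist
  whatever the types are; by \<open>crit_list_correct\<close> this already yields finiteness of the
  critical pairs.\<close>

lemma ex_presents:
  assumes "wf_theory T" "dpoi_system T \<I> \<R>"
  obtains \<kappa> \<nu> \<rho>s where "presents T \<I> \<kappa> \<nu> \<rho>s \<R>"
proof -
  have "finite \<R>" "finite (colours T)"
    using assms by (simp_all add: dpoi_system_def wf_theory_def)
  moreover have "finite (system_ops \<R>)"
    using \<open>finite \<R>\<close> unfolding system_ops_def hgraph_ops_def by simp
  ultimately obtain \<rho>s and \<kappa> :: "'a \<Rightarrow> nat" and \<nu> :: "'b \<Rightarrow> nat"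
    where "set \<rho>s = \<R>" "inj_on \<kappa> (colours T)" "inj_on \<nu> (system_ops \<R>)"
    using finite_list finite_imp_inj_to_nat_seg by metis
  then show thesis using that[of \<kappa> \<nu> \<rho>s] assms(2) by (simp add: presents_def)
qed

lemma knuth_bendix:
  fixes T :: "('c, 'o) monoidal_theory"
  assumes T: "wf_theory T"
    and ifc: "\<And>\<R>. dpoi_system T \<I> \<R> \<Longrightarrow> \<forall>cp \<in> critical_pairs T \<R>. cifc cp \<in> \<I>"
  shows "knuth_bendix_property T \<I>"
proof -
  have fin: "finite (critical_pairs T \<R>)" if sys: "dpoi_system T \<I> \<R>" for \<R>
  proof -
    obtain \<kappa> \<nu> \<rho>s where "presents T \<I> \<kappa> \<nu> \<rho>s \<R>" using ex_presents[OF T sys] .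
    from crit_list_correct[OF this] show ?thesis by (metis List.finite_set)
  qed
  have kb: "confluent T \<I> \<R> \<longleftrightarrow> (\<forall>cp \<in> critical_pairs T \<R>. cpair_joinable T \<R> cp)"
    if sys: "dpoi_system T \<I> \<R>" and trm: "terminating T \<I> \<R>" for \<R>
  proof
    assume conf: "confluent T \<I> \<R>"
    show "\<forall>cp \<in> critical_pairs T \<R>. cpair_joinable T \<R> cp"
    proof
      fix cp
      assume cp: "cp \<in> critical_pairs T \<R>"
      have "cifc cp \<in> hyp T" "reduces T \<R> (cifc cp) (csrc cp) (ctgt1 cp)" "reduces T \<R> (cifc cp) (csrc cp) (ctgt2 cp)"
        using cp unfolding critical_pairs_def reduces_def by auto
      then show "cpair_joinable T \<R> cp"
        unfolding cpair_joinable_def using joinable_if_confluent[OF conf] ifc[OF sys] cp by blast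
    qed
  qed (rule confluent_if_joinable[OF sys trm])
  have dec: "confluence_decidable_if_terminating T \<I>"
  proof -
    have "decidable (\<lambda>p. settled (parse_system (fst p)) (snd p))"
      and "computable (\<lambda>p. of_bool (agree (parse_system (fst p)) (snd p)) :: nat)"
      by (intro comp_intros)+
    then obtain P where P: "\<And>s n. settled (parse_system s) n \<Longrightarrow>
        evalr P [encode s] (encode (of_bool (agree (parse_system s) (LEAST n. settled (parse_system s) n)) :: nat))"
      by (rule evalr_search) blast
    have "evalr P [code_system \<kappa> \<nu> \<rho>s] (if confluent T \<I> \<R> then 1 else 0)"
      if pres: "presents T \<I> \<kappa> \<nu> \<rho>s \<R>" and trm: "terminating T \<I> \<R>" for \<kappa> \<nu> \<rho>s \<R>
    proof -
      have sys: "dpoi_system T \<I> \<R>" using pres by (simp add: presents_def)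
      let ?\<rho>s = "map (map_dpoi_rule \<kappa> \<nu>) \<rho>s"
      obtain n where n: "settled ?\<rho>s n" using ex_settled[OF pres trm ifc[OF sys]] by blast
      have "evalr P [code_system \<kappa> \<nu> \<rho>s] (of_bool (agree ?\<rho>s (LEAST n. settled ?\<rho>s n)))"
        using P[of "code_system \<kappa> \<nu> \<rho>s" n] n unfolding code_system_map[of \<kappa> \<nu>] parse_system_code by simp
      then show ?thesis
        using agree_iff_confluent[OF pres trm ifc[OF sys] LeastI[of "settled ?\<rho>s", OF n]]
        by (simp add: of_bool_def)
    qed
    then show ?thesis unfolding confluence_decidable_if_terminating_def by blast
  qed
  show ?thesis
    unfolding knuth_bendix_property_def using fin critical_pairs_computable kb dec by blast
qed

theorem theorem25:
  fixes T :: "('c, 'o) monoidal_theory"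
  assumes "wf_theory T"
  shows "knuth_bendix_property T (hyp T) \<and> knuth_bendix_property T (discrete_hyp T)"
proof
  show "knuth_bendix_property T (hyp T)"
    by (rule knuth_bendix[OF assms]) (auto simp: critical_pairs_def)
  show "knuth_bendix_property T (discrete_hyp T)"
    by (rule knuth_bendix[OF assms]) (blast intro: critical_pair_discrete)
qed

end
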